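(* Let $(X^4,g)$ be an oriented asymptotically hyperbolic 4-manifold. The $0$-instanton obstruction tensor of $(X,g)$ is conformally invariant; more precisely, for every $h_0\in\mathfrak{c}_\infty(g)$, the tensor $\mathring{\mathrm{symm}}\star_0(\star_2\theta-f_{\alpha_0})$ (seen as an endomorphism of $T\partial X$) coincides with $$2\left(\overline{\mathrm{W}}_0^B-\overline{\mathrm{W}}_0^E\right),$$ where $\overline{\mathrm{W}}^E_0,\overline{\mathrm{W}}_0^B$ are the electric and magnetic parts at $\partial X$ of the Weyl tensor of $\overline g=x^2g$, with $x$ the geodesic boundary defining function inducing $h_0$.
   Context: $X$ is a compact manifold with boundary. A boundary defining function (bdf) is a smooth $x:X\to[0,\infty)$ with $x^{-1}(0)=\partial X$, $dx\ne0$ along $\partial X$. A metric $g$ on the interior is asymptotically hyperbolic if $x^2g$ extends to a smooth metric on $X$ and $|dx|^2_{x^2g}\equiv1$ on $\partial X$. $\mathfrak{c}_\infty(g)=\{(x^2g)_{|\partial X}: x\text{ bdf}\}$. For $h_0\in\mathfrak c_\infty(g)$ the geodesic bdf $x$ inducing $h_0$ satisfies $(x^2g)_{|\partial X}=h_0$ and $|dx|^2_{x^2g}\equiv1$ near $\partial X$ (unique near $\partial X$); in the collar $[0,\varepsilon)\times\partial X$ given by the flow of the $\overline g$-gradient $\partial_x$, $\overline g=x^2g=dx^2+h(x)$. Boundaries are oriented outward-normal-first: if $e_1,e_2,e_3$ is an oriented frame of $T\partial X$, then $-\partial_x,e_1,e_2,e_3$ is an oriented frame of $TX$. Obstruction tensor.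 $\star(x)\sim\sum_k\star_kx^k$ is the expansion at $x=0$ of the Hodge star of $h(x)$ on $\partial X$. Choose a spin structure on $(\partial X,h_0)$: an $\mathrm{SU}(2)$ bundle $\mathbb S$ with $\mathbf c:T^*\partial X\to\mathfrak{su}(\mathbb S)$ such that $\theta:=\frac12\mathbf c$ is an isomorphism of Lie algebra bundles ($T^*\partial X\simeq T\partial X$ with the cross product). Regard $\theta$ as an $\mathfrak{su}(\mathbb S)$-valued $1$-form (the soldering form). Identify $\mathfrak{su}(\mathbb S)$-valued $1$-forms $\gamma$ with endomorphisms $\theta^{-1}\circ\gamma$ of $T\partial X$; $\mathring{\mathrm{symm}}\,\gamma$ denotes the trace-free part of the self-adjoint part $\frac12(\gamma+\gamma^* )$. Let $\alpha_0$ be the unique $\mathrm{SU}(2)$ connection on $\mathbb S$ with $d_{\alpha_0}\theta=\star_1\theta$, and $f_{\alpha_0}$ its curvature. The $0$-instanton obstruction tensor is $\mathring{\mathrm{symm}}\star_0(\star_2\theta-f_{\alpha_0})$. Weyl tensor. $\overline{\mathrm W}$ is the Weyl tensor of $\overline g$ as a type $(1,3)$ tensor, and $( *\overline{\mathrm W})_{abc}{}^d=\frac12\varepsilon_{ab}{}^{\alpha\beta}\overline{\mathrm W}_{\alpha\beta c}{}^d$ in an oriented orthonormal frame. Along level sets of $x$: $\overline{\mathrm W}^EV=\overline{\mathrm W}(V,\partial_x)\partial_x$ (i.e. $\overline{\mathrm W}_{a00}{}^b$) and $\overline{\mathrm W}^B=( *\overline{\mathrm W})^E$, as endomorphisms of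 $T\partial X$; the subscript $0$ denotes evaluation at $x=0$. Sign convention for $\overline{\mathrm W}$: with $\overline{\mathrm R}(V_1,V_2)V_3=\overline\nabla_{V_1}\overline\nabla_{V_2}V_3-\overline\nabla_{V_2}\overline\nabla_{V_1}V_3-\overline\nabla_{[V_1,V_2]}V_3$, $\overline{\mathrm W}$ is minus the totally trace-free part of $\overline{\mathrm R}$ (the index convention in which $\overline{\mathrm R}_{abab}$ is positive on a round sphere). Equivalently $\overline{\mathrm W}^E=\frac12\mathrm{tf}(S^2-\overline{\mathrm R}^N+\mathrm{Ric}^\sharp-HS)$, where $SV=-\overline\nabla_V\partial_x$, $H=\mathrm{tr}\,S$, $\overline{\mathrm R}^NV=\overline{\mathrm R}(V,\partial_x)\partial_x$, $\mathrm{Ric}$ is the Ricci tensor of $h(x)$ and $\mathrm{tf}$ is the trace-free part; and $\overline{\mathrm W}^B=\mathring{\mathrm{symm}}\star d_\nabla S$, with $S$ viewed as a $T\partial X$-valued $1$-form. *)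

theory Defs
  imports "HOL-Analysis.Analysis"
begin

section \<open>Calculus up to the boundary\<close>

text \<open>
  The model spaces are the half space \<open>{(t, y). t \<ge> 0}\<close> in \<open>real \<times> real^3\<close> for \<open>X\<close>, and
  \<open>real^3\<close> for the boundary.  Derivatives are taken within a set \<open>S\<close>; the sets that occur are
  relatively open in the half space (or open), so these derivatives are unique.
\<close>

definition pd :: "'e::real_normed_vector set \<Rightarrow> ('e \<Rightarrow> 'f::real_normed_vector) \<Rightarrow> 'e \<Rightarrow> 'e \<Rightarrow> 'f" where
  "pd S f y v = frechet_derivative f (at y within S) v"

primrec Ck_on :: "nat \<Rightarrow> 'e::real_normed_vector set \<Rightarrow> ('e \<Rightarrow> 'f::real_normed_vector) \<Rightarrow> bool" where
  "Ck_on 0 S f \<longleftrightarrow> continuous_on S f"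
| "Ck_on (Suc k) S f \<longleftrightarrow> f differentiable_on S \<and> (\<forall>v. Ck_on k S (\<lambda>y. pd S f y v))"

definition smooth_on :: "'e::real_normed_vector set \<Rightarrow> ('e \<Rightarrow> 'f::real_normed_vector) \<Rightarrow> bool" where
  "smooth_on S f \<longleftrightarrow> (\<forall>k. Ck_on k S f)"

text \<open>The coefficient of \<open>s^k\<close> in the expansion of \<open>f\<close> at \<open>s = 0\<close>, for \<open>f\<close> smooth on some
  \<open>[0, \<epsilon>)\<close>.\<close>

definition taylor_coeff :: "nat \<Rightarrow> (real \<Rightarrow> 'f::real_normed_vector) \<Rightarrow> 'f" where
  "taylor_coeff k f = (((\<lambda>F s. vector_derivative F (at s within {0..})) ^^ k) f 0) /\<^sub>R fact k"

section \<open>Pointwise linear algebra of a metric\<close>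

definition is_metric :: "('e::euclidean_space \<Rightarrow> 'e \<Rightarrow> real) \<Rightarrow> bool" where
  "is_metric h \<longleftrightarrow> bilinear h \<and> (\<forall>u v. h u v = h v u) \<and> (\<forall>u. u \<noteq> 0 \<longrightarrow> 0 < h u u)"

definition sharp :: "('e::euclidean_space \<Rightarrow> 'e \<Rightarrow> real) \<Rightarrow> ('e \<Rightarrow> real) \<Rightarrow> 'e" where
  "sharp h \<beta> = (THE v. \<forall>w. h v w = \<beta> w)"

text \<open>The sharp of the coordinate covector dual to the basis vector \<open>b\<close>, so that the inverse metric
  is the sum of \<open>b \<otimes> recip h b\<close> over \<open>b \<in> Basis\<close>.\<close>

definition recip :: "('e::euclidean_space \<Rightarrow> 'e \<Rightarrow> real) \<Rightarrow> 'e \<Rightarrow> 'e" where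
  "recip h b = sharp h (\<lambda>w. b \<bullet> w)"

definition endo_trace :: "('e::euclidean_space \<Rightarrow> 'e) \<Rightarrow> real" where
  "endo_trace E = (\<Sum>b\<in>Basis. E b \<bullet> b)"

definition metric_adjoint :: "('e::euclidean_space \<Rightarrow> 'e \<Rightarrow> real) \<Rightarrow> ('e \<Rightarrow> 'e) \<Rightarrow> 'e \<Rightarrow> 'e" where
  "metric_adjoint h E u = sharp h (\<lambda>v. h u (E v))"

definition selfadjoint_part :: "('e::euclidean_space \<Rightarrow> 'e \<Rightarrow> real) \<Rightarrow> ('e \<Rightarrow> 'e) \<Rightarrow> 'e \<Rightarrow> 'e" where
  "selfadjoint_part h E u = (1/2) *\<^sub>R (E u + metric_adjoint h E u)"

definition tf_symm :: "('e::euclidean_space \<Rightarrow> 'e \<Rightarrow> real) \<Rightarrow> ('e \<Rightarrow> 'e) \<Rightarrow> 'e \<Rightarrow> 'e" where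
  "tf_symm h E u =
     selfadjoint_part h E u - (endo_trace (selfadjoint_part h E) / real DIM('e)) *\<^sub>R u"

text \<open>\<open>real^3\<close> carries its standard orientation.\<close>

definition vol3 :: "(real^3 \<Rightarrow> real^3 \<Rightarrow> real) \<Rightarrow> real^3 \<Rightarrow> real^3 \<Rightarrow> real^3 \<Rightarrow> real" where
  "vol3 h u v w = sqrt (det (\<chi> i j. h (axis i 1) (axis j 1))) * det (vector [u, v, w] :: real^3^3)"

definition metric_cross :: "(real^3 \<Rightarrow> real^3 \<Rightarrow> real) \<Rightarrow> real^3 \<Rightarrow> real^3 \<Rightarrow> real^3" where
  "metric_cross h u v = sharp h (\<lambda>w. vol3 h u v w)"

text \<open>Hodge stars of vector-valued forms: \<open>\<star>\<beta>\<close> is the contraction of the sharp of \<open>\<beta>\<close> into the volume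
  form, and \<open>(\<star>\<omega>)(v)\<close> is half the full contraction of \<open>\<omega>\<close> with the volume form (in an oriented
  orthonormal frame, \<open>e\<^sub>1 \<mapsto> e\<^sub>2 \<and> e\<^sub>3\<close> and \<open>e\<^sub>2 \<and> e\<^sub>3 \<mapsto> e\<^sub>1\<close> on the dual coframe).\<close>

definition hodge1 ::
  "(real^3 \<Rightarrow> real^3 \<Rightarrow> real) \<Rightarrow> (real^3 \<Rightarrow> 'f::real_normed_vector) \<Rightarrow> real^3 \<Rightarrow> real^3 \<Rightarrow> 'f" where
  "hodge1 h \<beta> u v = (\<Sum>b\<in>Basis. vol3 h (recip h b) u v *\<^sub>R \<beta> b)"

definition hodge2 ::
  "(real^3 \<Rightarrow> real^3 \<Rightarrow> real) \<Rightarrow> (real^3 \<Rightarrow> real^3 \<Rightarrow> 'f::real_normed_vector) \<Rightarrow> real^3 \<Rightarrow> 'f" where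
  "hodge2 h \<omega> v =
     (1/2) *\<^sub>R (\<Sum>a\<in>Basis. \<Sum>b\<in>Basis. vol3 h (recip h a) (recip h b) v *\<^sub>R \<omega> a b)"

text \<open>For a path of metrics \<open>hs s\<close>, the coefficients \<open>\<star>\<^sub>k\<close> of the Hodge stars at \<open>s = 0\<close>.\<close>

definition hodge1_coeff ::
  "nat \<Rightarrow> (real \<Rightarrow> real^3 \<Rightarrow> real^3 \<Rightarrow> real) \<Rightarrow> (real^3 \<Rightarrow> 'f::real_normed_vector) \<Rightarrow> real^3 \<Rightarrow> real^3 \<Rightarrow> 'f"
  where "hodge1_coeff k hs \<beta> u v = taylor_coeff k (\<lambda>s. hodge1 (hs s) \<beta> u v)"

definition hodge2_coeff ::
  "nat \<Rightarrow> (real \<Rightarrow> real^3 \<Rightarrow> real^3 \<Rightarrow> real) \<Rightarrow> (real^3 \<Rightarrow> real^3 \<Rightarrow> 'f::real_normed_vector) \<Rightarrow> real^3 \<Rightarrow> 'f"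
  where "hodge2_coeff k hs \<omega> v = taylor_coeff k (\<lambda>s. hodge2 (hs s) \<omega> v)"

definition coord_frame :: "4 \<Rightarrow> real \<times> (real^3)" where
  "coord_frame i = (if i = 1 then (1, 0) else if i = 2 then (0, axis 1 1)
     else if i = 3 then (0, axis 2 1) else (0, axis 3 1))"

text \<open>The half space is oriented so that \<open>(-\<partial>\<^sub>t, \<partial>\<^sub>1, \<partial>\<^sub>2, \<partial>\<^sub>3)\<close> is a positive frame.  With the
  outward-normal-first convention its boundary then has the standard orientation of \<open>real^3\<close>;
  this is the origin of the minus sign.\<close>

definition vol4 ::
  "(real \<times> (real^3) \<Rightarrow> real \<times> (real^3) \<Rightarrow> real) \<Rightarrow>
   real \<times> (real^3) \<Rightarrow> real \<times> (real^3) \<Rightarrow> real \<times> (real^3) \<Rightarrow> real \<times> (real^3) \<Rightarrow> real" where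
  "vol4 g a b c d = - sqrt (det (\<chi> i j. g (coord_frame i) (coord_frame j))) *
     det (\<chi> i j. (vector [a, b, c, d] :: (real \<times> (real^3))^4) $ i \<bullet> coord_frame j)"

section \<open>Curvature in a chart\<close>

text \<open>Here \<open>g\<close> is the coordinate expression of a metric.  \<open>riemann S g y u v w\<close> is \<open>R(u, v) w\<close> with
  \<open>R(u, v) = [\<nabla>\<^sub>u, \<nabla>\<^sub>v] - \<nabla>\<^bsub>[u, v]\<^esub>\<close>.\<close>

definition christoffel ::
  "'e::euclidean_space set \<Rightarrow> ('e \<Rightarrow> 'e \<Rightarrow> 'e \<Rightarrow> real) \<Rightarrow> 'e \<Rightarrow> 'e \<Rightarrow> 'e \<Rightarrow> 'e" where
  "christoffel S g y u v = sharp (g y) (\<lambda>w.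
     (pd S (\<lambda>z. g z v w) y u + pd S (\<lambda>z. g z u w) y v - pd S (\<lambda>z. g z u v) y w) / 2)"

definition riemann ::
  "'e::euclidean_space set \<Rightarrow> ('e \<Rightarrow> 'e \<Rightarrow> 'e \<Rightarrow> real) \<Rightarrow> 'e \<Rightarrow> 'e \<Rightarrow> 'e \<Rightarrow> 'e \<Rightarrow> 'e" where
  "riemann S g y u v w =
     pd S (\<lambda>z. christoffel S g z v w) y u - pd S (\<lambda>z. christoffel S g z u w) y v
     + christoffel S g y u (christoffel S g y v w) - christoffel S g y v (christoffel S g y u w)"

definition ricci ::
  "'e::euclidean_space set \<Rightarrow> ('e \<Rightarrow> 'e \<Rightarrow> 'e \<Rightarrow> real) \<Rightarrow> 'e \<Rightarrow> 'e \<Rightarrow> 'e \<Rightarrow> real" where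
  "ricci S g y v w = endo_trace (\<lambda>u. riemann S g y u v w)"

definition scalar_curv :: "'e::euclidean_space set \<Rightarrow> ('e \<Rightarrow> 'e \<Rightarrow> 'e \<Rightarrow> real) \<Rightarrow> 'e \<Rightarrow> real" where
  "scalar_curv S g y = (\<Sum>b\<in>Basis. ricci S g y b (recip (g y) b))"

definition schouten ::
  "'e::euclidean_space set \<Rightarrow> ('e \<Rightarrow> 'e \<Rightarrow> 'e \<Rightarrow> real) \<Rightarrow> 'e \<Rightarrow> 'e \<Rightarrow> 'e \<Rightarrow> real" where
  "schouten S g y v w =
     (ricci S g y v w - scalar_curv S g y / (2 * (real DIM('e) - 1)) * g y v w) / (real DIM('e) - 2)"

text \<open>Minus the totally trace-free part of the type \<open>(1,3)\<close> tensor \<open>riemann\<close>.\<close>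

definition weyl ::
  "'e::euclidean_space set \<Rightarrow> ('e \<Rightarrow> 'e \<Rightarrow> 'e \<Rightarrow> real) \<Rightarrow> 'e \<Rightarrow> 'e \<Rightarrow> 'e \<Rightarrow> 'e \<Rightarrow> 'e" where
  "weyl S g y u v w = - (riemann S g y u v w -
     (schouten S g y v w *\<^sub>R u - schouten S g y u w *\<^sub>R v
      + g y v w *\<^sub>R sharp (g y) (schouten S g y u) - g y u w *\<^sub>R sharp (g y) (schouten S g y v)))"

text \<open>The dual \<open>(*W)\<^sub>a\<^sub>b\<^sub>c\<^sup>d = 1/2 \<epsilon>\<^sub>a\<^sub>b\<^sup>\<alpha>\<^sup>\<beta> W\<^sub>\<alpha>\<^sub>\<beta>\<^sub>c\<^sup>d\<close>, written in a coordinate frame.\<close>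

definition dual_weyl ::
  "(real \<times> (real^3)) set \<Rightarrow> (real \<times> (real^3) \<Rightarrow> real \<times> (real^3) \<Rightarrow> real \<times> (real^3) \<Rightarrow> real) \<Rightarrow>
   real \<times> (real^3) \<Rightarrow> real \<times> (real^3) \<Rightarrow> real \<times> (real^3) \<Rightarrow> real \<times> (real^3) \<Rightarrow> real \<times> (real^3)" where
  "dual_weyl S g y u v w = (1/2) *\<^sub>R (\<Sum>a\<in>Basis. \<Sum>b\<in>Basis.
     vol4 (g y) u v (recip (g y) a) (recip (g y) b) *\<^sub>R weyl S g y a b w)"

section \<open>Oriented 4-manifolds with boundary\<close>

text \<open>
  A chart is a pair of a domain and a coordinate map into the half space.  A manifold is given by a
  smooth oriented atlas on the type \<open>'a\<close>; tensor fields are given by their components in the charts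
  of the atlas, subject to the usual transformation laws.  Coordinate expressions are only
  meaningful at points of the image of the chart.
\<close>

type_synonym 'a chart = "'a set \<times> ('a \<Rightarrow> real \<times> (real^3))"

abbreviation cdom :: "'a chart \<Rightarrow> 'a set" where "cdom c \<equiv> fst c"
abbreviation cmap :: "'a chart \<Rightarrow> 'a \<Rightarrow> real \<times> (real^3)" where "cmap c \<equiv> snd c"

definition cinv :: "'a chart \<Rightarrow> real \<times> (real^3) \<Rightarrow> 'a" where
  "cinv c = inv_into (cdom c) (cmap c)"

definition cimg :: "'a chart \<Rightarrow> (real \<times> (real^3)) set" where
  "cimg c = cmap c ` cdom c"

definition halfspace :: "(real \<times> (real^3)) set" where
  "halfspace = {z. 0 \<le> fst z}"

text \<open>Differential at \<open>p\<close> of the change of coordinates from \<open>c\<close> to \<open>d\<close>.\<close>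

definition trans_diff ::
  "'a chart \<Rightarrow> 'a chart \<Rightarrow> 'a \<Rightarrow> real \<times> (real^3) \<Rightarrow> real \<times> (real^3)" where
  "trans_diff c d p = pd halfspace (\<lambda>z. cmap d (cinv c z)) (cmap c p)"

definition is_chart :: "'a::topological_space chart \<Rightarrow> bool" where
  "is_chart c \<longleftrightarrow> open (cdom c) \<and> openin (top_of_set halfspace) (cimg c) \<and>
     homeomorphism (cdom c) (cimg c) (cmap c) (cinv c)"

definition oriented_atlas :: "'a::topological_space chart set \<Rightarrow> bool" where
  "oriented_atlas A \<longleftrightarrow>
     (\<forall>c\<in>A. is_chart c) \<and> (\<Union>c\<in>A. cdom c) = UNIV \<and>
     (\<forall>c\<in>A. \<forall>d\<in>A. smooth_on (cmap c ` (cdom c \<inter> cdom d)) (\<lambda>z. cmap d (cinv c z))) \<and>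
     (\<forall>c\<in>A. \<forall>d\<in>A. \<forall>p\<in>cdom c \<inter> cdom d.
        0 < det (\<chi> i j. trans_diff c d p (coord_frame i) \<bullet> coord_frame j))"

definition bdry :: "'a chart set \<Rightarrow> 'a set" where
  "bdry A = {p. \<exists>c\<in>A. p \<in> cdom c \<and> fst (cmap c p) = 0}"

type_synonym 'a bulk_form2 =
  "'a chart \<Rightarrow> real \<times> (real^3) \<Rightarrow> real \<times> (real^3) \<Rightarrow> real \<times> (real^3) \<Rightarrow> real"

text \<open>Smooth Riemannian metrics on the open subset \<open>D\<close> of the manifold.\<close>

definition metric_field :: "'a chart set \<Rightarrow> 'a set \<Rightarrow> 'a bulk_form2 \<Rightarrow> bool" where
  "metric_field A D g \<longleftrightarrow>
     (\<forall>c\<in>A. \<forall>u v. smooth_on (cmap c ` (cdom c \<inter> D)) (\<lambda>z. g c z u v)) \<and>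
     (\<forall>c\<in>A. \<forall>p\<in>cdom c \<inter> D. is_metric (g c (cmap c p))) \<and>
     (\<forall>c\<in>A. \<forall>d\<in>A. \<forall>p\<in>cdom c \<inter> cdom d \<inter> D. \<forall>u v.
        g c (cmap c p) u v = g d (cmap d p) (trans_diff c d p u) (trans_diff c d p v))"

section \<open>Asymptotically hyperbolic metrics\<close>

definition in_chart :: "'a chart \<Rightarrow> ('a \<Rightarrow> 'b) \<Rightarrow> real \<times> (real^3) \<Rightarrow> 'b" where
  "in_chart c x z = x (cinv c z)"

definition bdf :: "'a chart set \<Rightarrow> ('a \<Rightarrow> real) \<Rightarrow> bool" where
  "bdf A x \<longleftrightarrow>
     (\<forall>c\<in>A. smooth_on (cimg c) (in_chart c x)) \<and>
     (\<forall>p. 0 \<le> x p) \<and> (\<forall>p. x p = 0 \<longleftrightarrow> p \<in> bdry A) \<and>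
     (\<forall>c\<in>A. \<forall>p\<in>cdom c \<inter> bdry A. \<exists>v. pd halfspace (in_chart c x) (cmap c p) v \<noteq> 0)"

text \<open>\<open>gb\<close> is the smooth extension of \<open>x\<^sup>2 g\<close> to the whole manifold.\<close>

definition compactification ::
  "'a chart set \<Rightarrow> 'a bulk_form2 \<Rightarrow> ('a \<Rightarrow> real) \<Rightarrow> 'a bulk_form2 \<Rightarrow> bool" where
  "compactification A g x gb \<longleftrightarrow> metric_field A UNIV gb \<and>
     (\<forall>c\<in>A. \<forall>p\<in>cdom c - bdry A. \<forall>u v. gb c (cmap c p) u v = (x p)\<^sup>2 * g c (cmap c p) u v)"

definition grad :: "'a bulk_form2 \<Rightarrow> ('a \<Rightarrow> real) \<Rightarrow> 'a chart \<Rightarrow> real \<times> (real^3) \<Rightarrow> real \<times> (real^3)" where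
  "grad gb x c z = sharp (gb c z) (pd halfspace (in_chart c x) z)"

definition eikonal_at :: "'a chart set \<Rightarrow> 'a bulk_form2 \<Rightarrow> ('a \<Rightarrow> real) \<Rightarrow> 'a \<Rightarrow> bool" where
  "eikonal_at A gb x p \<longleftrightarrow> (\<forall>c\<in>A. p \<in> cdom c \<longrightarrow>
     gb c (cmap c p) (grad gb x c (cmap c p)) (grad gb x c (cmap c p)) = 1)"

definition asymptotically_hyperbolic :: "'a chart set \<Rightarrow> 'a bulk_form2 \<Rightarrow> bool" where
  "asymptotically_hyperbolic A g \<longleftrightarrow> metric_field A (- bdry A) g \<and>
     (\<exists>x gb. bdf A x \<and> compactification A g x gb \<and> (\<forall>p\<in>bdry A. eikonal_at A gb x p))"

text \<open>A chart \<open>c\<close> of the manifold induces the chart of the boundary with inverse \<open>bpt c\<close>;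
  \<open>bimg c W\<close> consists of the boundary coordinates of the points of \<open>W \<subseteq> bdry A\<close>.\<close>

definition bpt :: "'a chart \<Rightarrow> real^3 \<Rightarrow> 'a" where
  "bpt c y = cinv c (0, y)"

definition bimg :: "'a chart \<Rightarrow> 'a set \<Rightarrow> (real^3) set" where
  "bimg c W = {y. (0, y) \<in> cimg c \<and> bpt c y \<in> W}"

type_synonym 'a bdry_form2 = "'a chart \<Rightarrow> real^3 \<Rightarrow> real^3 \<Rightarrow> real^3 \<Rightarrow> real"

definition restricts_to :: "'a chart set \<Rightarrow> 'a bulk_form2 \<Rightarrow> 'a bdry_form2 \<Rightarrow> bool" where
  "restricts_to A gb h \<longleftrightarrow>
     (\<forall>c\<in>A. \<forall>y\<in>bimg c (bdry A). \<forall>u v. h c y u v = gb c (0, y) (0, u) (0, v))"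

definition conformal_infinity :: "'a chart set \<Rightarrow> 'a bulk_form2 \<Rightarrow> 'a bdry_form2 set" where
  "conformal_infinity A g =
     {h. \<exists>x gb. bdf A x \<and> compactification A g x gb \<and> restricts_to A gb h}"

text \<open>\<open>x\<close> is a geodesic boundary defining function inducing \<open>h0\<close>, and \<open>gb\<close> extends \<open>x\<^sup>2 g\<close>.\<close>

definition geodesic_bdf ::
  "'a::topological_space chart set \<Rightarrow> 'a bulk_form2 \<Rightarrow> 'a bdry_form2 \<Rightarrow> ('a \<Rightarrow> real) \<Rightarrow> 'a bulk_form2 \<Rightarrow> bool"
  where
  "geodesic_bdf A g h0 x gb \<longleftrightarrow> bdf A x \<and> compactification A g x gb \<and> restricts_to A gb h0 \<and>
     (\<exists>U. open U \<and> bdry A \<subseteq> U \<and> (\<forall>p\<in>U. eikonal_at A gb x p))"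

text \<open>\<open>\<Phi> s p\<close> is the flow for time \<open>s\<close> of the gradient of \<open>x\<close> starting at the boundary point \<open>p\<close>; it
  identifies \<open>[0, \<epsilon>) \<times> bdry A\<close> with an open neighbourhood of the boundary on which \<open>|dx| = 1\<close>.\<close>

definition geodesic_collar ::
  "'a::topological_space chart set \<Rightarrow> 'a bulk_form2 \<Rightarrow> ('a \<Rightarrow> real) \<Rightarrow> real \<Rightarrow> (real \<Rightarrow> 'a \<Rightarrow> 'a) \<Rightarrow> bool"
  where
  "geodesic_collar A gb x \<epsilon> \<Phi> \<longleftrightarrow> 0 < \<epsilon> \<and> (\<forall>p\<in>bdry A. \<Phi> 0 p = p) \<and>
     (\<forall>p\<in>bdry A. \<forall>s\<in>{0..<\<epsilon>}. \<forall>d\<in>A. \<Phi> s p \<in> cdom d \<longrightarrow>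
        ((\<lambda>r. cmap d (\<Phi> r p)) has_vector_derivative grad gb x d (cmap d (\<Phi> s p)))
          (at s within {0..<\<epsilon>})) \<and>
     (\<exists>U \<Psi>. open U \<and> (\<forall>p\<in>U. eikonal_at A gb x p) \<and>
        homeomorphism ({0..<\<epsilon>} \<times> bdry A) U (\<lambda>(s, p). \<Phi> s p) \<Psi>) \<and>
     (\<forall>c\<in>A. \<forall>d\<in>A.
        smooth_on {(s, y). 0 \<le> s \<and> s < \<epsilon> \<and> y \<in> bimg c (bdry A) \<and> \<Phi> s (bpt c y) \<in> cdom d}
          (\<lambda>(s, y). cmap d (\<Phi> s (bpt c y))))"

text \<open>The metric \<open>h(s)\<close> on the boundary, in the collar form \<open>dx\<^sup>2 + h(x)\<close> of \<open>gb\<close>: the pullback of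
  \<open>gb\<close> by \<open>\<Phi> s\<close>.  The same chart is used at \<open>p\<close> and at \<open>\<Phi> s p\<close>, which is legitimate for the
  small \<open>s\<close> that matter for expansions at \<open>s = 0\<close>.\<close>

definition collar_metric ::
  "'a bulk_form2 \<Rightarrow> (real \<Rightarrow> 'a \<Rightarrow> 'a) \<Rightarrow> 'a chart \<Rightarrow> real^3 \<Rightarrow> real \<Rightarrow> real^3 \<Rightarrow> real^3 \<Rightarrow> real" where
  "collar_metric gb \<Phi> c y s u v =
     gb c (cmap c (\<Phi> s (bpt c y)))
       (pd UNIV (\<lambda>z. cmap c (\<Phi> s (bpt c z))) y u)
       (pd UNIV (\<lambda>z. cmap c (\<Phi> s (bpt c z))) y v)"

section \<open>Electric and magnetic parts of the Weyl tensor at the boundary\<close>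

text \<open>On the boundary \<open>grad gb x\<close> is \<open>\<partial>\<^sub>x\<close>.  Both endomorphisms take values in its orthogonal complement,
  which at the boundary is the tangent space of the boundary.\<close>

definition weyl_electric ::
  "'a bulk_form2 \<Rightarrow> ('a \<Rightarrow> real) \<Rightarrow> 'a chart \<Rightarrow> real \<times> (real^3) \<Rightarrow> real \<times> (real^3) \<Rightarrow> real \<times> (real^3)" where
  "weyl_electric gb x c z v = weyl halfspace (gb c) z v (grad gb x c z) (grad gb x c z)"

definition weyl_magnetic ::
  "'a bulk_form2 \<Rightarrow> ('a \<Rightarrow> real) \<Rightarrow> 'a chart \<Rightarrow> real \<times> (real^3) \<Rightarrow> real \<times> (real^3) \<Rightarrow> real \<times> (real^3)" where
  "weyl_magnetic gb x c z v = dual_weyl halfspace (gb c) z v (grad gb x c z) (grad gb x c z)"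

section \<open>Spin structures and \<open>SU(2)\<close> connections on the boundary\<close>

type_synonym mat2 = "complex^2^2"

definition mat_adj :: "mat2 \<Rightarrow> mat2" where
  "mat_adj M = (\<chi> i j. cnj (M $ j $ i))"

definition SU2 :: "mat2 set" where
  "SU2 = {U. U ** mat_adj U = mat 1 \<and> det U = 1}"

definition su2 :: "mat2 set" where
  "su2 = {M. mat_adj M = - M \<and> trace M = 0}"

definition lie_bracket :: "mat2 \<Rightarrow> mat2 \<Rightarrow> mat2" where
  "lie_bracket M N = M ** N - N ** M"

text \<open>An \<open>SU(2)\<close> bundle on the boundary, given by a trivializing cover \<open>V i\<close>, \<open>i \<in> I\<close>, and a smooth
  cocycle; the components of a section satisfy \<open>\<psi>\<^sub>i = t\<^sub>i\<^sub>j \<psi>\<^sub>j\<close>.\<close>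

definition SU2_bundle ::
  "'a::topological_space chart set \<Rightarrow> 'i set \<Rightarrow> ('i \<Rightarrow> 'a set) \<Rightarrow> ('i \<Rightarrow> 'i \<Rightarrow> 'a \<Rightarrow> mat2) \<Rightarrow> bool" where
  "SU2_bundle A I V t \<longleftrightarrow>
     (\<forall>i\<in>I. openin (top_of_set (bdry A)) (V i)) \<and> (\<Union>i\<in>I. V i) = bdry A \<and>
     (\<forall>i\<in>I. \<forall>j\<in>I. \<forall>p\<in>V i \<inter> V j. t i j p \<in> SU2) \<and>
     (\<forall>i\<in>I. \<forall>j\<in>I. \<forall>k\<in>I. \<forall>p\<in>V i \<inter> V j \<inter> V k. t i j p ** t j k p = t i k p) \<and>
     (\<forall>i\<in>I. \<forall>j\<in>I. \<forall>c\<in>A. smooth_on (bimg c (V i \<inter> V j)) (\<lambda>y. t i j (bpt c y)))"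

type_synonym ('a, 'i) su_form1 = "'i \<Rightarrow> 'a chart \<Rightarrow> real^3 \<Rightarrow> real^3 \<Rightarrow> mat2"

text \<open>Families of smooth \<open>su(2)\<close>-valued 1-forms on the sets \<open>V i\<close>.\<close>

definition local_su_forms ::
  "'a chart set \<Rightarrow> 'i set \<Rightarrow> ('i \<Rightarrow> 'a set) \<Rightarrow> ('a, 'i) su_form1 \<Rightarrow> bool" where
  "local_su_forms A I V \<gamma> \<longleftrightarrow>
     (\<forall>i\<in>I. \<forall>c\<in>A. \<forall>u. smooth_on (bimg c (V i)) (\<lambda>y. \<gamma> i c y u)) \<and>
     (\<forall>i\<in>I. \<forall>c\<in>A. \<forall>y\<in>bimg c (V i). linear (\<gamma> i c y) \<and> range (\<gamma> i c y) \<subseteq> su2) \<and>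
     (\<forall>i\<in>I. \<forall>c\<in>A. \<forall>d\<in>A. \<forall>y\<in>bimg c (V i). bpt c y \<in> cdom d \<longrightarrow>
        (\<forall>u. \<gamma> i c y u =
           \<gamma> i d (snd (cmap d (bpt c y))) (pd UNIV (\<lambda>z. snd (cmap d (bpt c z))) y u)))"

text \<open>The soldering form \<open>\<theta>\<close> attached to the Clifford multiplication \<open>cl\<close>.  Clifford
  multiplication is regarded as a function of tangent vectors through the identification of
  tangent and cotangent vectors by \<open>h0\<close>.\<close>

definition soldering :: "('a, 'i) su_form1 \<Rightarrow> ('a, 'i) su_form1" where
  "soldering cl i c y u = (1/2) *\<^sub>R cl i c y u"

definition spin_structure ::
  "'a::topological_space chart set \<Rightarrow> 'a bdry_form2 \<Rightarrow> 'i set \<Rightarrow> ('i \<Rightarrow> 'a set) \<Rightarrow>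
   ('i \<Rightarrow> 'i \<Rightarrow> 'a \<Rightarrow> mat2) \<Rightarrow> ('a, 'i) su_form1 \<Rightarrow> bool" where
  "spin_structure A h0 I V t cl \<longleftrightarrow> SU2_bundle A I V t \<and> local_su_forms A I V cl \<and>
     (\<forall>i\<in>I. \<forall>j\<in>I. \<forall>c\<in>A. \<forall>y\<in>bimg c (V i \<inter> V j). \<forall>u.
        cl i c y u = t i j (bpt c y) ** cl j c y u ** mat_adj (t i j (bpt c y))) \<and>
     (\<forall>i\<in>I. \<forall>c\<in>A. \<forall>y\<in>bimg c (V i).
        bij_betw (soldering cl i c y) UNIV su2 \<and>
        (\<forall>u v. lie_bracket (soldering cl i c y u) (soldering cl i c y v)
               = soldering cl i c y (metric_cross (h0 c y) u v)))"

text \<open>Connection forms: the covariant derivative of a section is \<open>d\<psi>\<^sub>i + \<alpha>\<^sub>i \<psi>\<^sub>i\<close> over \<open>V i\<close>.\<close>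

definition SU2_connection ::
  "'a chart set \<Rightarrow> 'i set \<Rightarrow> ('i \<Rightarrow> 'a set) \<Rightarrow> ('i \<Rightarrow> 'i \<Rightarrow> 'a \<Rightarrow> mat2) \<Rightarrow> ('a, 'i) su_form1 \<Rightarrow> bool" where
  "SU2_connection A I V t \<alpha> \<longleftrightarrow> local_su_forms A I V \<alpha> \<and>
     (\<forall>i\<in>I. \<forall>j\<in>I. \<forall>c\<in>A. \<forall>y\<in>bimg c (V i \<inter> V j). \<forall>u.
        \<alpha> i c y u = t i j (bpt c y) ** \<alpha> j c y u ** mat_adj (t i j (bpt c y))
                    - pd UNIV (\<lambda>z. t i j (bpt c z)) y u ** mat_adj (t i j (bpt c y)))"

definition cov_ext_deriv ::
  "(real^3 \<Rightarrow> real^3 \<Rightarrow> mat2) \<Rightarrow> (real^3 \<Rightarrow> real^3 \<Rightarrow> mat2) \<Rightarrow> real^3 \<Rightarrow> real^3 \<Rightarrow> real^3 \<Rightarrow> mat2" where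
  "cov_ext_deriv a \<gamma> y u v =
     pd UNIV (\<lambda>z. \<gamma> z v) y u - pd UNIV (\<lambda>z. \<gamma> z u) y v
     + lie_bracket (a y u) (\<gamma> y v) - lie_bracket (a y v) (\<gamma> y u)"

definition conn_curvature ::
  "(real^3 \<Rightarrow> real^3 \<Rightarrow> mat2) \<Rightarrow> real^3 \<Rightarrow> real^3 \<Rightarrow> real^3 \<Rightarrow> mat2" where
  "conn_curvature a y u v =
     pd UNIV (\<lambda>z. a z v) y u - pd UNIV (\<lambda>z. a z u) y v + lie_bracket (a y u) (a y v)"

section \<open>The 0-instanton obstruction tensor\<close>

text \<open>All the choices entering the obstruction tensor for the representative \<open>h0\<close> of the conformal
  infinity; \<open>\<alpha>\<close> is the connection \<open>\<alpha>\<^sub>0\<close> with \<open>d\<^sub>\<alpha> \<theta> = \<star>\<^sub>1 \<theta>\<close>.\<close>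

definition obstruction_data ::
  "'a::topological_space chart set \<Rightarrow> 'a bulk_form2 \<Rightarrow> 'a bdry_form2 \<Rightarrow> ('a \<Rightarrow> real) \<Rightarrow> 'a bulk_form2 \<Rightarrow>
   real \<Rightarrow> (real \<Rightarrow> 'a \<Rightarrow> 'a) \<Rightarrow> 'i set \<Rightarrow> ('i \<Rightarrow> 'a set) \<Rightarrow> ('i \<Rightarrow> 'i \<Rightarrow> 'a \<Rightarrow> mat2) \<Rightarrow>
   ('a, 'i) su_form1 \<Rightarrow> ('a, 'i) su_form1 \<Rightarrow> bool" where
  "obstruction_data A g h0 x gb \<epsilon> \<Phi> I V t cl \<alpha> \<longleftrightarrow>
     h0 \<in> conformal_infinity A g \<and> geodesic_bdf A g h0 x gb \<and> geodesic_collar A gb x \<epsilon> \<Phi> \<and>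
     spin_structure A h0 I V t cl \<and> SU2_connection A I V t \<alpha> \<and>
     (\<forall>i\<in>I. \<forall>c\<in>A. \<forall>y\<in>bimg c (V i). \<forall>u v.
        cov_ext_deriv (\<alpha> i c) (soldering cl i c) y u v =
          hodge1_coeff 1 (collar_metric gb \<Phi> c y) (soldering cl i c y) u v)"

text \<open>The trace-free symmetric part of \<open>\<star>\<^sub>0(\<star>\<^sub>2 \<theta> - f\<^sub>\<alpha>)\<close> as an endomorphism of the tangent space of
  the boundary at the point with coordinate \<open>y\<close>, with \<open>hs\<close> the path of metrics \<open>h(s)\<close> at that
  point, computed in a local trivialization.\<close>

definition obstruction_tensor ::
  "(real^3 \<Rightarrow> real^3 \<Rightarrow> real) \<Rightarrow> (real \<Rightarrow> real^3 \<Rightarrow> real^3 \<Rightarrow> real) \<Rightarrow>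
   (real^3 \<Rightarrow> real^3 \<Rightarrow> mat2) \<Rightarrow> (real^3 \<Rightarrow> real^3 \<Rightarrow> mat2) \<Rightarrow> real^3 \<Rightarrow> real^3 \<Rightarrow> real^3" where
  "obstruction_tensor h hs \<theta> a y =
     tf_symm h (\<lambda>v. inv (\<theta> y)
       (hodge2_coeff 0 hs (\<lambda>u w. hodge1_coeff 2 hs (\<theta> y) u w - conn_curvature a y u w) v))"

end

theory Submission
  imports Defs
begin

text \<open>
  Let \<open>N = \<partial>\<^sub>x\<close> and \<open>P = \<nabla>N\<close> along the boundary, so that \<open>S = -P\<close>. In the collar, \<open>h' = 2h(P\<cdot>,\<cdot>)\<close> and
  \<open>\<onehalf>h'' = h(P\<cdot>,P\<cdot>) - h(R\<^sup>N\<cdot>,\<cdot>)\<close>; differentiating the relation between \<open>\<star>(x)\<close> and \<open>\<star>\<^sub>0\<close> gives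
  \<open>\<star>\<^sub>1\<theta>\<close> and \<open>\<star>\<^sub>2\<theta>\<close> in terms of \<open>P\<close> and \<open>R\<^sup>N\<close>. A metric connection on a 3-manifold is determined by its
  torsion, so \<open>\<alpha>\<^sub>0\<close> is the Levi-Civita connection of \<open>h\<^sub>0\<close> plus \<open>\<theta> \<circ> \<beta>\<close> with
  \<open>\<beta> = 2P - \<onehalf> tr P\<close>. By the Gauss and Codazzi equations its curvature is expressed by the
  components of the ambient curvature and by \<open>P\<close>. All terms in \<open>P\<close> cancel, and what is
  left is a linear combination of components of the ambient curvature, which is the difference of the
  magnetic and the electric part of the Weyl tensor.

  For the conformal invariance, two compactifications \<open>x\<^sup>2g\<close> and \<open>x'\<^sup>2g\<close> are proportional by a factor
  \<open>\<lambda>\<close> that is regular up to the boundary. The (1,3) Weyl tensor does not see \<open>\<lambda>\<close>, while \<open>N\<close> is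
  multiplied by \<open>\<lambda>\<close> to the power \<open>-1/2\<close>; hence the endomorphisms \<open>W\<^sup>E\<close> and \<open>W\<^sup>B\<close> are divided by \<open>\<lambda>\<close>,
  and the bilinear form of the obstruction is unchanged.
\<close>

section \<open>Calculus up to the boundary\<close>

text \<open>Every computation stays in one chart of the manifold. Instead the Levi-Civita connection
  is pulled back along F and along the inclusion of the boundary, which keeps the Weyl tensor in the
  chart in which it is stated. The price is one-sided calculus at boundary points, above all the
  symmetry of second derivatives and the derivative of the musical isomorphism. Two quantities are
  never computed. The second derivative of the volume density enters \<star>_2 only as a multiple of
  the identity, and the derivative of tr P enters the curvature only as an antisymmetric
  endomorphism; the trace-free symmetric part removes both. The terms in P cancel by
  Cayley-Hamilton. Modulo the identity the cofactor endomorphisms of P and \<beta> are P^2 - (tr P)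
  P and 4 P^2 - 3 (tr P) P, and their difference is what \<star>_2 and the second variation of h
  contribute, 3 P^2 - 2 (tr P) P.\<close>

text \<open>On such sets a derivative within the set is unique, and second differences in basis directions
  give the symmetry of second derivatives also at boundary points.\<close>

definition corner_domain :: "'e::euclidean_space set \<Rightarrow> bool" where
  "corner_domain S \<longleftrightarrow> (\<forall>z\<in>S. \<exists>\<epsilon>>0. \<forall>a\<in>Basis. \<forall>b\<in>Basis. \<forall>s\<in>{0..<\<epsilon>}. \<forall>t\<in>{0..<\<epsilon>}.
     z + s *\<^sub>R a + t *\<^sub>R b \<in> S)"

text \<open>Second derivatives are only required to exist. This is the regularity in which second
  derivatives are symmetric and curvature can be formed; it is inherited by relatively open subsets
  and by quotients.\<close>

definition twice_diff :: "'e::real_normed_vector set \<Rightarrow> ('e \<Rightarrow> 'f::real_normed_vector) \<Rightarrow> bool" where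
  "twice_diff S f \<longleftrightarrow> f differentiable_on S \<and> (\<forall>v. (\<lambda>z. pd S f z v) differentiable_on S)"

text \<open>Small steps do not leave an open set, so stability of C under nonnegative steps in basis
  directions passes to relatively open subsets. With the whole space, the half space and the ray for
  C this yields every domain that occurs.\<close>

lemma corner_domain_openin:
  fixes C :: "'e::euclidean_space set"
  assumes C: "\<And>z a b s t. z \<in> C \<Longrightarrow> a \<in> Basis \<Longrightarrow> b \<in> Basis \<Longrightarrow> 0 \<le> s \<Longrightarrow> 0 \<le> t \<Longrightarrow> z + s *\<^sub>R a + t *\<^sub>R b \<in> C"
    and S: "openin (top_of_set C) S"
  shows "corner_domain S"
  unfolding corner_domain_def
proof
  fix z assume z: "z \<in> S"
  obtain T where T: "open T" "S = C \<inter> T"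
    using S by (auto simp: openin_open)
  obtain e where e: "e > 0" "ball z e \<subseteq> T"
    using T z open_contains_ball by blast
  have "z + s *\<^sub>R a + t *\<^sub>R b \<in> S"
    if "a \<in> Basis" "b \<in> Basis" "s \<in> {0..<e/2}" "t \<in> {0..<e/2}" for a b :: 'e and s t
  proof -
    have "norm (s *\<^sub>R a + t *\<^sub>R b) \<le> norm (s *\<^sub>R a) + norm (t *\<^sub>R b)" by (rule norm_triangle_ineq)
    also have "\<dots> = s + t" using that by simp
    also have "\<dots> < e" using that by simp
    finally have "dist (z + s *\<^sub>R a + t *\<^sub>R b) z < e"
      by (simp add: dist_norm add.assoc)
    then have "dist z (z + s *\<^sub>R a + t *\<^sub>R b) < e" by (simp only: dist_commute)
    then have "z + s *\<^sub>R a + t *\<^sub>R b \<in> T" using e by auto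
    moreover have "z + s *\<^sub>R a + t *\<^sub>R b \<in> C" using C[of z a b s t] that z T by auto
    ultimately show ?thesis using T by simp
  qed
  then show "\<exists>\<epsilon>>0. \<forall>a\<in>Basis. \<forall>b\<in>Basis. \<forall>s\<in>{0..<\<epsilon>}. \<forall>t\<in>{0..<\<epsilon>}. z + s *\<^sub>R a + t *\<^sub>R b \<in> S"
    using e by (intro exI[of _ "e/2"]) auto
qed

lemma corner_domain_open: "open S \<Longrightarrow> corner_domain (S :: 'e::euclidean_space set)"
  by (rule corner_domain_openin[of UNIV]) auto

lemma corner_domain_halfspace: "openin (top_of_set halfspace) S \<Longrightarrow> corner_domain S"
  by (rule corner_domain_openin[of halfspace])
     (auto simp: halfspace_def Basis_prod_def)

lemma corner_domain_interval: "corner_domain {0..<\<delta>::real}"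
  by (rule corner_domain_openin[of "{0..}"])
     (auto simp: openin_open intro!: exI[of _ "{..<\<delta>}"])

section \<open>Derivatives within a set: uniqueness, locality and regularity\<close>

lemma pd_has_derivative:
  "f differentiable (at z within S) \<Longrightarrow> (f has_derivative pd S f z) (at z within S)"
  unfolding pd_def using frechet_derivative_works by (metis eta_contract_eq)

lemma corner_domain_unique:
  fixes f :: "'e::euclidean_space \<Rightarrow> 'f::real_normed_vector"
  assumes "corner_domain S" "z \<in> S"
    and "(f has_derivative f') (at z within S)" "(f has_derivative f'') (at z within S)"
  shows "f' = f''"
proof (rule frechet_derivative_unique_within[OF assms(3,4)])
  fix i :: 'e and e :: real assume i: "i \<in> Basis" "e > 0"
  obtain \<epsilon> where e: "\<epsilon> > 0" "\<And>a b s t. a\<in>Basis \<Longrightarrow> b\<in>Basis \<Longrightarrow> s\<in>{0..<\<epsilon>} \<Longrightarrow> t\<in>{0..<\<epsilon>} \<Longrightarrow>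
     z + s *\<^sub>R a + t *\<^sub>R b \<in> S"
    using assms(1,2) unfolding corner_domain_def by metis
  have "z + (min e \<epsilon> / 2) *\<^sub>R i + 0 *\<^sub>R i \<in> S"
    using i e(1) by (intro e) auto
  then show "\<exists>d. 0 < \<bar>d\<bar> \<and> \<bar>d\<bar> < e \<and> z + d *\<^sub>R i \<in> S"
    using i e(1) by (intro exI[of _ "min e \<epsilon> / 2"]) auto
qed

lemma pd_eqI:
  fixes f :: "'e::euclidean_space \<Rightarrow> 'f::real_normed_vector"
  assumes "corner_domain S" "z \<in> S" "(f has_derivative f') (at z within S)"
  shows "pd S f z = f'"
  using corner_domain_unique[OF assms(1,2) pd_has_derivative assms(3)] assms(3)
  by (auto simp: differentiable_def)

lemma linear_pd:
  "f differentiable (at z within S) \<Longrightarrow> linear (pd S f z)"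
  by (rule has_derivative_linear[OF pd_has_derivative])

text \<open>Both functions have the same derivatives within S, and \<open>frechet_derivative\<close>
  chooses from that common set; so the equality covers the non-differentiable case too.\<close>

lemma pd_cong:
  assumes "z \<in> S" "\<And>w. w \<in> S \<Longrightarrow> f w = g w"
  shows "pd S f z = pd S g z"
proof -
  have "(f has_derivative D) (at z within S) \<longleftrightarrow> (g has_derivative D) (at z within S)" for D
    using has_derivative_transform[OF assms(1), of g f] has_derivative_transform[OF assms(1), of f g] assms(2)
    by auto
  then show ?thesis unfolding pd_def frechet_derivative_def by presburger
qed

lemma at_within_openin:
  assumes "openin (top_of_set C) S" "z \<in> S"
  shows "at z within S = at z within C"
proof -
  obtain T where "open T" "S = T \<inter> C" using assms(1) by (auto simp: openin_open)
  then show ?thesis using assms(2)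
    by (intro at_within_nhd[of z T]) auto
qed

lemma pd_openin:
  assumes "openin (top_of_set C) S" "z \<in> S"
  shows "pd S f z = pd C f z"
  unfolding pd_def using at_within_openin[OF assms] by presburger

lemma smooth_on_twice: "smooth_on S f \<Longrightarrow> twice_diff S f"
  unfolding smooth_on_def twice_diff_def by (metis Ck_on.simps(2))

lemma smooth_on_pd: "smooth_on S f \<Longrightarrow> smooth_on S (\<lambda>z. pd S f z v)"
  unfolding smooth_on_def by (metis Ck_on.simps(2))

lemma twice_diffD:
  assumes "twice_diff S f"
  shows "f differentiable_on S" "(\<lambda>z. pd S f z v) differentiable_on S"
  using assms by (auto simp: twice_diff_def)

lemma twice_diff_cong:
  assumes "\<And>z. z \<in> S \<Longrightarrow> f z = g z"
  shows "twice_diff S f \<longleftrightarrow> twice_diff S g"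
proof -
  have 1: "f differentiable_on S \<longleftrightarrow> g differentiable_on S" if "\<And>z. z \<in> S \<Longrightarrow> f z = g z" 
    for f g :: "'a \<Rightarrow> 'b"
    using that unfolding differentiable_on_def differentiable_def
    using has_derivative_transform[of _ S f g] has_derivative_transform[of _ S g f] by metis
  have 2: "pd S f z v = pd S g z v" if "z \<in> S" for z v
    using pd_cong[of z S f g] that assms by simp
  have "(\<lambda>z. pd S f z v) differentiable_on S \<longleftrightarrow> (\<lambda>z. pd S g z v) differentiable_on S" for v
    by (rule 1) (rule 2)
  then show ?thesis unfolding twice_diff_def
    using 1[OF assms] by simp
qed

lemma twice_diff_subset:
  assumes "openin (top_of_set S) T" "twice_diff S f"
  shows "twice_diff T f"
proof -
  have sub: "T \<subseteq> S" using assms(1) openin_imp_subset by auto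
  have "(\<lambda>z. pd T f z v) differentiable_on T" for v
  proof -
    have "(\<lambda>z. pd S f z v) differentiable_on T"
      using assms(2) sub differentiable_on_subset unfolding twice_diff_def by blast
    then show ?thesis
      unfolding differentiable_on_def differentiable_def
      using has_derivative_transform[of _ T "\<lambda>z. pd T f z v" "\<lambda>z. pd S f z v"] pd_openin[OF assms(1)] by metis
  qed
  then show ?thesis
    using assms(2) sub differentiable_on_subset unfolding twice_diff_def by blast
qed

section \<open>Second differences and the symmetry of second derivatives\<close>

lemma has_derivative_pd_compose:
  assumes g: "(g has_derivative g') (at t within T)" and f: "f differentiable (at (g t) within S)"
    and sub: "\<And>r. r \<in> T \<Longrightarrow> g r \<in> S"
  shows "((\<lambda>r. f (g r)) has_derivative (\<lambda>h. pd S f (g t) (g' h))) (at t within T)"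
proof -
  have "(f has_derivative pd S f (g t)) (at (g t) within g ` T)"
    by (rule has_derivative_subset[OF pd_has_derivative[OF f]]) (use sub in auto)
  from has_derivative_in_compose[OF g this] show ?thesis .
qed

text \<open>For fixed s, the difference of f along two parallel segments in direction a has
  r-derivative q(z + ra + sb) - q(z + ra), where q is the derivative of f in direction a.
  Differentiability of q at z makes this s q'(b) up to o(s), and the mean value inequality on [0, s]
  gives the claim. Only nonnegative steps are taken, so z may lie on the boundary.\<close>

lemma second_difference_limit:
  fixes f :: "'e::euclidean_space \<Rightarrow> 'f::real_normed_vector"
  assumes f: "f differentiable_on S" and f2: "(\<lambda>w. pd S f w a) differentiable (at z within S)"
    and z: "z \<in> S" and \<epsilon>: "\<epsilon> > 0"
    and seg: "\<And>s t. s \<in> {0..<\<epsilon>} \<Longrightarrow> t \<in> {0..<\<epsilon>} \<Longrightarrow> z + s *\<^sub>R a + t *\<^sub>R b \<in> S"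
    and e: "e > 0"
  shows "\<exists>d>0. d \<le> \<epsilon> \<and> (\<forall>s\<in>{0<..<d}. norm (f (z + s *\<^sub>R a + s *\<^sub>R b) - f (z + s *\<^sub>R a) - f (z + s *\<^sub>R b) + f z
    - s\<^sup>2 *\<^sub>R pd S (\<lambda>w. pd S f w a) z b) \<le> e * s\<^sup>2)"
proof -
  define q where "q = (\<lambda>w. pd S f w a)"
  define q' where "q' = pd S q z"
  have q: "(q has_derivative q') (at z within S)"
    unfolding q'_def using f2 pd_has_derivative q_def by blast
  have lq: "linear q'" using q has_derivative_linear by blast
  \<comment> \<open>Both points at which q is compared with its linearisation lie within s K of z,
    and the two error bounds add up to a multiple of \<open>2 * norm a + norm b\<close>, which is
    below K.\<close>
  define K where "K = 2 * norm a + norm b + 1"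
  have K: "K > 0" unfolding K_def by (simp add: add_nonneg_pos)
  obtain d where d: "d > 0" "\<And>y. y \<in> S \<Longrightarrow> norm (y - z) < d \<Longrightarrow> norm (q y - q z - q' (y - z)) \<le> (e / (2*K)) * norm (y - z)"
  proof -
    have "\<forall>e>0. \<exists>d>0. \<forall>y\<in>S. norm (y - z) < d \<longrightarrow> norm (q y - q z - q' (y - z)) \<le> e * norm (y - z)"
      using q unfolding has_derivative_within_alt by blast
    moreover have "e / (2*K) > 0" using K e by simp
    ultimately show ?thesis using that by blast
  qed
  define D where "D = min \<epsilon> (d / K)"
  have D: "D > 0" "D \<le> \<epsilon>" using d K \<epsilon> by (auto simp: D_def)
  have "norm (f (z + s *\<^sub>R a + s *\<^sub>R b) - f (z + s *\<^sub>R a) - f (z + s *\<^sub>R b) + f z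
    - s\<^sup>2 *\<^sub>R q' b) \<le> e * s\<^sup>2" if s: "s \<in> {0<..<D}" for s
  proof -
    \<comment> \<open>The term linear in r makes \<open>\<psi> s - \<psi> 0\<close> the second
      difference minus its claimed leading term.\<close>
    define \<psi> where "\<psi> = (\<lambda>r. f (z + r *\<^sub>R a + s *\<^sub>R b) - f (z + r *\<^sub>R a) - r *\<^sub>R s *\<^sub>R q' b)"
    have inS: "z + r *\<^sub>R a + s *\<^sub>R b \<in> S" "z + r *\<^sub>R a \<in> S" if "r \<in> {0..s}" for r
      using seg[of r s] seg[of r 0] that s D by auto
    have der: "(\<psi> has_derivative (\<lambda>h. h *\<^sub>R (q (z + r *\<^sub>R a + s *\<^sub>R b) - q (z + r *\<^sub>R a) - s *\<^sub>R q' b))) (at r within {0..s})"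
      if r: "r \<in> {0..s}" for r
    proof -
      have 1: "((\<lambda>r. f (z + r *\<^sub>R a + c)) has_derivative (\<lambda>h. h *\<^sub>R q (z + r *\<^sub>R a + c))) (at r within {0..s})"
        if c: "\<And>r. r \<in> {0..s} \<Longrightarrow> z + r *\<^sub>R a + c \<in> S" for c
      proof -
        have g: "((\<lambda>r. z + r *\<^sub>R a + c) has_derivative (\<lambda>h. h *\<^sub>R a)) (at r within {0..s})"
          by (auto intro!: derivative_eq_intros)
        have ff: "f differentiable (at (z + r *\<^sub>R a + c) within S)"
          using differentiable_onD[OF f c[OF r]] .
        have "((\<lambda>r. f (z + r *\<^sub>R a + c)) has_derivative (\<lambda>h. pd S f (z + r *\<^sub>R a + c) (h *\<^sub>R a))) (at r within {0..s})"
          by (rule has_derivative_pd_compose[OF g ff c])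
        then show ?thesis using linear_pd[OF ff] by (simp add: q_def linear_cmul)
      qed
      have A: "((\<lambda>r. f (z + r *\<^sub>R a + s *\<^sub>R b)) has_derivative (\<lambda>h. h *\<^sub>R q (z + r *\<^sub>R a + s *\<^sub>R b))) (at r within {0..s})"
        using 1[of "s *\<^sub>R b"] inS by auto
      have B: "((\<lambda>r. f (z + r *\<^sub>R a)) has_derivative (\<lambda>h. h *\<^sub>R q (z + r *\<^sub>R a))) (at r within {0..s})"
        using 1[of 0] inS by auto
      show ?thesis unfolding \<psi>_def
        by (rule derivative_eq_intros A B refl)+ (auto simp: algebra_simps)
    qed
    have bd: "norm (q (z + r *\<^sub>R a + s *\<^sub>R b) - q (z + r *\<^sub>R a) - s *\<^sub>R q' b) \<le> e * s" if r: "r \<in> {0..s}" for r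
    proof -
      have n1: "norm (r *\<^sub>R a + s *\<^sub>R b) \<le> s * (norm a + norm b)"
      proof -
        have "norm (r *\<^sub>R a + s *\<^sub>R b) \<le> r * norm a + s * norm b" 
          using norm_triangle_ineq[of "r *\<^sub>R a" "s *\<^sub>R b"] r s by simp
        also have "\<dots> \<le> s * norm a + s * norm b" using r by (simp add: mult_right_mono)
        finally show ?thesis by (simp add: algebra_simps)
      qed
      have n2: "norm (r *\<^sub>R a) \<le> s * norm a" using r by (simp add: mult_right_mono)
      have sK: "s * K < d" using s K by (simp add: D_def field_simps)
      have l1: "s * (norm a + norm b) < d" "s * norm a < d"
      proof -
        have "s * (norm a + norm b) \<le> s * K" "s * norm a \<le> s * K" using s by (auto simp: K_def intro!: mult_left_mono)
        then show "s * (norm a + norm b) < d" "s * norm a < d" using sK by auto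
      qed
      have e1: "norm (q (z + r *\<^sub>R a + s *\<^sub>R b) - q z - q' (r *\<^sub>R a + s *\<^sub>R b)) \<le> (e / (2*K)) * (s * (norm a + norm b))"
      proof -
        have "norm (z + r *\<^sub>R a + s *\<^sub>R b - z) < d" using n1 l1 by (simp add: add.assoc)
        note d(2)[OF inS(1)[OF r] this]
        also have "(e / (2*K)) * norm (z + r *\<^sub>R a + s *\<^sub>R b - z) \<le> (e / (2*K)) * (s * (norm a + norm b))"
          using n1 e K by (intro mult_left_mono) (simp_all add: add.assoc)
        finally show ?thesis by (simp add: add.assoc)
      qed
      have e2: "norm (q (z + r *\<^sub>R a) - q z - q' (r *\<^sub>R a)) \<le> (e / (2*K)) * (s * norm a)"
      proof -
        have "norm (z + r *\<^sub>R a - z) < d" using n2 l1 by simp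
        note d(2)[OF inS(2)[OF r] this]
        also have "(e / (2*K)) * norm (z + r *\<^sub>R a - z) \<le> (e / (2*K)) * (s * norm a)"
          using n2 e K by (intro mult_left_mono) simp_all
        finally show ?thesis by simp
      qed
      have eq: "q (z + r *\<^sub>R a + s *\<^sub>R b) - q (z + r *\<^sub>R a) - s *\<^sub>R q' b =
         (q (z + r *\<^sub>R a + s *\<^sub>R b) - q z - q' (r *\<^sub>R a + s *\<^sub>R b)) - (q (z + r *\<^sub>R a) - q z - q' (r *\<^sub>R a))"
        using lq by (simp add: linear_add linear_cmul)
      have "norm (q (z + r *\<^sub>R a + s *\<^sub>R b) - q (z + r *\<^sub>R a) - s *\<^sub>R q' b) \<le>
          (e / (2*K)) * (s * (norm a + norm b)) + (e / (2*K)) * (s * norm a)"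
        unfolding eq by (rule order_trans[OF norm_triangle_ineq4 add_mono[OF e1 e2]])
      also have "\<dots> = (e / (2*K)) * s * (2 * norm a + norm b)" by algebra
      also have "\<dots> \<le> (e / (2*K)) * s * (2 * K)" using e K s by (intro mult_left_mono) (auto simp: K_def)
      also have "\<dots> = e * s" using K by simp
      finally show ?thesis .
    qed
    have "norm (\<psi> s - \<psi> 0) \<le> (e * s) * norm (s - 0)"
    proof (rule differentiable_bound[where S="{0..s}"])
      show "onorm (\<lambda>h. h *\<^sub>R (q (z + r *\<^sub>R a + s *\<^sub>R b) - q (z + r *\<^sub>R a) - s *\<^sub>R q' b)) \<le> e * s" if "r \<in> {0..s}" for r
        by (rule onorm_bound) (use bd[OF that] e s in \<open>auto simp: mult.commute[of "e * s"] intro: mult_left_mono\<close>)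
    qed (use der s in auto)
    moreover have "\<psi> s - \<psi> 0 = f (z + s *\<^sub>R a + s *\<^sub>R b) - f (z + s *\<^sub>R a) - f (z + s *\<^sub>R b) + f z - s\<^sup>2 *\<^sub>R q' b"
      by (simp add: \<psi>_def power2_eq_square)
    ultimately show ?thesis using s by (simp add: power2_eq_square mult.assoc)
  qed
  then show ?thesis using D unfolding q'_def q_def by blast
qed

text \<open>The second difference does not depend on the order of the two directions, and divided by
  s^2 it tends to either mixed derivative. This settles basis directions, for which S contains small
  corners; bilinearity does the rest.\<close>

theorem pd_symmetric:
  fixes f :: "'e::euclidean_space \<Rightarrow> 'f::real_normed_vector"
  assumes S: "corner_domain S" and f: "twice_diff S f" and z: "z \<in> S"
  shows "pd S (\<lambda>w. pd S f w u) z v = pd S (\<lambda>w. pd S f w v) z u"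
proof -
  note d1 = twice_diffD(1)[OF f, THEN differentiable_onD]
  note d2 = twice_diffD(2)[OF f, THEN differentiable_onD, OF z]
  obtain \<epsilon> where \<epsilon>: "\<epsilon> > 0" "\<And>a b s t. a\<in>Basis \<Longrightarrow> b\<in>Basis \<Longrightarrow> s\<in>{0..<\<epsilon>} \<Longrightarrow> t\<in>{0..<\<epsilon>} \<Longrightarrow>
     z + s *\<^sub>R a + t *\<^sub>R b \<in> S"
    using S z unfolding corner_domain_def by metis
  have basis: "pd S (\<lambda>w. pd S f w a) z b = pd S (\<lambda>w. pd S f w b) z a" (is "?l = ?r") if a: "a \<in> Basis" and b: "b \<in> Basis" for a b
  proof (rule ccontr)
    assume ne: "?l \<noteq> ?r"
    \<comment> \<open>A third of the gap, because the two errors together then account for at most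
      two thirds of it.\<close>
    define e where "e = norm (?l - ?r) / 3"
    have e: "e > 0" using ne by (simp add: e_def)
    obtain d1 where d1: "d1 > 0" "d1 \<le> \<epsilon>" "\<And>s. s\<in>{0<..<d1} \<Longrightarrow> norm (f (z + s *\<^sub>R a + s *\<^sub>R b) - f (z + s *\<^sub>R a) - f (z + s *\<^sub>R b) + f z
    - s\<^sup>2 *\<^sub>R ?l) \<le> e * s\<^sup>2"
      using second_difference_limit[OF twice_diffD(1)[OF f] d2 z \<epsilon>(1) \<epsilon>(2)[OF a b] e] by auto
    obtain d2 where d2: "d2 > 0" "d2 \<le> \<epsilon>" "\<And>s. s\<in>{0<..<d2} \<Longrightarrow> norm (f (z + s *\<^sub>R b + s *\<^sub>R a) - f (z + s *\<^sub>R b) - f (z + s *\<^sub>R a) + f z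
    - s\<^sup>2 *\<^sub>R ?r) \<le> e * s\<^sup>2"
      using second_difference_limit[OF twice_diffD(1)[OF f] d2 z \<epsilon>(1) \<epsilon>(2)[OF b a] e] by auto
    define s where "s = min d1 d2 / 2"
    have s: "s \<in> {0<..<d1}" "s \<in> {0<..<d2}" using d1 d2 by (auto simp: s_def)
    define \<Delta> where "\<Delta> = f (z + s *\<^sub>R a + s *\<^sub>R b) - f (z + s *\<^sub>R a) - f (z + s *\<^sub>R b) + f z"
    have 1: "norm (\<Delta> - s\<^sup>2 *\<^sub>R ?l) \<le> e * s\<^sup>2" using d1(3)[OF s(1)] by (simp add: \<Delta>_def)
    have 2: "norm (\<Delta> - s\<^sup>2 *\<^sub>R ?r) \<le> e * s\<^sup>2" using d2(3)[OF s(2)] by (simp add: \<Delta>_def algebra_simps)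
    have "s\<^sup>2 *\<^sub>R (?l - ?r) = (\<Delta> - s\<^sup>2 *\<^sub>R ?r) - (\<Delta> - s\<^sup>2 *\<^sub>R ?l)" by (simp add: algebra_simps)
    then have "norm (s\<^sup>2 *\<^sub>R (?l - ?r)) \<le> e * s\<^sup>2 + e * s\<^sup>2"
      using order_trans[OF norm_triangle_ineq4 add_mono[OF 2 1]] by simp
    then have "s\<^sup>2 * norm (?l - ?r) \<le> s\<^sup>2 * (2 * e)"
      unfolding norm_scaleR by (simp add: mult_ac)
    then have "norm (?l - ?r) \<le> 2 * e" using s by simp
    then show False using e by (simp add: e_def)
  qed
  define Q where "Q = (\<lambda>u v. pd S (\<lambda>w. pd S f w u) z v)"
  have l2: "linear (Q u)" for u unfolding Q_def using linear_pd[OF d2] .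
  have l1: "linear (\<lambda>u. Q u v)" for v
  proof (rule linearI)
    have sum: "pd S f w (c *\<^sub>R u1 + u2) = c *\<^sub>R pd S f w u1 + pd S f w u2" if "w \<in> S" for w u1 u2 c
      using linear_pd[OF d1[OF that]] by (simp add: linear_add linear_cmul)
    have *: "Q (c *\<^sub>R u1 + u2) v = c *\<^sub>R Q u1 v + Q u2 v" for c u1 u2
    proof -
      have "Q (c *\<^sub>R u1 + u2) = pd S (\<lambda>w. c *\<^sub>R pd S f w u1 + pd S f w u2) z"
        unfolding Q_def by (rule pd_cong[OF z]) (rule sum)
      also have "\<dots> = (\<lambda>h. c *\<^sub>R Q u1 h + Q u2 h)"
        unfolding Q_def
        by (rule pd_eqI[OF S z]) (rule derivative_eq_intros pd_has_derivative d2 refl)+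
      finally show ?thesis by simp
    qed
    show "Q (b1 + b2) v = Q b1 v + Q b2 v" for b1 b2 using *[of 1 b1 b2] by simp
    have z0: "Q 0 v = 0" using *[of 1 0 0] by simp
    show "Q (r *\<^sub>R b) v = r *\<^sub>R Q b v" for r b using *[of r b 0] z0 by simp
  qed
  have "bilinear Q" "bilinear (\<lambda>u v. Q v u)" using l1 l2 unfolding bilinear_def by auto
  then have "Q = (\<lambda>u v. Q v u)"
    by (rule bilinear_eq_stdbasis) (use basis in \<open>auto simp: Q_def\<close>)
  then show ?thesis unfolding Q_def by metis
qed

section \<open>Product rules for families of linear and bilinear maps\<close>

text \<open>The factor q is only assumed to tend to 0. In the derivative of \<open>sharp\<close>
  this factor is the increment of the solution, whose limit is known before its
  differentiability.\<close>

lemma has_derivative_mult_vanishing: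
  fixes p q :: "'e::real_normed_vector \<Rightarrow> real"
  assumes p: "(p has_derivative p') (at z within S)" and p0: "p z = 0"
    and q: "(q \<longlongrightarrow> 0) (at z within S)" and z: "z \<in> S" and q0: "q z = 0"
  shows "((\<lambda>w. q w * p w) has_derivative (\<lambda>_. 0)) (at z within S)"
  unfolding has_derivative_within_alt
proof (intro conjI allI impI)
  show "bounded_linear (\<lambda>_::'e. 0::real)" by (rule bounded_linear_zero)
  fix e :: real assume e: "e > 0"
  obtain K where K: "K > 0" "\<And>x. norm (p' x) \<le> norm x * K"
    using bounded_linear.pos_bounded[OF has_derivative_bounded_linear[OF p]] by blast
  obtain d where d: "d > 0" "\<And>y. y \<in> S \<Longrightarrow> norm (y - z) < d \<Longrightarrow> norm (p y - p z - p' (y - z)) \<le> 1 * norm (y - z)"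
    using p unfolding has_derivative_within_alt by (metis zero_less_one)
  have "eventually (\<lambda>y. dist (q y) 0 < e / (K + 1)) (at z within S)"
    using q e K by (intro tendstoD) auto
  then obtain d' where d': "d' > 0" "\<And>y. y \<in> S \<Longrightarrow> y \<noteq> z \<Longrightarrow> dist y z < d' \<Longrightarrow> \<bar>q y\<bar> < e / (K + 1)"
    unfolding eventually_at by auto
  have "norm (q y * p y - q z * p z - 0) \<le> e * norm (y - z)" if y: "y \<in> S" "norm (y - z) < min d d'" for y
  proof (cases "y = z")
    case False
    have "norm (p y) \<le> norm (p' (y - z)) + norm (p y - p z - p' (y - z))"
      using p0 by (simp add: norm_triangle_sub)
    also have "\<dots> \<le> (K + 1) * norm (y - z)"
      using K(2)[of "y - z"] d(2)[of y] y by (simp add: algebra_simps)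
    finally have 1: "\<bar>p y\<bar> \<le> (K + 1) * norm (y - z)" by simp
    have 2: "\<bar>q y\<bar> \<le> e / (K + 1)" using d'(2)[of y] y False by (simp add: dist_norm)
    have "\<bar>q y\<bar> * \<bar>p y\<bar> \<le> (e / (K + 1)) * ((K + 1) * norm (y - z))"
      using 1 2 e K by (intro mult_mono) auto
    then show ?thesis using K p0 by (simp add: abs_mult)
  qed simp
  then show "\<exists>d>0. \<forall>y\<in>S. norm (y - z) < d \<longrightarrow> norm (q y * p y - q z * p z - 0) \<le> e * norm (y - z)"
    using d(1) d'(1) by (intro exI[of _ "min d d'"]) auto
qed

text \<open>Differentiability is given for \<open>w \<mapsto> L w u\<close> with fixed u, not for L
  as an operator-valued map. Expanding the increment of X in a basis leaves finitely many such
  functions, with coefficients that vanish at z, so their own derivatives do not contribute.\<close>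

lemma has_derivative_linear_family:
  fixes L :: "'d::real_normed_vector \<Rightarrow> 'e::euclidean_space \<Rightarrow> 'f::real_normed_vector"
  assumes z: "z \<in> S" and lin: "\<And>w. w \<in> S \<Longrightarrow> linear (L w)"
    and L: "\<And>u. (\<lambda>w. L w u) differentiable (at z within S)"
    and X: "(X has_derivative X') (at z within S)"
  shows "((\<lambda>w. L w (X w)) has_derivative (\<lambda>h. pd S (\<lambda>w. L w (X z)) z h + L z (X' h))) (at z within S)"
proof -
  have split: "L w (X w) = L w (X z) + (\<Sum>b\<in>Basis. ((X w - X z) \<bullet> b) *\<^sub>R L w b)" if "w \<in> S" for w
  proof -
    have "L w (X w) = L w (X z + (\<Sum>b\<in>Basis. ((X w - X z) \<bullet> b) *\<^sub>R b))"
      by (simp add: euclidean_representation)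
    also have "\<dots> = L w (X z) + (\<Sum>b\<in>Basis. ((X w - X z) \<bullet> b) *\<^sub>R L w b)"
      using lin[OF that] by (simp add: linear_add linear_sum linear_cmul)
    finally show ?thesis .
  qed
  have X'z: "L z (X' h) = (\<Sum>b\<in>Basis. (X' h \<bullet> b) *\<^sub>R L z b)" for h
  proof -
    have "L z (X' h) = L z (\<Sum>b\<in>Basis. (X' h \<bullet> b) *\<^sub>R b)"
      by (simp add: euclidean_representation)
    then show ?thesis using lin[OF z] by (simp add: linear_sum linear_cmul)
  qed
  have 1: "((\<lambda>w. ((X w - X z) \<bullet> b) *\<^sub>R L w b) has_derivative (\<lambda>h. (X' h \<bullet> b) *\<^sub>R L z b)) (at z within S)" for b
  proof -
    have i: "((\<lambda>w. (X w - X z) \<bullet> b) has_derivative (\<lambda>h. X' h \<bullet> b)) (at z within S)"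
      by (auto intro!: derivative_eq_intros X)
    have "((\<lambda>w. ((X w - X z) \<bullet> b) *\<^sub>R L w b) has_derivative
       (\<lambda>h. ((X z - X z) \<bullet> b) *\<^sub>R pd S (\<lambda>w. L w b) z h + (X' h \<bullet> b) *\<^sub>R L z b)) (at z within S)"
      by (rule has_derivative_scaleR[OF i pd_has_derivative[OF L]])
    then show ?thesis by simp
  qed
  have "((\<lambda>w. L w (X z) + (\<Sum>b\<in>Basis. ((X w - X z) \<bullet> b) *\<^sub>R L w b)) has_derivative
      (\<lambda>h. pd S (\<lambda>w. L w (X z)) z h + (\<Sum>b\<in>Basis. (X' h \<bullet> b) *\<^sub>R L z b))) (at z within S)"
    by (intro has_derivative_add pd_has_derivative[OF L] has_derivative_sum 1)
  then have "((\<lambda>w. L w (X w)) has_derivative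
      (\<lambda>h. pd S (\<lambda>w. L w (X z)) z h + (\<Sum>b\<in>Basis. (X' h \<bullet> b) *\<^sub>R L z b))) (at z within S)"
    by (rule has_derivative_transform[OF z, rotated]) (rule split)
  then show ?thesis unfolding X'z .
qed

lemma bilinear_linear: "bilinear B \<Longrightarrow> linear (B u)" "bilinear B \<Longrightarrow> linear (\<lambda>u. B u v)"
  by (auto simp: bilinear_def)

text \<open>The linear case is used in each argument in turn; the first use supplies the
  differentiability of the family \<open>w \<mapsto> B w (X w)\<close> for the second.\<close>

lemma has_derivative_bilinear_family:
  fixes B :: "'d::real_normed_vector \<Rightarrow> 'e::euclidean_space \<Rightarrow> 'e2::euclidean_space \<Rightarrow> 'f::real_normed_vector"
  assumes z: "z \<in> S" and bil: "\<And>w. w \<in> S \<Longrightarrow> bilinear (B w)"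
    and B: "\<And>u v. (\<lambda>w. B w u v) differentiable (at z within S)"
    and X: "(X has_derivative X') (at z within S)" and Y: "(Y has_derivative Y') (at z within S)"
  shows "((\<lambda>w. B w (X w) (Y w)) has_derivative
    (\<lambda>h. pd S (\<lambda>w. B w (X z) (Y z)) z h + B z (X' h) (Y z) + B z (X z) (Y' h))) (at z within S)"
proof -
  have 1: "((\<lambda>w. B w (X w) v) has_derivative (\<lambda>h. pd S (\<lambda>w. B w (X z) v) z h + B z (X' h) v)) (at z within S)" for v
    by (rule has_derivative_linear_family[OF z _ B X]) (rule bilinear_linear(2)[OF bil])
  have 2: "((\<lambda>w. B w (X w) (Y w)) has_derivative (\<lambda>h. pd S (\<lambda>w. B w (X w) (Y z)) z h + B z (X z) (Y' h))) (at z within S)"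
    by (rule has_derivative_linear_family[OF z bilinear_linear(1)[OF bil] differentiableI[OF 1] Y])
  have "((\<lambda>w. B w (X w) (Y z) + (B w (X w) (Y w) - B w (X w) (Y z))) has_derivative
     (\<lambda>h. (pd S (\<lambda>w. B w (X z) (Y z)) z h + B z (X' h) (Y z)) + B z (X z) (Y' h))) (at z within S)"
  proof (rule has_derivative_add[OF 1])
    have "((\<lambda>w. B w (X w) (Y w) - B w (X w) (Y z)) has_derivative
       (\<lambda>h. (pd S (\<lambda>w. B w (X w) (Y z)) z h + B z (X z) (Y' h)) - pd S (\<lambda>w. B w (X w) (Y z)) z h)) (at z within S)"
      by (rule has_derivative_diff[OF 2]) (rule pd_has_derivative[OF differentiableI[OF 1]])
    then show "((\<lambda>w. B w (X w) (Y w) - B w (X w) (Y z)) has_derivative (\<lambda>h. B z (X z) (Y' h))) (at z within S)"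
      by simp
  qed
  then show ?thesis by simp
qed

lemma linear_pd_family:
  fixes L :: "'d::euclidean_space \<Rightarrow> 'e::real_vector \<Rightarrow> 'f::real_normed_vector"
  assumes S: "corner_domain S" and z: "z \<in> S" and lin: "\<And>w. w \<in> S \<Longrightarrow> linear (L w)"
    and L: "\<And>u. (\<lambda>w. L w u) differentiable (at z within S)"
  shows "linear (\<lambda>u. pd S (\<lambda>w. L w u) z h)"
proof (rule linearI)
  fix u v c
  have "pd S (\<lambda>w. L w (u + v)) z = pd S (\<lambda>w. L w u + L w v) z"
    by (rule pd_cong[OF z]) (simp add: lin linear_add)
  also have "\<dots> = (\<lambda>h. pd S (\<lambda>w. L w u) z h + pd S (\<lambda>w. L w v) z h)"
    by (rule pd_eqI[OF S z]) (intro has_derivative_add pd_has_derivative L)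
  finally show "pd S (\<lambda>w. L w (u + v)) z h = pd S (\<lambda>w. L w u) z h + pd S (\<lambda>w. L w v) z h" by simp
  have "pd S (\<lambda>w. L w (c *\<^sub>R u)) z = pd S (\<lambda>w. c *\<^sub>R L w u) z"
    by (rule pd_cong[OF z]) (simp add: lin linear_cmul)
  also have "\<dots> = (\<lambda>h. c *\<^sub>R pd S (\<lambda>w. L w u) z h)"
    by (rule pd_eqI[OF S z]) (intro has_derivative_scaleR_right pd_has_derivative L)
  finally show "pd S (\<lambda>w. L w (c *\<^sub>R u)) z h = c *\<^sub>R pd S (\<lambda>w. L w u) z h" by simp
qed

section \<open>Metrics and musical isomorphisms\<close>

lemma is_metricD:
  assumes "is_metric h"
  shows "bilinear h" "h u v = h v u" "u \<noteq> 0 \<Longrightarrow> 0 < h u u"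
  using assms unfolding is_metric_def by blast+

lemma metric_add:
  assumes "is_metric h"
  shows "h (u + u') v = h u v + h u' v" "h v (u + u') = h v u + h v u'"
    "h (u - u') v = h u v - h u' v" "h v (u - u') = h v u - h v u'"
    "h (c *\<^sub>R u) v = c * h u v" "h v (c *\<^sub>R u) = c * h v u"
    "h (- u) v = - h u v" "h v (- u) = - h v u" "h 0 v = 0" "h v 0 = 0"
  using is_metricD(1)[OF assms]
  by (simp_all add: bilinear_ladd bilinear_radd bilinear_lmul bilinear_rmul bilinear_lsub bilinear_rsub
     bilinear_lneg bilinear_rneg bilinear_lzero bilinear_rzero)

lemma metric_sum:
  assumes "is_metric h"
  shows "h (sum f A) v = (\<Sum>a\<in>A. h (f a) v)" "h v (sum f A) = (\<Sum>a\<in>A. h v (f a))"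
  using linear_sum[OF bilinear_linear(2)[OF is_metricD(1)[OF assms]], of f A v]
    linear_sum[OF bilinear_linear(1)[OF is_metricD(1)[OF assms]], of v f A] by auto

lemma metric_eqI:
  assumes "is_metric h" "\<And>w. h u w = h v w"
  shows "u = v"
proof (rule ccontr)
  assume "u \<noteq> v"
  then have "0 < h (u - v) (u - v)" using is_metricD(3)[OF assms(1)] by simp
  then show False using assms(2)[of "u - v"] by (simp add: metric_add[OF assms(1)])
qed

lemma sharp_eqI:
  assumes "is_metric h" "\<And>w. h v w = \<beta> w"
  shows "sharp h \<beta> = v"
  unfolding sharp_def using assms metric_eqI[OF assms(1)] by (intro the_equality) auto

lemma sharp_ex:
  fixes h :: "'e::euclidean_space \<Rightarrow> 'e \<Rightarrow> real"
  assumes h: "is_metric h" and \<beta>: "linear \<beta>"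
  shows "\<exists>v. \<forall>w. h v w = \<beta> w"
proof -
  define M where "M = (\<lambda>v. \<Sum>b\<in>Basis. h v b *\<^sub>R b)"
  have lM: "linear M" unfolding M_def
    by (rule linearI) (simp_all add: metric_add[OF h] scaleR_add_left sum.distrib scaleR_sum_right)
  have Mb: "M v \<bullet> b = h v b" if "b \<in> Basis" for v b
    using that unfolding M_def by (simp add: inner_sum_left inner_Basis if_distrib cong: if_cong)
  have hv: "h v w = M v \<bullet> w" for v w
  proof -
    have "h v w = h v (\<Sum>b\<in>Basis. (w \<bullet> b) *\<^sub>R b)" by (simp add: euclidean_representation)
    also have "\<dots> = (\<Sum>b\<in>Basis. (w \<bullet> b) * h v b)" by (simp add: metric_sum[OF h] metric_add[OF h])
    also have "\<dots> = M v \<bullet> w" unfolding M_def by (simp add: inner_sum_left inner_commute[of w] mult.commute)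
    finally show ?thesis .
  qed
  have "inj M"
  proof (rule injI)
    fix u v assume "M u = M v" then show "u = v" using hv by (intro metric_eqI[OF h]) simp
  qed
  then have "surj M" using lM linear_injective_imp_surjective by blast
  then obtain v where v: "M v = (\<Sum>b\<in>Basis. \<beta> b *\<^sub>R b)" by (metis surj_def)
  have "h v w = \<beta> w" for w
  proof -
    have "h v w = (\<Sum>b\<in>Basis. \<beta> b * (w \<bullet> b))" unfolding hv v by (simp add: inner_sum_left inner_commute[of w])
    also have "\<dots> = \<beta> (\<Sum>b\<in>Basis. (w \<bullet> b) *\<^sub>R b)" using \<beta> by (simp add: linear_sum linear_cmul mult.commute)
    finally show ?thesis by (simp add: euclidean_representation)
  qed
  then show ?thesis by blast
qed

lemma sharp_works:
  fixes h :: "'e::euclidean_space \<Rightarrow> 'e \<Rightarrow> real"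
  assumes "is_metric h" "linear \<beta>"
  shows "h (sharp h \<beta>) w = \<beta> w"
  using sharp_ex[OF assms] sharp_eqI[OF assms(1)] by blast

lemma recip_works: "is_metric h \<Longrightarrow> h (recip h b) w = b \<bullet> w"
  unfolding recip_def by (rule sharp_works) (auto intro: bounded_linear.linear bounded_linear_inner_right)

lemma sharp_sum_recip:
  fixes h :: "'e::euclidean_space \<Rightarrow> 'e \<Rightarrow> real"
  assumes "is_metric h" "linear \<beta>"
  shows "sharp h \<beta> = (\<Sum>b\<in>Basis. \<beta> b *\<^sub>R recip h b)"
proof (rule sharp_eqI[OF assms(1)])
  fix w
  have "h (\<Sum>b\<in>Basis. \<beta> b *\<^sub>R recip h b) w = (\<Sum>b\<in>Basis. \<beta> b * (b \<bullet> w))"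
    by (simp add: metric_sum[OF assms(1)] metric_add[OF assms(1)] recip_works[OF assms(1)])
  also have "\<dots> = \<beta> (\<Sum>b\<in>Basis. (w \<bullet> b) *\<^sub>R b)" using assms(2) by (simp add: linear_sum linear_cmul mult.commute inner_commute)
  finally show "h (\<Sum>b\<in>Basis. \<beta> b *\<^sub>R recip h b) w = \<beta> w" by (simp add: euclidean_representation)
qed

section \<open>Uniform positivity and the derivative of the musical isomorphism\<close>

lemma metric_coercive:
  fixes h :: "'e::euclidean_space \<Rightarrow> 'e \<Rightarrow> real"
  assumes h: "is_metric h"
  obtains c where "c > 0" "\<And>u. c * (norm u)\<^sup>2 \<le> h u u"
proof -
  have bb: "bounded_bilinear h" using is_metricD(1)[OF h] bilinear_conv_bounded_bilinear by blast
  have cont: "continuous_on (sphere 0 1) (\<lambda>u. h u u)"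
    by (intro bounded_bilinear.continuous_on[OF bb] continuous_intros)
  obtain b :: 'e where b: "b \<in> Basis" using nonempty_Basis by blast
  then have "sphere (0::'e) 1 \<noteq> {}" by (auto intro!: exI[of _ b])
  then obtain x where x: "x \<in> sphere 0 1" "\<And>y. y \<in> sphere 0 1 \<Longrightarrow> h x x \<le> h y y"
    using continuous_attains_inf[OF compact_sphere _ cont] by blast
  have "x \<noteq> 0" using x(1) by auto
  then have "h x x > 0" using is_metricD(3)[OF h] by blast
  moreover have "h x x * (norm u)\<^sup>2 \<le> h u u" for u
  proof (cases "u = 0")
    case False
    have "h x x \<le> h ((1/norm u) *\<^sub>R u) ((1/norm u) *\<^sub>R u)" using False by (intro x(2)) simp
    also have "\<dots> = h u u / (norm u)\<^sup>2" by (simp add: metric_add[OF h] power2_eq_square)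
    finally show ?thesis using False by (simp add: field_simps)
  qed (simp add: metric_add[OF h])
  ultimately show ?thesis using that by blast
qed

lemma bilinear_basis_bound:
  fixes B :: "'e::euclidean_space \<Rightarrow> 'e \<Rightarrow> real"
  assumes "bilinear B"
  shows "\<bar>B u v\<bar> \<le> (\<Sum>a\<in>Basis. \<Sum>b\<in>Basis. \<bar>B a b\<bar>) * (norm u * norm v)"
proof -
  have "B u v = B (\<Sum>a\<in>Basis. (u \<bullet> a) *\<^sub>R a) (\<Sum>b\<in>Basis. (v \<bullet> b) *\<^sub>R b)" by (simp add: euclidean_representation)
  also have "\<dots> = (\<Sum>a\<in>Basis. \<Sum>b\<in>Basis. (u \<bullet> a) * ((v \<bullet> b) * B a b))"
    by (simp add: linear_sum[OF bilinear_linear(1)[OF assms]] linear_sum[OF bilinear_linear(2)[OF assms]] bilinear_lmul[OF assms] bilinear_rmul[OF assms] sum_distrib_left)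
      (subst sum.swap, simp add: mult.left_commute)
  finally have "\<bar>B u v\<bar> \<le> (\<Sum>a\<in>Basis. \<Sum>b\<in>Basis. \<bar>(u \<bullet> a) * ((v \<bullet> b) * B a b)\<bar>)"
    by (simp only:) (rule order_trans[OF sum_abs sum_mono[OF sum_abs]])
  also have "\<dots> \<le> (\<Sum>a\<in>Basis. \<Sum>b\<in>Basis. \<bar>B a b\<bar> * (norm u * norm v))"
  proof (intro sum_mono)
    fix a b :: 'e assume "a \<in> Basis" "b \<in> Basis"
    then have "\<bar>u \<bullet> a\<bar> * \<bar>v \<bullet> b\<bar> \<le> norm u * norm v"
      by (intro mult_mono) (auto simp: Basis_le_norm)
    then have "\<bar>B a b\<bar> * (\<bar>u \<bullet> a\<bar> * \<bar>v \<bullet> b\<bar>) \<le> \<bar>B a b\<bar> * (norm u * norm v)" by (intro mult_left_mono) auto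
    then show "\<bar>(u \<bullet> a) * ((v \<bullet> b) * B a b)\<bar> \<le> \<bar>B a b\<bar> * (norm u * norm v)" by (simp add: abs_mult mult_ac)
  qed
  finally show ?thesis by (simp add: sum_distrib_right)
qed

lemma bilinear_diff: 
  fixes B :: "'e::euclidean_space \<Rightarrow> 'e2::euclidean_space \<Rightarrow> real"
  shows "bilinear B \<Longrightarrow> bilinear C \<Longrightarrow> bilinear (\<lambda>u v. B u v - C u v)"
  unfolding bilinear_def by (auto intro: linear_compose_sub)

text \<open>Positivity is assumed of the limit alone: the finitely many basis components control the
  difference from \<open>g0\<close>, which takes away at most half of the coercivity constant. In
  this form it also applies to the pulled-back forms of the collar, which are not yet known to be
  definite.\<close>

lemma metric_coercive_nearby:
  fixes g :: "'d::topological_space \<Rightarrow> 'e::euclidean_space \<Rightarrow> 'e \<Rightarrow> real"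
  assumes g0: "is_metric g0" and bil: "\<And>w. w \<in> S \<Longrightarrow> bilinear (g w)"
    and g: "\<And>u v. ((\<lambda>w. g w u v) \<longlongrightarrow> g0 u v) (at z within S)"
  obtains c where "c > 0" "eventually (\<lambda>w. \<forall>u. c * (norm u)\<^sup>2 \<le> g w u u) (at z within S)"
proof -
  obtain c where c: "c > 0" "\<And>u. c * (norm u)\<^sup>2 \<le> g0 u u" using metric_coercive[OF g0] by blast
  have "((\<lambda>w. \<Sum>a\<in>Basis. \<Sum>b\<in>Basis. \<bar>g w a b - g0 a b\<bar>) \<longlongrightarrow> (\<Sum>a\<in>Basis. \<Sum>b\<in>Basis. \<bar>g0 a b - g0 a (b::'e)\<bar>)) (at z within S)"
    by (intro tendsto_intros g)
  then have ev: "eventually (\<lambda>w. (\<Sum>a\<in>Basis. \<Sum>b\<in>Basis. \<bar>g w a b - g0 a b\<bar>) < c / 2) (at z within S)"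
    using c by (intro order_tendstoD(2)) auto
  have evS: "eventually (\<lambda>w. w \<in> S) (at z within S)" by (simp add: eventually_at_filter)
  have "eventually (\<lambda>w. \<forall>u. (c/2) * (norm u)\<^sup>2 \<le> g w u u) (at z within S)"
    using ev evS
  proof eventually_elim
    case (elim w)
    have "(c/2) * (norm u)\<^sup>2 \<le> g w u u" for u
    proof -
      have "\<bar>g w u u - g0 u u\<bar> \<le> (\<Sum>a\<in>Basis. \<Sum>b\<in>Basis. \<bar>g w a b - g0 a b\<bar>) * (norm u * norm u)"
        by (rule bilinear_basis_bound[OF bilinear_diff[OF bil[OF elim(2)] is_metricD(1)[OF g0]]])
      also have "\<dots> \<le> (c/2) * (norm u * norm u)" using elim(1) by (intro mult_right_mono) auto
      finally have "\<bar>g w u u - g0 u u\<bar> \<le> (c/2) * (norm u * norm u)" .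
      then have "g0 u u - g w u u \<le> (c/2) * (norm u * norm u)" by linarith
      moreover have "(c/2) * (norm u * norm u) + (c/2) * (norm u * norm u) \<le> g0 u u"
        using c(2)[of u] by (simp add: power2_eq_square)
      ultimately show ?thesis by (simp add: power2_eq_square)
    qed
    then show ?case by blast
  qed
  then show ?thesis using that[of "c/2"] c by auto
qed

text \<open>Let d be the increment of the solution. Then \<open>g w (d w) = \<rho> w\<close> for a
  covector \<open>\<rho>\<close> that vanishes at z, and coercivity bounds the norm of d by the
  components of \<open>\<rho>\<close>, so d tends to 0. Rewritten with the metric at z,
  \<open>g z (d w)\<close> is \<open>\<rho> w\<close> minus a sum of products of two vanishing
  factors, whose derivative is 0. Hence the derivative of d is the sharp, taken at z, of the
  derivative of \<open>\<rho>\<close>.\<close>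

theorem has_derivative_sharp:
  fixes g :: "'d::euclidean_space \<Rightarrow> 'e::euclidean_space \<Rightarrow> 'e \<Rightarrow> real"
  assumes z: "z \<in> S" and met: "\<And>w. w \<in> S \<Longrightarrow> is_metric (g w)"
    and g: "\<And>u v. (\<lambda>w. g w u v) differentiable (at z within S)"
    and lin: "\<And>w. w \<in> S \<Longrightarrow> linear (\<beta> w)"
    and b: "\<And>u. (\<lambda>w. \<beta> w u) differentiable (at z within S)"
    and v: "v = sharp (g z) (\<beta> z)"
  shows "((\<lambda>w. sharp (g w) (\<beta> w)) has_derivative
    (\<lambda>h. \<Sum>b\<in>Basis. (pd S (\<lambda>w. \<beta> w b) z h - pd S (\<lambda>w. g w v b) z h) *\<^sub>R recip (g z) b)) (at z within S)"
proof -
  define d where "d = (\<lambda>w. sharp (g w) (\<beta> w) - v)"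
  define \<rho> where "\<rho> = (\<lambda>w b. (\<beta> w b - \<beta> z b) - (g w v b - g z v b))"
  have d0: "d z = 0" by (simp add: d_def v)
  have lin\<rho>: "linear (\<rho> w)" if "w \<in> S" for w
    unfolding \<rho>_def using lin[OF that] lin[OF z] bilinear_linear(1)[OF is_metricD(1)[OF met[OF that]]]
      bilinear_linear(1)[OF is_metricD(1)[OF met[OF z]]] by (intro linear_compose_sub)
  have gv: "g z v b = \<beta> z b" for b unfolding v by (rule sharp_works[OF met[OF z] lin[OF z]])
  have gd: "g w (d w) b = \<rho> w b" if "w \<in> S" for w b
    unfolding d_def \<rho>_def using gv sharp_works[OF met[OF that] lin[OF that]]
    by (simp add: metric_add[OF met[OF that]])
  have cont: "((\<lambda>w. f w) \<longlongrightarrow> f z) (at z within S)" if "f differentiable (at z within S)" for f :: "'d \<Rightarrow> real"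
    using differentiable_imp_continuous_within[OF that] by (simp add: continuous_within)
  obtain c where c: "c > 0" "eventually (\<lambda>w. \<forall>u. c * (norm u)\<^sup>2 \<le> g w u u) (at z within S)"
    using metric_coercive_nearby[OF met[OF z], where S=S and z=z and g=g]
      is_metricD(1)[OF met] cont[OF g] by blast
  have evS: "eventually (\<lambda>w. w \<in> S) (at z within S)" by (simp add: eventually_at_filter)
  have dlim: "(d \<longlongrightarrow> 0) (at z within S)"
  proof (rule Lim_null_comparison)
    show "eventually (\<lambda>w. norm (d w) \<le> (\<Sum>b\<in>Basis. \<bar>\<rho> w b\<bar>) / c) (at z within S)"
      using c(2) evS
    proof eventually_elim
      case (elim w)
      have "c * (norm (d w))\<^sup>2 \<le> g w (d w) (d w)" using elim by blast
      also have "\<dots> = \<rho> w (d w)" by (rule gd[OF elim(2)])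
      also have "\<dots> = \<rho> w (\<Sum>b\<in>Basis. (d w \<bullet> b) *\<^sub>R b)" by (simp add: euclidean_representation)
      also have "\<dots> = (\<Sum>b\<in>Basis. (d w \<bullet> b) * \<rho> w b)" using lin\<rho>[OF elim(2)] by (simp add: linear_sum linear_cmul)
      also have "\<dots> \<le> (\<Sum>b\<in>Basis. \<bar>\<rho> w b\<bar> * norm (d w))"
      proof (rule sum_mono)
        fix b :: 'e assume b: "b \<in> Basis"
        have "(d w \<bullet> b) * \<rho> w b \<le> \<bar>d w \<bullet> b\<bar> * \<bar>\<rho> w b\<bar>" by (metis abs_ge_self abs_mult)
        also have "\<dots> \<le> norm (d w) * \<bar>\<rho> w b\<bar>" using Basis_le_norm[OF b] by (intro mult_right_mono) auto
        finally show "(d w \<bullet> b) * \<rho> w b \<le> \<bar>\<rho> w b\<bar> * norm (d w)" by (simp add: mult.commute)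
      qed
      also have "\<dots> = (\<Sum>b\<in>Basis. \<bar>\<rho> w b\<bar>) * norm (d w)" by (simp add: sum_distrib_right)
      finally have "norm (d w) * (c * norm (d w)) \<le> norm (d w) * (\<Sum>b\<in>Basis. \<bar>\<rho> w b\<bar>)"
        by (simp add: power2_eq_square mult_ac)
      then have "c * norm (d w) \<le> (\<Sum>b\<in>Basis. \<bar>\<rho> w b\<bar>)"
        by (cases "d w = 0") (auto simp: sum_nonneg)
      then show ?case using c(1) by (simp add: field_simps)
    qed
    have "((\<lambda>w. (\<Sum>b\<in>Basis. \<bar>\<rho> w b\<bar>) / c) \<longlongrightarrow> (\<Sum>b\<in>(Basis::'e set). \<bar>\<rho> z b\<bar>) / c) (at z within S)"
      unfolding \<rho>_def using cont[OF g] cont[OF b] c(1) by (intro tendsto_intros) auto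
    then show "((\<lambda>w. (\<Sum>b\<in>Basis. \<bar>\<rho> w b\<bar>) / c) \<longlongrightarrow> 0) (at z within S)"
      by (simp add: \<rho>_def)
  qed
  have repr: "sharp (g w) (\<beta> w) = v + (\<Sum>b\<in>Basis. (\<rho> w b - (\<Sum>a\<in>Basis. (d w \<bullet> a) * (g w a b - g z a b))) *\<^sub>R recip (g z) b)"
    if w: "w \<in> S" for w
  proof -
    have gz: "is_metric (g z)" "is_metric (g w)" using met z w by auto
    have "d w = sharp (g z) (\<lambda>u. g z (d w) u)" using sharp_eqI[OF gz(1), of "d w" "g z (d w)"] by simp
    also have "\<dots> = (\<Sum>b\<in>Basis. g z (d w) b *\<^sub>R recip (g z) b)"
      by (rule sharp_sum_recip[OF gz(1)]) (use bilinear_linear(1)[OF is_metricD(1)[OF gz(1)]] in simp)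
    also have "\<dots> = (\<Sum>b\<in>Basis. (\<rho> w b - (\<Sum>a\<in>Basis. (d w \<bullet> a) * (g w a b - g z a b))) *\<^sub>R recip (g z) b)"
    proof (rule sum.cong[OF refl])
      fix b :: 'e
      have "g w (d w) b - g z (d w) b = (g w (\<Sum>a\<in>Basis. (d w \<bullet> a) *\<^sub>R a) b - g z (\<Sum>a\<in>Basis. (d w \<bullet> a) *\<^sub>R a) b)"
        by (simp add: euclidean_representation)
      also have "\<dots> = (\<Sum>a\<in>Basis. (d w \<bullet> a) * (g w a b - g z a b))"
        by (simp add: metric_sum[OF gz(1)] metric_sum[OF gz(2)] metric_add[OF gz(1)] metric_add[OF gz(2)]
          sum_subtractf right_diff_distrib)
      finally show "g z (d w) b *\<^sub>R recip (g z) b = (\<rho> w b - (\<Sum>a\<in>Basis. (d w \<bullet> a) * (g w a b - g z a b))) *\<^sub>R recip (g z) b"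
        using gd[OF w, of b] by simp
    qed
    finally show ?thesis unfolding d_def by (simp add: algebra_simps)
  qed
  have van: "((\<lambda>w. (d w \<bullet> a) * (g w a b - g z a b)) has_derivative (\<lambda>_. 0)) (at z within S)" for a b
  proof (rule has_derivative_mult_vanishing[OF _ _ _ z])
    show "((\<lambda>w. g w a b - g z a b) has_derivative (\<lambda>h. pd S (\<lambda>w. g w a b) z h)) (at z within S)"
      using has_derivative_diff[OF pd_has_derivative[OF g[of a b]] has_derivative_const[of "g z a b"]] by simp
    show "((\<lambda>w. d w \<bullet> a) \<longlongrightarrow> 0) (at z within S)" using tendsto_inner[OF dlim tendsto_const[of a]] by simp
  qed (simp_all add: d0)
  have "((\<lambda>w. v + (\<Sum>b\<in>Basis. (\<rho> w b - (\<Sum>a\<in>Basis. (d w \<bullet> a) * (g w a b - g z a b))) *\<^sub>R recip (g z) b)) has_derivative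
    (\<lambda>h. 0 + (\<Sum>b\<in>Basis. ((((pd S (\<lambda>w. \<beta> w b) z h - 0) - (pd S (\<lambda>w. g w v b) z h - 0)) - (\<Sum>a\<in>(Basis::'e set). 0))) *\<^sub>R recip (g z) b))) (at z within S)"
    unfolding \<rho>_def
    by (intro has_derivative_add has_derivative_const has_derivative_sum has_derivative_scaleR_left has_derivative_diff
      pd_has_derivative[OF b] pd_has_derivative[OF g] van)
  then have "((\<lambda>w. v + (\<Sum>b\<in>Basis. (\<rho> w b - (\<Sum>a\<in>Basis. (d w \<bullet> a) * (g w a b - g z a b))) *\<^sub>R recip (g z) b)) has_derivative
    (\<lambda>h. (\<Sum>b\<in>Basis. (pd S (\<lambda>w. \<beta> w b) z h - pd S (\<lambda>w. g w v b) z h) *\<^sub>R recip (g z) b))) (at z within S)"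
    by simp
  then show ?thesis
    by (rule has_derivative_transform[OF z, rotated]) (rule repr)
qed

lemma pd_const: "corner_domain S \<Longrightarrow> z \<in> S \<Longrightarrow> pd S (\<lambda>z. c) z v = 0"
  by (subst pd_eqI[OF _ _ has_derivative_const]) auto

lemma twice_diff_const: "corner_domain S \<Longrightarrow> twice_diff S (\<lambda>_. c)"
proof -
  assume S: "corner_domain S"
  have "pd S (\<lambda>_. c) z v = 0" if "z \<in> S" for z v
    by (rule pd_const[OF S that])
  then show ?thesis unfolding twice_diff_def
    by (auto simp: differentiable_on_def intro: differentiableI[OF has_derivative_transform[OF _ _ has_derivative_const]])
qed

lemma twice_diff_id: "corner_domain S \<Longrightarrow> twice_diff S (\<lambda>z. z)"
proof -
  assume S: "corner_domain S"
  have "pd S (\<lambda>z. z) z v = v" if "z \<in> S" for z v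
    using pd_eqI[OF S that has_derivative_ident] by simp
  then show ?thesis unfolding twice_diff_def
    by (auto simp: differentiable_on_def intro: differentiableI[OF has_derivative_ident]
        differentiableI[OF has_derivative_transform[OF _ _ has_derivative_const]])
qed

lemma pd_ident: "corner_domain S \<Longrightarrow> z \<in> S \<Longrightarrow> pd S (\<lambda>z. z) z = (\<lambda>v. v)"
  by (rule pd_eqI[OF _ _ has_derivative_ident])

section \<open>The Levi-Civita connection along maps\<close>

locale chart_metric =
  fixes S :: "'e::euclidean_space set" and g :: "'e \<Rightarrow> 'e \<Rightarrow> 'e \<Rightarrow> real"
  assumes dom: "corner_domain S"
    and met: "\<And>z. z \<in> S \<Longrightarrow> is_metric (g z)"
    and tw: "\<And>u v. twice_diff S (\<lambda>z. g z u v)"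
begin

abbreviation \<Gamma> where "\<Gamma> \<equiv> christoffel S g"

abbreviation dg :: "'e \<Rightarrow> 'e \<Rightarrow> 'e \<Rightarrow> 'e \<Rightarrow> real" where "dg z u v h \<equiv> pd S (\<lambda>z. g z u v) z h"

lemma g_diff: "z \<in> S \<Longrightarrow> (\<lambda>z. g z u v) differentiable (at z within S)"
  by (rule differentiable_onD[OF twice_diffD(1)[OF tw]])

lemma dg_diff: "z \<in> S \<Longrightarrow> (\<lambda>z. dg z u v h) differentiable (at z within S)"
  by (rule differentiable_onD[OF twice_diffD(2)[OF tw]])

lemma g_bilinear: "z \<in> S \<Longrightarrow> bilinear (g z)"
  by (rule is_metricD(1)[OF met])

lemma dg_linear:
  assumes "z \<in> S"
  shows "linear (\<lambda>h. dg z u v h)" "linear (\<lambda>u. dg z u v h)" "linear (\<lambda>v. dg z u v h)"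
  using linear_pd[OF g_diff[OF assms]]
    linear_pd_family[OF dom assms bilinear_linear(2)[OF g_bilinear] g_diff[OF assms]]
    linear_pd_family[OF dom assms bilinear_linear(1)[OF g_bilinear] g_diff[OF assms]]
  by auto

lemma dg_sym: "z \<in> S \<Longrightarrow> dg z u v h = dg z v u h"
proof -
  assume z: "z \<in> S"
  have "pd S (\<lambda>z. g z u v) z = pd S (\<lambda>z. g z v u) z"
    by (rule pd_cong[OF z]) (rule is_metricD(2)[OF met])
  then show ?thesis by simp
qed

lemma linear_koszul:
  assumes "z \<in> S"
  shows "linear (\<lambda>w. (dg z v w u + dg z u w v - dg z u v w) / 2)"
proof -
  have "linear (\<lambda>w. (1/2) *\<^sub>R ((dg z v w u + dg z u w v) - dg z u v w))"
    by (intro linear_compose_scale_right linear_compose_add linear_compose_sub dg_linear[OF assms])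
  then show ?thesis by simp
qed

lemma g_christoffel: "z \<in> S \<Longrightarrow> g z (\<Gamma> z u v) w = (dg z v w u + dg z u w v - dg z u v w) / 2"
  unfolding christoffel_def by (rule sharp_works[OF met linear_koszul])

lemma christoffel_sym: "z \<in> S \<Longrightarrow> \<Gamma> z u v = \<Gamma> z v u"
  unfolding christoffel_def using dg_sym by (simp add: add.commute)

lemma christoffel_bilinear:
  assumes z: "z \<in> S"
  shows "bilinear (\<Gamma> z)"
proof -
  note l = dg_linear[OF z]
  have "linear (\<lambda>v. \<Gamma> z u v)" for u
  proof (rule linearI)
    show "\<Gamma> z u (v + v') = \<Gamma> z u v + \<Gamma> z u v'" for v v'
      by (rule metric_eqI[OF met[OF z]])
         (simp add: metric_add[OF met[OF z]] g_christoffel[OF z] linear_add[OF l(1)] linear_add[OF l(2)] linear_add[OF l(3)] field_simps)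
    show "\<Gamma> z u (r *\<^sub>R v) = r *\<^sub>R \<Gamma> z u v" for v r
      by (rule metric_eqI[OF met[OF z]])
         (simp add: metric_add[OF met[OF z]] g_christoffel[OF z] linear_cmul[OF l(1)] linear_cmul[OF l(2)] linear_cmul[OF l(3)] algebra_simps)
  qed
  then show ?thesis unfolding bilinear_def using christoffel_sym[OF z] by simp
qed

lemma christoffel_metric: "z \<in> S \<Longrightarrow> dg z v w u = g z (\<Gamma> z u v) w + g z v (\<Gamma> z u w)"
proof -
  assume z: "z \<in> S"
  have "g z v (\<Gamma> z u w) = (dg z w v u + dg z u v w - dg z u w v) / 2"
    unfolding is_metricD(2)[OF met[OF z], of v] by (rule g_christoffel[OF z])
  moreover have "dg z w v u = dg z v w u" by (rule dg_sym[OF z])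
  ultimately show ?thesis by (simp add: g_christoffel[OF z] field_simps)
qed

lemma christoffel_diff:
  assumes z: "z \<in> S"
  shows "(\<lambda>z. \<Gamma> z u v) differentiable (at z within S)"
proof -
  have "(\<lambda>z. (dg z v w u + dg z u w v - dg z u v w) / 2) differentiable (at z within S)" for w
    using dg_diff[OF z] by (intro derivative_intros) auto
  then show ?thesis unfolding christoffel_def
    by (intro differentiableI[OF has_derivative_sharp[OF z met g_diff[OF z] linear_koszul _ refl]])
qed

abbreviation R where "R \<equiv> riemann S g"

lemma riemann_antisym: "R z u v w = - R z v u w"
  unfolding riemann_def by simp

lemma riemann_bianchi: "z \<in> S \<Longrightarrow> R z u v w + R z v w u + R z w u v = 0"
proof -
  assume z: "z \<in> S"
  have "pd S (\<lambda>z. \<Gamma> z u v) z h = pd S (\<lambda>z. \<Gamma> z v u) z h" for u v h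
    using pd_cong[OF z christoffel_sym[of _ u v]] by simp
  then show ?thesis unfolding riemann_def
    using christoffel_sym[OF z, of v w] christoffel_sym[OF z, of u w] christoffel_sym[OF z, of v u] by (simp add: algebra_simps)
qed

lemma riemann_linear:
  assumes z: "z \<in> S"
  shows "linear (\<lambda>u. R z u v w)" "linear (\<lambda>v. R z u v w)" "linear (\<lambda>w. R z u v w)"
proof -
  note b = christoffel_bilinear
  have l: "linear (\<lambda>h. pd S (\<lambda>z. \<Gamma> z u v) z h)" "linear (\<lambda>u. pd S (\<lambda>z. \<Gamma> z u v) z h)" "linear (\<lambda>v. pd S (\<lambda>z. \<Gamma> z u v) z h)" for u v h
    using linear_pd[OF christoffel_diff[OF z]]
    linear_pd_family[OF dom z bilinear_linear(2)[OF b] christoffel_diff[OF z]]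
    linear_pd_family[OF dom z bilinear_linear(1)[OF b] christoffel_diff[OF z]] by auto
  have c: "linear (\<lambda>u. \<Gamma> z u v)" "linear (\<lambda>v. \<Gamma> z u v)" for u v
    using bilinear_linear[OF b[OF z]] by auto
  have cc: "linear (\<lambda>u. \<Gamma> z v (\<Gamma> z u w))" "linear (\<lambda>u. \<Gamma> z v (\<Gamma> z w u))" for v w
    using linear_compose[OF c(1)[of w] c(2)[of v]] linear_compose[OF c(2)[of w] c(2)[of v]] by (auto simp: o_def)
  show 1: "linear (\<lambda>u. R z u v w)" for v
    unfolding riemann_def by (intro linear_compose_add linear_compose_sub l c cc)
  show "linear (\<lambda>v. R z u v w)"
    using linear_compose_neg[OF 1[of u]] riemann_antisym[of z u] by simp
  show "linear (\<lambda>w. R z u v w)"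
    unfolding riemann_def by (intro linear_compose_add linear_compose_sub l c cc)
qed

end

text \<open>Vector fields along a map F into the chart, with the pulled-back connection
  \<open>cov\<close>. The instances are the collar map, the inclusion of the boundary and the
  identity.\<close>

locale chart_map = chart_metric S g for S :: "'e::euclidean_space set" and g +
  fixes D :: "'d::euclidean_space set" and F :: "'d \<Rightarrow> 'e"
  assumes domD: "corner_domain D" and F_in: "\<And>z. z \<in> D \<Longrightarrow> F z \<in> S" and F_tw: "twice_diff D F"
begin

abbreviation dF where "dF \<equiv> pd D F"

definition cov :: "('d \<Rightarrow> 'e) \<Rightarrow> 'd \<Rightarrow> 'd \<Rightarrow> 'e" where
  "cov X a z = pd D X z a + \<Gamma> (F z) (dF z a) (X z)"

lemma F_has: "z \<in> D \<Longrightarrow> (F has_derivative dF z) (at z within D)"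
  by (rule pd_has_derivative[OF differentiable_onD[OF twice_diffD(1)[OF F_tw]]])

lemma dF_diff: "z \<in> D \<Longrightarrow> (\<lambda>z. dF z a) differentiable (at z within D)"
  by (rule differentiable_onD[OF twice_diffD(2)[OF F_tw]])

lemma comp_has:
  assumes "z \<in> D" "f differentiable (at (F z) within S)"
  shows "((\<lambda>z. f (F z)) has_derivative (\<lambda>h. pd S f (F z) (dF z h))) (at z within D)"
  by (rule has_derivative_pd_compose[OF F_has[OF assms(1)] assms(2) F_in])

lemma pd_comp:
  assumes "z \<in> D" "f differentiable (at (F z) within S)"
  shows "pd D (\<lambda>z. f (F z)) z h = pd S f (F z) (dF z h)"
  using pd_eqI[OF domD assms(1) comp_has[OF assms]] by simp

lemma cov_torsion: "z \<in> D \<Longrightarrow> cov (\<lambda>z. dF z b) a z = cov (\<lambda>z. dF z a) b z"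
  unfolding cov_def using pd_symmetric[OF domD F_tw, of z b a] christoffel_sym[OF F_in] by simp

lemma metric_along:
  assumes z: "z \<in> D" and X: "X differentiable (at z within D)" and Y: "Y differentiable (at z within D)"
  shows "((\<lambda>z. g (F z) (X z) (Y z)) has_derivative
      (\<lambda>a. g (F z) (cov X a z) (Y z) + g (F z) (X z) (cov Y a z))) (at z within D)"
proof -
  note Fz = F_in[OF z]
  have "((\<lambda>w. g (F w) (X w) (Y w)) has_derivative
    (\<lambda>h. pd D (\<lambda>w. g (F w) (X z) (Y z)) z h + g (F z) (pd D X z h) (Y z) + g (F z) (X z) (pd D Y z h))) (at z within D)"
    by (rule has_derivative_bilinear_family[OF z g_bilinear[OF F_in] differentiableI[OF comp_has[OF z g_diff[OF Fz]]]
       pd_has_derivative[OF X] pd_has_derivative[OF Y]])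
  then show ?thesis
    unfolding pd_comp[OF z g_diff[OF Fz]] christoffel_metric[OF Fz] cov_def
    by (simp add: metric_add[OF met[OF Fz]] algebra_simps)
qed

lemma pd_metric_along:
  assumes z: "z \<in> D" and X: "X differentiable (at z within D)" and Y: "Y differentiable (at z within D)"
  shows "pd D (\<lambda>z. g (F z) (X z) (Y z)) z a = g (F z) (cov X a z) (Y z) + g (F z) (X z) (cov Y a z)"
  using pd_eqI[OF domD z metric_along[OF assms]] by simp

lemma christoffel_along:
  assumes z: "z \<in> D" and X: "X differentiable (at z within D)" and Y: "Y differentiable (at z within D)"
  shows "((\<lambda>z. \<Gamma> (F z) (X z) (Y z)) has_derivative (\<lambda>h. pd S (\<lambda>w. \<Gamma> w (X z) (Y z)) (F z) (dF z h) + \<Gamma> (F z) (pd D X z h) (Y z) + \<Gamma> (F z) (X z) (pd D Y z h))) (at z within D)"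
proof -
  note Fz = F_in[OF z]
  have "((\<lambda>w. \<Gamma> (F w) (X w) (Y w)) has_derivative
    (\<lambda>h. pd D (\<lambda>w. \<Gamma> (F w) (X z) (Y z)) z h + \<Gamma> (F z) (pd D X z h) (Y z) + \<Gamma> (F z) (X z) (pd D Y z h))) (at z within D)"
    by (rule has_derivative_bilinear_family[OF z christoffel_bilinear[OF F_in] differentiableI[OF comp_has[OF z christoffel_diff[OF Fz]]]
       pd_has_derivative[OF X] pd_has_derivative[OF Y]])
  then show ?thesis
    unfolding pd_comp[OF z christoffel_diff[OF Fz]] .
qed

lemma cov_has_derivative:
  assumes z: "z \<in> D" and X: "twice_diff D X"
  shows "((\<lambda>z. cov X b z) has_derivative (\<lambda>a. pd D (\<lambda>z. pd D X z b) z a +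
    (pd S (\<lambda>w. \<Gamma> w (dF z b) (X z)) (F z) (dF z a) + \<Gamma> (F z) (pd D (\<lambda>z. dF z b) z a) (X z) + \<Gamma> (F z) (dF z b) (pd D X z a)))) (at z within D)"
  unfolding cov_def
  by (intro has_derivative_add pd_has_derivative christoffel_along dF_diff z twice_diffD[OF X, THEN differentiable_onD])

lemma cov_diff:
  assumes z: "z \<in> D" and X: "twice_diff D X"
  shows "(\<lambda>z. cov X b z) differentiable (at z within D)"
  by (rule differentiableI[OF cov_has_derivative[OF assms]])

text \<open>The parameter directions a and b are constant and commute, so there is no bracket term;
  symmetry of the second derivatives of X and F removes everything except the terms of
  \<open>riemann\<close>.\<close>

theorem curvature_along:
  assumes z: "z \<in> D" and X: "twice_diff D X"
  shows "cov (\<lambda>z. cov X b z) a z - cov (\<lambda>z. cov X a z) b z = R (F z) (dF z a) (dF z b) (X z)"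
proof -
  note Fz = F_in[OF z]
  note bil = christoffel_bilinear[OF Fz]
  have 1: "cov (\<lambda>z. cov X b z) a z = pd D (\<lambda>z. pd D X z b) z a +
    (pd S (\<lambda>w. \<Gamma> w (dF z b) (X z)) (F z) (dF z a) + \<Gamma> (F z) (pd D (\<lambda>z. dF z b) z a) (X z) + \<Gamma> (F z) (dF z b) (pd D X z a))
     + \<Gamma> (F z) (dF z a) (pd D X z b) + \<Gamma> (F z) (dF z a) (\<Gamma> (F z) (dF z b) (X z))" for a b
  proof -
    have "cov (\<lambda>z. cov X b z) a z = pd D (\<lambda>z. cov X b z) z a + \<Gamma> (F z) (dF z a) (cov X b z)"
      by (rule cov_def)
    then show ?thesis unfolding pd_eqI[OF domD z cov_has_derivative[OF z X]]
      by (simp add: cov_def bilinear_radd[OF bil])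
  qed
  show ?thesis unfolding 1 riemann_def
    using pd_symmetric[OF domD X z, of a b] pd_symmetric[OF domD F_tw z, of a b] by simp
qed

end

section \<open>Antisymmetry of the curvature in its last two arguments\<close>

context chart_metric begin

text \<open>For a constant field w, the second derivative of g(w, w) is 2 g(\<nabla>_u \<nabla>_v w,
  w) plus a term symmetric in u and v. Second derivatives are symmetric as well, so the commutator
  of covariant derivatives is orthogonal to w.\<close>

lemma riemann_skew_diag: "z \<in> S \<Longrightarrow> g z (R z u v w) w = 0"
proof -
  assume z: "z \<in> S"
  interpret I: chart_map S g S "\<lambda>z. z"
    by unfold_locales (auto simp: dom twice_diff_id)
  have cst: "twice_diff S (\<lambda>_. w)" by (rule twice_diff_const[OF dom])
  have 1: "pd S (\<lambda>z. pd S (\<lambda>z. g z w w) z v) z u = 2 * (g z (I.cov (\<lambda>z. I.cov (\<lambda>_. w) v z) u z) w + g z (I.cov (\<lambda>_. w) v z) (I.cov (\<lambda>_. w) u z))" for u v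
  proof -
    have "pd S (\<lambda>z. pd S (\<lambda>z. g z w w) z v) z u = pd S (\<lambda>z. 2 * g z (I.cov (\<lambda>_. w) v z) w) z u"
    proof -
      have "pd S (\<lambda>z. pd S (\<lambda>z. g z w w) z v) z = pd S (\<lambda>z. 2 * g z (I.cov (\<lambda>_. w) v z) w) z"
      proof (rule pd_cong[OF z])
        fix y assume y: "y \<in> S"
        show "pd S (\<lambda>z. g z w w) y v = 2 * g y (I.cov (\<lambda>_. w) v y) w"
          using I.pd_metric_along[of y "\<lambda>_. w" "\<lambda>_. w" v] y is_metricD(2)[OF met[OF y], of w] by simp
      qed
      then show ?thesis by simp
    qed
    also have "\<dots> = 2 * (g z (I.cov (\<lambda>z. I.cov (\<lambda>_. w) v z) u z) w + g z (I.cov (\<lambda>_. w) v z) (I.cov (\<lambda>_. w) u z))"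
      using pd_eqI[OF dom z has_derivative_mult_right[OF I.metric_along[OF z I.cov_diff[OF z cst, of v], of "\<lambda>_. w"]]] by simp
    finally show ?thesis .
  qed
  have "g z (I.cov (\<lambda>z. I.cov (\<lambda>_. w) v z) u z) w = g z (I.cov (\<lambda>z. I.cov (\<lambda>_. w) u z) v z) w"
    using pd_symmetric[OF dom tw z, of w w u v] 1[of u v] 1[of v u]
      is_metricD(2)[OF met[OF z], of "I.cov (\<lambda>_. w) v z"] by simp
  moreover have "R z u v w = I.cov (\<lambda>z. I.cov (\<lambda>_. w) v z) u z - I.cov (\<lambda>z. I.cov (\<lambda>_. w) u z) v z"
    using I.curvature_along[OF z cst, of v u] by (simp add: pd_ident[OF dom z])
  ultimately show ?thesis by (simp add: metric_add[OF met[OF z]])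
qed

lemma riemann_skew: "z \<in> S \<Longrightarrow> g z (R z u v w) w' = - g z (R z u v w') w"
proof -
  assume z: "z \<in> S"
  note m = metric_add[OF met[OF z]]
  have "g z (R z u v (w + w')) (w + w') = 0" by (rule riemann_skew_diag[OF z])
  then show ?thesis using riemann_skew_diag[OF z, of u v w] riemann_skew_diag[OF z, of u v w']
    by (simp add: linear_add[OF riemann_linear(3)[OF z]] m)
qed

end

section \<open>Volume forms and oriented frames\<close>

text \<open>The Gram matrix of V is M H M^T, with M the coordinates of V. For orthonormal V its
  determinant is 1, which ties the volume density to the determinant of the frame.\<close>

lemma gram_det:
  fixes h :: "'e::euclidean_space \<Rightarrow> 'e \<Rightarrow> real" and c V :: "'n::finite \<Rightarrow> 'e"
  assumes bil: "bilinear h" and c: "\<And>v. v = (\<Sum>j\<in>UNIV. (v \<bullet> c j) *\<^sub>R c j)"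
  shows "det (\<chi> i j. h (V i) (V j)) = (det (\<chi> i j. V i \<bullet> c j))\<^sup>2 * det (\<chi> i j. h (c i) (c j))"
proof -
  define M where "M = (\<chi> i j. V i \<bullet> c j)"
  define H where "H = (\<chi> i j. h (c i) (c j))"
  have "(M ** H ** transpose M) $ i $ j = h (V i) (V j)" for i j
  proof -
    have "h (V i) (V j) = h (\<Sum>k\<in>UNIV. (V i \<bullet> c k) *\<^sub>R c k) (\<Sum>l\<in>UNIV. (V j \<bullet> c l) *\<^sub>R c l)"
      using c by metis
    also have "\<dots> = (\<Sum>l\<in>UNIV. \<Sum>k\<in>UNIV. (V i \<bullet> c k) * h (c k) (c l) * (V j \<bullet> c l))"
      by (simp add: linear_sum[OF bilinear_linear(1)[OF bil]] linear_sum[OF bilinear_linear(2)[OF bil]]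
        bilinear_lmul[OF bil] bilinear_rmul[OF bil] sum_distrib_left mult_ac)
    finally show ?thesis
      by (simp add: matrix_matrix_mult_def M_def H_def transpose_def sum_distrib_right)
  qed
  then have "(\<chi> i j. h (V i) (V j)) = M ** H ** transpose M" by (simp add: vec_eq_iff)
  then show ?thesis by (simp add: det_mul det_transpose M_def H_def power2_eq_square)
qed

lemma axis_expansion: "v = (\<Sum>j\<in>UNIV. (v \<bullet> axis j 1) *\<^sub>R axis j (1::real))"
  by (simp add: vec_eq_iff inner_axis) (simp add: axis_def if_distrib cong: if_cong)

lemma vec3_inner_axis: "(\<chi> i j. (vector [u, v, w] :: real^3^3) $ i \<bullet> axis j 1) = vector [u, v, w]"
  by (simp add: vec_eq_iff inner_axis)

lemma vol3_alt: "vol3 h u v w = sqrt (det (\<chi> i j. h (axis i 1) (axis j 1))) * (u \<bullet> cross3 v w)"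
  unfolding vol3_def by (simp add: dot_cross_det)

lemma linear_triple_product:
  "linear (\<lambda>u. c * (u \<bullet> cross3 v w))" "linear (\<lambda>v. c * (u \<bullet> cross3 v w))" "linear (\<lambda>w. c * (u \<bullet> cross3 v w))"
proof -
  show "linear (\<lambda>u. c * (u \<bullet> cross3 v w))"
    by (rule linearI) (simp_all add: inner_add_left distrib_left mult.left_commute)
  show "linear (\<lambda>v. c * (u \<bullet> cross3 v w))"
    by (rule linearI) (simp_all add: inner_add_right cross_add_left cross_mult_left distrib_left mult.left_commute)
  show "linear (\<lambda>w. c * (u \<bullet> cross3 v w))"
    by (rule linearI) (simp_all add: inner_add_right cross_add_right cross_mult_right distrib_left mult.left_commute)
qed

lemma vol3_linear: "linear (\<lambda>u. vol3 h u v w)" "linear (\<lambda>v. vol3 h u v w)" "linear (\<lambda>w. vol3 h u v w)"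
  unfolding vol3_alt by (rule linear_triple_product)+

lemma vol3_cyc: "vol3 h u v w = vol3 h v w u"
  unfolding vol3_alt using cross_triple[of v w u] inner_commute[of u "cross3 v w"]
    inner_commute[of v "cross3 w u"] by simp

lemma vol3_swap: "vol3 h u v w = - vol3 h v u w"
proof -
  have "u \<bullet> cross3 v w = - (v \<bullet> cross3 u w)" by (simp add: cross3_simps)
  then show ?thesis unfolding vol3_alt by simp
qed

lemma vol3_same [simp]: "vol3 h u u w = 0" "vol3 h u v u = 0" "vol3 h u v v = 0"
  unfolding vol3_alt by (simp_all add: dot_cross_self)

lemma metric_cross_works: "is_metric h \<Longrightarrow> h (metric_cross h u v) w = vol3 h u v w"
  unfolding metric_cross_def by (rule sharp_works[OF _ vol3_linear(3)])

section \<open>Oriented orthonormal frames in dimension three\<close>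

definition oriented_frame :: "(real^3 \<Rightarrow> real^3 \<Rightarrow> real) \<Rightarrow> real^3 \<Rightarrow> real^3 \<Rightarrow> real^3 \<Rightarrow> bool" where
  "oriented_frame h e1 e2 e3 \<longleftrightarrow> h e1 e1 = 1 \<and> h e2 e2 = 1 \<and> h e3 e3 = 1 \<and> h e1 e2 = 0 \<and> h e1 e3 = 0 \<and> h e2 e3 = 0
     \<and> 0 < det (vector [e1, e2, e3] :: real^3^3)"

text \<open>Gram-Schmidt on the coordinate axes. The resulting matrix is triangular with positive
  diagonal, which gives the orientation.\<close>

lemma oriented_frame_exists:
  assumes h: "is_metric h"
  obtains e1 e2 e3 where "oriented_frame h e1 e2 e3"
proof -
  note m = metric_add[OF h] and pos = is_metricD(3)[OF h] and sym = is_metricD(2)[OF h]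
  define f1 where "f1 = (axis 1 1 :: real^3)"
  define e1 where "e1 = (1 / sqrt (h f1 f1)) *\<^sub>R f1"
  have f1: "f1 \<noteq> 0" by (simp add: f1_def axis_eq_0_iff)
  define f2 where "f2 = axis 2 1 - h (axis 2 1) e1 *\<^sub>R e1"
  define e2 where "e2 = (1 / sqrt (h f2 f2)) *\<^sub>R f2"
  have e1c: "e1 $ 2 = 0" "e1 $ 3 = 0" by (simp_all add: e1_def f1_def axis_def)
  have f2c: "f2 $ 2 = 1" "f2 $ 3 = 0" by (simp_all add: f2_def e1c axis_def)
  then have f2: "f2 \<noteq> 0" by (metis zero_index zero_neq_one)
  have e2c: "e2 $ 3 = 0" by (simp add: e2_def f2c)
  define f3 where "f3 = axis 3 1 - h (axis 3 1) e1 *\<^sub>R e1 - h (axis 3 1) e2 *\<^sub>R e2"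
  define e3 where "e3 = (1 / sqrt (h f3 f3)) *\<^sub>R f3"
  have f3c: "f3 $ 3 = 1" by (simp add: f3_def e1c e2c axis_def)
  then have f3: "f3 \<noteq> 0" by (metis zero_index zero_neq_one)
  have unit: "h ((1 / sqrt (h f f)) *\<^sub>R f) ((1 / sqrt (h f f)) *\<^sub>R f) = 1" if "f \<noteq> 0" for f
    using pos[OF that] by (simp add: m)
  have u: "h e1 e1 = 1" "h e2 e2 = 1" "h e3 e3 = 1" unfolding e1_def e2_def e3_def using unit f1 f2 f3 by auto
  have "h e1 f2 = 0" unfolding f2_def by (simp add: m u sym[of e1 "axis 2 1"])
  then have o12: "h e1 e2 = 0" by (simp add: e2_def m)
  have o21: "h e2 e1 = 0" using o12 sym by metis
  have "h e1 f3 = 0" "h e2 f3 = 0" unfolding f3_def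
    by (simp_all add: m u o12 o21 sym[of e1 "axis 3 1"] sym[of e2 "axis 3 1"])
  then have o3: "h e1 e3 = 0" "h e2 e3 = 0" by (simp_all add: e3_def m)
  have "det (vector [e1, e2, e3] :: real^3^3) = e1 $ 1 * e2 $ 2 * e3 $ 3"
    by (simp add: det_3 e1c e2c)
  also have "\<dots> > 0"
    using pos[OF f1] pos[OF f2] pos[OF f3] by (simp add: e1_def e2_def e3_def f2c f3c f1_def axis_def)
  finally show ?thesis using that u o12 o3 unfolding oriented_frame_def by blast
qed

locale frame3 =
  fixes h :: "real^3 \<Rightarrow> real^3 \<Rightarrow> real" and e1 e2 e3
  assumes h: "is_metric h" and fr: "oriented_frame h e1 e2 e3"
begin

lemma ortho [simp]: "h e1 e1 = 1" "h e2 e2 = 1" "h e3 e3 = 1" "h e1 e2 = 0" "h e1 e3 = 0" "h e2 e3 = 0"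
  "h e2 e1 = 0" "h e3 e1 = 0" "h e3 e2 = 0"
  using fr is_metricD(2)[OF h] unfolding oriented_frame_def by metis+

lemma gram: "det (\<chi> i j. h (axis i 1) (axis j 1)) * (det (vector [e1, e2, e3] :: real^3^3))\<^sup>2 = 1"
proof -
  have "(\<chi> i j. h ((vector [e1, e2, e3] :: real^3^3) $ i) ((vector [e1, e2, e3] :: real^3^3) $ j)) = mat 1"
    by (simp add: vec_eq_iff forall_3 mat_def)
  then show ?thesis
    using gram_det[OF is_metricD(1)[OF h] axis_expansion, of "\<lambda>i. (vector [e1, e2, e3] :: real^3^3) $ i"]
    unfolding vec3_inner_axis by (simp add: mult.commute)
qed

lemma vol_frame [simp]: "vol3 h e1 e2 e3 = 1"
proof -
  define d where "d = det (vector [e1, e2, e3] :: real^3^3)"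
  have d: "d > 0" using fr by (simp add: oriented_frame_def d_def)
  have "(vol3 h e1 e2 e3) = sqrt (1 / d\<^sup>2) * d"
    using gram d unfolding vol3_def d_def[symmetric] by (simp add: eq_divide_eq)
  then show ?thesis using d by (simp add: real_sqrt_divide)
qed

lemma indep:
  assumes "h v e1 = 0" "h v e2 = 0" "h v e3 = 0"
  shows "v = 0"
proof -
  have d: "det (vector [e1, e2, e3] :: real^3^3) \<noteq> 0" using fr by (simp add: oriented_frame_def)
  define A where "A = (vector [e1, e2, e3] :: real^3^3)"
  have inv: "invertible (transpose A)" by (subst invertible_det_nz) (simp add: A_def det_transpose d)
  obtain B where B: "transpose A ** B = mat 1" using inv unfolding invertible_def by blast
  define x where "x = B *v v"
  have x: "transpose A *v x = v" unfolding x_def by (simp add: matrix_vector_mul_assoc B)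
  have "transpose A *v x = x $ 1 *\<^sub>R e1 + x $ 2 *\<^sub>R e2 + x $ 3 *\<^sub>R e3"
    by (simp add: vec_eq_iff matrix_vector_mult_def transpose_def A_def sum_3 mult.commute)
  then have "v = x $ 1 *\<^sub>R e1 + x $ 2 *\<^sub>R e2 + x $ 3 *\<^sub>R e3" unfolding x .
  then have "h v v = h v (x $ 1 *\<^sub>R e1 + x $ 2 *\<^sub>R e2 + x $ 3 *\<^sub>R e3)" by simp
  also have "\<dots> = x $ 1 * h v e1 + x $ 2 * h v e2 + x $ 3 * h v e3"
    by (simp only: metric_add(2,6)[OF h])
  finally have "h v v = 0" using assms by simp
  then show ?thesis using is_metricD(3)[OF h, of v] by (cases "v = 0") auto
qed

lemma expand: "v = h v e1 *\<^sub>R e1 + h v e2 *\<^sub>R e2 + h v e3 *\<^sub>R e3"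
proof -
  have "v - (h v e1 *\<^sub>R e1 + h v e2 *\<^sub>R e2 + h v e3 *\<^sub>R e3) = 0"
    by (rule indep) (simp_all add: metric_add[OF h])
  then show ?thesis by simp
qed

lemma eqI: "h u e1 = h v e1 \<Longrightarrow> h u e2 = h v e2 \<Longrightarrow> h u e3 = h v e3 \<Longrightarrow> u = v"
  by (metis expand)

lemma h_expand: "h u v = h u e1 * h v e1 + h u e2 * h v e2 + h u e3 * h v e3"
proof -
  have "h u v = h u (h v e1 *\<^sub>R e1 + h v e2 *\<^sub>R e2 + h v e3 *\<^sub>R e3)" using expand[of v] by simp
  then show ?thesis by (simp add: metric_add[OF h] mult.commute)
qed

lemma vol_frame_all [simp]: "vol3 h e2 e3 e1 = 1" "vol3 h e3 e1 e2 = 1" "vol3 h e2 e1 e3 = -1" "vol3 h e1 e3 e2 = -1" "vol3 h e3 e2 e1 = -1"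
proof -
  show a: "vol3 h e2 e3 e1 = 1" "vol3 h e3 e1 e2 = 1"
    using vol_frame vol3_cyc[of h e1 e2 e3] vol3_cyc[of h e2 e3 e1] by auto
  show "vol3 h e2 e1 e3 = -1" "vol3 h e1 e3 e2 = -1" "vol3 h e3 e2 e1 = -1"
    using vol3_swap[of h e2 e1 e3] vol3_swap[of h e1 e3 e2] vol3_swap[of h e3 e2 e1] a vol_frame by auto
qed

abbreviation cr (infixl "\<otimes>" 70) where "u \<otimes> v \<equiv> metric_cross h u v"

lemma vol_expand: "vol3 h u v w = h u e1 * (h v e2 * h w e3 - h v e3 * h w e2) + h u e2 * (h v e3 * h w e1 - h v e1 * h w e3)
   + h u e3 * (h v e1 * h w e2 - h v e2 * h w e1)"
proof -
  note l = vol3_linear[THEN linear_add] vol3_linear[THEN linear_cmul]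
  have "vol3 h u v w = vol3 h (h u e1 *\<^sub>R e1 + h u e2 *\<^sub>R e2 + h u e3 *\<^sub>R e3) (h v e1 *\<^sub>R e1 + h v e2 *\<^sub>R e2 + h v e3 *\<^sub>R e3)
     (h w e1 *\<^sub>R e1 + h w e2 *\<^sub>R e2 + h w e3 *\<^sub>R e3)"
    using expand[of u] expand[of v] expand[of w] by simp
  then show ?thesis by (simp add: l algebra_simps)
qed

lemma cross_comp:
  "h (u \<otimes> v) e1 = h u e2 * h v e3 - h u e3 * h v e2"
  "h (u \<otimes> v) e2 = h u e3 * h v e1 - h u e1 * h v e3"
  "h (u \<otimes> v) e3 = h u e1 * h v e2 - h u e2 * h v e1"
  unfolding metric_cross_works[OF h] vol_expand by simp_all

end

section \<open>Cross product, Hodge star and contractions in frames\<close>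

text \<open>This formula recovers the metric from the cross product; set against
  \<open>su2_triple\<close> it forces a soldering form to be an isometry.\<close>

lemma metric_triple_cross:
  assumes h: "is_metric h"
  shows "metric_cross h u (metric_cross h v w) = h u w *\<^sub>R v - h u v *\<^sub>R w"
proof -
  obtain e1 e2 e3 where "oriented_frame h e1 e2 e3" using oriented_frame_exists[OF h] .
  then interpret frame3 h e1 e2 e3 using h by unfold_locales
  show ?thesis
    by (rule eqI) (simp_all add: cross_comp metric_add[OF h] h_expand[of u w] h_expand[of u v] algebra_simps)
qed

lemma metric_cross_bilinear:
  assumes h: "is_metric h"
  shows "bilinear (metric_cross h)"
proof -
  note l = vol3_linear[THEN linear_add] vol3_linear[THEN linear_cmul]
  show ?thesis unfolding bilinear_def
    by (intro conjI allI linearI; rule metric_eqI[OF h]; simp add: metric_cross_works[OF h] metric_add[OF h] l)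
qed

text \<open>By this identity the star of a 1-form depends on the metric only through the cross
  product, which is a \<open>sharp\<close> and can be differentiated along a path of
  metrics.\<close>

lemma hodge1_linear:
  assumes h: "is_metric h" and \<beta>: "linear \<beta>"
  shows "hodge1 h \<beta> u v = \<beta> (metric_cross h u v)"
proof -
  have "vol3 h (recip h b) u v = b \<bullet> metric_cross h u v" for b
    using recip_works[OF h, of b "metric_cross h u v"] metric_cross_works[OF h, of u v "recip h b"]
      is_metricD(2)[OF h] vol3_cyc by metis
  then have "hodge1 h \<beta> u v = (\<Sum>b\<in>Basis. (metric_cross h u v \<bullet> b) *\<^sub>R \<beta> b)"
    unfolding hodge1_def by (simp add: inner_commute)
  also have "\<dots> = \<beta> (\<Sum>b\<in>Basis. (metric_cross h u v \<bullet> b) *\<^sub>R b)" using \<beta> by (simp add: linear_sum linear_cmul)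
  finally show ?thesis by (simp add: euclidean_representation)
qed

text \<open>The sum of \<open>recip g b\<close> tensor b is the inverse metric, whatever the frame.
  Traces, scalar curvature, Hodge stars and the dual Weyl tensor are defined by coordinate
  contractions; this moves them to orthonormal frames.\<close>

lemma contract_frame:
  fixes g :: "'e::euclidean_space \<Rightarrow> 'e \<Rightarrow> real" and f :: "'e \<Rightarrow> 'e \<Rightarrow> 'f::real_vector"
  assumes g: "is_metric g" and fin: "finite I" and e: "\<And>v. v = (\<Sum>i\<in>I. g v (e i) *\<^sub>R e i)" and f: "bilinear f"
  shows "(\<Sum>b\<in>Basis. f (recip g b) b) = (\<Sum>i\<in>I. f (e i) (e i))"
proof -
  have "f (recip g b) b = (\<Sum>i\<in>I. (e i \<bullet> b) *\<^sub>R f (e i) b)" for b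
  proof -
    have "f (recip g b) b = f (\<Sum>i\<in>I. g (recip g b) (e i) *\<^sub>R e i) b" using e[of "recip g b"] by simp
    then show ?thesis
      by (simp add: recip_works[OF g] linear_sum[OF bilinear_linear(2)[OF f]] bilinear_lmul[OF f] inner_commute)
  qed
  then have "(\<Sum>b\<in>Basis. f (recip g b) b) = (\<Sum>b\<in>Basis. \<Sum>i\<in>I. (e i \<bullet> b) *\<^sub>R f (e i) b)" by simp
  also have "\<dots> = (\<Sum>i\<in>I. \<Sum>b\<in>Basis. (e i \<bullet> b) *\<^sub>R f (e i) b)" by (rule sum.swap)
  also have "\<dots> = (\<Sum>i\<in>I. f (e i) (\<Sum>b\<in>Basis. (e i \<bullet> b) *\<^sub>R b))"
    by (simp add: linear_sum[OF bilinear_linear(1)[OF f]] bilinear_rmul[OF f])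
  finally show ?thesis by (simp add: euclidean_representation)
qed

lemma endo_trace_frame:
  fixes g :: "'e::euclidean_space \<Rightarrow> 'e \<Rightarrow> real"
  assumes g: "is_metric g" and fin: "finite I" and e: "\<And>v. v = (\<Sum>i\<in>I. g v (e i) *\<^sub>R e i)" and E: "linear E"
  shows "endo_trace E = (\<Sum>i\<in>I. g (E (e i)) (e i))"
proof -
  have "bilinear (\<lambda>a b. g a (E b))"
    unfolding bilinear_def using E by (auto intro!: linearI simp: metric_add[OF g] linear_add linear_cmul)
  from contract_frame[OF g fin e this]
  have "(\<Sum>b\<in>Basis. b \<bullet> E b) = (\<Sum>i\<in>I. g (e i) (E (e i)))" by (simp add: recip_works[OF g])
  then show ?thesis unfolding endo_trace_def
    by (simp add: inner_commute[of "E b" b for b] is_metricD(2)[OF g, of "E b" b for b])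
qed

context frame3 begin

definition e :: "nat \<Rightarrow> real^3" where "e i = (if i = 0 then e1 else if i = 1 then e2 else e3)"

lemma expand_sum: "v = (\<Sum>i\<in>{0,1,2::nat}. h v (e i) *\<^sub>R e i)"
  using expand[of v] by (simp add: e_def add.assoc)

lemma trace_frame: "linear E \<Longrightarrow> endo_trace E = h (E e1) e1 + h (E e2) e2 + h (E e3) e3"
  by (subst endo_trace_frame[OF h _ expand_sum]) (simp_all add: e_def)

lemma hodge2_frame:
  assumes M: "bilinear M" and alt: "\<And>u v. M u v = - M v u"
  shows "hodge2 h M v = h v e1 *\<^sub>R M e2 e3 + h v e2 *\<^sub>R M e3 e1 + h v e3 *\<^sub>R (M e1 e2 :: 'f::real_normed_vector)"
proof -
  note l = vol3_linear[THEN linear_add] vol3_linear[THEN linear_cmul] bilinear_ladd[OF M] bilinear_radd[OF M] bilinear_lmul[OF M] bilinear_rmul[OF M]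
  have b1: "bilinear (\<lambda>x b. vol3 h (recip h a) x v *\<^sub>R M a b)" for a
    unfolding bilinear_def by (auto intro!: linearI simp: l algebra_simps)
  have b2: "bilinear (\<lambda>x a. \<Sum>i\<in>{0,1,2::nat}. vol3 h x (e i) v *\<^sub>R M a (e i))"
    unfolding bilinear_def by (auto intro!: linearI simp: l algebra_simps)
  have "hodge2 h M v = (1/2) *\<^sub>R (\<Sum>a\<in>Basis. \<Sum>i\<in>{0,1,2::nat}. vol3 h (recip h a) (e i) v *\<^sub>R M a (e i))"
    unfolding hodge2_def by (simp only: contract_frame[OF h _ expand_sum b1] finite.intros)
  also have "\<dots> = (1/2) *\<^sub>R (\<Sum>j\<in>{0,1,2::nat}. \<Sum>i\<in>{0,1,2::nat}. vol3 h (e j) (e i) v *\<^sub>R M (e j) (e i))"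
    by (simp only: contract_frame[OF h _ expand_sum b2] finite.intros)
  also have "\<dots> = h v e1 *\<^sub>R M e2 e3 + h v e2 *\<^sub>R M e3 e1 + h v e3 *\<^sub>R M e1 e2"
    using alt[of e2 e1] alt[of e3 e2] alt[of e1 e3] 
    by (simp add: e_def vol_expand algebra_simps flip: scaleR_add_left)
  finally show ?thesis .
qed

lemma tf_symm_frame:
  assumes E: "linear E"
  shows "h (tf_symm h E u) v = (h (E u) v + h (E v) u) / 2 - (h (E e1) e1 + h (E e2) e2 + h (E e3) e3) / 3 * h u v"
proof -
  have lin: "linear (\<lambda>v. h u (E v))" for u
    using E by (auto intro!: linearI simp: metric_add[OF h] linear_add linear_cmul)
  have adj: "h (metric_adjoint h E u) v = h u (E v)" for u v
    unfolding metric_adjoint_def by (rule sharp_works[OF h lin])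
  have sa: "h (selfadjoint_part h E u) v = (h (E u) v + h (E v) u) / 2" for u v
    unfolding selfadjoint_part_def using is_metricD(2)[OF h, of u "E v"] by (simp add: metric_add[OF h] adj)
  have "linear (selfadjoint_part h E)"
    by (rule linearI; rule metric_eqI[OF h]) (simp_all add: sa metric_add[OF h] linear_add[OF E] linear_cmul[OF E] algebra_simps add_divide_distrib)
  then have tr: "endo_trace (selfadjoint_part h E) = h (E e1) e1 + h (E e2) e2 + h (E e3) e3"
    by (simp add: trace_frame sa)
  show ?thesis unfolding tf_symm_def tr by (simp add: metric_add[OF h] sa)
qed

end

lemma vector_4: "(vector [a,b,c,d] :: 'a::zero^4) $ 1 = a" "(vector [a,b,c,d] :: 'a::zero^4) $ 2 = b"
  "(vector [a,b,c,d] :: 'a::zero^4) $ 3 = c" "(vector [a,b,c,d] :: 'a::zero^4) $ 4 = d"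
  unfolding vector_def by simp_all

lemma det_4:
  "det (A::'a::comm_ring_1^4^4) =
    A$1$1 * (A$2$2 * A$3$3 * A$4$4 + A$2$3 * A$3$4 * A$4$2 + A$2$4 * A$3$2 * A$4$3
      - A$2$2 * A$3$4 * A$4$3 - A$2$3 * A$3$2 * A$4$4 - A$2$4 * A$3$3 * A$4$2)
  - A$1$2 * (A$2$1 * A$3$3 * A$4$4 + A$2$3 * A$3$4 * A$4$1 + A$2$4 * A$3$1 * A$4$3
      - A$2$1 * A$3$4 * A$4$3 - A$2$3 * A$3$1 * A$4$4 - A$2$4 * A$3$3 * A$4$1)
  + A$1$3 * (A$2$1 * A$3$2 * A$4$4 + A$2$2 * A$3$4 * A$4$1 + A$2$4 * A$3$1 * A$4$2
      - A$2$1 * A$3$4 * A$4$2 - A$2$2 * A$3$1 * A$4$4 - A$2$4 * A$3$2 * A$4$1)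
  - A$1$4 * (A$2$1 * A$3$2 * A$4$3 + A$2$2 * A$3$3 * A$4$1 + A$2$3 * A$3$1 * A$4$2
      - A$2$1 * A$3$3 * A$4$2 - A$2$2 * A$3$1 * A$4$3 - A$2$3 * A$3$2 * A$4$1)"
proof -
  have f: "finite {2::4, 3, 4}" "1 \<notin> {2::4, 3, 4}" "finite {3::4, 4}" "2 \<notin> {3::4, 4}" "finite {4::4}" "3 \<notin> {4::4}"
    by auto
  show ?thesis
    unfolding det_def UNIV_4
    unfolding sum_over_permutations_insert[OF f(1,2)]
    unfolding sum_over_permutations_insert[OF f(3,4)]
    unfolding sum_over_permutations_insert[OF f(5,6)]
    unfolding permutes_sing
    by (simp add: sign_swap_id permutation_swap_id sign_compose sign_id swap_id_eq permutation_compose algebra_simps)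
qed

section \<open>Algebraic Weyl tensors\<close>

text \<open>Contractions of an arbitrary (1,3) tensor at a single point. They separate pointwise
  algebra from differentiation, so that conformal changes and frame computations take place in one
  vector space.\<close>

definition ricci_alg :: "('e::euclidean_space \<Rightarrow> 'e \<Rightarrow> 'e \<Rightarrow> 'e) \<Rightarrow> 'e \<Rightarrow> 'e \<Rightarrow> real" where
  "ricci_alg R v w = endo_trace (\<lambda>u. R u v w)"

definition scalar_alg :: "('e::euclidean_space \<Rightarrow> 'e \<Rightarrow> real) \<Rightarrow> ('e \<Rightarrow> 'e \<Rightarrow> 'e \<Rightarrow> 'e) \<Rightarrow> real" where
  "scalar_alg g R = (\<Sum>b\<in>Basis. ricci_alg R b (recip g b))"

definition schouten_alg :: "('e::euclidean_space \<Rightarrow> 'e \<Rightarrow> real) \<Rightarrow> ('e \<Rightarrow> 'e \<Rightarrow> 'e \<Rightarrow> 'e) \<Rightarrow> 'e \<Rightarrow> 'e \<Rightarrow> real" where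
  "schouten_alg g R v w = (ricci_alg R v w - scalar_alg g R / (2 * (real DIM('e) - 1)) * g v w) / (real DIM('e) - 2)"

definition weyl_alg :: "('e::euclidean_space \<Rightarrow> 'e \<Rightarrow> real) \<Rightarrow> ('e \<Rightarrow> 'e \<Rightarrow> 'e \<Rightarrow> 'e) \<Rightarrow> 'e \<Rightarrow> 'e \<Rightarrow> 'e \<Rightarrow> 'e" where
  "weyl_alg g R u v w = - (R u v w -
     (schouten_alg g R v w *\<^sub>R u - schouten_alg g R u w *\<^sub>R v
      + g v w *\<^sub>R sharp g (schouten_alg g R u) - g u w *\<^sub>R sharp g (schouten_alg g R v)))"

lemma weyl_eq_weyl_alg: "weyl S g y = weyl_alg (g y) (riemann S g y)"
  unfolding fun_eq_iff weyl_def weyl_alg_def schouten_def schouten_alg_def scalar_curv_def scalar_alg_def ricci_def ricci_alg_def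
  by simp

lemma endo_trace_rank_one: "linear l \<Longrightarrow> endo_trace (\<lambda>u. l u *\<^sub>R a) = l a"
proof -
  assume l: "linear l"
  have "endo_trace (\<lambda>u. l u *\<^sub>R a) = (\<Sum>b\<in>Basis. (a \<bullet> b) *\<^sub>R l b)"
    by (simp add: endo_trace_def mult.commute)
  also have "\<dots> = l (\<Sum>b\<in>Basis. (a \<bullet> b) *\<^sub>R b)" using l by (simp add: linear_sum linear_cmul)
  finally show ?thesis by (simp add: euclidean_representation)
qed

lemma endo_trace_add:
  "endo_trace (\<lambda>u. A u + B u) = endo_trace A + endo_trace B"
  "endo_trace (\<lambda>u. A u - B u) = endo_trace A - endo_trace B"
  "endo_trace (\<lambda>u. c *\<^sub>R A u) = c * endo_trace A"
  "endo_trace (\<lambda>u::'e::euclidean_space. u) = real DIM('e)"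
  by (simp_all add: endo_trace_def inner_add_left inner_diff_left sum.distrib sum_subtractf sum_distrib_left)

lemma is_metric_scale: "is_metric g \<Longrightarrow> 0 < c \<Longrightarrow> is_metric (\<lambda>u v. c * g u v)"
  unfolding is_metric_def bilinear_def
  by (auto intro!: linearI simp: linear_add linear_cmul algebra_simps)

lemma sharp_scale:
  assumes g: "is_metric g" and c: "0 < c" and b: "linear \<beta>"
  shows "sharp (\<lambda>u v. c * g u v) \<beta> = (1/c) *\<^sub>R sharp g \<beta>"
  by (rule sharp_eqI[OF is_metric_scale[OF g c]]) (use c in \<open>simp add: metric_add[OF g] sharp_works[OF g b]\<close>)

lemma recip_scale: "is_metric g \<Longrightarrow> 0 < c \<Longrightarrow> recip (\<lambda>u v. c * g u v) b = (1/c) *\<^sub>R recip g b"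
  unfolding recip_def by (rule sharp_scale) (auto intro: bounded_linear.linear bounded_linear_inner_right)

lemma ricci_alg_linear:
  assumes "\<And>u w. linear (\<lambda>v. R u v w)" "\<And>u v. linear (\<lambda>w. R u v w)"
  shows "linear (\<lambda>v. ricci_alg R v w)" "linear (\<lambda>w. ricci_alg R v w)"
  unfolding ricci_alg_def endo_trace_def
  by (rule linearI; simp add: linear_add[OF assms(1)] linear_cmul[OF assms(1)] linear_add[OF assms(2)] linear_cmul[OF assms(2)]
     inner_add_left sum.distrib sum_distrib_left)+

lemma schouten_alg_linear:
  assumes g: "is_metric g" and R: "\<And>u w. linear (\<lambda>v. R u v w)" "\<And>u v. linear (\<lambda>w. R u v w)"
  shows "linear (schouten_alg g R u)" "linear (\<lambda>v. schouten_alg g R v u)"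
proof -
  have "linear (\<lambda>w. (1 / (real DIM('a) - 2)) *\<^sub>R (ricci_alg R u w - (scalar_alg g R / (2 * (real DIM('a) - 1))) *\<^sub>R g u w))"
    "linear (\<lambda>v. (1 / (real DIM('a) - 2)) *\<^sub>R (ricci_alg R v u - (scalar_alg g R / (2 * (real DIM('a) - 1))) *\<^sub>R g v u))"
    by (intro linear_compose_scale_right linear_compose_sub ricci_alg_linear[OF R] bilinear_linear[OF is_metricD(1)[OF g]])+
  then show "linear (schouten_alg g R u)" "linear (\<lambda>v. schouten_alg g R v u)"
    unfolding schouten_alg_def by simp_all
qed

text \<open>R' differs from R by a Kulkarni-Nomizu type product of g and Q. Tracing changes Ricci by
  -(n-2) Q - q g and the scalar curvature by -2(n-1) q, up to the factor 1/c, so the Schouten tensor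
  changes exactly by -Q and compensates the change of R. The factor c cancels between the metric and
  its sharp.\<close>

lemma weyl_alg_conformal:
  fixes g :: "'e::euclidean_space \<Rightarrow> 'e \<Rightarrow> real"
  assumes dim: "2 < DIM('e)" and g: "is_metric g" and c: "0 < c"
    and R: "\<And>u w. linear (\<lambda>v. R u v w)" "\<And>u v. linear (\<lambda>w. R u v w)"
    and Q: "bilinear Q" "\<And>u v. Q u v = Q v u"
    and R': "\<And>u v w. R' u v w = R u v w + (Q u w *\<^sub>R v - Q v w *\<^sub>R u + g u w *\<^sub>R sharp g (Q v) - g v w *\<^sub>R sharp g (Q u))"
  shows "weyl_alg (\<lambda>u v. c * g u v) R' = weyl_alg g R"
proof -
  define n where "n = real DIM('e)"
  have n: "n > 2" using dim by (simp add: n_def)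
  define q where "q = endo_trace (\<lambda>u. sharp g (Q u))"
  have Ql: "linear (Q u)" "linear (\<lambda>u. Q u v)" for u v using bilinear_linear[OF Q(1)] by auto
  have gl: "linear (g u)" "linear (\<lambda>u. g u v)" for u v using bilinear_linear[OF is_metricD(1)[OF g]] by auto
  have ric: "ricci_alg R' v w = ricci_alg R v w - (n - 2) * Q v w - q * g v w" for v w
  proof -
    have "endo_trace (\<lambda>u. g u w *\<^sub>R sharp g (Q v)) = Q v w"
      by (simp add: endo_trace_rank_one[OF gl(2)] sharp_works[OF g Ql(1)])
    then show ?thesis
      unfolding ricci_alg_def R' 
      by (simp add: endo_trace_add endo_trace_rank_one[OF Ql(2)] q_def n_def algebra_simps)
  qed
  have scal: "scalar_alg (\<lambda>u v. c * g u v) R' = (scalar_alg g R - 2 * (n - 1) * q) / c"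
  proof -
    have "(\<Sum>b\<in>Basis. Q b (recip g b)) = q"
      unfolding q_def endo_trace_def
    proof (rule sum.cong[OF refl])
      fix b :: 'e
      have "Q b (recip g b) = g (recip g b) (sharp g (Q b))"
        using sharp_works[OF g Ql(1)[of b], of "recip g b"] is_metricD(2)[OF g] by metis
      then show "Q b (recip g b) = sharp g (Q b) \<bullet> b" by (simp add: recip_works[OF g] inner_commute)
    qed
    moreover have "(\<Sum>b\<in>Basis. g b (recip g b)) = n"
      unfolding n_def using is_metricD(2)[OF g, of _ "recip g _"] by (simp add: recip_works[OF g] is_metricD(2)[OF g, of b "recip g b" for b])
    ultimately have "(\<Sum>b\<in>Basis. ricci_alg R' b (recip g b)) = scalar_alg g R - (n - 2) * q - q * n"
      unfolding ric scalar_alg_def by (simp add: sum_subtractf flip: sum_distrib_left)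
    moreover have "ricci_alg R' b (recip (\<lambda>u v. c * g u v) b) = ricci_alg R' b (recip g b) / c" for b
      unfolding recip_scale[OF g c] ric
      using linear_cmul[OF ricci_alg_linear(2)[OF R]] linear_cmul[OF Ql(1)] linear_cmul[OF gl(1)]
      by (simp add: diff_divide_distrib)
    ultimately show ?thesis unfolding scalar_alg_def by (simp add: algebra_simps flip: sum_divide_distrib)
  qed
  have sch: "schouten_alg (\<lambda>u v. c * g u v) R' v w = schouten_alg g R v w - Q v w" for v w
  proof -
    have "schouten_alg (\<lambda>u v. c * g u v) R' v w = (ricci_alg R v w - (n - 2) * Q v w - q * g v w
       - (scalar_alg g R - 2 * (n - 1) * q) / (2 * (n - 1)) * g v w) / (n - 2)"
      unfolding schouten_alg_def ric scal n_def[symmetric] using c by simp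
    also have "(scalar_alg g R - 2 * (n - 1) * q) / (2 * (n - 1)) = scalar_alg g R / (2 * (n - 1)) - q"
      using n by (simp add: field_simps)
    also have "(ricci_alg R v w - (n - 2) * Q v w - q * g v w
       - (scalar_alg g R / (2 * (n - 1)) - q) * g v w) / (n - 2) = schouten_alg g R v w - Q v w"
    proof -
      have "(x - (n - 2) * y - q * z - (s - q) * z) / (n - 2) = (x - s * z) / (n - 2) - y" for x y z s :: real
      proof -
        have "x - (n - 2) * y - q * z - (s - q) * z = (x - s * z) - (n - 2) * y" by (simp add: algebra_simps)
        moreover have "((x - s * z) - (n - 2) * y) / (n - 2) = (x - s * z) / (n - 2) - y"
          using n by (simp add: diff_divide_distrib)
        ultimately show ?thesis by (simp only:)
      qed
      then show ?thesis unfolding schouten_alg_def n_def[symmetric] .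
    qed
    finally show ?thesis .
  qed
  have sl: "linear (schouten_alg g R u)" for u by (rule schouten_alg_linear[OF g R])
  have sh: "c *\<^sub>R sharp (\<lambda>u v. c * g u v) (schouten_alg (\<lambda>u v. c * g u v) R' u) = sharp g (schouten_alg g R u) - sharp g (Q u)" for u
  proof -
    have l: "linear (\<lambda>w. schouten_alg g R u w - Q u w)" using sl Ql by (intro linear_compose_sub)
    have "sharp g (\<lambda>w. schouten_alg g R u w - Q u w) = sharp g (schouten_alg g R u) - sharp g (Q u)"
      by (rule sharp_eqI[OF g]) (simp add: metric_add[OF g] sharp_works[OF g sl] sharp_works[OF g Ql(1)])
    then show ?thesis unfolding sch[abs_def] sharp_scale[OF g c l] using c by simp
  qed
  have sh': "(c * k) *\<^sub>R sharp (\<lambda>u v. c * g u v) (schouten_alg (\<lambda>u v. c * g u v) R' u) = k *\<^sub>R (sharp g (schouten_alg g R u) - sharp g (Q u))" for u k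
    unfolding sh[symmetric] by (simp add: mult.commute)
  show ?thesis
    unfolding fun_eq_iff weyl_alg_def sh' sch R' by (simp add: algebra_simps)
qed

section \<open>Duality of two-forms in dimension four\<close>

definition dual_alg ::
  "(real \<times> (real^3) \<Rightarrow> real \<times> (real^3) \<Rightarrow> real) \<Rightarrow> (real \<times> (real^3) \<Rightarrow> real \<times> (real^3) \<Rightarrow> real \<times> (real^3) \<Rightarrow> real \<times> (real^3)) \<Rightarrow>
   real \<times> (real^3) \<Rightarrow> real \<times> (real^3) \<Rightarrow> real \<times> (real^3) \<Rightarrow> real \<times> (real^3)" where
  "dual_alg g W u v w = (1/2) *\<^sub>R (\<Sum>a\<in>Basis. \<Sum>b\<in>Basis.
     vol4 g u v (recip g a) (recip g b) *\<^sub>R W a b w)"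

lemma dual_weyl_eq: "dual_weyl S g y = dual_alg (g y) (weyl S g y)"
  unfolding fun_eq_iff dual_weyl_def dual_alg_def by simp

lemma det_scale: "det (\<chi> i j. c * A i j) = c ^ CARD('n) * det (\<chi> i j. A i j)"
  for A :: "'n::finite \<Rightarrow> 'n \<Rightarrow> real"
  using det_rows_mul[of "\<lambda>_. c" "\<lambda>i. \<chi> j. A i j"] by (simp add: vector_scalar_mult_def)

text \<open>In dimension four the volume form scales by c^2, and each of the two raised indices by
  1/c.\<close>

lemma dual_alg_conformal:
  assumes g: "is_metric g" and c: "0 < c"
  shows "dual_alg (\<lambda>u v. c * g u v) W = dual_alg g W"
proof -
  have scale: "vol4 (\<lambda>u v. c * g u v) a b x y = c\<^sup>2 * vol4 g a b x y" for a b x y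
  proof -
    have "sqrt (c ^ 4 * d) = c\<^sup>2 * sqrt d" for d
    proof -
      have "sqrt (c ^ 4) = c\<^sup>2" using c by (intro real_sqrt_unique) (auto simp: power_mult[symmetric])
      then show ?thesis by (simp add: real_sqrt_mult)
    qed
    then show ?thesis unfolding vol4_def by (simp add: det_scale)
  qed
  have lin: "vol4 g a b (k *\<^sub>R x) (l *\<^sub>R y) = k * l * vol4 g a b x y" for a b x y k l
    unfolding vol4_def by (simp add: det_4 vector_4 algebra_simps)
  show ?thesis unfolding fun_eq_iff dual_alg_def recip_scale[OF g c] scale lin
    using c by (simp add: power2_eq_square)
qed

section \<open>Frames adapted to the boundary\<close>

lemma coord_frame_expansion: "v = (\<Sum>j\<in>UNIV. (v \<bullet> coord_frame j) *\<^sub>R coord_frame j)"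
  by (simp add: sum_4 coord_frame_def prod_eq_iff vec_eq_iff forall_3 inner_axis inner_prod_def)
    (simp add: axis_def)

lemma vol4_frame:
  assumes G: "is_metric G" and e: "\<And>v. v = (\<Sum>j\<in>UNIV. G v (E j) *\<^sub>R E j)"
  shows "vol4 G a b c d = det (\<chi> i j. G ((vector [a, b, c, d] :: (real \<times> (real^3))^4) $ i) (E j)) * vol4 G (E 1) (E 2) (E 3) (E 4)"
proof -
  define V where "V = (vector [a, b, c, d] :: (real \<times> (real^3))^4)"
  define X where "X = (vector [E 1, E 2, E 3, E 4] :: (real \<times> (real^3))^4)"
  have X: "X $ i = E i" for i using exhaust_4[of i] by (auto simp: X_def vector_4)
  have "(\<chi> i j. V $ i \<bullet> coord_frame j) = (\<chi> i j. G (V $ i) (E j)) ** (\<chi> i j. X $ i \<bullet> coord_frame j)"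
  proof -
    have "V $ i \<bullet> coord_frame j = (\<Sum>k\<in>UNIV. G (V $ i) (E k) * (X $ k \<bullet> coord_frame j))" for i j
    proof -
      have "V $ i \<bullet> coord_frame j = (\<Sum>k\<in>UNIV. G (V $ i) (E k) *\<^sub>R E k) \<bullet> coord_frame j" using e[of "V $ i"] by simp
      then show ?thesis unfolding inner_sum_left X by simp
    qed
    then show ?thesis by (simp add: vec_eq_iff matrix_matrix_mult_def)
  qed
  then show ?thesis unfolding vol4_def V_def[symmetric] X_def[symmetric] by (simp add: det_mul)
qed

text \<open>N is the inward unit normal, h the induced metric. The sign of the first component of N
  fixes the orientation of the frame X formed by N and the boundary frame.\<close>

locale frame4 = frame3 h e1 e2 e3 for h e1 e2 e3 +
  fixes G :: "real \<times> (real^3) \<Rightarrow> real \<times> (real^3) \<Rightarrow> real" and N :: "real \<times> (real^3)"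
  assumes G: "is_metric G" and hG: "\<And>u v. h u v = G (0, u) (0, v)"
    and NN: "G N N = 1" and Nu: "\<And>u. G N (0, u) = 0" and Npos: "0 < fst N"
begin

declare One_nat_def [simp del]

definition X :: "nat \<Rightarrow> real \<times> (real^3)" where
  "X i = (if i = 0 then N else if i = 1 then (0, e1) else if i = 2 then (0, e2) else (0, e3))"

lemma Xs: "X 0 = N" "X 1 = (0, e1)" "X 2 = (0, e2)" "X 3 = (0, e3)"
  by (simp_all add: X_def)

lemma uN: "G (0, u) N = 0" using Nu is_metricD(2)[OF G] by metis

lemma G_X [simp]: "G (X 0) (X 0) = 1" "G (X 0) (X 1) = 0" "G (X 0) (X 2) = 0" "G (X 0) (X 3) = 0"
  "G (X 1) (X 0) = 0" "G (X 1) (X 1) = 1" "G (X 1) (X 2) = 0" "G (X 1) (X 3) = 0"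
  "G (X 2) (X 0) = 0" "G (X 2) (X 1) = 0" "G (X 2) (X 2) = 1" "G (X 2) (X 3) = 0"
  "G (X 3) (X 0) = 0" "G (X 3) (X 1) = 0" "G (X 3) (X 2) = 0" "G (X 3) (X 3) = 1"
  unfolding Xs NN Nu uN hG[symmetric] by simp_all

text \<open>Subtracting from w the multiple of N that kills the first component leaves a tangent
  vector. It is orthogonal to N, as w is, so that multiple is zero.\<close>

lemma tangential:
  assumes "G w N = 0"
  shows "fst w = 0"
proof -
  define w' where "w' = w - (fst w / fst N) *\<^sub>R N"
  have "w' = (0, snd w')" using Npos by (simp add: w'_def prod_eq_iff)
  then have "G N w' = 0" using Nu by metis
  moreover have "G N w = 0" using assms is_metricD(2)[OF G] by metis
  ultimately show ?thesis using Npos by (simp add: w'_def metric_add[OF G] NN)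
qed

lemma expand4: "v = (\<Sum>i\<in>{0,1,2,3}. G v (X i) *\<^sub>R X i)"
proof -
  define w where "w = v - G v N *\<^sub>R N"
  have "G w N = 0" by (simp add: w_def metric_add[OF G] NN)
  then have w: "w = (0, snd w)" using tangential by (simp add: prod_eq_iff)
  have c: "G v (0, u) = h (snd w) u" for u
  proof -
    have "G v (0, u) = G w (0, u)" by (simp add: w_def metric_add[OF G] Nu)
    then show ?thesis unfolding hG using w by metis
  qed
  have "w = (0, h (snd w) e1 *\<^sub>R e1 + h (snd w) e2 *\<^sub>R e2 + h (snd w) e3 *\<^sub>R e3)"
    using w expand[of "snd w"] by simp
  also have "\<dots> = G v (X 1) *\<^sub>R X 1 + G v (X 2) *\<^sub>R X 2 + G v (X 3) *\<^sub>R X 3"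
    unfolding Xs c by (simp add: prod_eq_iff)
  finally have "v = G v N *\<^sub>R N + (G v (X 1) *\<^sub>R X 1 + G v (X 2) *\<^sub>R X 2 + G v (X 3) *\<^sub>R X 3)"
    unfolding w_def by (simp add: diff_eq_eq add.commute)
  then show ?thesis by (simp add: Xs(1) add.assoc)
qed

lemma X_eqI:
  assumes "G u (X 0) = G v (X 0)" "G u (X 1) = G v (X 1)" "G u (X 2) = G v (X 2)" "G u (X 3) = G v (X 3)"
  shows "u = v"
  using expand4[of u] expand4[of v] assms by simp

definition E4 :: "4 \<Rightarrow> real \<times> (real^3)" where
  "E4 i = (if i = 1 then X 0 else if i = 2 then X 1 else if i = 3 then X 2 else X 3)"

lemma E4s: "E4 1 = X 0" "E4 2 = X 1" "E4 3 = X 2" "E4 4 = X 3"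
  by (simp_all add: E4_def)

lemma expand_E4: "v = (\<Sum>j\<in>UNIV. G v (E4 j) *\<^sub>R E4 j)"
  using expand4[of v] by (simp add: sum_4 E4s add.assoc)

text \<open>The orientation convention makes \<open>-N\<close> followed by an oriented boundary frame an oriented frame.\<close>

lemma vol4_X: "vol4 G (X 0) (X 1) (X 2) (X 3) = - 1"
proof -
  define d where "d = det (\<chi> i j. (vector [X 0, X 1, X 2, X 3] :: (real \<times> (real^3))^4) $ i \<bullet> coord_frame j)"
  have "d = fst N * det (vector [e1, e2, e3] :: real^3^3)"
    unfolding d_def det_4 det_3 by (simp add: vector_4 coord_frame_def Xs inner_axis inner_prod_def algebra_simps)
  then have d: "d > 0" using Npos fr by (simp add: oriented_frame_def)
  have "det (\<chi> i j. G ((vector [X 0, X 1, X 2, X 3] :: (real \<times> (real^3))^4) $ i) ((vector [X 0, X 1, X 2, X 3] :: (real \<times> (real^3))^4) $ j)) = 1"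
    by (simp add: det_4 vector_4)
  then have "d\<^sup>2 * det (\<chi> i j. G (coord_frame i) (coord_frame j)) = 1"
    using gram_det[OF is_metricD(1)[OF G] coord_frame_expansion, of "\<lambda>i. (vector [X 0, X 1, X 2, X 3] :: (real \<times> (real^3))^4) $ i"]
    by (simp add: d_def)
  then have "det (\<chi> i j. G (coord_frame i) (coord_frame j)) = 1 / d\<^sup>2" using d by (simp add: field_simps)
  then show ?thesis unfolding vol4_def d_def[symmetric] using d by (simp add: real_sqrt_divide)
qed

lemma vol4_comp: "vol4 G a b c d = - det (\<chi> i j. G ((vector [a, b, c, d] :: (real \<times> (real^3))^4) $ i) (E4 j))"
  using vol4_frame[OF G expand_E4] vol4_X by (simp add: E4s)

lemma dual_frame:
  assumes W: "\<And>w v. linear (\<lambda>u. W u v w)" "\<And>u w. linear (\<lambda>v. W u v w)"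
  shows "dual_alg G W u v w = (1/2) *\<^sub>R (\<Sum>i\<in>{0,1,2,3}. \<Sum>j\<in>{0,1,2,3}. vol4 G u v (X i) (X j) *\<^sub>R W (X i) (X j) w)"
proof -
  have vl: "vol4 G a b (k *\<^sub>R x + x') y = k * vol4 G a b x y + vol4 G a b x' y"
     "vol4 G a b x (k *\<^sub>R y + y') = k * vol4 G a b x y + vol4 G a b x y'" for a b x y k x' y'
    unfolding vol4_comp by (simp_all add: det_4 vector_4 metric_add[OF G] algebra_simps)
  note vl' = vl(1)[where k=1, simplified] vl(2)[where k=1, simplified]
  have z: "vol4 G a b 0 y = 0" "vol4 G a b x 0 = 0" for a b x y using vl'(1)[of a b 0 0 y] vl'(2)[of a b x 0 0] by auto
  note vl'' = vl(1)[where x'=0, simplified z add_0_right] vl(2)[where y'=0, simplified z add_0_right]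
  note l = vl' vl'' linear_add[OF W(1)] linear_cmul[OF W(1)] linear_add[OF W(2)] linear_cmul[OF W(2)]
  have b1: "bilinear (\<lambda>x b. vol4 G u v (recip G a) x *\<^sub>R W a b w)" for a
    unfolding bilinear_def by (intro conjI allI linearI) (simp_all add: l algebra_simps)
  have b2: "bilinear (\<lambda>x a. \<Sum>i\<in>{0,1,2,3}. vol4 G u v x (X i) *\<^sub>R W a (X i) w)"
    unfolding bilinear_def by (intro conjI allI linearI) (simp_all add: l algebra_simps)
  have "dual_alg G W u v w = (1/2) *\<^sub>R (\<Sum>a\<in>Basis. \<Sum>i\<in>{0,1,2,3}. vol4 G u v (recip G a) (X i) *\<^sub>R W a (X i) w)"
    unfolding dual_alg_def by (simp only: contract_frame[OF G _ expand4 b1] finite.intros)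
  also have "\<dots> = (1/2) *\<^sub>R (\<Sum>i\<in>{0,1,2,3}. \<Sum>j\<in>{0,1,2,3}. vol4 G u v (X i) (X j) *\<^sub>R W (X i) (X j) w)"
    by (simp only: contract_frame[OF G _ expand4 b2] finite.intros)
  finally show ?thesis .
qed

lemma trace4: "linear E \<Longrightarrow> endo_trace E = G (E (X 0)) (X 0) + G (E (X 1)) (X 1) + G (E (X 2)) (X 2) + G (E (X 3)) (X 3)"
  by (subst endo_trace_frame[OF G _ expand4]) simp_all

end

section \<open>Curvature components in an adapted frame\<close>

locale curvature4 = frame4 h e1 e2 e3 G N for h e1 e2 e3 G N +
  fixes R :: "real \<times> (real^3) \<Rightarrow> real \<times> (real^3) \<Rightarrow> real \<times> (real^3) \<Rightarrow> real \<times> (real^3)"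
  assumes Rlin: "\<And>v w. linear (\<lambda>u. R u v w)" "\<And>u w. linear (\<lambda>v. R u v w)" "\<And>u v. linear (\<lambda>w. R u v w)"
    and Ranti: "\<And>u v w. R u v w = - R v u w"
    and Rbianchi: "\<And>u v w. R u v w + R v w u + R w u v = 0"
    and Rskew: "\<And>u v w w'. G (R u v w) w' = - G (R u v w') w"
begin

declare One_nat_def [simp del]

definition r :: "nat \<Rightarrow> nat \<Rightarrow> nat \<Rightarrow> nat \<Rightarrow> real" where
  "r a b c d = G (R (X a) (X b) (X c)) (X d)"

lemma r_anti: "r a b c d = - r b a c d" "r a b c d = - r a b d c"
  unfolding r_def by (subst Ranti, simp only: metric_add(7)[OF G]) (rule Rskew)

lemma r_bianchi: "r a b c d + r b c a d + r c a b d = 0"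
  unfolding r_def using Rbianchi[of "X a" "X b" "X c"] metric_add[OF G] by metis

text \<open>The octahedron argument: Bianchi identities for the four cyclic shifts of the indices,
  combined by the two antisymmetries.\<close>

lemma r_pair: "r a b c d = r c d a b"
  using r_bianchi[of a b c d] r_bianchi[of b c d a] r_bianchi[of c d a b] r_bianchi[of d a b c]
   r_anti(1)[of a b c d] r_anti(1)[of b c a d] r_anti(1)[of c a b d]
   r_anti(1)[of b c d a] r_anti(1)[of c d b a] r_anti(1)[of d b c a]
   r_anti(1)[of c d a b] r_anti(1)[of d a c b] r_anti(1)[of a c d b]
   r_anti(1)[of d a b c] r_anti(1)[of a b d c] r_anti(1)[of b d a c]
   r_anti(2)[of a b c d] r_anti(2)[of b c a d] r_anti(2)[of c a b d]
   r_anti(2)[of b c d a] r_anti(2)[of c d b a] r_anti(2)[of d b c a]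
   r_anti(2)[of c d a b] r_anti(2)[of d a c b] r_anti(2)[of a c d b]
   r_anti(2)[of d a b c] r_anti(2)[of a b d c] r_anti(2)[of b d a c]
  by linarith

lemma r_same: "r a a c d = 0" "r a b c c = 0"
  using r_anti(1)[of a a c d] r_anti(2)[of a b c c] by auto

text \<open>The symmetries oriented as rewrite rules: indices increase within each pair and the
  smaller pair comes first. This leaves 21 components, and the last rule removes one of them by the
  Bianchi identity; the remaining 20 are independent, so linear identities between components are
  decided by normal forms.\<close>

lemma r_norm:
  "r 1 0 c d = - r 0 1 c d" "r 2 0 c d = - r 0 2 c d" "r 3 0 c d = - r 0 3 c d"
  "r 2 1 c d = - r 1 2 c d" "r 3 1 c d = - r 1 3 c d" "r 3 2 c d = - r 2 3 c d"
  "r a b 1 0 = - r a b 0 1" "r a b 2 0 = - r a b 0 2" "r a b 3 0 = - r a b 0 3"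
  "r a b 2 1 = - r a b 1 2" "r a b 3 1 = - r a b 1 3" "r a b 3 2 = - r a b 2 3"
  "r 0 2 0 1 = r 0 1 0 2" "r 0 3 0 1 = r 0 1 0 3" "r 1 2 0 1 = r 0 1 1 2" "r 1 3 0 1 = r 0 1 1 3" "r 2 3 0 1 = r 0 1 2 3"
  "r 0 3 0 2 = r 0 2 0 3" "r 1 2 0 2 = r 0 2 1 2" "r 1 3 0 2 = r 0 2 1 3" "r 2 3 0 2 = r 0 2 2 3"
  "r 1 2 0 3 = r 0 3 1 2" "r 1 3 0 3 = r 0 3 1 3" "r 2 3 0 3 = r 0 3 2 3"
  "r 1 3 1 2 = r 1 2 1 3" "r 2 3 1 2 = r 1 2 2 3" "r 2 3 1 3 = r 1 3 2 3"
  "r 0 3 1 2 = r 0 2 1 3 - r 0 1 2 3"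
proof -
  show "r 0 3 1 2 = r 0 2 1 3 - r 0 1 2 3"
    using r_bianchi[of 1 2 3 0] r_pair[of 1 2 3 0] r_pair[of 2 3 1 0] r_pair[of 3 1 2 0]
      r_anti(1)[of 3 0 1 2] r_anti(1)[of 1 0 2 3] r_anti(1)[of 2 0 3 1] r_anti(2)[of 0 2 3 1] by linarith
qed (rule r_anti r_pair)+

definition ric :: "nat \<Rightarrow> nat \<Rightarrow> real" where "ric b c = r 0 b c 0 + r 1 b c 1 + r 2 b c 2 + r 3 b c 3"

definition sc :: real where "sc = ric 0 0 + ric 1 1 + ric 2 2 + ric 3 3"

lemma ricci_X: "ricci_alg R (X b) (X c) = ric b c"
  unfolding ricci_alg_def trace4[OF Rlin(1)] ric_def r_def ..

lemma scalar_X: "scalar_alg G R = sc"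
proof -
  have "bilinear (\<lambda>a b. ricci_alg R b a)"
    unfolding bilinear_def using ricci_alg_linear[OF Rlin(2,3)] by simp
  from contract_frame[OF G _ expand4 this] show ?thesis
    unfolding scalar_alg_def sc_def by (simp add: ricci_X)
qed

definition sch :: "nat \<Rightarrow> nat \<Rightarrow> real" where "sch b c = (ric b c - sc / 6 * G (X b) (X c)) / 2"

lemma schouten_X: "schouten_alg G R (X b) (X c) = sch b c"
  unfolding schouten_alg_def ricci_X scalar_X sch_def by simp

lemmas schouten_linear = schouten_alg_linear(1)[OF G Rlin(2,3)]
  and schouten_linear' = schouten_alg_linear(2)[OF G Rlin(2,3)]

abbreviation W where "W \<equiv> weyl_alg G R"

lemma weyl_comp: "G (W u v w) z = - (G (R u v w) z - (schouten_alg G R v w * G u z - schouten_alg G R u w * G v z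
   + G v w * schouten_alg G R u z - G u w * schouten_alg G R v z))"
  unfolding weyl_alg_def by (simp add: metric_add[OF G] sharp_works[OF G schouten_linear])

lemma weyl_X: "G (W (X a) (X b) (X c)) (X d) = - (r a b c d - (sch b c * G (X a) (X d) - sch a c * G (X b) (X d)
   + G (X b) (X c) * sch a d - G (X a) (X c) * sch b d))"
  unfolding weyl_comp schouten_X r_def ..

lemma weyl_linear: "linear (\<lambda>u. W u v w)" "linear (\<lambda>v. W u v w)" "linear (\<lambda>w. W u v w)"
proof -
  note s = linear_add[OF schouten_linear] linear_cmul[OF schouten_linear] linear_add[OF schouten_linear'] linear_cmul[OF schouten_linear']
  show "linear (\<lambda>u. W u v w)"
    by (rule linearI; rule metric_eqI[OF G]) (simp_all add: weyl_comp metric_add[OF G] s linear_add[OF Rlin(1)] linear_cmul[OF Rlin(1)] algebra_simps)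
  show "linear (\<lambda>u. W v u w)"  for v
    by (rule linearI; rule metric_eqI[OF G]) (simp_all add: weyl_comp metric_add[OF G] s linear_add[OF Rlin(2)] linear_cmul[OF Rlin(2)] algebra_simps)
  show "linear (\<lambda>w. W u v w)"
    by (rule linearI; rule metric_eqI[OF G]) (simp_all add: weyl_comp metric_add[OF G] s linear_add[OF Rlin(3)] linear_cmul[OF Rlin(3)] algebra_simps)
qed

lemma weyl_anti: "W u v w = - W v u w"
  unfolding weyl_alg_def using Ranti[of u v w] by (simp add: algebra_simps)

text \<open>By \<open>vol4_X\<close> the frame that starts with N is negative, so X 1, X 0, X 2, X 3
  is positive. The two orders of the complementary pair give equal terms, which absorbs the factor
  1/2. Here the orientation convention fixes the sign of the magnetic part.\<close>

lemma dual_X: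
  "dual_alg G W (X 1) (X 0) w = W (X 2) (X 3) w"
  "dual_alg G W (X 2) (X 0) w = W (X 3) (X 1) w"
  "dual_alg G W (X 3) (X 0) w = W (X 1) (X 2) w"
  unfolding dual_frame[OF weyl_linear(1,2)] vol4_comp
  using weyl_anti[of "X 3" "X 2" w] weyl_anti[of "X 1" "X 3" w] weyl_anti[of "X 2" "X 1" w]
  by (simp_all add: det_4 vector_4 E4s flip: scaleR_add_left)

end

section \<open>The algebraic identity between obstruction and Weyl components\<close>

context curvature4 begin

text \<open>\<open>\<phi>\<close> is the curvature of the connection carried over to tangent
  vectors, and E stands for \<star>_0(\<star>_2 - \<phi>). Here \<open>\<kappa>\<close> and
  \<open>\<tau>\<close> are arbitrary; they give a multiple of the identity and an antisymmetric
  endomorphism. Once P has cancelled, R(v, N)N meets the tangential components of R. Their Ricci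
  parts combine to a multiple of the identity, and trace-freeness makes their Weyl parts equal,
  whence the factor 2 of the electric part. The Codazzi term 2n is twice the magnetic part.\<close>

lemma obstruction_algebra:
  assumes P: "linear P" and Psym: "\<And>u v. h (P u) v = h u (P v)"
    and E: "linear E" and \<phi>: "bilinear \<phi>" "\<And>u v. \<phi> u v = - \<phi> v u"
    and n: "\<And>u v. R (0, u) (0, v) N = (0, n u v)"
    and \<beta>: "\<And>u. \<beta> u = 2 *\<^sub>R P u - (endo_trace P / 2) *\<^sub>R u"
    and Ec: "\<And>v w. h (E v) w = \<kappa> * h v w + 3 * h (P v) (P w) + G (R (0, v) N N) (0, w)
        - 2 * endo_trace P * h (P v) w - h (hodge2 h \<phi> v) w"
    and \<phi>c: "\<And>u v w w'. h (metric_cross h (\<phi> u v) w) w' = G (R (0, u) (0, v) (0, w)) (0, w') +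
        h (metric_cross h (2 *\<^sub>R n u v - metric_cross h (P u) (P v) + (\<tau> v / 2) *\<^sub>R u - (\<tau> u / 2) *\<^sub>R v
           + metric_cross h (\<beta> u) (\<beta> v)) w) w'"
  shows "(0, tf_symm h E v) = 2 *\<^sub>R (dual_alg G W (0, v) N N - W (0, v) N N)"
proof -
  define p11 p12 p13 p22 p23 p33 where "p11 = h (P e1) e1" and "p12 = h (P e1) e2" and "p13 = h (P e1) e3"
    and "p22 = h (P e2) e2" and "p23 = h (P e2) e3" and "p33 = h (P e3) e3"
  note p_def = p11_def[symmetric] p12_def[symmetric] p13_def[symmetric] p22_def[symmetric] p23_def[symmetric] p33_def[symmetric]
  have p: "h (P e1) e1 = p11" "h (P e1) e2 = p12" "h (P e1) e3 = p13" "h (P e2) e1 = p12" "h (P e2) e2 = p22" "h (P e2) e3 = p23"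
    "h (P e3) e1 = p13" "h (P e3) e2 = p23" "h (P e3) e3 = p33"
    using Psym[of e2 e1] Psym[of e3 e1] Psym[of e3 e2] is_metricD(2)[OF h, of e2 "P e1"] is_metricD(2)[OF h, of e3 "P e1"]
      is_metricD(2)[OF h, of e3 "P e2"] by (auto simp: p_def)
  have tr: "endo_trace P = p11 + p22 + p33" by (simp add: trace_frame[OF P] p)
  have nc: "h (n u v) w = G (R (0, u) (0, v) (X 0)) (0, w)" for u v w unfolding hG by (simp add: Xs n)
  \<comment> \<open>In an oriented orthonormal frame the components of a vector can be read off from
    its cross product endomorphism, which is what \<open>\<phi>c\<close> describes.\<close>
  have phi: "h (\<phi> u v) e1 = h (metric_cross h (\<phi> u v) e2) e3" "h (\<phi> u v) e2 = h (metric_cross h (\<phi> u v) e3) e1"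
    "h (\<phi> u v) e3 = h (metric_cross h (\<phi> u v) e1) e2" for u v
    by (simp_all add: cross_comp)
  have rX: "G (R (0, e1) N N) (0, e1) = r 1 0 0 1"
    "G (R (0, e1) N N) (0, e2) = r 1 0 0 2"
    "G (R (0, e1) N N) (0, e3) = r 1 0 0 3"
    "G (R (0, e2) N N) (0, e1) = r 2 0 0 1"
    "G (R (0, e2) N N) (0, e2) = r 2 0 0 2"
    "G (R (0, e2) N N) (0, e3) = r 2 0 0 3"
    "G (R (0, e3) N N) (0, e1) = r 3 0 0 1"
    "G (R (0, e3) N N) (0, e2) = r 3 0 0 2"
    "G (R (0, e3) N N) (0, e3) = r 3 0 0 3"
    by (simp_all add: r_def Xs)
  have hPP: "h (P e1) (P e1) = p11 * p11 + p12 * p12 + p13 * p13"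
    "h (P e1) (P e2) = p11 * p12 + p12 * p22 + p13 * p23"
    "h (P e1) (P e3) = p11 * p13 + p12 * p23 + p13 * p33"
    "h (P e2) (P e1) = p12 * p11 + p22 * p12 + p23 * p13"
    "h (P e2) (P e2) = p12 * p12 + p22 * p22 + p23 * p23"
    "h (P e2) (P e3) = p12 * p13 + p22 * p23 + p23 * p33"
    "h (P e3) (P e1) = p13 * p11 + p23 * p12 + p33 * p13"
    "h (P e3) (P e2) = p13 * p12 + p23 * p22 + p33 * p23"
    "h (P e3) (P e3) = p13 * p13 + p23 * p23 + p33 * p33"
    by (simp_all only: h_expand[of "P e1" "P e1"] h_expand[of "P e1" "P e2"] h_expand[of "P e1" "P e3"]
      h_expand[of "P e2" "P e1"] h_expand[of "P e2" "P e2"] h_expand[of "P e2" "P e3"]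
      h_expand[of "P e3" "P e1"] h_expand[of "P e3" "P e2"] h_expand[of "P e3" "P e3"] p)
  note hd = hodge2_frame[OF \<phi>]
  note lb = metric_add[OF h] cross_comp p nc \<beta> tr
  have Ek: "h (E e1) e1 = \<kappa> + 3 * (p11\<^sup>2 + p12\<^sup>2 + p13\<^sup>2) - 2 * (p11 + p22 + p33) * p11 + r 1 0 0 1 - h (\<phi> e2 e3) e1"
    "h (E e1) e2 = 3 * (p11 * p12 + p12 * p22 + p13 * p23) - 2 * (p11 + p22 + p33) * p12 + r 1 0 0 2 - h (\<phi> e2 e3) e2"
    "h (E e1) e3 = 3 * (p11 * p13 + p12 * p23 + p13 * p33) - 2 * (p11 + p22 + p33) * p13 + r 1 0 0 3 - h (\<phi> e2 e3) e3"
    "h (E e2) e1 = 3 * (p11 * p12 + p12 * p22 + p13 * p23) - 2 * (p11 + p22 + p33) * p12 + r 2 0 0 1 - h (\<phi> e3 e1) e1"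
    "h (E e2) e2 = \<kappa> + 3 * (p12\<^sup>2 + p22\<^sup>2 + p23\<^sup>2) - 2 * (p11 + p22 + p33) * p22 + r 2 0 0 2 - h (\<phi> e3 e1) e2"
    "h (E e2) e3 = 3 * (p12 * p13 + p22 * p23 + p23 * p33) - 2 * (p11 + p22 + p33) * p23 + r 2 0 0 3 - h (\<phi> e3 e1) e3"
    "h (E e3) e1 = 3 * (p11 * p13 + p12 * p23 + p13 * p33) - 2 * (p11 + p22 + p33) * p13 + r 3 0 0 1 - h (\<phi> e1 e2) e1"
    "h (E e3) e2 = 3 * (p12 * p13 + p22 * p23 + p23 * p33) - 2 * (p11 + p22 + p33) * p23 + r 3 0 0 2 - h (\<phi> e1 e2) e2"
    "h (E e3) e3 = \<kappa> + 3 * (p13\<^sup>2 + p23\<^sup>2 + p33\<^sup>2) - 2 * (p11 + p22 + p33) * p33 + r 3 0 0 3 - h (\<phi> e1 e2) e3"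
    by (simp_all only: Ec hd tr hPP rX metric_add[OF h] ortho p mult_zero_left mult_zero_right mult_1_left mult_1_right
       add_0_left add_0_right power2_eq_square) simp_all
  \<comment> \<open>These are the six combinations that survive symmetrisation. A single
    off-diagonal component still contains \<open>\<tau>\<close>, which cancels in the sums.\<close>
  have phk: "h (\<phi> e2 e3) e1 = r 2 3 2 3 + 2 * r 2 3 0 1 - (p22 * p33 - p23\<^sup>2) + ((2 * p22 - (p11 + p22 + p33) / 2) * (2 * p33 - (p11 + p22 + p33) / 2) - 4 * p23\<^sup>2)"
    "h (\<phi> e3 e1) e2 = r 3 1 3 1 + 2 * r 3 1 0 2 - (p33 * p11 - p13\<^sup>2) + ((2 * p33 - (p11 + p22 + p33) / 2) * (2 * p11 - (p11 + p22 + p33) / 2) - 4 * p13\<^sup>2)"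
    "h (\<phi> e1 e2) e3 = r 1 2 1 2 + 2 * r 1 2 0 3 - (p11 * p22 - p12\<^sup>2) + ((2 * p11 - (p11 + p22 + p33) / 2) * (2 * p22 - (p11 + p22 + p33) / 2) - 4 * p12\<^sup>2)"
    "h (\<phi> e2 e3) e2 + h (\<phi> e3 e1) e1 = r 2 3 3 1 + r 3 1 2 3 + 2 * r 2 3 0 2 + 2 * r 3 1 0 1 - 2 * (p23 * p13 - p12 * p33)
        + 2 * (4 * p23 * p13 - 2 * p12 * (2 * p33 - (p11 + p22 + p33) / 2))"
    "h (\<phi> e3 e1) e3 + h (\<phi> e1 e2) e2 = r 3 1 1 2 + r 1 2 3 1 + 2 * r 3 1 0 3 + 2 * r 1 2 0 2 - 2 * (p13 * p12 - p23 * p11)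
        + 2 * (4 * p13 * p12 - 2 * p23 * (2 * p11 - (p11 + p22 + p33) / 2))"
    "h (\<phi> e2 e3) e3 + h (\<phi> e1 e2) e1 = r 2 3 1 2 + r 1 2 2 3 + 2 * r 2 3 0 3 + 2 * r 1 2 0 1 - 2 * (p12 * p23 - p22 * p13)
        + 2 * (4 * p12 * p23 - 2 * p13 * (2 * p22 - (p11 + p22 + p33) / 2))"
    unfolding phi \<phi>c
    by (simp_all add: lb r_def Xs power2_eq_square algebra_simps)
  note sym = tf_symm_frame[OF E] Ek
  have red: "(0, tf_symm h E v) = 2 *\<^sub>R (dual_alg G W (0, v) N N - W (0, v) N N)"
    if "v = e1 \<or> v = e2 \<or> v = e3" for v
  proof (rule X_eqI)
    have N0: "G (0, u) (X 0) = 0" for u by (simp add: Xs uN)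
    have t: "G (0, u) (X 1) = h u e1" "G (0, u) (X 2) = h u e2" "G (0, u) (X 3) = h u e3" for u by (simp_all add: Xs hG)
    have d: "dual_alg G W (0, e1) N N = W (X 2) (X 3) (X 0)" "dual_alg G W (0, e2) N N = W (X 3) (X 1) (X 0)"
      "dual_alg G W (0, e3) N N = W (X 1) (X 2) (X 0)" using dual_X[of N] by (simp_all add: Xs)
    have w: "W (0, e1) N N = W (X 1) (X 0) (X 0)" "W (0, e2) N N = W (X 2) (X 0) (X 0)" "W (0, e3) N N = W (X 3) (X 0) (X 0)"
      by (simp_all add: Xs)
    note rules = metric_add[OF G] d w weyl_X sch_def sc_def ric_def r_same r_norm
    show "G (0, tf_symm h E v) (X 0) = G (2 *\<^sub>R (dual_alg G W (0, v) N N - W (0, v) N N)) (X 0)"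
      using that by (elim disjE) (simp_all add: N0 rules)
    \<comment> \<open>An off-diagonal component becomes the known sum minus its partner, and the
      partner then cancels in the symmetric part.\<close>
    have s1: "h (\<phi> e3 e1) e1 = (h (\<phi> e2 e3) e2 + h (\<phi> e3 e1) e1) - h (\<phi> e2 e3) e2"
       "h (\<phi> e1 e2) e2 = (h (\<phi> e3 e1) e3 + h (\<phi> e1 e2) e2) - h (\<phi> e3 e1) e3"
       "h (\<phi> e1 e2) e1 = (h (\<phi> e2 e3) e3 + h (\<phi> e1 e2) e1) - h (\<phi> e2 e3) e3" by simp_all
    note rules' = t tf_symm_frame[OF E] Ek s1[unfolded phk(4-6)] phk(1-3) rules power2_eq_square
    show "G (0, tf_symm h E v) (X 1) = G (2 *\<^sub>R (dual_alg G W (0, v) N N - W (0, v) N N)) (X 1)"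
      using that by (elim disjE) (simp_all add: rules' field_simps)
    show "G (0, tf_symm h E v) (X 2) = G (2 *\<^sub>R (dual_alg G W (0, v) N N - W (0, v) N N)) (X 2)"
      using that by (elim disjE) (simp_all add: rules' field_simps)
    show "G (0, tf_symm h E v) (X 3) = G (2 *\<^sub>R (dual_alg G W (0, v) N N - W (0, v) N N)) (X 3)"
      using that by (elim disjE) (simp_all add: rules' field_simps)
  qed
  have lt: "tf_symm h E (a *\<^sub>R u + b *\<^sub>R v + c *\<^sub>R w) = a *\<^sub>R tf_symm h E u + b *\<^sub>R tf_symm h E v + c *\<^sub>R tf_symm h E w" for a b c u v w
    by (rule metric_eqI[OF h]) (simp add: tf_symm_frame[OF E] metric_add[OF h] linear_add[OF E] linear_cmul[OF E] algebra_simps add_divide_distrib)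
  have ld: "linear (\<lambda>v. dual_alg G W v N N - W v N N)"
  proof -
    have vl: "vol4 G (k *\<^sub>R a) b x y = k * vol4 G a b x y"
     "vol4 G (a + a') b x y = vol4 G a b x y + vol4 G a' b x y" for a b x y k a'
      unfolding vol4_comp by (simp_all add: det_4 vector_4 metric_add[OF G] algebra_simps)
    have "linear (\<lambda>v. dual_alg G W v N N)" unfolding dual_alg_def
      by (rule linearI) (simp_all add: vl scaleR_add_left sum.distrib scaleR_sum_right algebra_simps)
    then show ?thesis using weyl_linear(1) by (rule linear_compose_sub)
  qed
  define f where "f = (\<lambda>v. dual_alg G W (0, v) N N - W (0, v) N N)"
  have lf: "f (a *\<^sub>R u + b *\<^sub>R v + c *\<^sub>R w) = a *\<^sub>R f u + b *\<^sub>R f v + c *\<^sub>R f w" for a b c u v w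
  proof -
    have "(0, a *\<^sub>R u + b *\<^sub>R v + c *\<^sub>R w) = a *\<^sub>R (0, u) + b *\<^sub>R (0, v) + c *\<^sub>R (0::real, w)" by simp
    then show ?thesis unfolding f_def by (simp only: linear_add[OF ld] linear_cmul[OF ld])
  qed
  have "(0, tf_symm h E v) = h v e1 *\<^sub>R (0, tf_symm h E e1) + h v e2 *\<^sub>R (0, tf_symm h E e2) + h v e3 *\<^sub>R (0::real, tf_symm h E e3)"
    using lt[of "h v e1" e1 "h v e2" e2 "h v e3" e3] expand[of v] by simp
  also have "\<dots> = 2 *\<^sub>R (h v e1 *\<^sub>R f e1 + h v e2 *\<^sub>R f e2 + h v e3 *\<^sub>R f e3)"
    using red[of e1] red[of e2] red[of e3] by (simp add: f_def scaleR_add_right mult.commute)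
  also have "h v e1 *\<^sub>R f e1 + h v e2 *\<^sub>R f e2 + h v e3 *\<^sub>R f e3 = f v"
    using lf[of "h v e1" e1 "h v e2" e2 "h v e3" e3] expand[of v] by simp
  finally show ?thesis unfolding f_def .
qed

end

section \<open>Connections with prescribed torsion on spin bundles\<close>

definition su2_mat :: "real \<Rightarrow> real \<Rightarrow> real \<Rightarrow> mat2" where
  "su2_mat x y z = vector [vector [Complex 0 x, Complex y z], vector [Complex (- y) z, Complex 0 (- x)]]"

lemma su2_mat_comps: "su2_mat x y z $ 1 $ 1 = Complex 0 x" "su2_mat x y z $ 1 $ 2 = Complex y z"
  "su2_mat x y z $ 2 $ 1 = Complex (- y) z" "su2_mat x y z $ 2 $ 2 = Complex 0 (- x)"
  unfolding su2_mat_def by simp_all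

lemma su2_iff: "a \<in> su2 \<longleftrightarrow> (\<exists>x y z. a = su2_mat x y z)"
proof
  assume a: "a \<in> su2"
  have c: "cnj (a $ j $ i) = - a $ i $ j" for i j
  proof -
    have "mat_adj a $ i $ j = (- a) $ i $ j" using a by (simp add: su2_def)
    then show ?thesis by (simp add: mat_adj_def)
  qed
  have t: "a $ 1 $ 1 + a $ 2 $ 2 = 0" using a by (simp add: su2_def trace_def sum_2)
  have "a $ 1 $ 1 = Complex 0 (Im (a$1$1))" using c[of 1 1] by (simp add: complex_eq_iff)
  moreover have "a $ 2 $ 2 = Complex 0 (- Im (a$1$1))" using c[of 1 1] t by (simp add: complex_eq_iff)
  moreover have "a $ 2 $ 1 = Complex (- Re (a$1$2)) (Im (a$1$2))" using c[of 1 2] by (simp add: complex_eq_iff)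
  ultimately have "a = su2_mat (Im (a$1$1)) (Re (a$1$2)) (Im (a$1$2))"
    by (simp add: vec_eq_iff forall_2 su2_mat_comps)
  then show "\<exists>x y z. a = su2_mat x y z" by blast
next
  assume "\<exists>x y z. a = su2_mat x y z"
  then obtain x y z where a: "a = su2_mat x y z" by blast
  show "a \<in> su2" unfolding a su2_def
    by (simp add: mat_adj_def trace_def vec_eq_iff forall_2 sum_2 complex_eq_iff su2_mat_comps)
qed

text \<open>The invariant inner product of su(2), normalised so that the bracket is a cross product
  for it, as \<open>su2_triple\<close> expresses.\<close>

definition kform :: "mat2 \<Rightarrow> mat2 \<Rightarrow> real" where "kform a b = - 2 * Re (trace (a ** b))"

lemmas mat2_simps = vec_eq_iff forall_2 matrix_matrix_mult_def sum_2 trace_def complex_eq_iff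

lemma su2_triple:
  assumes "a \<in> su2" "b \<in> su2" "c \<in> su2"
  shows "lie_bracket a (lie_bracket b c) = kform a c *\<^sub>R b - kform a b *\<^sub>R c"
proof -
  obtain x y z where a: "a = su2_mat x y z" using assms su2_iff by blast
  obtain x' y' z' where b: "b = su2_mat x' y' z'" using assms su2_iff by blast
  obtain x'' y'' z'' where c: "c = su2_mat x'' y'' z''" using assms su2_iff by blast
  show ?thesis unfolding a b c
    by (simp add: lie_bracket_def kform_def su2_mat_comps mat2_simps) algebra
qed

lemma bilinear_lie_bracket: "bilinear lie_bracket"
  unfolding bilinear_def
  by (intro conjI allI linearI; simp add: lie_bracket_def mat2_simps algebra_simps)

lemma bilinear_kform: "bilinear kform"
  unfolding bilinear_def
  by (intro conjI allI linearI; simp add: kform_def mat2_simps algebra_simps)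

lemma kform_invariant: "kform (lie_bracket c a) b + kform a (lie_bracket c b) = 0"
  by (simp add: kform_def lie_bracket_def mat2_simps algebra_simps)

lemma lie_bracket_anti: "lie_bracket a b = - lie_bracket b a"
  by (simp add: lie_bracket_def)

lemma lie_jacobi: "lie_bracket a (lie_bracket b c) - lie_bracket b (lie_bracket a c) = lie_bracket (lie_bracket a b) c"
proof -
  have d: "(x - y) ** z = x ** z - y ** z" "z ** (x - y) = z ** x - z ** y" for x y z :: mat2
    by (simp_all add: mat2_simps algebra_simps)
  show ?thesis by (simp add: lie_bracket_def d matrix_mul_assoc)
qed

lemma su2_closed:
  assumes "a \<in> su2"
  shows "b \<in> su2 \<Longrightarrow> a + b \<in> su2" "b \<in> su2 \<Longrightarrow> a - b \<in> su2" "r *\<^sub>R a \<in> su2"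
    "b \<in> su2 \<Longrightarrow> lie_bracket a b \<in> su2"
proof -
  obtain x y z where a: "a = su2_mat x y z" using assms su2_iff by blast
  note su = su2_mat_comps mat_adj_def trace_def vec_eq_iff forall_2 sum_2 complex_eq_iff
  show "r *\<^sub>R a \<in> su2" unfolding a su2_def by (simp add: su)
  assume "b \<in> su2"
  then obtain x' y' z' where b: "b = su2_mat x' y' z'" using su2_iff by blast
  show "a + b \<in> su2" "a - b \<in> su2" "lie_bracket a b \<in> su2"
    unfolding a b su2_def lie_bracket_def by (simp_all add: su matrix_matrix_mult_def)
qed

lemma has_derivative_lie_bracket:
  "(X has_derivative X') (at y within S) \<Longrightarrow> (Y has_derivative Y') (at y within S) \<Longrightarrow>
   ((\<lambda>y. lie_bracket (X y) (Y y)) has_derivative (\<lambda>h. lie_bracket (X y) (Y' h) + lie_bracket (X' h) (Y y))) (at y within S)"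
  by (rule bounded_bilinear.FDERIV) (use bilinear_lie_bracket bilinear_conv_bounded_bilinear in blast)

lemma has_derivative_kform:
  "(X has_derivative X') (at y within S) \<Longrightarrow> (Y has_derivative Y') (at y within S) \<Longrightarrow>
   ((\<lambda>y. kform (X y) (Y y)) has_derivative (\<lambda>h. kform (X y) (Y' h) + kform (X' h) (Y y))) (at y within S)"
  by (rule bounded_bilinear.FDERIV) (use bilinear_kform bilinear_conv_bounded_bilinear in blast)

text \<open>su(2) is the kernel of the real linear map L, and differentiating L after f gives
  0.\<close>

lemma pd_in_su2:
  assumes S: "corner_domain S" and y: "y \<in> S" and f: "f differentiable (at y within S)" and su: "\<And>z. z \<in> S \<Longrightarrow> f z \<in> su2"
  shows "pd S f y h \<in> su2"
proof -
  define L where "L = (\<lambda>a::mat2. (mat_adj a + a, trace a))"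
  have lin: "linear L" unfolding L_def
    by (rule linearI) (simp_all add: mat_adj_def mat2_simps algebra_simps)
  then have bl: "bounded_linear L" by (simp add: linear_conv_bounded_linear)
  have L0: "L a = 0 \<longleftrightarrow> a \<in> su2" for a
    unfolding L_def su2_def zero_prod_def by (auto simp: eq_neg_iff_add_eq_0)
  have "((\<lambda>z. L (f z)) has_derivative (\<lambda>h. L (pd S f y h))) (at y within S)"
    by (rule bounded_linear.has_derivative[OF bl pd_has_derivative[OF f]])
  moreover have "((\<lambda>z. L (f z)) has_derivative (\<lambda>h. 0)) (at y within S)"
    by (rule has_derivative_transform[OF y _ has_derivative_const[of 0]]) (use su L0 in auto)
  ultimately have "(\<lambda>h. L (pd S f y h)) = (\<lambda>h. 0)" by (rule corner_domain_unique[OF S y])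
  then show ?thesis using L0 by metis
qed

text \<open>Comparing the double cross product with \<open>su2_triple\<close> gives
  \<open>d u w *\<^sub>R v = d u v *\<^sub>R w\<close> for the difference d of the two forms, and
  independent v, w force d to vanish.\<close>

lemma soldering_isometry:
  assumes h: "is_metric h" and lin: "linear \<theta>" and inj: "inj \<theta>" and su: "\<And>u. \<theta> u \<in> su2"
    and lie: "\<And>u v. lie_bracket (\<theta> u) (\<theta> v) = \<theta> (metric_cross h u v)"
  shows "kform (\<theta> u) (\<theta> v) = h u v"
proof -
  obtain e1 e2 e3 where "oriented_frame h e1 e2 e3" using oriented_frame_exists[OF h] .
  then interpret frame3 h e1 e2 e3 using h by unfold_locales
  define d where "d = (\<lambda>u v. h u v - kform (\<theta> u) (\<theta> v))"
  have key: "d u w *\<^sub>R v = d u v *\<^sub>R w" for u v w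
  proof -
    have "\<theta> (h u w *\<^sub>R v - h u v *\<^sub>R w) = kform (\<theta> u) (\<theta> w) *\<^sub>R \<theta> v - kform (\<theta> u) (\<theta> v) *\<^sub>R \<theta> w"
      using su2_triple[OF su su su, of u v w] by (simp add: lie metric_triple_cross[OF h])
    then have "\<theta> (d u w *\<^sub>R v) = \<theta> (d u v *\<^sub>R w)"
      unfolding d_def by (simp add: linear_diff[OF lin] linear_cmul[OF lin] algebra_simps)
    then show ?thesis using inj by (simp add: inj_eq)
  qed
  have "h (d u e2 *\<^sub>R e1) e1 = h (d u e1 *\<^sub>R e2) e1" "h (d u e1 *\<^sub>R e2) e2 = h (d u e2 *\<^sub>R e1) e2"
    "h (d u e3 *\<^sub>R e1) e1 = h (d u e1 *\<^sub>R e3) e1"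
    using key[of u e2 e1] key[of u e3 e1] by simp_all
  then have d: "d u e1 = 0" "d u e2 = 0" "d u e3 = 0" by (simp_all add: metric_add[OF h])
  have "linear (d u)"
  proof -
    have "linear (\<lambda>v. kform (\<theta> u) (\<theta> v))"
      using linear_compose[OF lin bilinear_linear(1)[OF bilinear_kform]] by (simp add: o_def)
    then show ?thesis unfolding d_def
      by (rule linear_compose_sub[OF bilinear_linear(1)[OF is_metricD(1)[OF h]]])
  qed
  then have "d u (h v e1 *\<^sub>R e1 + h v e2 *\<^sub>R e2 + h v e3 *\<^sub>R e3) = 0"
    by (simp add: linear_add linear_cmul d)
  then show ?thesis unfolding expand[symmetric] by (simp add: d_def)
qed

text \<open>\<open>\<Gamma>'\<close> is a torsion-free metric connection, described by these
  properties instead of a formula so that the tangential part of the ambient connection can be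
  inserted later. The assumption \<open>tors\<close> says that the torsion of
  \<open>\<alpha>\<close> is the one that arises from adding \<open>\<theta> \<circ> \<beta>\<close>
  to the lift of \<open>\<Gamma>'\<close>.\<close>

locale spin_patch =
  fixes B :: "(real^3) set" and h :: "real^3 \<Rightarrow> real^3 \<Rightarrow> real^3 \<Rightarrow> real"
    and \<theta> \<alpha> :: "real^3 \<Rightarrow> real^3 \<Rightarrow> mat2" and \<Gamma>' :: "real^3 \<Rightarrow> real^3 \<Rightarrow> real^3 \<Rightarrow> real^3" and \<beta> :: "real^3 \<Rightarrow> real^3 \<Rightarrow> real^3"
  assumes B: "open B" and hm: "\<And>y. y \<in> B \<Longrightarrow> is_metric (h y)"
    and \<theta>lin: "\<And>y. y \<in> B \<Longrightarrow> linear (\<theta> y)" and \<theta>bij: "\<And>y. y \<in> B \<Longrightarrow> bij_betw (\<theta> y) UNIV su2"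
    and \<theta>lie: "\<And>y u v. y \<in> B \<Longrightarrow> lie_bracket (\<theta> y u) (\<theta> y v) = \<theta> y (metric_cross (h y) u v)"
    and \<theta>tw: "\<And>u. twice_diff B (\<lambda>y. \<theta> y u)"
    and \<alpha>lin: "\<And>y. y \<in> B \<Longrightarrow> linear (\<alpha> y)" and \<alpha>su: "\<And>y u. y \<in> B \<Longrightarrow> \<alpha> y u \<in> su2"
    and \<alpha>d: "\<And>u. (\<lambda>y. \<alpha> y u) differentiable_on B"
    and \<Gamma>bil: "\<And>y. y \<in> B \<Longrightarrow> bilinear (\<Gamma>' y)" and \<Gamma>sym: "\<And>y u v. y \<in> B \<Longrightarrow> \<Gamma>' y u v = \<Gamma>' y v u"
    and \<Gamma>met: "\<And>y u v w. y \<in> B \<Longrightarrow> pd B (\<lambda>y. h y v w) y u = h y (\<Gamma>' y u v) w + h y v (\<Gamma>' y u w)"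
    and \<Gamma>d: "\<And>u v. (\<lambda>y. \<Gamma>' y u v) differentiable_on B"
    and \<beta>lin: "\<And>y. y \<in> B \<Longrightarrow> linear (\<beta> y)" and \<beta>d: "\<And>u. (\<lambda>y. \<beta> y u) differentiable_on B"
    and tors: "\<And>y u v. y \<in> B \<Longrightarrow> pd B (\<lambda>y. \<theta> y v) y u - pd B (\<lambda>y. \<theta> y u) y v + lie_bracket (\<alpha> y u) (\<theta> y v) - lie_bracket (\<alpha> y v) (\<theta> y u)
       = \<theta> y (metric_cross (h y) (\<beta> y u) v - metric_cross (h y) (\<beta> y v) u)"
begin

lemma dom: "corner_domain B" using B by (rule corner_domain_open)

abbreviation cr where "cr y \<equiv> metric_cross (h y)"

lemma \<theta>su: "y \<in> B \<Longrightarrow> \<theta> y u \<in> su2"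
  using \<theta>bij[of y] unfolding bij_betw_def by auto

lemma \<theta>inj: "y \<in> B \<Longrightarrow> inj (\<theta> y)"
  using \<theta>bij[of y] unfolding bij_betw_def by auto

lemma \<theta>diff: "y \<in> B \<Longrightarrow> (\<lambda>y. \<theta> y u) differentiable (at y within B)"
  by (rule differentiable_onD[OF twice_diffD(1)[OF \<theta>tw]])

lemma \<theta>surj: "y \<in> B \<Longrightarrow> a \<in> su2 \<Longrightarrow> \<exists>u. \<theta> y u = a"
  using \<theta>bij[of y] unfolding bij_betw_def by (metis imageE)

lemma kh: "y \<in> B \<Longrightarrow> kform (\<theta> y u) (\<theta> y v) = h y u v"
  by (rule soldering_isometry[OF hm \<theta>lin \<theta>inj \<theta>su \<theta>lie])

text \<open>Uniqueness of a metric connection with given torsion. The difference D is symmetric in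
  its two arguments by the torsion equation. Paired with a third vector it is skew in the last two
  slots: \<open>\<Gamma>'\<close> is metric, \<open>kform\<close> is invariant under the bracket
  with \<open>\<alpha>\<close>, and a cross product is skew. Such a trilinear form vanishes.\<close>

lemma connection_formula:
  assumes y: "y \<in> B"
  shows "pd B (\<lambda>y. \<theta> y w) y u + lie_bracket (\<alpha> y u) (\<theta> y w) = \<theta> y (\<Gamma>' y u w + cr y (\<beta> y u) w)"
proof -
  note m = metric_add[OF hm[OF y]] and bk = bilinear_kform
  define A where "A = (\<lambda>u w. inv (\<theta> y) (pd B (\<lambda>y. \<theta> y w) y u + lie_bracket (\<alpha> y u) (\<theta> y w)))"
  have A: "\<theta> y (A u w) = pd B (\<lambda>y. \<theta> y w) y u + lie_bracket (\<alpha> y u) (\<theta> y w)" for u w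
  proof -
    have "pd B (\<lambda>y. \<theta> y w) y u + lie_bracket (\<alpha> y u) (\<theta> y w) \<in> su2"
      by (intro su2_closed pd_in_su2[OF dom y \<theta>diff[OF y]] \<theta>su \<alpha>su y)
    from \<theta>surj[OF y this] show ?thesis unfolding A_def by (metis f_inv_into_f rangeI)
  qed
  define D where "D = (\<lambda>u w. A u w - \<Gamma>' y u w - cr y (\<beta> y u) w)"
  have Dsym: "D u v = D v u" for u v
  proof -
    have "\<theta> y (A u v - A v u) = \<theta> y (cr y (\<beta> y u) v - cr y (\<beta> y v) u)"
      using tors[OF y, of v u] by (simp add: linear_diff[OF \<theta>lin[OF y]] A algebra_simps)
    then have "A u v - A v u = cr y (\<beta> y u) v - cr y (\<beta> y v) u" using \<theta>inj[OF y] by (simp add: inj_eq)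
    then show ?thesis unfolding D_def using \<Gamma>sym[OF y, of u v] by (simp add: algebra_simps)
  qed
  have Danti: "h y (D u v) w = - h y (D u w) v" for u v w
  proof -
    have "((\<lambda>y. kform (\<theta> y v) (\<theta> y w)) has_derivative
        (\<lambda>u. kform (\<theta> y v) (pd B (\<lambda>y. \<theta> y w) y u) + kform (pd B (\<lambda>y. \<theta> y v) y u) (\<theta> y w))) (at y within B)"
      by (intro has_derivative_kform pd_has_derivative \<theta>diff y)
    note hk = this
    have "pd B (\<lambda>y. h y v w) y = pd B (\<lambda>y. kform (\<theta> y v) (\<theta> y w)) y"
      by (rule pd_cong[OF y]) (simp add: kh)
    also have "\<dots> = (\<lambda>u. kform (\<theta> y v) (pd B (\<lambda>y. \<theta> y w) y u) + kform (pd B (\<lambda>y. \<theta> y v) y u) (\<theta> y w))"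
      by (rule pd_eqI[OF dom y hk])
    finally have "pd B (\<lambda>y. h y v w) y u = kform (\<theta> y v) (pd B (\<lambda>y. \<theta> y w) y u) + kform (pd B (\<lambda>y. \<theta> y v) y u) (\<theta> y w)"
      by simp
    also have "\<dots> = kform (\<theta> y v) (\<theta> y (A u w) - lie_bracket (\<alpha> y u) (\<theta> y w)) + kform (\<theta> y (A u v) - lie_bracket (\<alpha> y u) (\<theta> y v)) (\<theta> y w)"
      unfolding A by simp
    also have "\<dots> = h y v (A u w) + h y (A u v) w"
      using kform_invariant[of "\<alpha> y u" "\<theta> y v" "\<theta> y w"]
      by (simp add: bilinear_lsub[OF bk] bilinear_rsub[OF bk] kh[OF y])
    finally have "h y v (A u w) + h y (A u v) w = h y (\<Gamma>' y u v) w + h y v (\<Gamma>' y u w)"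
      unfolding \<Gamma>met[OF y] by simp
    moreover have "h y (cr y b v) w = - h y (cr y b w) v" for b
      unfolding metric_cross_works[OF hm[OF y]]
      using vol3_cyc[of "h y" b v w] vol3_cyc[of "h y" b w v] vol3_swap[of "h y" v w b] by simp
    ultimately show ?thesis unfolding D_def
      using is_metricD(2)[OF hm[OF y], of v "A u w"] is_metricD(2)[OF hm[OF y], of v "\<Gamma>' y u w"]
      by (simp add: m)
  qed
  have "h y (D u w) v = 0" for v
    using Danti[of u w v] Danti[of v u w] Danti[of w v u] Dsym[of u w] Dsym[of u v] Dsym[of v w] by simp
  then have "D u w = 0" by (intro metric_eqI[OF hm[OF y]]) (simp add: m)
  then have "A u w = \<Gamma>' y u w + cr y (\<beta> y u) w" unfolding D_def by (simp add: algebra_simps)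
  then show ?thesis using A by metis
qed

text \<open>The lift of \<open>\<Gamma>'\<close> to the bundle: with
  \<open>\<theta> \<circ> \<beta>\<close> removed from \<open>\<alpha>\<close>, the soldering form
  is parallel, as \<open>d\<theta>\<close> expresses.\<close>

definition a' where "a' y u = \<alpha> y u - \<theta> y (\<beta> y u)"

lemma d\<theta>: "y \<in> B \<Longrightarrow> pd B (\<lambda>y. \<theta> y w) y u = \<theta> y (\<Gamma>' y u w) - lie_bracket (a' y u) (\<theta> y w)"
  using connection_formula[of y w u] \<theta>lie[of y "\<beta> y u" w]
  by (simp add: a'_def bilinear_lsub[OF bilinear_lie_bracket] linear_add[OF \<theta>lin] algebra_simps)

lemma has_\<theta>\<beta>:
  assumes y: "y \<in> B"
  shows "((\<lambda>y. \<theta> y (\<beta> y v)) has_derivative (\<lambda>u. pd B (\<lambda>z. \<theta> z (\<beta> y v)) y u + \<theta> y (pd B (\<lambda>y. \<beta> y v) y u))) (at y within B)"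
  by (rule has_derivative_linear_family[OF y \<theta>lin \<theta>diff[OF y] pd_has_derivative[OF differentiable_onD[OF \<beta>d y]]])

lemma has_a':
  assumes y: "y \<in> B"
  shows "((\<lambda>y. a' y v) has_derivative (\<lambda>u. pd B (\<lambda>y. \<alpha> y v) y u - (pd B (\<lambda>z. \<theta> z (\<beta> y v)) y u + \<theta> y (pd B (\<lambda>y. \<beta> y v) y u)))) (at y within B)"
  unfolding a'_def by (intro has_derivative_diff has_\<theta>\<beta>[OF y] pd_has_derivative differentiable_onD[OF \<alpha>d y])

section \<open>Curvature of the connection in terms of tangent vectors\<close>

definition Riem' where "Riem' y u v w = pd B (\<lambda>y. \<Gamma>' y v w) y u - pd B (\<lambda>y. \<Gamma>' y u w) y v
   + \<Gamma>' y u (\<Gamma>' y v w) - \<Gamma>' y v (\<Gamma>' y u w)"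

definition d\<beta> where "d\<beta> y u v = (pd B (\<lambda>y. \<beta> y v) y u + \<Gamma>' y u (\<beta> y v)) - (pd B (\<lambda>y. \<beta> y u) y v + \<Gamma>' y v (\<beta> y u))"

definition curv where "curv y u v = pd B (\<lambda>y. \<alpha> y v) y u - pd B (\<lambda>y. \<alpha> y u) y v + lie_bracket (\<alpha> y u) (\<alpha> y v)"

text \<open>The integrability condition of a parallel soldering form: \<open>d\<theta>\<close> is
  differentiated once more, the second derivatives of \<open>\<theta>\<close> commute, and the
  Jacobi identity merges the iterated brackets.\<close>

lemma curvature_a':
  assumes y: "y \<in> B"
  shows "\<theta> y (Riem' y u v w) = lie_bracket (pd B (\<lambda>y. a' y v) y u - pd B (\<lambda>y. a' y u) y v + lie_bracket (a' y u) (a' y v)) (\<theta> y w)"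
proof -
  note bl = bilinear_lsub[OF bilinear_lie_bracket] bilinear_rsub[OF bilinear_lie_bracket]
     bilinear_ladd[OF bilinear_lie_bracket] bilinear_radd[OF bilinear_lie_bracket]
  have second: "pd B (\<lambda>y. pd B (\<lambda>y. \<theta> y w) y v) y u = \<theta> y (\<Gamma>' y u (\<Gamma>' y v w)) - lie_bracket (a' y u) (\<theta> y (\<Gamma>' y v w)) + \<theta> y (pd B (\<lambda>y. \<Gamma>' y v w) y u)
     - lie_bracket (pd B (\<lambda>y. a' y v) y u) (\<theta> y w) - lie_bracket (a' y v) (\<theta> y (\<Gamma>' y u w)) + lie_bracket (a' y v) (lie_bracket (a' y u) (\<theta> y w))" for u v
  proof -
    have 1: "((\<lambda>y. \<theta> y (\<Gamma>' y v w)) has_derivative (\<lambda>u. pd B (\<lambda>z. \<theta> z (\<Gamma>' y v w)) y u + \<theta> y (pd B (\<lambda>y. \<Gamma>' y v w) y u))) (at y within B)"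
      by (rule has_derivative_linear_family[OF y \<theta>lin \<theta>diff[OF y] pd_has_derivative[OF differentiable_onD[OF \<Gamma>d y]]])
    have 2: "((\<lambda>y. lie_bracket (a' y v) (\<theta> y w)) has_derivative (\<lambda>u. lie_bracket (a' y v) (pd B (\<lambda>y. \<theta> y w) y u) + lie_bracket (pd B (\<lambda>y. a' y v) y u) (\<theta> y w))) (at y within B)"
      by (intro has_derivative_lie_bracket pd_has_derivative \<theta>diff[OF y] differentiableI[OF has_a'[OF y]])
    have "pd B (\<lambda>y. pd B (\<lambda>y. \<theta> y w) y v) y = pd B (\<lambda>y. \<theta> y (\<Gamma>' y v w) - lie_bracket (a' y v) (\<theta> y w)) y"
      by (rule pd_cong[OF y]) (rule d\<theta>)
    also have "\<dots> = (\<lambda>u. (pd B (\<lambda>z. \<theta> z (\<Gamma>' y v w)) y u + \<theta> y (pd B (\<lambda>y. \<Gamma>' y v w) y u)) -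
        (lie_bracket (a' y v) (pd B (\<lambda>y. \<theta> y w) y u) + lie_bracket (pd B (\<lambda>y. a' y v) y u) (\<theta> y w)))"
      by (rule pd_eqI[OF dom y has_derivative_diff[OF 1 2]])
    finally show ?thesis unfolding d\<theta>[OF y] by (simp add: bl)
  qed
  have "pd B (\<lambda>y. pd B (\<lambda>y. \<theta> y w) y v) y u = pd B (\<lambda>y. pd B (\<lambda>y. \<theta> y w) y u) y v"
    by (rule pd_symmetric[OF dom \<theta>tw y])
  then show ?thesis unfolding second Riem'_def
    using lie_jacobi[of "a' y u" "a' y v" "\<theta> y w"]
    by (simp add: linear_add[OF \<theta>lin[OF y]] linear_diff[OF \<theta>lin[OF y]] bl algebra_simps)
qed

text \<open>The covariant derivative of \<open>\<theta> \<circ> \<beta>\<close> with respect to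
  \<open>\<alpha>\<close> produces the cross product of the two values of \<open>\<beta>\<close>
  twice, as \<open>\<alpha>\<close> contains \<open>\<theta> \<circ> \<beta>\<close> itself; the
  quadratic term returns it once, and the coefficient 1 remains.\<close>

lemma curvature_shift:
  assumes y: "y \<in> B"
  shows "pd B (\<lambda>y. a' y v) y u - pd B (\<lambda>y. a' y u) y v + lie_bracket (a' y u) (a' y v)
    = curv y u v - \<theta> y (d\<beta> y u v + cr y (\<beta> y u) (\<beta> y v))"
proof -
  note bl = bilinear_lsub[OF bilinear_lie_bracket] bilinear_rsub[OF bilinear_lie_bracket]
     bilinear_ladd[OF bilinear_lie_bracket] bilinear_radd[OF bilinear_lie_bracket]
  have 1: "pd B (\<lambda>z. \<theta> z (\<beta> y v)) y u = \<theta> y (\<Gamma>' y u (\<beta> y v)) + \<theta> y (cr y (\<beta> y u) (\<beta> y v)) - lie_bracket (\<alpha> y u) (\<theta> y (\<beta> y v))" for u v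
    using connection_formula[OF y, of "\<beta> y v" u] by (simp add: linear_add[OF \<theta>lin[OF y]] algebra_simps)
  have 2: "\<theta> y (cr y (\<beta> y v) (\<beta> y u)) = - \<theta> y (cr y (\<beta> y u) (\<beta> y v))"
    using lie_bracket_anti[of "\<theta> y (\<beta> y v)" "\<theta> y (\<beta> y u)"] by (simp add: \<theta>lie[OF y])
  have 3: "lie_bracket (\<theta> y (\<beta> y u)) (\<alpha> y v) = - lie_bracket (\<alpha> y v) (\<theta> y (\<beta> y u))" by (rule lie_bracket_anti)
  show ?thesis
    unfolding pd_eqI[OF dom y has_a'[OF y]] 1 curv_def d\<beta>_def unfolding a'_def bl 3 \<theta>lie[OF y] 2
    by (simp add: linear_add[OF \<theta>lin[OF y]] linear_diff[OF \<theta>lin[OF y]] algebra_simps)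
qed

text \<open>The curvature takes values in su(2), hence is \<open>\<theta>\<close> of a vector, and
  bracketing with \<open>\<theta>\<close> is the cross product. By injectivity of
  \<open>\<theta>\<close> the two preceding identities become one between endomorphisms of the
  tangent space.\<close>

theorem curvature_cross:
  assumes y: "y \<in> B"
  shows "\<theta> y (inv (\<theta> y) (curv y u v)) = curv y u v"
    "cr y (inv (\<theta> y) (curv y u v)) w = Riem' y u v w + cr y (d\<beta> y u v + cr y (\<beta> y u) (\<beta> y v)) w"
proof -
  have "curv y u v \<in> su2" unfolding curv_def
    by (intro su2_closed pd_in_su2[OF dom y differentiable_onD[OF \<alpha>d y]] \<alpha>su y)
  then show 1: "\<theta> y (inv (\<theta> y) (curv y u v)) = curv y u v"
    using \<theta>surj[OF y] by (metis f_inv_into_f rangeI)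
  have "\<theta> y (Riem' y u v w) = lie_bracket (\<theta> y (inv (\<theta> y) (curv y u v)) - \<theta> y (d\<beta> y u v + cr y (\<beta> y u) (\<beta> y v))) (\<theta> y w)"
    unfolding curvature_a'[OF y] curvature_shift[OF y] 1 ..
  also have "\<dots> = \<theta> y (cr y (inv (\<theta> y) (curv y u v) - (d\<beta> y u v + cr y (\<beta> y u) (\<beta> y v))) w)"
    unfolding linear_diff[OF \<theta>lin[OF y], symmetric] \<theta>lie[OF y] ..
  finally have "Riem' y u v w = cr y (inv (\<theta> y) (curv y u v) - (d\<beta> y u v + cr y (\<beta> y u) (\<beta> y v))) w"
    using \<theta>inj[OF y] by (simp add: inj_eq)
  then show "cr y (inv (\<theta> y) (curv y u v)) w = Riem' y u v w + cr y (d\<beta> y u v + cr y (\<beta> y u) (\<beta> y v)) w"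
    by (simp add: bilinear_lsub[OF metric_cross_bilinear[OF hm[OF y]]])
qed

end

section \<open>Expansion of the Hodge star along a path of metrics\<close>

lemma openin_ray: "openin (top_of_set {0..}) {0..<\<delta>::real}"
  by (auto simp: openin_open intro!: exI[of _ "{..<\<delta>}"])

text \<open>Taylor coefficients are defined with derivatives within the closed ray, whereas a path
  is controlled only on a short interval; at points of the interval both sets give the same
  filter.\<close>

lemma vector_derivative_ray:
  assumes s: "s \<in> {0..<\<delta>::real}" and f: "f differentiable (at s within {0..<\<delta>})"
  shows "vector_derivative f (at s within {0..}) = pd {0..<\<delta>} f s 1"
proof -
  have eq: "at s within {0..<\<delta>} = at s within {0..}" by (rule at_within_openin[OF openin_ray s])
  define c where "c = pd {0..<\<delta>} f s 1"
  have pdx: "pd {0..<\<delta>} f s x = x *\<^sub>R c" for x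
  proof -
    have "pd {0..<\<delta>} f s (x *\<^sub>R 1) = x *\<^sub>R c" unfolding c_def by (rule linear_cmul[OF linear_pd[OF f]])
    then show ?thesis by (simp only: real_scaleR_def mult_1_right)
  qed
  have "pd {0..<\<delta>} f s = (\<lambda>x. x *\<^sub>R c)" by (rule ext) (rule pdx)
  from pd_has_derivative[OF f, unfolded this]
  have "(f has_derivative (\<lambda>x. x *\<^sub>R c)) (at s within {0..})" unfolding eq .
  then have "(f has_vector_derivative c) (at s within {0..})"
    unfolding has_vector_derivative_def .
  moreover have "at s within {0..} \<noteq> bot"
  proof -
    have "{s<..<\<delta>} \<subseteq> {0..}" "s islimpt {s<..<\<delta>}" using s by (auto simp: islimpt_greaterThanLessThan1)
    then have "s islimpt {0..}" using islimpt_subset[of s "{s<..<\<delta>}" "{0..}"] by simp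
    then show ?thesis by (simp add: trivial_limit_within)
  qed
  ultimately show ?thesis unfolding c_def by (intro vector_derivative_within)
qed

lemma taylor_coeff_1:
  assumes "0 < \<delta>" "f differentiable (at 0 within {0..<\<delta>})"
  shows "taylor_coeff 1 f = pd {0..<\<delta>} f 0 1"
  unfolding taylor_coeff_def using vector_derivative_ray[of 0 \<delta> f] assms by simp

lemma taylor_coeff_2:
  assumes \<delta>: "0 < \<delta>" and f: "f differentiable_on {0..<\<delta>}"
    and f1: "(\<lambda>s. pd {0..<\<delta>} f s 1) differentiable (at 0 within {0..<\<delta>})"
  shows "taylor_coeff 2 f = (1/2) *\<^sub>R pd {0..<\<delta>} (\<lambda>s. pd {0..<\<delta>} f s 1) 0 1"
proof -
  define F where "F = (\<lambda>s. vector_derivative f (at s within {0..}))"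
  have F: "F s = pd {0..<\<delta>} f s 1" if "s \<in> {0..<\<delta>}" for s
    unfolding F_def by (rule vector_derivative_ray[OF that differentiable_onD[OF f that]])
  have 0: "0 \<in> {0..<\<delta>}" using \<delta> by simp
  have "F differentiable (at 0 within {0..<\<delta>})"
    by (rule differentiableI[OF has_derivative_transform[OF 0 F pd_has_derivative[OF f1]]])
  then have "vector_derivative F (at 0 within {0..}) = pd {0..<\<delta>} F 0 1" by (rule vector_derivative_ray[OF 0])
  also have "pd {0..<\<delta>} F 0 = pd {0..<\<delta>} (\<lambda>s. pd {0..<\<delta>} f s 1) 0" by (rule pd_cong[OF 0 F])
  finally show ?thesis unfolding taylor_coeff_def F_def by (simp add: numeral_2_eq_2)
qed

lemma has_derivative_scaleR_pd:
  fixes f :: "real \<Rightarrow> 'f::real_normed_vector"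
  assumes f: "f differentiable (at s within I)"
  shows "(f has_derivative (\<lambda>x. x *\<^sub>R pd I f s 1)) (at s within I)"
proof -
  define c where "c = pd I f s 1"
  have pdx: "pd I f s x = x *\<^sub>R c" for x
  proof -
    have "pd I f s (x *\<^sub>R 1) = x *\<^sub>R c" unfolding c_def by (rule linear_cmul[OF linear_pd[OF f]])
    then show ?thesis by (simp only: real_scaleR_def mult_1_right)
  qed
  have "pd I f s = (\<lambda>x. x *\<^sub>R c)" by (rule ext) (rule pdx)
  from pd_has_derivative[OF f, unfolded this] show ?thesis unfolding c_def .
qed

text \<open>The first derivative is given on the whole interval, so that it can be differentiated
  once more at 0; the second is asked for at 0 only. P encodes half of the first derivative at 0 as
  an endomorphism, as in the first variation formula.\<close>

locale metric_path =
  fixes \<delta> :: real and hs :: "real \<Rightarrow> real^3 \<Rightarrow> real^3 \<Rightarrow> real" and h1 h2 P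
  assumes \<delta>: "0 < \<delta>" and hm: "\<And>s. s \<in> {0..<\<delta>} \<Longrightarrow> is_metric (hs s)"
    and h1: "\<And>s u v. s \<in> {0..<\<delta>} \<Longrightarrow> ((\<lambda>s. hs s u v) has_derivative (\<lambda>x. x * h1 s u v)) (at s within {0..<\<delta>})"
    and h2: "\<And>u v. ((\<lambda>s. h1 s u v) has_derivative (\<lambda>x. x * h2 u v)) (at 0 within {0..<\<delta>})"
    and P: "linear P" and h1P: "\<And>u v. h1 0 u v = 2 * hs 0 (P u) v"
begin

abbreviation I where "I \<equiv> {0..<\<delta>}"

lemma I0: "0 \<in> I" and dom: "corner_domain I"
  using \<delta> corner_domain_interval by auto

lemma h1_pd: "s \<in> I \<Longrightarrow> h1 s u v = pd I (\<lambda>s. hs s u v) s 1"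
  using pd_eqI[OF dom _ h1] by simp

lemma hdiff: "s \<in> I \<Longrightarrow> (\<lambda>s. hs s u v) differentiable (at s within I)"
  by (rule differentiableI[OF h1])

lemma h1_bilinear:
  assumes s: "s \<in> I"
  shows "bilinear (h1 s)"
proof -
  have "linear (\<lambda>u. pd I (\<lambda>s. hs s u v) s 1)" "linear (\<lambda>u. pd I (\<lambda>s. hs s v u) s 1)" for v
    using linear_pd_family[OF dom s bilinear_linear(2)[OF is_metricD(1)[OF hm]] hdiff[OF s]]
     linear_pd_family[OF dom s bilinear_linear(1)[OF is_metricD(1)[OF hm]] hdiff[OF s]] by auto
  moreover have "h1 s = (\<lambda>u v. pd I (\<lambda>s. hs s u v) s 1)" by (intro ext h1_pd[OF s])
  ultimately show ?thesis unfolding bilinear_def by simp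
qed

lemma h1_sym:
  assumes s: "s \<in> I"
  shows "h1 s u v = h1 s v u"
proof -
  have "pd I (\<lambda>s. hs s u v) s = pd I (\<lambda>s. hs s v u) s" by (rule pd_cong[OF s is_metricD(2)[OF hm]])
  then show ?thesis by (simp add: h1_pd[OF s])
qed

lemma Psym: "hs 0 (P u) v = hs 0 u (P v)"
  using h1_sym[OF I0, of u v] is_metricD(2)[OF hm[OF I0], of u "P v"] by (simp add: h1P)

text \<open>The ratio of the volume forms is the square root of the Gram determinant q of a frame
  that is orthonormal at s = 0. Its derivative at 0 is half the trace of h', which is tr P. For the
  second derivative existence suffices, because it only enters multiples of the identity.\<close>

lemma vol_ratio:
  obtains r r1 r2 where "\<And>s u v w. vol3 (hs s) u v w = r s * vol3 (hs 0) u v w"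
    "\<And>s. s \<in> I \<Longrightarrow> (r has_derivative (\<lambda>x. x * r1 s)) (at s within I)" "r 0 = 1"
    "(r1 has_derivative (\<lambda>x. x * r2)) (at 0 within I)" "r1 0 = endo_trace P"
proof -
  obtain e1 e2 e3 where fr: "oriented_frame (hs 0) e1 e2 e3" using oriented_frame_exists[OF hm[OF I0]] .
  interpret frame3 "hs 0" e1 e2 e3 using hm[OF I0] fr by unfold_locales
  define d where "d = det (vector [e1, e2, e3] :: real^3^3)"
  have d: "d > 0" using fr by (simp add: oriented_frame_def d_def)
  define r where "r = (\<lambda>s. vol3 (hs s) e1 e2 e3)"
  have rv: "vol3 (hs s) u v w = r s * vol3 (hs 0) u v w" for s u v w
  proof -
    have "vol3 (hs s) u v w * vol3 (hs 0) e1 e2 e3 = r s * vol3 (hs 0) u v w"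
      unfolding r_def vol3_def by (simp only: mult_ac)
    then show ?thesis by simp
  qed
  define m where "m = (\<lambda>s i j. hs s ((vector [e1, e2, e3] :: real^3^3) $ i) ((vector [e1, e2, e3] :: real^3^3) $ j))"
  define m1 where "m1 = (\<lambda>s i j. h1 s ((vector [e1, e2, e3] :: real^3^3) $ i) ((vector [e1, e2, e3] :: real^3^3) $ j))"
  define q where "q = (\<lambda>s. det (\<chi> i j. m s i j))"
  \<comment> \<open>The Gram identity of an orthonormal frame for \<open>hs s\<close> writes 1 as
    this determinant times a square.\<close>
  have Hpos: "det (\<chi> i j. hs s (axis i 1) (axis j 1)) > 0" if s: "s \<in> I" for s
  proof -
    obtain f1 f2 f3 where "oriented_frame (hs s) f1 f2 f3" using oriented_frame_exists[OF hm[OF s]] .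
    then interpret F: frame3 "hs s" f1 f2 f3 using hm[OF s] by unfold_locales
    have "0 \<le> (det (vector [f1, f2, f3] :: real^3^3))\<^sup>2" by simp
    then show ?thesis using F.gram by (metis mult_not_zero not_less zero_le_mult_iff zero_less_one less_eq_real_def)
  qed
  have q: "q s = d\<^sup>2 * det (\<chi> i j. hs s (axis i 1) (axis j 1))" if s: "s \<in> I" for s
    using gram_det[OF is_metricD(1)[OF hm[OF s]] axis_expansion, of "\<lambda>i. (vector [e1, e2, e3] :: real^3^3) $ i"]
    unfolding vec3_inner_axis q_def m_def d_def .
  have qpos: "q s > 0" if "s \<in> I" for s using q[OF that] Hpos[OF that] d by simp
  have rq: "r s = sqrt (q s)" if "s \<in> I" for s
    unfolding r_def vol3_def q[OF that] real_sqrt_mult d_def[symmetric] using d by simp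
  \<comment> \<open>Product rule for the six terms of the determinant. At s = 0 the frame is
    orthonormal and only the products of diagonal entries survive.\<close>
  define q1 where "q1 = (\<lambda>s. 
    m1 s 1 1 * m s 2 2 * m s 3 3 + m s 1 1 * m1 s 2 2 * m s 3 3 + m s 1 1 * m s 2 2 * m1 s 3 3 +
    (m1 s 1 2 * m s 2 3 * m s 3 1 + m s 1 2 * m1 s 2 3 * m s 3 1 + m s 1 2 * m s 2 3 * m1 s 3 1) +
    (m1 s 1 3 * m s 2 1 * m s 3 2 + m s 1 3 * m1 s 2 1 * m s 3 2 + m s 1 3 * m s 2 1 * m1 s 3 2) -
    (m1 s 1 1 * m s 2 3 * m s 3 2 + m s 1 1 * m1 s 2 3 * m s 3 2 + m s 1 1 * m s 2 3 * m1 s 3 2) -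
    (m1 s 1 2 * m s 2 1 * m s 3 3 + m s 1 2 * m1 s 2 1 * m s 3 3 + m s 1 2 * m s 2 1 * m1 s 3 3) -
    (m1 s 1 3 * m s 2 2 * m s 3 1 + m s 1 3 * m1 s 2 2 * m s 3 1 + m s 1 3 * m s 2 2 * m1 s 3 1))"
  have md: "((\<lambda>s. m s i j) has_derivative (\<lambda>x. x * m1 s i j)) (at s within I)" if "s \<in> I" for s i j
    unfolding m_def m1_def by (rule h1[OF that])
  have qd: "(q has_derivative (\<lambda>x. x * q1 s)) (at s within I)" if s: "s \<in> I" for s
    unfolding q_def det_3 vec_lambda_beta q1_def
    by (rule derivative_eq_intros md[OF s] refl)+ (simp add: algebra_simps)
  define r1 where "r1 = (\<lambda>s. q1 s / (2 * r s))"
  have rd: "(r has_derivative (\<lambda>x. x * r1 s)) (at s within I)" if s: "s \<in> I" for s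
  proof -
    have "((\<lambda>s. sqrt (q s)) has_derivative (\<lambda>x. x * r1 s)) (at s within I)"
      unfolding r1_def rq[OF s]
      by (rule derivative_eq_intros qd[OF s] refl | use qpos[OF s] in \<open>simp add: field_simps\<close>)+
    then show ?thesis by (rule has_derivative_transform[OF s rq, rotated])
  qed
  have m0: "m 0 1 1 = 1" "m 0 2 2 = 1" "m 0 3 3 = 1" "m 0 1 2 = 0" "m 0 1 3 = 0" "m 0 2 3 = 0" "m 0 2 1 = 0" "m 0 3 1 = 0" "m 0 3 2 = 0"
    unfolding m_def by simp_all
  have r0: "r 0 = 1" by (simp add: r_def)
  have "r1 0 = (m1 0 1 1 + m1 0 2 2 + m1 0 3 3) / 2" unfolding r1_def r0 q1_def by (simp add: m0)
  also have "\<dots> = endo_trace P" unfolding m1_def by (simp add: h1P trace_frame[OF P])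
  finally have r10: "r1 0 = endo_trace P" .
  have "r1 differentiable (at 0 within I)"
  proof -
    have a: "(\<lambda>s. m s i j) differentiable (at 0 within I)" "(\<lambda>s. m1 s i j) differentiable (at 0 within I)" for i j
      using differentiableI[OF md[OF I0]] differentiableI[OF h2] unfolding m1_def by auto
    have "q1 differentiable (at 0 within I)" unfolding q1_def by (intro derivative_intros a)
    moreover have "r differentiable (at 0 within I)" by (rule differentiableI[OF rd[OF I0]])
    ultimately show ?thesis unfolding r1_def by (intro derivative_intros) (auto simp: r0)
  qed
  then have "(r1 has_derivative (\<lambda>x. x * pd I r1 0 1)) (at 0 within I)"
    using has_derivative_scaleR_pd[of r1] by simp
  then show ?thesis using that[of r r1 "pd I r1 0 1"] rv rd r0 r10 by blast
qed

lemma sharp_pd_sum: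
  assumes "is_metric h" "linear \<gamma>"
  shows "(\<Sum>b\<in>Basis. (x * \<gamma> b) *\<^sub>R recip h b) = x *\<^sub>R sharp h \<gamma>" 
  unfolding sharp_sum_recip[OF assms] by (simp add: scaleR_sum_right)

text \<open>For the cross product X, differentiate h(X, w) = r vol, with vol the volume at s = 0.
  This gives h'(X, w) + h(X', w) = r' vol, then h''(X, w) + 2 h'(X', w) + h(X'', w) = r'' vol.
  Inserting h'(u, w) = 2 h(P u, w) and X' = (tr P) X - 2 P X yields the constants 8 and 4; r'' is
  left as \<open>\<kappa>\<close>.\<close>

lemma cross_derivatives:
  obtains X1 X2 \<kappa> where
    "\<And>s u v. s \<in> I \<Longrightarrow> ((\<lambda>s. metric_cross (hs s) u v) has_derivative (\<lambda>x. x *\<^sub>R X1 s u v)) (at s within I)"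
    "\<And>u v. ((\<lambda>s. X1 s u v) has_derivative (\<lambda>x. x *\<^sub>R X2 u v)) (at 0 within I)"
    "\<And>u v. X1 0 u v = endo_trace P *\<^sub>R metric_cross (hs 0) u v - 2 *\<^sub>R P (metric_cross (hs 0) u v)"
    "\<And>u v w. hs 0 (X2 u v) w = \<kappa> * hs 0 (metric_cross (hs 0) u v) w + 8 * hs 0 (P (metric_cross (hs 0) u v)) (P w)
       - h2 (metric_cross (hs 0) u v) w - 4 * endo_trace P * hs 0 (P (metric_cross (hs 0) u v)) w"
proof -
  obtain r r1 r2 where rv: "\<And>s u v w. vol3 (hs s) u v w = r s * vol3 (hs 0) u v w"
    and r: "\<And>s. s \<in> I \<Longrightarrow> (r has_derivative (\<lambda>x. x * r1 s)) (at s within I)" and r0: "r 0 = 1"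
    and r1: "(r1 has_derivative (\<lambda>x. x * r2)) (at 0 within I)" and r10: "r1 0 = endo_trace P"
    by (fact vol_ratio)
  note m0 = hm[OF I0] and mm = metric_add[OF hm[OF I0]]
  define X where "X = (\<lambda>s u v. metric_cross (hs s) u v)"
  define \<gamma> where "\<gamma> = (\<lambda>s u v w. r1 s * vol3 (hs 0) u v w - h1 s (X s u v) w)"
  define X1 where "X1 = (\<lambda>s u v. sharp (hs s) (\<gamma> s u v))"
  have \<gamma>lin: "linear (\<gamma> s u v)" if "s \<in> I" for s u v
  proof -
    have "linear (\<lambda>w. r1 s *\<^sub>R vol3 (hs 0) u v w - h1 s (X s u v) w)"
      by (intro linear_compose_sub linear_compose_scale_right vol3_linear bilinear_linear(1)[OF h1_bilinear[OF that]])
    then show ?thesis unfolding \<gamma>_def by simp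
  qed
  have dvol: "((\<lambda>s. vol3 (hs s) u v w) has_derivative (\<lambda>x. x * (r1 s * vol3 (hs 0) u v w))) (at s within I)" if s: "s \<in> I" for s u v w
  proof -
    have e: "(\<lambda>s. vol3 (hs s) u v w) = (\<lambda>s. r s * vol3 (hs 0) u v w)" by (rule ext) (rule rv)
    show ?thesis unfolding e by (rule derivative_eq_intros r[OF s] refl)+ (simp add: mult.assoc)
  qed
  have dX: "(\<lambda>s. X s u v) differentiable (at s within I)" and X1: "((\<lambda>s. X s u v) has_derivative (\<lambda>x. x *\<^sub>R X1 s u v)) (at s within I)" if s: "s \<in> I" for s u v
  proof -
    have "((\<lambda>s. sharp (hs s) (\<lambda>w. vol3 (hs s) u v w)) has_derivative
      (\<lambda>h. \<Sum>b\<in>Basis. (pd I (\<lambda>s. vol3 (hs s) u v b) s h - pd I (\<lambda>w. hs w (X s u v) b) s h) *\<^sub>R recip (hs s) b)) (at s within I)"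
      by (rule has_derivative_sharp[OF s hm hdiff[OF s] vol3_linear(3) differentiableI[OF dvol[OF s]]])
         (simp_all add: X_def metric_cross_def)
    also have "(\<lambda>h. \<Sum>b\<in>Basis. (pd I (\<lambda>s. vol3 (hs s) u v b) s h - pd I (\<lambda>w. hs w (X s u v) b) s h) *\<^sub>R recip (hs s) b)
       = (\<lambda>x. \<Sum>b\<in>Basis. (x * \<gamma> s u v b) *\<^sub>R recip (hs s) b)"
      unfolding pd_eqI[OF dom s dvol[OF s]] pd_eqI[OF dom s h1[OF s]] \<gamma>_def by (simp add: right_diff_distrib)
    finally show "((\<lambda>s. X s u v) has_derivative (\<lambda>x. x *\<^sub>R X1 s u v)) (at s within I)"
      unfolding X1_def X_def metric_cross_def sharp_pd_sum[OF hm[OF s] \<gamma>lin[OF s]] .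
    then show "(\<lambda>s. X s u v) differentiable (at s within I)" by (rule differentiableI)
  qed
  define \<gamma>1 where "\<gamma>1 = (\<lambda>u v w. r2 * vol3 (hs 0) u v w - (h2 (X 0 u v) w + h1 0 (X1 0 u v) w))"
  have d\<gamma>: "((\<lambda>s. \<gamma> s u v w) has_derivative (\<lambda>x. x * \<gamma>1 u v w)) (at 0 within I)" for u v w
  proof -
    have "((\<lambda>s. h1 s (X s u v) w) has_derivative (\<lambda>x. pd I (\<lambda>s. h1 s (X 0 u v) w) 0 x + h1 0 (x *\<^sub>R X1 0 u v) w)) (at 0 within I)"
      by (rule has_derivative_linear_family[OF I0 bilinear_linear(2)[OF h1_bilinear] differentiableI[OF h2] X1[OF I0]])
    then have "((\<lambda>s. h1 s (X s u v) w) has_derivative (\<lambda>x. x * (h2 (X 0 u v) w + h1 0 (X1 0 u v) w))) (at 0 within I)"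
      unfolding pd_eqI[OF dom I0 h2] by (simp add: bilinear_lmul[OF h1_bilinear[OF I0]] distrib_left)
    from has_derivative_diff[OF has_derivative_mult_left[OF r1, of "vol3 (hs 0) u v w"] this]
    show ?thesis unfolding \<gamma>_def \<gamma>1_def by (simp add: right_diff_distrib mult.assoc)
  qed
  define X2 where "X2 = (\<lambda>u v. sharp (hs 0) (\<lambda>w. \<gamma>1 u v w - h1 0 (X1 0 u v) w))"
  have l1: "linear (\<gamma>1 u v)" for u v
  proof -
    have "linear (\<lambda>w. pd I (\<lambda>s. \<gamma> s u v w) 0 1)" 
      by (rule linear_pd_family[OF dom I0 \<gamma>lin differentiableI[OF d\<gamma>]])
    then show ?thesis unfolding pd_eqI[OF dom I0 d\<gamma>] by simp
  qed
  have l2: "linear (\<lambda>w. \<gamma>1 u v w - h1 0 (X1 0 u v) w)" for u v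
    by (intro linear_compose_sub l1 bilinear_linear(1)[OF h1_bilinear[OF I0]])
  have X2: "((\<lambda>s. X1 s u v) has_derivative (\<lambda>x. x *\<^sub>R X2 u v)) (at 0 within I)" for u v
  proof -
    have "((\<lambda>s. sharp (hs s) (\<gamma> s u v)) has_derivative
      (\<lambda>h. \<Sum>b\<in>Basis. (pd I (\<lambda>s. \<gamma> s u v b) 0 h - pd I (\<lambda>w. hs w (X1 0 u v) b) 0 h) *\<^sub>R recip (hs 0) b)) (at 0 within I)"
      by (rule has_derivative_sharp[OF I0 hm hdiff[OF I0] \<gamma>lin differentiableI[OF d\<gamma>]])
         (simp_all add: X1_def)
    also have "(\<lambda>h. \<Sum>b\<in>Basis. (pd I (\<lambda>s. \<gamma> s u v b) 0 h - pd I (\<lambda>w. hs w (X1 0 u v) b) 0 h) *\<^sub>R recip (hs 0) b)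
       = (\<lambda>x. \<Sum>b\<in>Basis. (x * (\<gamma>1 u v b - h1 0 (X1 0 u v) b)) *\<^sub>R recip (hs 0) b)"
      unfolding pd_eqI[OF dom I0 d\<gamma>] pd_eqI[OF dom I0 h1[OF I0]] by (simp add: right_diff_distrib)
    finally have fin: "((\<lambda>s. sharp (hs s) (\<gamma> s u v)) has_derivative (\<lambda>x. x *\<^sub>R X2 u v)) (at 0 within I)"
      unfolding X2_def sharp_pd_sum[OF m0 l2] .
    show ?thesis unfolding X1_def by (rule fin)
  qed
  have cw: "vol3 (hs 0) u v w = hs 0 (X 0 u v) w" for u v w unfolding X_def by (rule metric_cross_works[OF m0, symmetric])
  have X10: "X1 0 u v = endo_trace P *\<^sub>R X 0 u v - 2 *\<^sub>R P (X 0 u v)" for u v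
  proof (rule metric_eqI[OF m0])
    fix w
    have "hs 0 (X1 0 u v) w = \<gamma> 0 u v w" unfolding X1_def by (rule sharp_works[OF m0 \<gamma>lin[OF I0]])
    then show "hs 0 (X1 0 u v) w = hs 0 (endo_trace P *\<^sub>R X 0 u v - 2 *\<^sub>R P (X 0 u v)) w"
      by (simp add: \<gamma>_def cw r10 h1P mm)
  qed
  have X20: "hs 0 (X2 u v) w = r2 * hs 0 (X 0 u v) w + 8 * hs 0 (P (X 0 u v)) (P w) - h2 (X 0 u v) w - 4 * endo_trace P * hs 0 (P (X 0 u v)) w" for u v w
  proof -
    have "hs 0 (X2 u v) w = \<gamma>1 u v w - h1 0 (X1 0 u v) w" unfolding X2_def by (rule sharp_works[OF m0 l2])
    then show ?thesis
      using Psym[of "P (X 0 u v)" w] by (simp add: \<gamma>1_def cw h1P X10 mm linear_diff[OF P] linear_cmul[OF P])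
  qed
  show ?thesis
    by (rule that[of X1 X2 r2]) (fact X1[unfolded X_def] X2 X10[unfolded X_def] X20[unfolded X_def])+
qed

text \<open>The star of \<open>\<theta>\<close> is \<open>\<theta>\<close> of the moving cross
  product, so its coefficients are \<open>\<theta>\<close> of the derivatives of the latter, the
  second halved by the factorial. The second is packed as an endomorphism C of the cross product,
  which is the form that \<open>hodge2_cross\<close> undoes.\<close>

lemma hodge_coeffs:
  obtains C \<kappa> where "linear C"
    "\<And>(\<theta> :: real^3 \<Rightarrow> 'f::real_normed_vector) u v. linear \<theta> \<Longrightarrow> hodge1_coeff 1 hs \<theta> u v = \<theta> (endo_trace P *\<^sub>R metric_cross (hs 0) u v - 2 *\<^sub>R P (metric_cross (hs 0) u v))"
    "\<And>(\<theta> :: real^3 \<Rightarrow> 'f::real_normed_vector) u v. linear \<theta> \<Longrightarrow> hodge1_coeff 2 hs \<theta> u v = \<theta> (C (metric_cross (hs 0) u v))"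
    "\<And>u w. hs 0 (C u) w = \<kappa> * hs 0 u w + 4 * hs 0 (P u) (P w) - h2 u w / 2 - 2 * endo_trace P * hs 0 (P u) w"
proof -
  obtain \<kappa> X1 X2 where
    X1: "\<And>s u v. s \<in> I \<Longrightarrow> ((\<lambda>s. metric_cross (hs s) u v) has_derivative (\<lambda>x. x *\<^sub>R X1 s u v)) (at s within I)" and
    X2: "\<And>u v. ((\<lambda>s. X1 s u v) has_derivative (\<lambda>x. x *\<^sub>R X2 u v)) (at 0 within I)" and
    X10: "\<And>u v. X1 0 u v = endo_trace P *\<^sub>R metric_cross (hs 0) u v - 2 *\<^sub>R P (metric_cross (hs 0) u v)" and
    X20: "\<And>u v w. hs 0 (X2 u v) w = \<kappa> * hs 0 (metric_cross (hs 0) u v) w + 8 * hs 0 (P (metric_cross (hs 0) u v)) (P w)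
       - h2 (metric_cross (hs 0) u v) w - 4 * endo_trace P * hs 0 (P (metric_cross (hs 0) u v)) w"
    by (fact cross_derivatives)
  note m0 = hm[OF I0] and mm = metric_add[OF hm[OF I0]]
  have l2: "linear (h2 u)" for u
  proof -
    have "linear (\<lambda>w. pd I (\<lambda>s. h1 s u w) 0 1)" 
      by (rule linear_pd_family[OF dom I0 bilinear_linear(1)[OF h1_bilinear] differentiableI[OF h2]])
    then show ?thesis unfolding pd_eqI[OF dom I0 h2] by simp
  qed
  have l2': "linear (\<lambda>u. h2 u w)" for w
  proof -
    have "linear (\<lambda>u. pd I (\<lambda>s. h1 s u w) 0 1)" 
      by (rule linear_pd_family[OF dom I0 bilinear_linear(2)[OF h1_bilinear] differentiableI[OF h2]])
    then show ?thesis unfolding pd_eqI[OF dom I0 h2] by simp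
  qed
  define f where "f = (\<lambda>u w. (\<kappa>/2) * hs 0 u w + 4 * hs 0 (P u) (P w) - h2 u w / 2 - 2 * endo_trace P * hs 0 (P u) w)"
  define C where "C = (\<lambda>u. sharp (hs 0) (f u))"
  have lf: "linear (f u)" "linear (\<lambda>u. f u w)" for u w
    unfolding f_def by (rule linearI; simp add: mm linear_add[OF P] linear_cmul[OF P] linear_add[OF l2] linear_cmul[OF l2]
       linear_add[OF l2'] linear_cmul[OF l2'] algebra_simps add_divide_distrib)+
  have C: "hs 0 (C u) w = f u w" for u w unfolding C_def by (rule sharp_works[OF m0 lf(1)])
  have Clin: "linear C"
    by (rule linearI; rule metric_eqI[OF m0]) (simp_all add: C mm linear_add[OF lf(2)] linear_cmul[OF lf(2)])
  have X2C: "(1/2) *\<^sub>R X2 u v = C (metric_cross (hs 0) u v)" for u v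
    by (rule metric_eqI[OF m0]) (simp add: C mm X20 f_def field_simps)
  have main: "hodge1_coeff 1 hs \<theta> u v = \<theta> (X1 0 u v) \<and> hodge1_coeff 2 hs \<theta> u v = \<theta> ((1/2) *\<^sub>R X2 u v)"
    if lin: "linear \<theta>" for \<theta> :: "real^3 \<Rightarrow> 'f" and u v
  proof -
    have bl: "bounded_linear \<theta>" using lin by (simp add: linear_conv_bounded_linear)
    define F where "F = (\<lambda>s. hodge1 (hs s) \<theta> u v)"
    have F: "(F has_derivative (\<lambda>x. x *\<^sub>R \<theta> (X1 s u v))) (at s within I)" if s: "s \<in> I" for s
    proof -
      have "((\<lambda>s. \<theta> (metric_cross (hs s) u v)) has_derivative (\<lambda>x. \<theta> (x *\<^sub>R X1 s u v))) (at s within I)"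
        by (rule bounded_linear.has_derivative[OF bl X1[OF s]])
      then have "((\<lambda>s. \<theta> (metric_cross (hs s) u v)) has_derivative (\<lambda>x. x *\<^sub>R \<theta> (X1 s u v))) (at s within I)"
        by (simp add: linear_cmul[OF lin])
      then show ?thesis unfolding F_def
        by (rule has_derivative_transform[OF s hodge1_linear[OF hm lin], rotated])
    qed
    have Fd: "F differentiable_on I" unfolding differentiable_on_def using differentiableI[OF F] by blast
    have pF: "pd I F s 1 = \<theta> (X1 s u v)" if "s \<in> I" for s using pd_eqI[OF dom that F[OF that]] by simp
    have F2: "((\<lambda>s. pd I F s 1) has_derivative (\<lambda>x. x *\<^sub>R \<theta> (X2 u v))) (at 0 within I)"
    proof -
      have "((\<lambda>s. \<theta> (X1 s u v)) has_derivative (\<lambda>x. \<theta> (x *\<^sub>R X2 u v))) (at 0 within I)"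
        by (rule bounded_linear.has_derivative[OF bl X2])
      then have "((\<lambda>s. \<theta> (X1 s u v)) has_derivative (\<lambda>x. x *\<^sub>R \<theta> (X2 u v))) (at 0 within I)"
        by (simp add: linear_cmul[OF lin])
      then show ?thesis by (rule has_derivative_transform[OF I0 pF, rotated])
    qed
    have "taylor_coeff 1 F = \<theta> (X1 0 u v)"
      using taylor_coeff_1[OF \<delta> differentiableI[OF F[OF I0]]] pF[OF I0] by simp
    moreover have "taylor_coeff 2 F = \<theta> ((1/2) *\<^sub>R X2 u v)"
      using taylor_coeff_2[OF \<delta> Fd differentiableI[OF F2]] pd_eqI[OF dom I0 F2] by (simp add: linear_cmul[OF lin])
    ultimately show ?thesis unfolding hodge1_coeff_def F_def by blast
  qed
  show ?thesis
  proof (rule that[of C "\<kappa>/2", OF Clin])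
    fix \<theta> :: "real^3 \<Rightarrow> 'f" and u v assume lin: "linear \<theta>"
    show "hodge1_coeff 1 hs \<theta> u v = \<theta> (endo_trace P *\<^sub>R metric_cross (hs 0) u v - 2 *\<^sub>R P (metric_cross (hs 0) u v))"
      unfolding X10[symmetric] using main[OF lin] by blast
    show "hodge1_coeff 2 hs \<theta> u v = \<theta> (C (metric_cross (hs 0) u v))"
      unfolding X2C[symmetric] using main[OF lin] by blast
  next
    fix u w
    show "hs 0 (C u) w = \<kappa> / 2 * hs 0 u w + 4 * hs 0 (P u) (P w) - h2 u w / 2 - 2 * endo_trace P * hs 0 (P u) w"
      unfolding C f_def ..
  qed
qed

end

section \<open>Geodesic collars\<close>

lemma openin_collar: "open V \<Longrightarrow> openin (top_of_set halfspace) ({0..<\<delta>} \<times> V)" for V :: "(real^3) set"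
  unfolding openin_open halfspace_def
  by (rule exI[of _ "{..<\<delta>} \<times> V"]) (auto intro: open_Times)

lemma pd_open: "open V \<Longrightarrow> y \<in> V \<Longrightarrow> pd UNIV f y = pd V f y"
  using pd_openin[of UNIV V y f] by simp

text \<open>The gradient flow of x in one chart, near one boundary point. The unit normal is the
  s-derivative of F, and its curvature identity takes two further derivatives; hence the assumption
  \<open>F_tw2\<close>.\<close>

locale collar = chart_map S g "{0..<\<delta>::real} \<times> V" F
  for S :: "(real \<times> (real^3)) set" and g and \<delta> and V :: "(real^3) set" and F +
  fixes xh :: "real \<times> (real^3) \<Rightarrow> real"
  assumes \<delta>: "0 < \<delta>" and V: "open V" and S_half: "S \<subseteq> halfspace"
    and F_tw2: "\<And>a. twice_diff ({0..<\<delta>} \<times> V) (\<lambda>z. pd ({0..<\<delta>} \<times> V) F z a)"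
    and F0: "\<And>y. y \<in> V \<Longrightarrow> F (0, y) = (0, y)"
    and xh: "xh differentiable_on S" and xh0: "\<And>y. y \<in> V \<Longrightarrow> xh (0, y) = 0"
    and grad_eq: "\<And>z w. z \<in> {0..<\<delta>} \<times> V \<Longrightarrow> g (F z) (pd ({0..<\<delta>} \<times> V) F z (1, 0)) w = pd S xh (F z) w"
    and unit: "\<And>z. z \<in> {0..<\<delta>} \<times> V \<Longrightarrow> g (F z) (pd ({0..<\<delta>} \<times> V) F z (1, 0)) (pd ({0..<\<delta>} \<times> V) F z (1, 0)) = 1"
begin

abbreviation D where "D \<equiv> {0..<\<delta>} \<times> V"
abbreviation N where "N z \<equiv> pd D F z (1, 0)"
abbreviation E where "E u z \<equiv> pd D F z (0, u)"

lemma zD: "y \<in> V \<Longrightarrow> (0, y) \<in> D" using \<delta> by simp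

lemma domV: "corner_domain V" using V by (rule corner_domain_open)

lemma slice_y:
  assumes y: "y \<in> V" and s: "s \<in> {0..<\<delta>}" and f: "f differentiable (at (s, y) within D)"
  shows "((\<lambda>y. f (s, y)) has_derivative (\<lambda>u. pd D f (s, y) (0, u))) (at y within V)"
proof -
  have 1: "((\<lambda>y. (s, y)) has_derivative (\<lambda>u. (0, u))) (at y within V)"
    by (intro has_derivative_Pair has_derivative_const has_derivative_ident)
  show ?thesis by (rule has_derivative_pd_compose[OF 1 f]) (use s in simp)
qed

lemma slice_s:
  assumes y: "y \<in> V" and f: "f differentiable (at (s, y) within D)"
  shows "((\<lambda>s. f (s, y)) has_derivative (\<lambda>r. r *\<^sub>R pd D f (s, y) (1, 0))) (at s within {0..<\<delta>})"
proof -
  have 1: "((\<lambda>s. (s, y)) has_derivative (\<lambda>r. (r, 0))) (at s within {0..<\<delta>})"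
    by (intro has_derivative_Pair has_derivative_const has_derivative_ident)
  have 2: "((\<lambda>s. f (s, y)) has_derivative (\<lambda>r. pd D f (s, y) (r, 0))) (at s within {0..<\<delta>})"
    by (rule has_derivative_pd_compose[OF 1 f]) (use y in simp)
  have "pd D f (s, y) (r, 0) = r *\<^sub>R pd D f (s, y) (1, 0)" for r
    using linear_cmul[OF linear_pd[OF f], of r "(1, 0)"] by simp
  then have eq: "(\<lambda>r. pd D f (s, y) (r, 0)) = (\<lambda>r. r *\<^sub>R pd D f (s, y) (1, 0))" by (rule ext)
  show ?thesis by (rule 2[unfolded eq])
qed

lemma pd_slice_y:
  assumes "y \<in> V" "f differentiable (at (0, y) within D)"
  shows "pd V (\<lambda>y. f (0, y)) y u = pd D f (0, y) (0, u)"
proof -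
  have "0 \<in> {0..<\<delta>}" using \<delta> by simp
  from pd_eqI[OF domV assms(1) slice_y[OF assms(1) this assms(2)]] show ?thesis by (rule fun_cong)
qed

lemma dF0:
  assumes y: "y \<in> V"
  shows "E u (0, y) = (0, u)"
proof -
  have "pd V (\<lambda>y. F (0, y)) y = pd V (\<lambda>y. (0, y)) y" by (rule pd_cong[OF y F0])
  also have "\<dots> = (\<lambda>u. (0, u))"
    by (rule pd_eqI[OF domV y]) (intro has_derivative_Pair has_derivative_const has_derivative_ident)
  finally show ?thesis
    using pd_slice_y[OF y differentiableI[OF F_has[OF zD[OF y]]], of u] by simp
qed

text \<open>Along a flow line x starts at 0 and grows at the rate dx(N) = g(N, N) = 1, so x composed
  with F is the parameter s. Its derivatives in boundary directions vanish, which is the Gauss lemma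
  \<open>N_E\<close>.\<close>

lemma x_along:
  assumes z: "z \<in> D"
  shows "pd S xh (F z) (N z) = 1" "pd S xh (F z) (E u z) = 0"
proof -
  have xd: "xh differentiable (at (F z) within S)" if "z \<in> D" for z
    using differentiable_onD[OF xh F_in[OF that]] .
  have N: "pd S xh (F z) (N z) = 1" if "z \<in> D" for z using grad_eq[OF that, of "N z"] unit[OF that] by simp
  have phi: "xh (F z) = fst z" if "z \<in> D" for z
  proof -
    obtain s y where sy: "z = (s, y)" "s \<in> {0..<\<delta>}" "y \<in> V" using \<open>z \<in> D\<close> by auto
    have der: "((\<lambda>s. xh (F (s, y)) - s) has_derivative (\<lambda>r. 0)) (at r within {0..<\<delta>})" if r: "r \<in> {0..<\<delta>}" for r
    proof -
      have zr: "(r, y) \<in> D" using r sy by simp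
      have "((\<lambda>s. xh (F (s, y))) has_derivative (\<lambda>h. h *\<^sub>R pd D (\<lambda>z. xh (F z)) (r, y) (1, 0))) (at r within {0..<\<delta>})"
        by (rule slice_s[OF sy(3) differentiableI[OF comp_has[OF zr xd[OF zr]]]])
      then have "((\<lambda>s. xh (F (s, y))) has_derivative (\<lambda>h. h)) (at r within {0..<\<delta>})"
        unfolding pd_comp[OF zr xd[OF zr]] N[OF zr] by simp
      from has_derivative_diff[OF this has_derivative_ident] show ?thesis by simp
    qed
    obtain c where c: "\<And>r. r \<in> {0..<\<delta>} \<Longrightarrow> xh (F (r, y)) - r = c"
      using has_derivative_zero_constant[of "{0..<\<delta>}" "\<lambda>s. xh (F (s, y)) - s"] der by auto
    have "c = 0" using c[of 0] \<delta> F0[OF sy(3)] xh0[OF sy(3)] by simp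
    then show ?thesis using c[OF sy(2)] sy(1) by simp
  qed
  have "pd D (\<lambda>z. xh (F z)) z = pd D fst z" by (rule pd_cong[OF z phi])
  also have "pd D fst z = fst" by (rule pd_eqI[OF domD z]) (intro has_derivative_fst has_derivative_ident)
  finally show "pd S xh (F z) (E u z) = 0" using pd_comp[OF z xd[OF z], of "(0, u)"] by simp
  show "pd S xh (F z) (N z) = 1" by (rule N[OF z])
qed

lemma N_E: "z \<in> D \<Longrightarrow> g (F z) (N z) (E u z) = 0"
  unfolding grad_eq by (rule x_along(2))

lemma covN_N: "z \<in> D \<Longrightarrow> g (F z) (cov (\<lambda>z. N z) a z) (N z) = 0"
proof -
  assume z: "z \<in> D"
  have "pd D (\<lambda>z. g (F z) (N z) (N z)) z = pd D (\<lambda>z. 1) z" by (rule pd_cong[OF z unit])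
  then have "pd D (\<lambda>z. g (F z) (N z) (N z)) z a = 0" using pd_const[OF domD z] by metis
  then show ?thesis unfolding pd_metric_along[OF z dF_diff[OF z] dF_diff[OF z]]
    using is_metricD(2)[OF met[OF F_in[OF z]], of "N z" "cov (\<lambda>z. N z) a z"] by simp
qed

lemma cov_NE: "z \<in> D \<Longrightarrow> g (F z) (cov (\<lambda>z. N z) a z) (E u z) = - g (F z) (N z) (cov (\<lambda>z. E u z) a z)"
proof -
  assume z: "z \<in> D"
  have "pd D (\<lambda>z. g (F z) (N z) (E u z)) z = pd D (\<lambda>z. 0) z" by (rule pd_cong[OF z N_E])
  then have "pd D (\<lambda>z. g (F z) (N z) (E u z)) z a = 0" using pd_const[OF domD z] by metis
  then show ?thesis unfolding pd_metric_along[OF z dF_diff[OF z] dF_diff[OF z]] by simp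
qed

section \<open>First variation of the metrics h(s)\<close>

definition H where "H z u v = g (F z) (E u z) (E v z)"

definition H1 where "H1 z u v = 2 * g (F z) (cov (\<lambda>z. N z) (0, u) z) (E v z)"

lemma H_sym: "z \<in> D \<Longrightarrow> H z u v = H z v u"
  unfolding H_def by (rule is_metricD(2)[OF met[OF F_in]])

text \<open>As N is orthogonal to the fields E, derivatives can be moved from N to E, where
  vanishing torsion makes them symmetric in u and v.\<close>

lemma H1_sym: "z \<in> D \<Longrightarrow> H1 z u v = H1 z v u"
  unfolding H1_def by (simp add: cov_NE cov_torsion[of z "(0, u)" "(0, v)"])

lemma H_has: "z \<in> D \<Longrightarrow> ((\<lambda>z. H z u v) has_derivative (\<lambda>a. g (F z) (cov (\<lambda>z. E u z) a z) (E v z) + g (F z) (E u z) (cov (\<lambda>z. E v z) a z))) (at z within D)"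
  unfolding H_def by (rule metric_along[OF _ dF_diff dF_diff])

text \<open>By vanishing torsion the s-derivative of \<open>E u\<close> is the derivative of N in
  direction u, and metric compatibility then yields two equal terms.\<close>

lemma pd_H:
  assumes z: "z \<in> D"
  shows "pd D (\<lambda>z. H z u v) z (1, 0) = H1 z u v"
proof -
  have "pd D (\<lambda>z. H z u v) z (1, 0) = g (F z) (cov (\<lambda>z. N z) (0, u) z) (E v z) + g (F z) (E u z) (cov (\<lambda>z. N z) (0, v) z)"
    unfolding pd_eqI[OF domD z H_has[OF z]] cov_torsion[OF z, of _ "(1, 0)"] ..
  also have "g (F z) (E u z) (cov (\<lambda>z. N z) (0, v) z) = H1 z v u / 2"
    unfolding H1_def using is_metricD(2)[OF met[OF F_in[OF z]], of "E u z"] by simp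
  finally show ?thesis unfolding H1_sym[OF z, of v u] by (simp add: H1_def)
qed

lemma H1_has: "z \<in> D \<Longrightarrow> ((\<lambda>z. H1 z u v) has_derivative (\<lambda>a. 2 * (g (F z) (cov (\<lambda>z. cov (\<lambda>z. N z) (0, u) z) a z) (E v z)
    + g (F z) (cov (\<lambda>z. N z) (0, u) z) (cov (\<lambda>z. E v z) a z)))) (at z within D)"
  unfolding H1_def by (intro has_derivative_mult_right metric_along cov_diff F_tw2 dF_diff)

section \<open>Unit normal, shape operator and second variation at the boundary\<close>

definition N0 where "N0 y = N (0, y)"

definition h where "h y u v = g (0, y) (0, u) (0, v)"

lemma y_S: "y \<in> V \<Longrightarrow> (0, y) \<in> S"
  using F_in[OF zD] F0 by metis

lemma met0: "y \<in> V \<Longrightarrow> is_metric (g (0, y))"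
  by (rule met[OF y_S])

lemma h_metric:
  assumes y: "y \<in> V"
  shows "is_metric (h y)"
proof -
  note m = metric_add[OF met0[OF y]] 
  have "bilinear (h y)"
    unfolding bilinear_def h_def
    using m(1)[of "(0, _)" "(0, _)"] m(5)[of _ "(0, _)"] m(2)[of _ "(0, _)" "(0, _)"] m(6)[of _ _ "(0, _)"]
    by (auto intro!: linearI)
  then show ?thesis unfolding is_metric_def h_def
    using is_metricD(2,3)[OF met0[OF y]] by (auto simp: zero_prod_def)
qed

lemma N0N0: "y \<in> V \<Longrightarrow> g (0, y) (N0 y) (N0 y) = 1"
  unfolding N0_def using unit[OF zD] F0 by simp

lemma N0u: "y \<in> V \<Longrightarrow> g (0, y) (N0 y) (0, u) = 0"
  unfolding N0_def using N_E[OF zD, of y u] F0 dF0 by simp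

text \<open>F maps into the half space, so the first component of a flow line cannot start with
  negative slope; slope 0 would make the unit vector N tangent to the boundary, hence orthogonal to
  itself.\<close>

lemma N0pos: 
  assumes y: "y \<in> V"
  shows "0 < fst (N0 y)"
proof -
  have "0 \<le> fst (N0 y)"
  proof (rule ccontr)
    assume neg: "\<not> ?thesis"
    have "((\<lambda>s. F (s, y)) has_derivative (\<lambda>r. r *\<^sub>R N0 y)) (at 0 within {0..<\<delta>})"
      unfolding N0_def by (rule slice_s[OF y differentiableI[OF F_has[OF zD[OF y]]]])
    from has_derivative_fst[OF this]
    have der: "((\<lambda>s. fst (F (s, y))) has_derivative (\<lambda>r. r * fst (N0 y))) (at 0 within {0..<\<delta>})" by simp
    \<comment> \<open>Half of the supposed negative slope, so that the linear term -2 e r outweighs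
      the error e r.\<close>
    define e where "e = - fst (N0 y) / 2"
    have e: "e > 0" using neg by (simp add: e_def)
    then obtain d where d: "d > 0" "\<And>r. r \<in> {0..<\<delta>} \<Longrightarrow> norm (r - 0) < d \<Longrightarrow>
       norm (fst (F (r, y)) - fst (F (0, y)) - (r - 0) * fst (N0 y)) \<le> e * norm (r - 0)"
      using der unfolding has_derivative_within_alt by blast
    define r where "r = min d \<delta> / 2"
    have r: "r > 0" "r < d" "r < \<delta>" using d(1) \<delta> by (auto simp: r_def)
    have "F (r, y) \<in> S" using r y by (intro F_in) simp
    then have "0 \<le> fst (F (r, y))" using S_half by (auto simp: halfspace_def)
    moreover have "\<bar>fst (F (r, y)) - r * fst (N0 y)\<bar> \<le> e * r" using d(2)[of r] r F0[OF y] by simp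
    moreover have "r * fst (N0 y) = - (2 * (e * r))" by (simp add: e_def)
    moreover have "e * r > 0" using e r by simp
    ultimately show False by linarith
  qed
  moreover have "fst (N0 y) \<noteq> 0"
  proof
    assume "fst (N0 y) = 0"
    then have "N0 y = (0, snd (N0 y))" by (simp add: prod_eq_iff)
    then show False using N0u[OF y] N0N0[OF y] by (metis zero_neq_one)
  qed
  ultimately show ?thesis by simp
qed

lemma tangential0:
  assumes y: "y \<in> V" and w: "g (0, y) w (N0 y) = 0"
  shows "w = (0, snd w)"
proof -
  note m = metric_add[OF met0[OF y]]
  define w' where "w' = w - (fst w / fst (N0 y)) *\<^sub>R N0 y"
  have "w' = (0, snd w')" using N0pos[OF y] by (simp add: w'_def prod_eq_iff)
  then have "g (0, y) (N0 y) w' = 0" using N0u[OF y] by metis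
  moreover have "g (0, y) (N0 y) w = 0" using w is_metricD(2)[OF met0[OF y]] by metis
  ultimately have "fst w = 0" using N0pos[OF y] by (simp add: w'_def m N0N0[OF y])
  then show ?thesis by (simp add: prod_eq_iff)
qed

text \<open>The negative of the shape operator.\<close>

definition P where "P y u = snd (cov (\<lambda>z. N z) (0, u) (0, y))"

lemma cov_N0: "y \<in> V \<Longrightarrow> cov (\<lambda>z. N z) (0, u) (0, y) = (0, P y u)"
  unfolding P_def using covN_N[OF zD, of y "(0, u)"] F0 by (intro tangential0) (simp_all add: N0_def)

lemma cov_linear: 
  assumes "z \<in> D" "X differentiable (at z within D)"
  shows "linear (\<lambda>a. cov X a z)"
  unfolding cov_def
  by (intro linear_compose_add linear_pd[OF assms(2)]
    linear_compose[OF linear_pd[OF differentiableI[OF F_has[OF assms(1)]]] bilinear_linear(2)[OF christoffel_bilinear[OF F_in[OF assms(1)]]], unfolded o_def])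

lemma P_linear:
  assumes y: "y \<in> V"
  shows "linear (P y)"
proof -
  have "linear (\<lambda>u. snd (cov (\<lambda>z. N z) (0, u) (0, y)))"
  proof (rule linearI)
    note l = cov_linear[OF zD[OF y] dF_diff[OF zD[OF y]], of "(1, 0)"]
    show "snd (cov (\<lambda>z. N z) (0, u + v) (0, y)) = snd (cov (\<lambda>z. N z) (0, u) (0, y)) + snd (cov (\<lambda>z. N z) (0, v) (0, y))" for u v
      using linear_add[OF l, of "(0, u)" "(0, v)"] by simp
    show "snd (cov (\<lambda>z. N z) (0, c *\<^sub>R u) (0, y)) = c *\<^sub>R snd (cov (\<lambda>z. N z) (0, u) (0, y))" for c u
      using linear_cmul[OF l, of c "(0, u)"] by simp
  qed
  then show ?thesis unfolding P_def[abs_def] by simp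
qed

lemma H0: "y \<in> V \<Longrightarrow> H (0, y) u v = h y u v"
  unfolding H_def h_def by (simp add: F0 dF0)

lemma H10: "y \<in> V \<Longrightarrow> H1 (0, y) u v = 2 * h y (P y u) v"
  unfolding H1_def h_def by (simp add: F0 dF0 cov_N0)

lemma P_sym: "y \<in> V \<Longrightarrow> h y (P y u) v = h y u (P y v)"
  using H1_sym[OF zD, of y u v] is_metricD(2)[OF h_metric, of y u "P y v"] by (simp add: H10)

text \<open>The flow lines of a unit gradient are geodesics. Their acceleration is orthogonal to N
  by unit length, and to boundary directions since g(\<nabla>_s N, E) = -g(N, \<nabla>_s E) = -g(N,
  \<nabla>_u N) = 0.\<close>

lemma cov_s_N:
  assumes y: "y \<in> V"
  shows "cov (\<lambda>z. N z) (1, 0) (0, y) = 0"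
proof -
  define w where "w = cov (\<lambda>z. N z) (1, 0) (0, y)"
  have wN: "g (0, y) w (N0 y) = 0" using covN_N[OF zD[OF y], of "(1, 0)"] F0[OF y] by (simp add: w_def N0_def)
  then have w: "w = (0, snd w)" by (rule tangential0[OF y])
  have "g (0, y) w (0, u) = 0" for u
  proof -
    have "g (0, y) w (0, u) = - g (0, y) (N0 y) (cov (\<lambda>z. E u z) (1, 0) (0, y))"
      using cov_NE[OF zD[OF y], of "(1, 0)" u] F0[OF y] dF0[OF y] by (simp add: w_def N0_def)
    also have "cov (\<lambda>z. E u z) (1, 0) (0, y) = (0, P y u)"
      unfolding cov_torsion[OF zD[OF y], of "(0, u)" "(1, 0)"] by (rule cov_N0[OF y])
    finally show ?thesis using N0u[OF y] by simp
  qed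
  then have "g (0, y) w w = 0" using w by metis
  then have "w = 0" using is_metricD(3)[OF met0[OF y], of w] by (cases "w = 0") auto
  then show ?thesis unfolding w_def .
qed

text \<open>The second variation. Exchanging the derivatives of N in the directions s and u costs a
  curvature term, and the exchanged term vanishes because flow lines are geodesics; the rest is the
  square of P.\<close>

lemma pd_H1:
  assumes y: "y \<in> V"
  shows "pd D (\<lambda>z. H1 z u v) (0, y) (1, 0) = - 2 * g (0, y) (R (0, y) (0, u) (N0 y) (N0 y)) (0, v) + 2 * h y (P y u) (P y v)"
proof -
  note z = zD[OF y]
  \<comment> \<open>The acceleration is known to vanish on the boundary slice, which suffices for
    its derivative in a direction tangent to that slice.\<close>
  have tan: "cov (\<lambda>z. cov (\<lambda>z. N z) (1, 0) z) (0, u) (0, y) = 0"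
  proof -
    have d: "(\<lambda>z. cov (\<lambda>z. N z) (1, 0) z) differentiable (at (0, y) within D)" by (rule cov_diff[OF z F_tw2])
    have "pd V (\<lambda>y. cov (\<lambda>z. N z) (1, 0) (0, y)) y = pd V (\<lambda>y. 0) y" by (rule pd_cong[OF y cov_s_N])
    then have "pd D (\<lambda>z. cov (\<lambda>z. N z) (1, 0) z) (0, y) (0, u) = 0"
      using pd_slice_y[OF y d, of u] pd_const[OF domV y] by metis
    then show ?thesis 
      unfolding cov_def[of "\<lambda>z. cov (\<lambda>z. N z) (1, 0) z"] cov_s_N[OF y]
      by (simp add: bilinear_rzero[OF christoffel_bilinear[OF F_in[OF z]]])
  qed
  have "cov (\<lambda>z. cov (\<lambda>z. N z) (0, u) z) (1, 0) (0, y) = R (0, y) (N0 y) (0, u) (N0 y)"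
    using curvature_along[OF z F_tw2[of "(1, 0)"], of "(0, u)" "(1, 0)"] tan F0[OF y] dF0[OF y] by (simp add: N0_def)
  also have "\<dots> = - R (0, y) (0, u) (N0 y) (N0 y)" by (rule riemann_antisym)
  finally have "pd D (\<lambda>z. H1 z u v) (0, y) (1, 0) = 2 * (g (0, y) (- R (0, y) (0, u) (N0 y) (N0 y)) (0, v) + g (0, y) (0, P y u) (0, P y v))"
    unfolding pd_eqI[OF domD z H1_has[OF z]] cov_torsion[OF z, of _ "(1, 0)"]
    by (simp add: F0[OF y] dF0[OF y] cov_N0[OF y])
  then show ?thesis by (simp add: h_def metric_add[OF met0[OF y]])
qed

lemma H_bilinear:
  assumes z: "z \<in> D"
  shows "bilinear (H z)"
proof -
  have l: "linear (\<lambda>u. E u z)"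
  proof (rule linearI)
    note lp = linear_pd[OF differentiableI[OF F_has[OF z]]]
    show "E (u + v) z = E u z + E v z" for u v using linear_add[OF lp, of "(0, u)" "(0, v)"] by simp
    show "E (c *\<^sub>R u) z = c *\<^sub>R E u z" for c u using linear_cmul[OF lp, of c "(0, u)"] by simp
  qed
  show ?thesis unfolding bilinear_def H_def
    using linear_compose[OF l bilinear_linear(1)[OF g_bilinear[OF F_in[OF z]]]]
      linear_compose[OF l bilinear_linear(2)[OF g_bilinear[OF F_in[OF z]]]] by (simp add: o_def)
qed

text \<open>The pulled-back form H is not known to be definite on the whole collar. At s = 0 it is
  h, and its coercivity persists for small s; hence the shorter interval.\<close>

lemma metric_path_at:
  assumes y: "y \<in> V"
  obtains \<delta>' where "0 < \<delta>'" "\<delta>' \<le> \<delta>" "metric_path \<delta>' (\<lambda>s. H (s, y)) (\<lambda>s. H1 (s, y))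
     (\<lambda>u v. - 2 * g (0, y) (R (0, y) (0, u) (N0 y) (N0 y)) (0, v) + 2 * h y (P y u) (P y v)) (P y)"
proof -
  have dH: "((\<lambda>s. H (s, y) u v) has_derivative (\<lambda>x. x * H1 (s, y) u v)) (at s within {0..<\<delta>})" if s: "s \<in> {0..<\<delta>}" for s u v
  proof -
    have z: "(s, y) \<in> D" using s y by simp
    show ?thesis using slice_s[OF y differentiableI[OF H_has[OF z]]] pd_H[OF z] by simp
  qed
  have dH1: "((\<lambda>s. H1 (s, y) u v) has_derivative (\<lambda>x. x * (- 2 * g (0, y) (R (0, y) (0, u) (N0 y) (N0 y)) (0, v) + 2 * h y (P y u) (P y v)))) (at 0 within {0..<\<delta>})" for u v
    using slice_s[OF y differentiableI[OF H1_has[OF zD[OF y]]], of u v] unfolding pd_H1[OF y] by simp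
  have lim: "((\<lambda>s. H (s, y) u v) \<longlongrightarrow> h y u v) (at 0 within {0..<\<delta>})" for u v
    using has_derivative_continuous[OF dH[of 0 u v]] \<delta> by (simp add: continuous_within H0[OF y])
  obtain c where c: "c > 0" "eventually (\<lambda>s. \<forall>u. c * (norm u)\<^sup>2 \<le> H (s, y) u u) (at 0 within {0..<\<delta>})"
    by (rule metric_coercive_nearby[OF h_metric[OF y], where S="{0..<\<delta>}" and z=0 and g="\<lambda>s. H (s, y)"])
       (use y lim in \<open>auto intro: H_bilinear\<close>)
  obtain d where d: "d > 0" "\<And>s u. s \<in> {0..<\<delta>} \<Longrightarrow> s \<noteq> 0 \<Longrightarrow> dist s 0 < d \<Longrightarrow> c * (norm u)\<^sup>2 \<le> H (s, y) u u"
    using c(2) unfolding eventually_at by blast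
  define \<delta>' where "\<delta>' = min d \<delta>"
  have sub: "{0..<\<delta>'} \<subseteq> {0..<\<delta>}" by (auto simp: \<delta>'_def)
  have "metric_path \<delta>' (\<lambda>s. H (s, y)) (\<lambda>s. H1 (s, y))
     (\<lambda>u v. - 2 * g (0, y) (R (0, y) (0, u) (N0 y) (N0 y)) (0, v) + 2 * h y (P y u) (P y v)) (P y)"
  proof (rule metric_path.intro)
    show "0 < \<delta>'" using d \<delta> by (simp add: \<delta>'_def)
    fix s assume s: "s \<in> {0..<\<delta>'}"
    then have z: "(s, y) \<in> D" using sub y by auto
    show "is_metric (H (s, y))"
      unfolding is_metric_def
    proof (intro conjI allI impI)
      show "bilinear (H (s, y))" by (rule H_bilinear[OF z])
      show "H (s, y) u v = H (s, y) v u" for u v by (rule H_sym[OF z])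
      fix u :: "real^3" assume u: "u \<noteq> 0"
      show "0 < H (s, y) u u"
      proof (cases "s = 0")
        case True then show ?thesis using is_metricD(3)[OF h_metric[OF y] u] H0[OF y] by simp
      next
        case False
        have "c * (norm u)\<^sup>2 \<le> H (s, y) u u" using s z False by (intro d) (auto simp: \<delta>'_def)
        moreover have "0 < c * (norm u)\<^sup>2" using c u by simp
        ultimately show ?thesis by linarith
      qed
    qed
    show "((\<lambda>s. H (s, y) u v) has_derivative (\<lambda>x. x * H1 (s, y) u v)) (at s within {0..<\<delta>'})" for u v
      using has_derivative_subset[OF dH sub] s sub by blast
  next
    show "((\<lambda>s. H1 (s, y) u v) has_derivative (\<lambda>x. x * (- 2 * g (0, y) (R (0, y) (0, u) (N0 y) (N0 y)) (0, v) + 2 * h y (P y u) (P y v)))) (at 0 within {0..<\<delta>'})" for u v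
      by (rule has_derivative_subset[OF dH1 sub])
    show "linear (P y)" by (rule P_linear[OF y])
    show "H1 (0, y) u v = 2 * H (0, y) (P y u) v" for u v by (simp add: H10[OF y] H0[OF y])
  qed
  then show ?thesis using that[of \<delta>'] d \<delta> by (simp add: \<delta>'_def)
qed

end

section \<open>Gauss and Codazzi equations of the boundary\<close>

context collar begin

lemma pd_incl: "y \<in> V \<Longrightarrow> pd V (\<lambda>y. (0::real, y)) y u = (0, u)"
proof -
  assume y: "y \<in> V"
  have "pd V (\<lambda>y. (0::real, y)) y = (\<lambda>u. (0, u))"
    by (rule pd_eqI[OF domV y]) (intro has_derivative_Pair has_derivative_const has_derivative_ident)
  then show ?thesis by simp
qed

lemma twice_diff_incl: "twice_diff V (\<lambda>y. (0::real, y))"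
proof -
  have 1: "(\<lambda>y. (0::real, y)) differentiable_on V"
    unfolding differentiable_on_def
    by (intro ballI differentiableI[OF has_derivative_Pair[OF has_derivative_const has_derivative_ident]])
  have "(\<lambda>y. pd V (\<lambda>y. (0::real, y)) y v) differentiable_on V" for v
    unfolding differentiable_on_def
    by (intro ballI differentiableI[OF has_derivative_transform[OF _ _ has_derivative_const]]) (auto simp: pd_incl)
  with 1 show ?thesis unfolding twice_diff_def by blast
qed

text \<open>The ambient connection along the inclusion of the boundary. Differentiating normal and
  tangential fields with it and splitting off normal parts gives the Gauss and Codazzi
  equations.\<close>

sublocale bd: chart_map S g V "\<lambda>y. (0, y)"
  by unfold_locales (auto intro: domV y_S twice_diff_incl)

lemma N0_pd: "y \<in> V \<Longrightarrow> pd V N0 y u = pd D (\<lambda>z. N z) (0, y) (0, u)"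
  unfolding N0_def by (rule pd_slice_y[OF _ dF_diff[OF zD]])

lemma N0_twice: "twice_diff V N0"
proof -
  have i: "0 \<in> {0..<\<delta>}" using \<delta> by simp
  have 1: "N0 differentiable (at y within V)" if "y \<in> V" for y
    unfolding N0_def by (rule differentiableI[OF slice_y[OF that i dF_diff[OF zD[OF that]]]])
  have 2: "(\<lambda>y. pd V N0 y u) differentiable (at y within V)" if y: "y \<in> V" for y u
  proof -
    have "(\<lambda>z. pd D (\<lambda>z. N z) z (0, u)) differentiable (at (0, y) within D)"
      by (rule differentiable_onD[OF twice_diffD(2)[OF F_tw2] zD[OF y]])
    from slice_y[OF y i this]
    have "((\<lambda>y. pd V N0 y u) has_derivative (\<lambda>v. pd D (\<lambda>z. pd D (\<lambda>z. N z) z (0, u)) (0, y) (0, v))) (at y within V)"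
      by (rule has_derivative_transform[OF y N0_pd, rotated])
    then show ?thesis by (rule differentiableI)
  qed
  show ?thesis unfolding twice_diff_def differentiable_on_def using 1 2 by blast
qed

lemma bd_cov_N0: "y \<in> V \<Longrightarrow> bd.cov N0 u y = (0, P y u)"
proof -
  assume y: "y \<in> V"
  have "bd.cov N0 u y = cov (\<lambda>z. N z) (0, u) (0, y)"
    unfolding bd.cov_def cov_def N0_pd[OF y] pd_incl[OF y] F0[OF y] dF0[OF y] by (simp add: N0_def)
  then show ?thesis using cov_N0[OF y] by simp
qed

lemma bd_cov_cong:
  assumes "y \<in> V" "\<And>y. y \<in> V \<Longrightarrow> X y = Y y"
  shows "bd.cov X u y = bd.cov Y u y"
  unfolding bd.cov_def using pd_cong[OF assms] assms by simp

text \<open>Christoffel symbols of the induced connection, as the tangential part of the ambient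
  ones. The correction by N0 makes the vector tangential, so that \<open>snd\<close> loses nothing;
  see \<open>christoffel_split\<close>.\<close>

definition \<Gamma>t where "\<Gamma>t y u w = snd (\<Gamma> (0, y) (0, u) (0, w)) + h y (P y u) w *\<^sub>R snd (N0 y)"

lemma N0_diff: "y \<in> V \<Longrightarrow> N0 differentiable (at y within V)"
  by (rule differentiable_onD[OF twice_diffD(1)[OF N0_twice]])

text \<open>Differentiating g(w, N0) = 0 for constant tangential w shows that the normal component
  of the ambient symbol is -h(P u, w).\<close>

lemma christoffel_split:
  assumes y: "y \<in> V"
  shows "\<Gamma> (0, y) (0, u) (0, w) = (0, \<Gamma>t y u w) - h y (P y u) w *\<^sub>R N0 y"
proof -
  note m = metric_add[OF met0[OF y]]
  define v where "v = \<Gamma> (0, y) (0, u) (0, w) + h y (P y u) w *\<^sub>R N0 y"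
  have c: "(\<lambda>_. (0, w)) differentiable (at y within V)" by (rule differentiable_const)
  have sym: "g (0, y) (N0 y) (0, w) = g (0, y) (0, w) (N0 y)" if "y \<in> V" for y w
    by (rule is_metricD(2)[OF met0[OF that]])
  have "pd V (\<lambda>y. g (0, y) (0, w) (N0 y)) y = pd V (\<lambda>y. 0) y"
    by (rule pd_cong[OF y]) (use N0u sym in metis)
  then have "pd V (\<lambda>y. g (0, y) (0, w) (N0 y)) y u = 0" using pd_const[OF domV y] by metis
  moreover have "bd.cov (\<lambda>_. (0, w)) u y = \<Gamma> (0, y) (0, u) (0, w)"
    unfolding bd.cov_def pd_const[OF domV y] pd_incl[OF y] by simp
  ultimately have "g (0, y) (\<Gamma> (0, y) (0, u) (0, w)) (N0 y) + h y w (P y u) = 0"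
    using bd.pd_metric_along[OF y c N0_diff[OF y], of u] by (simp add: bd_cov_N0[OF y] h_def)
  then have "g (0, y) v (N0 y) = 0"
    unfolding v_def by (simp add: m N0N0[OF y] is_metricD(2)[OF h_metric[OF y], of w])
  then have "v = (0, snd v)" by (rule tangential0[OF y])
  moreover have "snd v = \<Gamma>t y u w" by (simp add: v_def \<Gamma>t_def)
  ultimately show ?thesis unfolding v_def by (simp add: eq_diff_eq)
qed

lemma P_diff: "y \<in> V \<Longrightarrow> (\<lambda>y. P y u) differentiable (at y within V)"
proof -
  assume y: "y \<in> V"
  have "((\<lambda>y. snd (bd.cov N0 u y)) has_derivative (\<lambda>a. snd (pd V (bd.cov N0 u) y a))) (at y within V)"
    by (rule has_derivative_snd[OF pd_has_derivative[OF bd.cov_diff[OF y N0_twice]]])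
  then show ?thesis
    by (intro differentiableI[OF has_derivative_transform[OF y]]) (auto simp: bd_cov_N0)
qed

lemma \<Gamma>t_diff:
  assumes y: "y \<in> V"
  shows "(\<lambda>y. \<Gamma>t y u w) differentiable (at y within V)"
proof -
  have c: "(\<lambda>_. (0, w)) differentiable (at y within V)" by (rule differentiable_const)
  have 1: "(\<lambda>y. \<Gamma> (0, y) (0, u) (0, w)) differentiable (at y within V)"
    by (rule differentiableI[OF bd.comp_has[OF y christoffel_diff[OF y_S[OF y]]]])
  have "(\<lambda>y. g (0, y) (bd.cov N0 u y) (0, w)) differentiable (at y within V)"
    by (rule differentiableI[OF bd.metric_along[OF y bd.cov_diff[OF y N0_twice] c]])
  then obtain f' where "((\<lambda>y. g (0, y) (bd.cov N0 u y) (0, w)) has_derivative f') (at y within V)"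
    unfolding differentiable_def by blast
  then have 2: "((\<lambda>y. h y (P y u) w) has_derivative f') (at y within V)"
    by (rule has_derivative_transform[OF y, rotated]) (simp add: bd_cov_N0 h_def)
  show ?thesis unfolding \<Gamma>t_def
    by (rule differentiableI[OF has_derivative_add[OF has_derivative_snd[OF pd_has_derivative[OF 1]]
       has_derivative_scaleR[OF 2 has_derivative_snd[OF pd_has_derivative[OF N0_diff[OF y]]]]]])
qed

lemma h_test: "y \<in> V \<Longrightarrow> g (0, y) ((0, a) - r *\<^sub>R N0 y) (0, b) = h y a b"
  by (simp add: metric_add[OF met0] N0u h_def)

lemma h_\<Gamma>t: "y \<in> V \<Longrightarrow> h y (\<Gamma>t y u w) v = g (0, y) (\<Gamma> (0, y) (0, u) (0, w)) (0, v)"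
  unfolding christoffel_split by (simp add: h_test)

lemma \<Gamma>t_bilinear:
  assumes y: "y \<in> V"
  shows "bilinear (\<Gamma>t y)"
proof -
  note b = christoffel_bilinear[OF y_S[OF y]]
  note mh = metric_add[OF h_metric[OF y]] and mg = metric_add[OF met0[OF y]]
  have 1: "\<Gamma>t y (u + u') w = \<Gamma>t y u w + \<Gamma>t y u' w" "\<Gamma>t y w (u + u') = \<Gamma>t y w u + \<Gamma>t y w u'" for u u' w
    using bilinear_ladd[OF b, of "(0, u)" "(0, u')" "(0, w)"] bilinear_radd[OF b, of "(0, w)" "(0, u)" "(0, u')"]
    by (auto intro!: metric_eqI[OF h_metric[OF y]] simp: mh h_\<Gamma>t[OF y] mg)
  have 2: "\<Gamma>t y (r *\<^sub>R u) w = r *\<^sub>R \<Gamma>t y u w" "\<Gamma>t y w (r *\<^sub>R u) = r *\<^sub>R \<Gamma>t y w u" for u r w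
    using bilinear_lmul[OF b, of r "(0, u)" "(0, w)"] bilinear_rmul[OF b, of "(0, w)" r "(0, u)"]
    by (auto intro!: metric_eqI[OF h_metric[OF y]] simp: mh h_\<Gamma>t[OF y] mg)
  show ?thesis unfolding bilinear_def by (intro conjI allI linearI 1 2)
qed

lemma \<Gamma>t_sym:
  assumes y: "y \<in> V"
  shows "\<Gamma>t y u w = \<Gamma>t y w u"
proof (rule metric_eqI[OF h_metric[OF y]])
  show "h y (\<Gamma>t y u w) v = h y (\<Gamma>t y w u) v" for v
    unfolding h_\<Gamma>t[OF y] christoffel_sym[OF y_S[OF y], of "(0, u)" "(0, w)"] ..
qed

lemma \<Gamma>t_metric:
  assumes y: "y \<in> V"
  shows "pd V (\<lambda>y. h y v w) y u = h y (\<Gamma>t y u v) w + h y v (\<Gamma>t y u w)"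
proof -
  have c: "(\<lambda>_. (0, w)) differentiable (at y within V)" for w by (rule differentiable_const)
  have k: "bd.cov (\<lambda>_. (0, w)) u y = \<Gamma> (0, y) (0, u) (0, w)" for w
    unfolding bd.cov_def pd_const[OF domV y] pd_incl[OF y] by simp
  have "pd V (\<lambda>y. h y v w) y u = g (0, y) (\<Gamma> (0, y) (0, u) (0, v)) (0, w) + g (0, y) (0, v) (\<Gamma> (0, y) (0, u) (0, w))"
    unfolding h_def bd.pd_metric_along[OF y c[of v] c[of w]] k ..
  also have "g (0, y) (0, v) (\<Gamma> (0, y) (0, u) (0, w)) = g (0, y) (\<Gamma> (0, y) (0, u) (0, w)) (0, v)"
    by (rule is_metricD(2)[OF met0[OF y]])
  finally show ?thesis
    unfolding h_\<Gamma>t[OF y, symmetric] is_metricD(2)[OF h_metric[OF y], of v] .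
qed

lemma bd_cov_tangential:
  assumes y: "y \<in> V" and A: "A differentiable (at y within V)"
  shows "bd.cov (\<lambda>y. (0, A y)) u y = (0, pd V A y u + \<Gamma>t y u (A y)) - h y (P y u) (A y) *\<^sub>R N0 y"
proof -
  have "pd V (\<lambda>y. (0::real, A y)) y = (\<lambda>u. (0, pd V A y u))"
    by (rule pd_eqI[OF domV y]) (intro has_derivative_Pair has_derivative_const pd_has_derivative[OF A])
  then show ?thesis unfolding bd.cov_def pd_incl[OF y] christoffel_split[OF y] by simp
qed

text \<open>The exterior covariant derivative of P, that is, minus that of the shape operator
  S.\<close>

definition n where "n y u v = (pd V (\<lambda>y. P y v) y u + \<Gamma>t y u (P y v)) - (pd V (\<lambda>y. P y u) y v + \<Gamma>t y v (P y u))"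

text \<open>The derivative of N0 is the tangential field P, whose own derivative has the normal part
  -h(P u, P v). This is symmetric in u and v and drops out of the commutator.\<close>

lemma codazzi:
  assumes y: "y \<in> V"
  shows "R (0, y) (0, u) (0, v) (N0 y) = (0, n y u v)"
proof -
  have c: "bd.cov (bd.cov N0 v) u y = (0, pd V (\<lambda>y. P y v) y u + \<Gamma>t y u (P y v)) - h y (P y u) (P y v) *\<^sub>R N0 y" for u v
  proof -
    have "bd.cov (bd.cov N0 v) u y = bd.cov (\<lambda>y. (0, P y v)) u y" by (rule bd_cov_cong[OF y bd_cov_N0])
    then show ?thesis by (simp only: bd_cov_tangential[OF y P_diff[OF y]])
  qed
  show ?thesis
    using bd.curvature_along[OF y N0_twice, of v u] is_metricD(2)[OF h_metric[OF y], of "P y u" "P y v"]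
    by (simp add: c pd_incl[OF y] n_def)
qed

definition Rt where "Rt y u v w = pd V (\<lambda>y. \<Gamma>t y v w) y u - pd V (\<lambda>y. \<Gamma>t y u w) y v
   + \<Gamma>t y u (\<Gamma>t y v w) - \<Gamma>t y v (\<Gamma>t y u w)"

text \<open>The derivative of a constant tangential w has the normal part -h(P v, w) N0;
  differentiating N0 once more turns it into the terms quadratic in P.\<close>

lemma gauss:
  assumes y: "y \<in> V"
  shows "g (0, y) (R (0, y) (0, u) (0, v) (0, w)) (0, w') = h y (Rt y u v w) w' - h y (P y v) w * h y (P y u) w' + h y (P y u) w * h y (P y v) w'"
proof -
  note mh = metric_add[OF h_metric[OF y]] and mg = metric_add[OF met0[OF y]]
  have cst: "twice_diff V (\<lambda>_. (0, w))" by (rule twice_diff_const[OF domV])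
  have k: "bd.cov (\<lambda>_. (0, w)) v y = (0, \<Gamma>t y v w) - h y (P y v) w *\<^sub>R N0 y" if "y \<in> V" for v y
    unfolding bd.cov_def pd_const[OF domV that] pd_incl[OF that] christoffel_split[OF that] by simp
  have c: "g (0, y) (bd.cov (bd.cov (\<lambda>_. (0, w)) v) u y) (0, w') =
     h y (pd V (\<lambda>y. \<Gamma>t y v w) y u + \<Gamma>t y u (\<Gamma>t y v w)) w' - h y (P y v) w * h y (P y u) w'" for u v
  proof -
    have d1: "(\<lambda>y. (0::real, \<Gamma>t y v w)) differentiable (at y within V)"
      by (rule differentiableI[OF has_derivative_Pair[OF has_derivative_const pd_has_derivative[OF \<Gamma>t_diff[OF y]]]])
    have "(\<lambda>y. g (0, y) (bd.cov N0 v y) (0, w)) differentiable (at y within V)"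
      by (rule differentiableI[OF bd.metric_along[OF y bd.cov_diff[OF y N0_twice] differentiable_const]])
    \<comment> \<open>The value of this derivative of h(P v, w) may stay unknown, as it multiplies
      N0, which is orthogonal to w'.\<close>
    then obtain f' where "((\<lambda>y. g (0, y) (bd.cov N0 v y) (0, w)) has_derivative f') (at y within V)"
      unfolding differentiable_def by blast
    then have f: "((\<lambda>y. h y (P y v) w) has_derivative f') (at y within V)"
      by (rule has_derivative_transform[OF y, rotated]) (simp add: bd_cov_N0 h_def)
    have pdd: "pd V (\<lambda>y. (0, \<Gamma>t y v w) - h y (P y v) w *\<^sub>R N0 y) y = (\<lambda>u. pd V (\<lambda>y. (0, \<Gamma>t y v w)) y u - (h y (P y v) w *\<^sub>R pd V N0 y u + f' u *\<^sub>R N0 y))"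
      by (rule pd_eqI[OF domV y]) (intro has_derivative_diff has_derivative_scaleR f pd_has_derivative d1 N0_diff[OF y])
    have "bd.cov (bd.cov (\<lambda>_. (0, w)) v) u y = bd.cov (\<lambda>y. (0, \<Gamma>t y v w) - h y (P y v) w *\<^sub>R N0 y) u y"
      by (rule bd_cov_cong[OF y k])
    also have "\<dots> = bd.cov (\<lambda>y. (0, \<Gamma>t y v w)) u y - h y (P y v) w *\<^sub>R bd.cov N0 u y - f' u *\<^sub>R N0 y"
      unfolding bd.cov_def pdd using christoffel_bilinear[OF y_S[OF y]]
      by (simp add: bilinear_rsub bilinear_rmul scaleR_add_right algebra_simps)
    finally show ?thesis
      unfolding bd_cov_N0[OF y] bd_cov_tangential[OF y \<Gamma>t_diff[OF y]]
      by (simp add: mg mh N0u[OF y] flip: h_def)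
  qed
  have "R (0, y) (0, u) (0, v) (0, w) = bd.cov (bd.cov (\<lambda>_. (0, w)) v) u y - bd.cov (bd.cov (\<lambda>_. (0, w)) u) v y"
    using bd.curvature_along[OF y cst, of v u] by (simp add: pd_incl[OF y])
  then show ?thesis by (simp add: mg c Rt_def mh)
qed

text \<open>The solution of \<open>\<beta> u \<times> v - \<beta> v \<times> u = (tr P) (u \<times>
  v) - 2 P (u \<times> v)\<close>, with the first Hodge coefficient on the right. By
  \<open>symmetric_cross\<close> the ansatz a P + b (tr P) leads to a + 2 b = 1 and a = 2, hence b =
  -1/2.\<close>

definition \<beta> where "\<beta> y u = 2 *\<^sub>R P y u - (endo_trace (P y) / 2) *\<^sub>R u"

lemma trace_diff: "y \<in> V \<Longrightarrow> (\<lambda>y. endo_trace (P y)) differentiable (at y within V)"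
  unfolding endo_trace_def by (rule differentiableI[OF has_derivative_sum[OF has_derivative_inner_left[OF pd_has_derivative[OF P_diff]]]])

lemma \<beta>_has: "y \<in> V \<Longrightarrow> ((\<lambda>y. \<beta> y v) has_derivative (\<lambda>u. 2 *\<^sub>R pd V (\<lambda>y. P y v) y u - (pd V (\<lambda>y. endo_trace (P y)) y u / 2) *\<^sub>R v)) (at y within V)"
proof -
  assume y: "y \<in> V"
  have "((\<lambda>y. 2 *\<^sub>R P y v - (endo_trace (P y) * (1/2)) *\<^sub>R v) has_derivative (\<lambda>u. 2 *\<^sub>R pd V (\<lambda>y. P y v) y u - (pd V (\<lambda>y. endo_trace (P y)) y u * (1/2)) *\<^sub>R v)) (at y within V)"
    by (intro has_derivative_diff has_derivative_scaleR_right has_derivative_scaleR_left has_derivative_mult_left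
        pd_has_derivative P_diff trace_diff y)
  then show ?thesis by (simp add: \<beta>_def)
qed

end

text \<open>P acts on the volume form as a derivation, with total factor tr P; self-adjointness
  moves P from the third slot onto the cross product.\<close>

lemma symmetric_cross:
  assumes h: "is_metric h" and P: "linear P" "\<And>u v. h (P u) v = h u (P v)"
  shows "metric_cross h (P u) v - metric_cross h (P v) u = endo_trace P *\<^sub>R metric_cross h u v - P (metric_cross h u v)"
proof -
  obtain e1 e2 e3 where "oriented_frame h e1 e2 e3" using oriented_frame_exists[OF h] .
  then interpret frame3 h e1 e2 e3 using h by unfold_locales
  note sym = is_metricD(2)[OF h]
  define p where "p = (\<lambda>a b. h (P a) b)"
  have p: "p e2 e1 = p e1 e2" "p e3 e1 = p e1 e3" "p e3 e2 = p e2 e3"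
    unfolding p_def using P(2) sym by metis+
  have hP: "h (P u) e1 = h u e1 * p e1 e1 + h u e2 * p e1 e2 + h u e3 * p e1 e3"
    "h (P u) e2 = h u e1 * p e1 e2 + h u e2 * p e2 e2 + h u e3 * p e2 e3"
    "h (P u) e3 = h u e1 * p e1 e3 + h u e2 * p e2 e3 + h u e3 * p e3 e3" for u
    using h_expand[of u "P e1"] h_expand[of u "P e2"] h_expand[of u "P e3"] P(2)[of u e1] P(2)[of u e2] P(2)[of u e3] p
    by (simp_all add: p_def)
  have tr: "endo_trace P = p e1 e1 + p e2 e2 + p e3 e3" by (simp add: trace_frame[OF P(1)] p_def)
  show ?thesis
    by (rule eqI) (simp_all add: cross_comp metric_add[OF h] hP tr algebra_simps)
qed

text \<open>The collar metrics in the chart agree with H only for small s, and expansions at 0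
  depend on nothing more.\<close>

lemma metric_path_cong:
  assumes mp: "metric_path \<delta> hs h1 h2 P" and \<delta>': "0 < \<delta>'" "\<delta>' \<le> \<delta>" and eq: "\<And>s. s \<in> {0..<\<delta>'} \<Longrightarrow> hs' s = hs s"
  shows "metric_path \<delta>' hs' h1 h2 P"
proof -
  interpret metric_path \<delta> hs h1 h2 P by (rule mp)
  have sub: "{0..<\<delta>'} \<subseteq> {0..<\<delta>}" using \<delta>' by auto
  have 0: "0 \<in> {0..<\<delta>'}" using \<delta>' by simp
  show ?thesis
  proof (rule metric_path.intro)
    show "0 < \<delta>'" "linear P" by (fact \<delta>'(1) P)+
    show "is_metric (hs' s)" if "s \<in> {0..<\<delta>'}" for s using eq[OF that] hm that sub by auto
    show "h1 0 u v = 2 * hs' 0 (P u) v" for u v using eq[OF 0] h1P by simp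
    show "((\<lambda>s. h1 s u v) has_derivative (\<lambda>x. x * h2 u v)) (at 0 within {0..<\<delta>'})" for u v
      by (rule has_derivative_subset[OF h2 sub])
    fix s u v assume s: "s \<in> {0..<\<delta>'}"
    have "((\<lambda>s. hs s u v) has_derivative (\<lambda>x. x * h1 s u v)) (at s within {0..<\<delta>'})"
      by (rule has_derivative_subset[OF h1 sub]) (use s sub in blast)
    then show "((\<lambda>s. hs' s u v) has_derivative (\<lambda>x. x * h1 s u v)) (at s within {0..<\<delta>'})"
      by (rule has_derivative_transform[OF s, rotated]) (simp add: eq)
  qed
qed

lemma hodge2_compose_linear:
  assumes "linear L"
  shows "hodge2 h (\<lambda>u w. L (M u w)) v = L (hodge2 h M v)"
  unfolding hodge2_def using assms by (simp add: linear_sum linear_cmul)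

lemma hodge2_diff: "hodge2 h (\<lambda>u w. M u w - M' u w) v = hodge2 h M v - hodge2 h M' v"
  unfolding hodge2_def by (simp add: scaleR_diff_right sum_subtractf)

lemma hodge2_linear: "linear (\<lambda>v. hodge2 h M v)"
  unfolding hodge2_def
  by (rule linearI) (simp_all add: linear_add[OF vol3_linear(3)] linear_cmul[OF vol3_linear(3)] scaleR_add_left sum.distrib scaleR_add_right scaleR_sum_right mult.commute)

lemma hodge2_cross:
  assumes h: "is_metric h" and C: "linear C"
  shows "hodge2 h (\<lambda>u w. C (metric_cross h u w)) v = C v"
proof -
  obtain e1 e2 e3 where "oriented_frame h e1 e2 e3" using oriented_frame_exists[OF h] .
  then interpret frame3 h e1 e2 e3 using h by unfold_locales
  have b: "bilinear (metric_cross h)" by (rule metric_cross_bilinear[OF h])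
  have a: "metric_cross h u v = - metric_cross h v u" for u v
    by (rule metric_eqI[OF h]) (simp add: metric_cross_works[OF h] metric_add[OF h] vol3_swap[of h u v])
  have "metric_cross h e2 e3 = e1" "metric_cross h e3 e1 = e2" "metric_cross h e1 e2 = e3"
    by (rule eqI; simp add: cross_comp)+
  then have "hodge2 h (metric_cross h) v = v" using hodge2_frame[OF b a, of v] expand[of v] by simp
  then show ?thesis unfolding hodge2_compose_linear[OF C] by simp
qed

lemma taylor_coeff_0: "taylor_coeff 0 f = f 0"
  unfolding taylor_coeff_def by simp

section \<open>Assembly of the obstruction formula in a collar\<close>

context collar begin

text \<open>\<open>\<theta>\<close>, a and hs are the soldering form, the connection and the collar
  metrics in one trivialisation. The torsion equation is used on all of V, because the connection it
  determines is differentiated to obtain the curvature; the second Hodge coefficient enters at y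
  alone.\<close>

theorem obstruction_formula:
  assumes \<theta>lin: "\<And>y. y \<in> V \<Longrightarrow> linear (\<theta> y)" and \<theta>bij: "\<And>y. y \<in> V \<Longrightarrow> bij_betw (\<theta> y) UNIV su2"
    and \<theta>lie: "\<And>y u v. y \<in> V \<Longrightarrow> lie_bracket (\<theta> y u) (\<theta> y v) = \<theta> y (metric_cross (h y) u v)"
    and \<theta>tw: "\<And>u. twice_diff V (\<lambda>y. \<theta> y u)"
    and alin: "\<And>y. y \<in> V \<Longrightarrow> linear (a y)" and asu: "\<And>y u. y \<in> V \<Longrightarrow> a y u \<in> su2"
    and ad: "\<And>u. (\<lambda>y. a y u) differentiable_on V"
    and hs: "\<And>y. y \<in> V \<Longrightarrow> \<exists>\<epsilon>>0. \<forall>s\<in>{0..<\<epsilon>}. hs y s = H (s, y)"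
    and tors: "\<And>y u v. y \<in> V \<Longrightarrow> cov_ext_deriv a \<theta> y u v = hodge1_coeff 1 (hs y) (\<theta> y) u v"
    and y: "y \<in> V"
  shows "(0, obstruction_tensor (h y) (hs y) \<theta> a y v) =
    2 *\<^sub>R (dual_alg (g (0, y)) (weyl_alg (g (0, y)) (R (0, y))) (0, v) (N0 y) (N0 y) - weyl_alg (g (0, y)) (R (0, y)) (0, v) (N0 y) (N0 y))"
proof -
  have mp: "\<exists>\<epsilon>. metric_path \<epsilon> (hs y) (\<lambda>s. H1 (s, y))
     (\<lambda>u v. - 2 * g (0, y) (R (0, y) (0, u) (N0 y) (N0 y)) (0, v) + 2 * h y (P y u) (P y v)) (P y)" if y: "y \<in> V" for y
  proof -
    obtain \<delta>' where d: "0 < \<delta>'" "\<delta>' \<le> \<delta>" and mp: "metric_path \<delta>' (\<lambda>s. H (s, y)) (\<lambda>s. H1 (s, y))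
     (\<lambda>u v. - 2 * g (0, y) (R (0, y) (0, u) (N0 y) (N0 y)) (0, v) + 2 * h y (P y u) (P y v)) (P y)"
      by (rule metric_path_at[OF y])
    obtain \<epsilon> where e: "\<epsilon> > 0" "\<forall>s\<in>{0..<\<epsilon>}. hs y s = H (s, y)" using hs[OF y] by blast
    show ?thesis
      by (rule exI[of _ "min \<delta>' \<epsilon>"], rule metric_path_cong[OF mp]) (use d e in auto)
  qed
  have hs0: "hs y 0 = h y" if y: "y \<in> V" for y
  proof -
    obtain \<epsilon> where e: "\<epsilon> > 0" "\<forall>s\<in>{0..<\<epsilon>}. hs y s = H (s, y)" using hs[OF y] by blast
    then have "hs y 0 = H (0, y)" by simp
    also have "\<dots> = h y" by (intro ext H0[OF y])
    finally show ?thesis .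
  qed
  have tors': "pd V (\<lambda>y. \<theta> y v) y u - pd V (\<lambda>y. \<theta> y u) y v + lie_bracket (a y u) (\<theta> y v) - lie_bracket (a y v) (\<theta> y u)
       = \<theta> y (metric_cross (h y) (\<beta> y u) v - metric_cross (h y) (\<beta> y v) u)" if y: "y \<in> V" for y u v
  proof -
    obtain \<epsilon> where "metric_path \<epsilon> (hs y) (\<lambda>s. H1 (s, y))
     (\<lambda>u v. - 2 * g (0, y) (R (0, y) (0, u) (N0 y) (N0 y)) (0, v) + 2 * h y (P y u) (P y v)) (P y)" using mp[OF y] by blast
    then interpret metric_path \<epsilon> "hs y" "\<lambda>s. H1 (s, y)" "\<lambda>u v. - 2 * g (0, y) (R (0, y) (0, u) (N0 y) (N0 y)) (0, v) + 2 * h y (P y u) (P y v)" "P y" .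
    note bil = metric_cross_bilinear[OF h_metric[OF y]]
    have swap: "metric_cross (h y) v u = - metric_cross (h y) u v"
      by (rule metric_eqI[OF h_metric[OF y]])
        (simp add: metric_cross_works[OF h_metric[OF y]] metric_add[OF h_metric[OF y]] vol3_swap[of "h y" v u])
    obtain C \<kappa> where c: "\<And>\<theta> u v. linear \<theta> \<Longrightarrow> hodge1_coeff 1 (hs y) \<theta> u v =
       (\<theta> (endo_trace (P y) *\<^sub>R metric_cross (hs y 0) u v - 2 *\<^sub>R P y (metric_cross (hs y 0) u v)) :: mat2)"
      using hodge_coeffs[where 'f=mat2] by metis
    have "metric_cross (h y) (\<beta> y u) v - metric_cross (h y) (\<beta> y v) u =
       2 *\<^sub>R (metric_cross (h y) (P y u) v - metric_cross (h y) (P y v) u) - endo_trace (P y) *\<^sub>R metric_cross (h y) u v"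
      unfolding \<beta>_def bilinear_lsub[OF bil] bilinear_lmul[OF bil] swap
      by (rule metric_eqI[OF h_metric[OF y]], simp only: metric_add[OF h_metric[OF y]]) (simp add: field_simps)
    also have "\<dots> = endo_trace (P y) *\<^sub>R metric_cross (h y) u v - 2 *\<^sub>R P y (metric_cross (h y) u v)"
      unfolding symmetric_cross[OF h_metric[OF y] P_linear[OF y] P_sym[OF y]]
      by (rule metric_eqI[OF h_metric[OF y]]) (simp add: metric_add[OF h_metric[OF y]] algebra_simps)
    finally show ?thesis
      using tors[OF y, of u v] c[OF \<theta>lin[OF y], of u v]
      unfolding cov_ext_deriv_def pd_open[OF V y] hs0[OF y] by simp
  qed
  interpret sp: spin_patch V h \<theta> a \<Gamma>t \<beta>
  proof (rule spin_patch.intro)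
    show "linear (\<beta> y)" if "y \<in> V" for y
      unfolding \<beta>_def[abs_def] by (intro linear_compose_sub linear_compose_scale_right P_linear[OF that] linear_id[unfolded id_def])
    show "(\<lambda>y. \<beta> y u) differentiable_on V" for u
      unfolding differentiable_on_def using differentiableI[OF \<beta>_has] by blast
    show "(\<lambda>y. \<Gamma>t y u v) differentiable_on V" for u v
      unfolding differentiable_on_def using \<Gamma>t_diff by blast
  qed (fact V h_metric \<theta>lin \<theta>bij \<theta>lie \<theta>tw alin asu ad \<Gamma>t_bilinear \<Gamma>t_sym \<Gamma>t_metric tors')+
  define \<phi> where "\<phi> = (\<lambda>u w. inv (\<theta> y) (sp.curv y u w))"
  have \<phi>: "\<theta> y (\<phi> u w) = sp.curv y u w" for u w
    unfolding \<phi>_def by (rule sp.curvature_cross(1)[OF y])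
  have curv: "conn_curvature a y u w = sp.curv y u w" for u w
    unfolding conn_curvature_def sp.curv_def pd_open[OF V y] ..
  have inj: "\<theta> y u = \<theta> y v \<longleftrightarrow> u = v" for u v using sp.\<theta>inj[OF y] by (simp add: inj_eq)
  note bl = bilinear_lie_bracket
  have curv_lin: "bilinear (sp.curv y)" 
  proof -
    have l: "linear (\<lambda>v. pd V (\<lambda>y. a y v) y u)" "linear (\<lambda>u. pd V (\<lambda>y. a y v) y u)" for u v
      using linear_pd_family[OF domV y alin differentiable_onD[OF ad y]] linear_pd[OF differentiable_onD[OF ad y]] by blast+
    have b: "linear (\<lambda>u. lie_bracket (a y u) (a y v))" "linear (\<lambda>u. lie_bracket (a y v) (a y u))" for v
      using linear_compose[OF alin[OF y] bilinear_linear(2)[OF bl]] linear_compose[OF alin[OF y] bilinear_linear(1)[OF bl]] by (simp_all add: o_def)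
    show ?thesis unfolding bilinear_def sp.curv_def
      by (intro conjI allI linear_compose_add linear_compose_sub l b)
  qed
  have \<phi>b: "bilinear \<phi>"
    unfolding bilinear_def
    by (intro conjI allI linearI)
      (simp_all add: inj[symmetric] linear_add[OF \<theta>lin[OF y]] linear_cmul[OF \<theta>lin[OF y]] \<phi>
       bilinear_ladd[OF curv_lin] bilinear_radd[OF curv_lin] bilinear_lmul[OF curv_lin] bilinear_rmul[OF curv_lin])
  have \<phi>a: "\<phi> u v = - \<phi> v u" for u v
    unfolding inj[symmetric] linear_neg[OF \<theta>lin[OF y]] \<phi> sp.curv_def using lie_bracket_anti[of "a y u" "a y v"] by simp
  obtain \<epsilon> where "metric_path \<epsilon> (hs y) (\<lambda>s. H1 (s, y))
     (\<lambda>u v. - 2 * g (0, y) (R (0, y) (0, u) (N0 y) (N0 y)) (0, v) + 2 * h y (P y u) (P y v)) (P y)" using mp[OF y] by blast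
  then interpret mpath: metric_path \<epsilon> "hs y" "\<lambda>s. H1 (s, y)" "\<lambda>u v. - 2 * g (0, y) (R (0, y) (0, u) (N0 y) (N0 y)) (0, v) + 2 * h y (P y u) (P y v)" "P y" .
  obtain C \<kappa> where C: "linear C" and c2: "\<And>\<theta> u v. linear \<theta> \<Longrightarrow> hodge1_coeff 2 (hs y) \<theta> u v = (\<theta> (C (metric_cross (hs y 0) u v)) :: mat2)"
    and Cv: "\<And>u w. hs y 0 (C u) w = \<kappa> * hs y 0 u w + 4 * hs y 0 (P y u) (P y w) - (- 2 * g (0, y) (R (0, y) (0, u) (N0 y) (N0 y)) (0, w) + 2 * h y (P y u) (P y w)) / 2
       - 2 * endo_trace (P y) * hs y 0 (P y u) w"
    using mpath.hodge_coeffs[where 'f=mat2] by metis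
  define E where "E = (\<lambda>v. C v - hodge2 (h y) \<phi> v)"
  have Elin: "linear E" unfolding E_def by (intro linear_compose_sub C hodge2_linear)
  have "obstruction_tensor (h y) (hs y) \<theta> a y = tf_symm (h y) E"
  proof -
    \<comment> \<open>The Hodge star commutes with the linear map \<open>\<theta> y\<close>, so the
      su(2)-valued form is \<open>\<theta> y\<close> after E, and the inverse soldering form leaves
      E.\<close>
    have "hodge2_coeff 0 (hs y) (\<lambda>u w. hodge1_coeff 2 (hs y) (\<theta> y) u w - conn_curvature a y u w) v = \<theta> y (E v)" for v
    proof -
      have "hodge2_coeff 0 (hs y) (\<lambda>u w. hodge1_coeff 2 (hs y) (\<theta> y) u w - conn_curvature a y u w) v
        = hodge2 (h y) (\<lambda>u w. \<theta> y (C (metric_cross (h y) u w) - \<phi> u w)) v"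
        unfolding hodge2_coeff_def taylor_coeff_0 hs0[OF y] c2[OF \<theta>lin[OF y]] curv \<phi>[symmetric] linear_diff[OF \<theta>lin[OF y]] ..
      also have "\<dots> = \<theta> y (E v)"
        unfolding hodge2_compose_linear[OF \<theta>lin[OF y]] hodge2_diff hodge2_cross[OF h_metric[OF y] C] E_def ..
      finally show ?thesis .
    qed
    then show ?thesis unfolding obstruction_tensor_def by (simp add: inv_f_f[OF sp.\<theta>inj[OF y]])
  qed
  moreover obtain e1 e2 e3 where fr: "oriented_frame (h y) e1 e2 e3" using oriented_frame_exists[OF h_metric[OF y]] .
  interpret c4: curvature4 "h y" e1 e2 e3 "g (0, y)" "N0 y" "R (0, y)"
    apply (intro curvature4.intro frame4.intro frame3.intro frame4_axioms.intro curvature4_axioms.intro)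
               apply (fact h_metric[OF y])
              apply (fact fr)
             apply (fact met0[OF y])
            apply (rule h_def)
           apply (fact N0N0[OF y])
          apply (fact N0u[OF y])
         apply (fact N0pos[OF y])
        apply (fact riemann_linear[OF y_S[OF y]])+
     apply (rule riemann_antisym)
    apply (fact riemann_bianchi[OF y_S[OF y]])
    apply (fact riemann_skew[OF y_S[OF y]])
    done
  have "(0, tf_symm (h y) E v) =
    2 *\<^sub>R (dual_alg (g (0, y)) (weyl_alg (g (0, y)) (R (0, y))) (0, v) (N0 y) (N0 y) - weyl_alg (g (0, y)) (R (0, y)) (0, v) (N0 y) (N0 y))"
  proof (rule c4.obstruction_algebra[OF P_linear[OF y] P_sym[OF y] Elin \<phi>b \<phi>a codazzi[OF y] \<beta>_def])
    fix v w
    \<comment> \<open>The Hodge coefficient contains 4 h(P v, P w), of which half the second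
      variation takes one away; this leaves 3.\<close>
    show "h y (E v) w = \<kappa> * h y v w + 3 * h y (P y v) (P y w) + g (0, y) (R (0, y) (0, v) (N0 y) (N0 y)) (0, w) - 2 * endo_trace (P y) * h y (P y v) w - h y (hodge2 (h y) \<phi> v) w"
      using Cv[of v w] unfolding hs0[OF y] E_def by (simp add: metric_add[OF h_metric[OF y]] field_simps)
  next
    fix u v w w'
    define t where "t = (\<lambda>u. pd V (\<lambda>y. endo_trace (P y)) y u)"
    \<comment> \<open>The derivative t of tr P comes from the scalar part of \<open>\<beta>\<close>.
      It takes the place of \<open>\<tau>\<close> in the algebraic identity, where it disappears on
      symmetrisation.\<close>
    have d: "sp.d\<beta> y u v = 2 *\<^sub>R n y u v + (t v / 2) *\<^sub>R u - (t u / 2) *\<^sub>R v"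
    proof -
      have g: "\<Gamma>t y u (\<beta> y v) = 2 *\<^sub>R \<Gamma>t y u (P y v) - (endo_trace (P y) / 2) *\<^sub>R \<Gamma>t y u v" for u v
        unfolding \<beta>_def bilinear_rsub[OF \<Gamma>t_bilinear[OF y]] bilinear_rmul[OF \<Gamma>t_bilinear[OF y]] ..
      show ?thesis
        unfolding sp.d\<beta>_def n_def pd_eqI[OF domV y \<beta>_has[OF y]] g t_def[symmetric] \<Gamma>t_sym[OF y, of v u]
        by (simp add: algebra_simps)
    qed
    have "metric_cross (h y) (\<phi> u v) w = Rt y u v w + metric_cross (h y) (2 *\<^sub>R n y u v + (t v / 2) *\<^sub>R u - (t u / 2) *\<^sub>R v + metric_cross (h y) (\<beta> y u) (\<beta> y v)) w"
      unfolding \<phi>_def sp.curvature_cross(2)[OF y] d sp.Riem'_def Rt_def ..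
    \<comment> \<open>The quadratic Gauss term is the cross product endomorphism of
      \<open>P u \<times> P v\<close>. Solving for Rt gives this vector its negative sign
      below.\<close>
    moreover have "g (0, y) (R (0, y) (0, u) (0, v) (0, w)) (0, w') = h y (Rt y u v w + metric_cross (h y) (metric_cross (h y) (P y u) (P y v)) w) w'"
    proof -
      have "metric_cross (h y) (metric_cross (h y) (P y u) (P y v)) w = - metric_cross (h y) w (metric_cross (h y) (P y u) (P y v))"
        by (rule metric_eqI[OF h_metric[OF y]])
          (simp add: metric_cross_works[OF h_metric[OF y]] metric_add[OF h_metric[OF y]] vol3_swap[of "h y" _ w])
      also have "\<dots> = h y (P y u) w *\<^sub>R P y v - h y (P y v) w *\<^sub>R P y u"
        unfolding metric_triple_cross[OF h_metric[OF y]] is_metricD(2)[OF h_metric[OF y], of w] by simp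
      finally show ?thesis unfolding gauss[OF y] by (simp add: metric_add[OF h_metric[OF y]])
    qed
    ultimately show "h y (metric_cross (h y) (\<phi> u v) w) w' = g (0, y) (R (0, y) (0, u) (0, v) (0, w)) (0, w') +
        h y (metric_cross (h y) (2 *\<^sub>R n y u v - metric_cross (h y) (P y u) (P y v) + (t v / 2) *\<^sub>R u - (t u / 2) *\<^sub>R v
           + metric_cross (h y) (\<beta> y u) (\<beta> y v)) w) w'"
      using metric_cross_bilinear[OF h_metric[OF y]]
      by (simp add: metric_add[OF h_metric[OF y]] bilinear_ladd bilinear_lsub)
  qed
  ultimately show ?thesis by simp
qed

end

section \<open>Conformal changes\<close>

lemma twice_diff_divide:
  fixes a b :: "'e::euclidean_space \<Rightarrow> real"
  assumes S: "corner_domain S" and a: "twice_diff S a" and b: "twice_diff S b" and nz: "\<And>z. z \<in> S \<Longrightarrow> a z \<noteq> 0"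
  shows "twice_diff S (\<lambda>z. b z / a z)"
proof -
  note ad = twice_diffD[OF a, THEN differentiable_onD] and bd = twice_diffD[OF b, THEN differentiable_onD]
  have 1: "((\<lambda>z. b z / a z) has_derivative (\<lambda>u. (pd S b z u * a z - b z * pd S a z u) / (a z * a z))) (at z within S)" if z: "z \<in> S" for z
    by (rule has_derivative_divide'[OF pd_has_derivative[OF bd(1)[OF z]] pd_has_derivative[OF ad(1)[OF z]] nz[OF z]])
  have 2: "(\<lambda>z. (pd S b z u * a z - b z * pd S a z u) / (a z * a z)) differentiable (at z within S)" if z: "z \<in> S" for z u
    using nz[OF z] by (intro derivative_intros ad bd z) auto
  have 3: "(\<lambda>z. pd S (\<lambda>z. b z / a z) z u) differentiable (at z within S)" if z: "z \<in> S" for z u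
    by (rule differentiableI[OF has_derivative_transform[OF z _ pd_has_derivative[OF 2[OF z, of u]]]])
       (simp add: pd_eqI[OF S _ 1])
  show ?thesis unfolding twice_diff_def differentiable_on_def using differentiableI[OF 1] 3 by blast
qed

text \<open>With lam = exp(2 \<omega>), the covector \<open>\<tau>\<close> is d\<omega>, T its
  gradient, K the difference of the connections, and Q the Hessian of \<omega> minus the square of
  d\<omega> plus half of |d\<omega>|^2 g, which is minus the change of the Schouten tensor.\<close>

locale conformal_pair = A: chart_metric S g + B: chart_metric S g'
  for S :: "'e::euclidean_space set" and g g' +
  fixes lam
  assumes lam_tw: "twice_diff S lam" and lam_pos: "\<And>z. z \<in> S \<Longrightarrow> 0 < lam z"
    and conf: "\<And>z u v. z \<in> S \<Longrightarrow> g' z u v = lam z * g z u v"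
begin

definition \<tau> where "\<tau> z u = pd S lam z u / (2 * lam z)"

definition T where "T z = sharp (g z) (\<tau> z)"

definition K where "K z u v = \<tau> z u *\<^sub>R v + \<tau> z v *\<^sub>R u - g z u v *\<^sub>R T z"

lemma lam_diff: "z \<in> S \<Longrightarrow> lam differentiable (at z within S)"
  by (rule differentiable_onD[OF twice_diffD(1)[OF lam_tw]])

lemma lam_diff2: "z \<in> S \<Longrightarrow> (\<lambda>z. pd S lam z u) differentiable (at z within S)"
  by (rule differentiable_onD[OF twice_diffD(2)[OF lam_tw]])

lemma \<tau>_linear: "z \<in> S \<Longrightarrow> linear (\<tau> z)"
proof -
  assume z: "z \<in> S"
  have "linear (\<lambda>u. (1 / (2 * lam z)) *\<^sub>R pd S lam z u)" by (intro linear_compose_scale_right linear_pd lam_diff z)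
  then show ?thesis unfolding \<tau>_def[abs_def] by simp
qed

lemma \<tau>_has: "z \<in> S \<Longrightarrow> ((\<lambda>z. \<tau> z v) has_derivative (\<lambda>u. (pd S (\<lambda>z. pd S lam z v) z u * (2 * lam z) - pd S lam z v * (2 * pd S lam z u)) / ((2 * lam z) * (2 * lam z)))) (at z within S)"
  unfolding \<tau>_def using lam_pos[of z]
  by (intro has_derivative_divide'[OF pd_has_derivative[OF lam_diff2] has_derivative_mult_right[OF pd_has_derivative[OF lam_diff]]]) auto

lemma \<tau>_diff: "z \<in> S \<Longrightarrow> (\<lambda>z. \<tau> z v) differentiable (at z within S)"
  by (rule differentiableI[OF \<tau>_has])

lemma d\<tau>_sym: 
  assumes z: "z \<in> S"
  shows "pd S (\<lambda>z. \<tau> z v) z u = pd S (\<lambda>z. \<tau> z u) z v"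
  unfolding pd_eqI[OF A.dom z \<tau>_has[OF z]] pd_symmetric[OF A.dom lam_tw z, of v u] by (simp add: mult.commute)

lemma g_T: "z \<in> S \<Longrightarrow> g z (T z) w = \<tau> z w"
  unfolding T_def by (rule sharp_works[OF A.met \<tau>_linear])

lemma T_diff: "z \<in> S \<Longrightarrow> T differentiable (at z within S)"
  unfolding T_def[abs_def]
  by (rule differentiableI[OF has_derivative_sharp[OF _ A.met A.g_diff \<tau>_linear \<tau>_diff refl]])

lemma dconf: 
  assumes z: "z \<in> S"
  shows "B.dg z u v w = lam z * (2 * \<tau> z w * g z u v + A.dg z u v w)"
proof -
  have "pd S (\<lambda>z. g' z u v) z = pd S (\<lambda>z. lam z * g z u v) z" by (rule pd_cong[OF z conf])
  also have "\<dots> = (\<lambda>w. lam z * A.dg z u v w + pd S lam z w * g z u v)"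
    by (rule pd_eqI[OF A.dom z]) (intro has_derivative_mult pd_has_derivative lam_diff A.g_diff z)
  finally show ?thesis using lam_pos[OF z] by (simp add: \<tau>_def field_simps)
qed

lemma christoffel_conf:
  assumes z: "z \<in> S"
  shows "B.\<Gamma> z u v = A.\<Gamma> z u v + K z u v"
proof (rule metric_eqI[OF A.met[OF z]])
  fix w
  have "lam z * g z (B.\<Gamma> z u v) w = lam z * g z (A.\<Gamma> z u v + K z u v) w"
    unfolding conf[OF z, symmetric] B.g_christoffel[OF z] dconf[OF z]
    unfolding conf[OF z] K_def metric_add[OF A.met[OF z]] A.g_christoffel[OF z] g_T[OF z]
    using is_metricD(2)[OF A.met[OF z]] by (simp add: field_simps)
  then show "g z (B.\<Gamma> z u v) w = g z (A.\<Gamma> z u v + K z u v) w" using lam_pos[OF z] by simp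
qed

definition hess where "hess z u v = pd S (\<lambda>z. \<tau> z v) z u - \<tau> z (A.\<Gamma> z u v)"

lemma hess_sym: "z \<in> S \<Longrightarrow> hess z u v = hess z v u"
  unfolding hess_def by (simp add: d\<tau>_sym[of z u v] A.christoffel_sym[of z u v])

lemma hess_T:
  assumes z: "z \<in> S"
  shows "g z (pd S T z u + A.\<Gamma> z u (T z)) w = hess z u w"
proof -
  note m = metric_add[OF A.met[OF z]]
  have "((\<lambda>z. g z (T z) w) has_derivative (\<lambda>u. pd S (\<lambda>x. g x (T z) w) z u + g z (pd S T z u) w)) (at z within S)"
    by (rule has_derivative_linear_family[OF z bilinear_linear(2)[OF A.g_bilinear] A.g_diff[OF z] pd_has_derivative[OF T_diff[OF z]]])
  from pd_eqI[OF A.dom z this]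
  have "pd S (\<lambda>z. g z (T z) w) z u = A.dg z (T z) w u + g z (pd S T z u) w" by simp
  moreover have "pd S (\<lambda>z. g z (T z) w) z = pd S (\<lambda>z. \<tau> z w) z" by (rule pd_cong[OF z g_T])
  ultimately show ?thesis unfolding hess_def A.christoffel_metric[OF z] by (simp add: m g_T[OF z])
qed

definition Q where "Q z u v = hess z u v - \<tau> z u * \<tau> z v + \<tau> z (T z) / 2 * g z u v"

lemma Q_bilinear:
  assumes z: "z \<in> S"
  shows "bilinear (Q z)"
proof -
  have l1: "linear (\<lambda>u. pd S (\<lambda>z. \<tau> z v) z u)" "linear (\<lambda>v. pd S (\<lambda>z. \<tau> z v) z u)" for u v
    using linear_pd[OF \<tau>_diff[OF z]] linear_pd_family[OF A.dom z \<tau>_linear \<tau>_diff[OF z]] by blast+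
  have l2: "linear (\<lambda>u. \<tau> z (A.\<Gamma> z u v))" "linear (\<lambda>u. \<tau> z (A.\<Gamma> z v u))" for v
    using linear_compose[OF bilinear_linear(2)[OF A.christoffel_bilinear[OF z]] \<tau>_linear[OF z]]
      linear_compose[OF bilinear_linear(1)[OF A.christoffel_bilinear[OF z]] \<tau>_linear[OF z]] by (simp_all add: o_def)
  note lt = linear_add[OF \<tau>_linear[OF z]] linear_cmul[OF \<tau>_linear[OF z]]
  show ?thesis unfolding bilinear_def Q_def hess_def
    by (intro conjI allI linearI)
      (simp_all add: linear_add[OF l1(1)] linear_cmul[OF l1(1)] linear_add[OF l1(2)] linear_cmul[OF l1(2)]
        linear_add[OF l2(1)] linear_cmul[OF l2(1)] linear_add[OF l2(2)] linear_cmul[OF l2(2)] lt metric_add[OF A.met[OF z]] algebra_simps)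
qed

lemma Q_sym: "z \<in> S \<Longrightarrow> Q z u v = Q z v u"
  unfolding Q_def using hess_sym[of z u v] is_metricD(2)[OF A.met, of z u v] by simp

lemma sharp_Q: 
  assumes z: "z \<in> S"
  shows "sharp (g z) (Q z u) = pd S T z u + A.\<Gamma> z u (T z) - \<tau> z u *\<^sub>R T z + (\<tau> z (T z) / 2) *\<^sub>R u"
proof (rule sharp_eqI[OF A.met[OF z]])
  fix w
  show "g z (pd S T z u + A.\<Gamma> z u (T z) - \<tau> z u *\<^sub>R T z + (\<tau> z (T z) / 2) *\<^sub>R u) w = Q z u w"
  proof -
    define Y where "Y = pd S T z u + A.\<Gamma> z u (T z)"
    have "g z Y w = hess z u w" unfolding Y_def by (rule hess_T[OF z])
    then show ?thesis unfolding Y_def[symmetric]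
      by (simp add: Q_def metric_add[OF A.met[OF z]] g_T[OF z])
  qed
qed

lemma K_has:
  assumes z: "z \<in> S"
  shows "((\<lambda>z. K z v w) has_derivative (\<lambda>u. pd S (\<lambda>z. \<tau> z v) z u *\<^sub>R w + pd S (\<lambda>z. \<tau> z w) z u *\<^sub>R v
     - (g z v w *\<^sub>R pd S T z u + A.dg z v w u *\<^sub>R T z))) (at z within S)"
  unfolding K_def
  by (intro has_derivative_add has_derivative_diff has_derivative_scaleR has_derivative_scaleR_left pd_has_derivative \<tau>_diff A.g_diff T_diff z)

text \<open>Derivatives of \<open>\<tau>\<close> and T are Hessians plus Christoffel terms, and
  derivatives of g are Christoffel terms. The Christoffel terms cancel; the Hessians and the
  quadratic terms in \<open>\<tau>\<close> group into Q.\<close>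

lemma riemann_conf:
  assumes z: "z \<in> S"
  shows "riemann S g' z u v w = riemann S g z u v w + (Q z u w *\<^sub>R v - Q z v w *\<^sub>R u + g z u w *\<^sub>R sharp (g z) (Q z v) - g z v w *\<^sub>R sharp (g z) (Q z u))"
proof -
  note m = metric_add[OF A.met[OF z]] and sym = is_metricD(2)[OF A.met[OF z]]
  note lt = linear_add[OF \<tau>_linear[OF z]] linear_diff[OF \<tau>_linear[OF z]] linear_cmul[OF \<tau>_linear[OF z]]
  note b = A.christoffel_bilinear[OF z]
  have 1: "pd S (\<lambda>z. B.\<Gamma> z v w) z u = pd S (\<lambda>z. A.\<Gamma> z v w) z u + (pd S (\<lambda>z. \<tau> z v) z u *\<^sub>R w + pd S (\<lambda>z. \<tau> z w) z u *\<^sub>R v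
     - (g z v w *\<^sub>R pd S T z u + A.dg z v w u *\<^sub>R T z))" for u v w
  proof -
    have "pd S (\<lambda>z. B.\<Gamma> z v w) z = pd S (\<lambda>z. A.\<Gamma> z v w + K z v w) z" by (rule pd_cong[OF z christoffel_conf])
    also have "\<dots> = (\<lambda>u. pd S (\<lambda>z. A.\<Gamma> z v w) z u + (pd S (\<lambda>z. \<tau> z v) z u *\<^sub>R w + pd S (\<lambda>z. \<tau> z w) z u *\<^sub>R v
     - (g z v w *\<^sub>R pd S T z u + A.dg z v w u *\<^sub>R T z)))"
      by (rule pd_eqI[OF A.dom z has_derivative_add[OF pd_has_derivative[OF A.christoffel_diff[OF z]] K_has[OF z]]])
    finally show ?thesis by simp
  qed
  have d\<tau>: "pd S (\<lambda>z. \<tau> z v) z u = hess z u v + \<tau> z (A.\<Gamma> z u v)" for u v by (simp add: hess_def)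
  have gT': "g z w (T z) = \<tau> z w" for w using g_T[OF z] sym by metis
  show ?thesis
  proof (rule metric_eqI[OF A.met[OF z]])
    fix x
    have hT: "g z (pd S T z u) x = hess z u x - g z (A.\<Gamma> z u (T z)) x" for u
      using hess_T[OF z, of u x] by (simp add: m)
    have s: "A.\<Gamma> z v u = A.\<Gamma> z u v" "hess z v u = hess z u v" "g z v u = g z u v"
      by (rule A.christoffel_sym[OF z] hess_sym[OF z] sym)+
    have c: "A.\<Gamma> z a (K z p q) = \<tau> z p *\<^sub>R A.\<Gamma> z a q + \<tau> z q *\<^sub>R A.\<Gamma> z a p - g z p q *\<^sub>R A.\<Gamma> z a (T z)" for a p q
      unfolding K_def bilinear_radd[OF b] bilinear_rsub[OF b] bilinear_rmul[OF b] ..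
    have mm: "A.dg z v w u = g z (A.\<Gamma> z u v) w + g z v (A.\<Gamma> z u w)" "A.dg z u w v = g z (A.\<Gamma> z v u) w + g z u (A.\<Gamma> z v w)"
      by (rule A.christoffel_metric[OF z])+
    show "g z (riemann S g' z u v w) x = g z (riemann S g z u v w + (Q z u w *\<^sub>R v - Q z v w *\<^sub>R u + g z u w *\<^sub>R sharp (g z) (Q z v) - g z v w *\<^sub>R sharp (g z) (Q z u))) x"
      unfolding riemann_def 1 sharp_Q[OF z] christoffel_conf[OF z] bilinear_radd[OF b] c mm d\<tau> s
      unfolding K_def Q_def
      by (simp add: m lt g_T[OF z] gT' hT s algebra_simps)
  qed
qed

theorem weyl_conf:
  assumes z: "z \<in> S" and dim: "2 < DIM('e)"
  shows "weyl_alg (g' z) (riemann S g' z) = weyl_alg (g z) (riemann S g z)"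
proof -
  have "g' z = (\<lambda>u v. lam z * g z u v)" by (intro ext conf[OF z])
  then show ?thesis
    using weyl_alg_conformal[OF dim A.met[OF z] lam_pos[OF z] A.riemann_linear(2,3)[OF z] Q_bilinear[OF z] Q_sym[OF z] riemann_conf[OF z]]
    by simp
qed

end

section \<open>The obstruction in boundary charts\<close>

lemma christoffel_openin: "openin (top_of_set C) S \<Longrightarrow> y \<in> S \<Longrightarrow> christoffel C g y = christoffel S g y"
  unfolding fun_eq_iff christoffel_def by (simp add: pd_openin)

lemma riemann_openin:
  assumes "openin (top_of_set C) S" "y \<in> S"
  shows "riemann C g y = riemann S g y"
proof -
  have "pd C (\<lambda>z. christoffel C g z v w) y = pd S (\<lambda>z. christoffel S g z v w) y" for v w
    unfolding pd_openin[OF assms, symmetric] by (rule pd_cong[OF assms(2)]) (simp add: christoffel_openin[OF assms(1)])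
  then show ?thesis unfolding fun_eq_iff riemann_def christoffel_openin[OF assms] by simp
qed

locale boundary_chart =
  fixes A :: "'a::t2_space chart set" and c
  assumes atlas: "oriented_atlas A" and cA: "c \<in> A"
begin

lemma cimg_openin: "openin (top_of_set halfspace) (cimg c)"
  and chart_homeo: "homeomorphism (cdom c) (cimg c) (cmap c) (cinv c)"
  and cdom_open: "open (cdom c)"
  using atlas cA unfolding oriented_atlas_def is_chart_def by auto

lemma cimg_dom: "corner_domain (cimg c)"
  by (rule corner_domain_halfspace[OF cimg_openin])

lemma cmap_cinv: "z \<in> cimg c \<Longrightarrow> cmap c (cinv c z) = z"
  and cinv_in: "z \<in> cimg c \<Longrightarrow> cinv c z \<in> cdom c"
  using chart_homeo unfolding homeomorphism_def by auto

lemma bimgD: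
  assumes "y \<in> bimg c W"
  shows "(0, y) \<in> cimg c" "bpt c y \<in> W" "bpt c y \<in> cdom c" "cmap c (bpt c y) = (0, y)" "y \<in> bimg c (bdry A)"
proof -
  show 1: "(0, y) \<in> cimg c" "bpt c y \<in> W" using assms by (auto simp: bimg_def)
  then show 2: "bpt c y \<in> cdom c" "cmap c (bpt c y) = (0, y)" by (simp_all add: bpt_def cmap_cinv cinv_in)
  then have "bpt c y \<in> bdry A" using cA by (auto simp: bdry_def)
  then show "y \<in> bimg c (bdry A)" using 1 by (simp add: bimg_def)
qed

text \<open>Points of the chart with first coordinate 0 lie in the boundary by definition, so
  \<open>bimg c W\<close> is the preimage under \<open>y \<mapsto> (0, y)\<close> of an open set
  that cuts out the chart image of T.\<close>

lemma bimg_open: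
  assumes "openin (top_of_set (bdry A)) W"
  shows "open (bimg c W)"
proof -
  obtain T where T: "open T" "W = bdry A \<inter> T" using assms by (auto simp: openin_open)
  have "openin (top_of_set (cimg c)) (cimg c \<inter> cinv c -` T)"
    using chart_homeo T(1) by (intro continuous_openin_preimage_gen) (auto simp: homeomorphism_def)
  then have "openin (top_of_set halfspace) (cimg c \<inter> cinv c -` T)"
    using cimg_openin openin_trans by blast
  then obtain U where U: "open U" "cimg c \<inter> cinv c -` T = halfspace \<inter> U" by (auto simp: openin_open)
  have "bimg c W = Pair 0 -` U"
  proof (intro equalityI subsetI)
    fix y assume "y \<in> bimg c W"
    then have "(0, y) \<in> cimg c \<inter> cinv c -` T" using T(2) by (auto simp: bimg_def bpt_def)
    then show "y \<in> Pair 0 -` U" unfolding U(2) by simp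
  next
    fix y assume "y \<in> Pair 0 -` U"
    then have "(0, y) \<in> cimg c \<inter> cinv c -` T" unfolding U(2) by (simp add: halfspace_def)
    then have "y \<in> bimg c T" "(0, y) \<in> cimg c" by (auto simp: bimg_def bpt_def)
    then show "y \<in> bimg c W" using bimgD(5)[of y T] T(2) by (auto simp: bimg_def)
  qed
  moreover have "open (Pair (0::real) -` U)" by (intro open_vimage U(1) continuous_intros)
  ultimately show ?thesis by simp
qed

lemma cont_bpt: "continuous_on (bimg c W) (bpt c)"
proof -
  have "continuous_on (cimg c) (cinv c)" using chart_homeo by (simp add: homeomorphism_def)
  moreover have "continuous_on (bimg c W) (\<lambda>y. (0::real, y))" by (intro continuous_intros)
  moreover have "(\<lambda>y. (0, y)) ` bimg c W \<subseteq> cimg c" using bimgD(1) by auto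
  ultimately have "continuous_on (bimg c W) (cinv c \<circ> (\<lambda>y. (0, y)))"
    by (meson continuous_on_compose continuous_on_subset)
  then show ?thesis by (simp add: bpt_def[abs_def] o_def)
qed

lemma chart_metric_metric_field: "metric_field A UNIV gb \<Longrightarrow> chart_metric (cimg c) (gb c)"
proof
  assume m: "metric_field A UNIV gb"
  show "corner_domain (cimg c)" by (rule cimg_dom)
  show "is_metric (gb c z)" if "z \<in> cimg c" for z
  proof -
    have "\<forall>p\<in>cdom c. is_metric (gb c (cmap c p))"
      using m[unfolded metric_field_def, THEN conjunct2, THEN conjunct1] cA by blast
    then show ?thesis using cinv_in[OF that] cmap_cinv[OF that] by metis
  qed
  show "twice_diff (cimg c) (\<lambda>z. gb c z u v)" for u v
  proof (rule smooth_on_twice)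
    have "smooth_on (cmap c ` (cdom c \<inter> UNIV)) (\<lambda>z. gb c z u v)"
      using m[unfolded metric_field_def, THEN conjunct1] cA by blast
    then show "smooth_on (cimg c) (\<lambda>z. gb c z u v)" by (simp only: cimg_def Int_UNIV_right)
  qed
qed

section \<open>Local collars in a chart of the manifold\<close>

text \<open>The flow may leave the chart, but at time 0 it is the identity. By continuity of the
  collar map the set \<open>\<Omega>\<close> on which it stays in the chart is relatively open, so
  it contains an interval times a neighbourhood of \<open>y0\<close>.\<close>

lemma collar_exists:
  assumes geo: "geodesic_bdf A g h0 x gb" and col: "geodesic_collar A gb x \<epsilon> \<Phi>"
    and W: "open W" "W \<subseteq> bimg c (bdry A)" and y0: "y0 \<in> W"
  shows "\<exists>V \<delta>. y0 \<in> V \<and> V \<subseteq> W \<and> collar (cimg c) (gb c) \<delta> V (\<lambda>(s, y). cmap c (\<Phi> s (bpt c y))) (in_chart c x) \<and>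
    (\<forall>z\<in>{0..<\<delta>} \<times> V. pd ({0..<\<delta>} \<times> V) (\<lambda>(s, y). cmap c (\<Phi> s (bpt c y))) z (1, 0) = grad gb x c (case z of (s, y) \<Rightarrow> cmap c (\<Phi> s (bpt c y))))"
proof -
  define F where "F = (\<lambda>(s, y). cmap c (\<Phi> s (bpt c y)))"
  define B where "B = bimg c (bdry A)"
  define \<Omega> where "\<Omega> = {(s, y). 0 \<le> s \<and> s < \<epsilon> \<and> y \<in> B \<and> \<Phi> s (bpt c y) \<in> cdom c}"
  note col' = col[unfolded geodesic_collar_def]
  have \<epsilon>: "\<epsilon> > 0" by (rule col'[THEN conjunct1])
  have \<Phi>0: "\<Phi> 0 p = p" if "p \<in> bdry A" for p
    by (rule col'[THEN conjunct2, THEN conjunct1, rule_format, OF that])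
  have flow: "((\<lambda>r. cmap c (\<Phi> r p)) has_vector_derivative grad gb x c (cmap c (\<Phi> s p))) (at s within {0..<\<epsilon>})"
    if "p \<in> bdry A" "s \<in> {0..<\<epsilon>}" "\<Phi> s p \<in> cdom c" for p s
    by (rule col'[THEN conjunct2, THEN conjunct2, THEN conjunct1, rule_format, OF that(1,2) cA that(3)])
  have sm: "smooth_on \<Omega> F"
    unfolding \<Omega>_def F_def B_def
    by (rule col'[THEN conjunct2, THEN conjunct2, THEN conjunct2, THEN conjunct2, rule_format, OF cA cA])
  obtain U \<Psi> where U: "\<forall>p\<in>U. eikonal_at A gb x p" and homeo: "homeomorphism ({0..<\<epsilon>} \<times> bdry A) U (\<lambda>(s, p). \<Phi> s p) \<Psi>"
    using col'[THEN conjunct2, THEN conjunct2, THEN conjunct2, THEN conjunct1] by blast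
  have bd: "bdf A x" and comp: "compactification A g x gb" using geo by (auto simp: geodesic_bdf_def)
  have mf: "metric_field A UNIV gb" using comp by (simp add: compactification_def)
  interpret M: chart_metric "cimg c" "gb c" by (rule chart_metric_metric_field[OF mf])
  have bB: "bpt c y \<in> bdry A" "bpt c y \<in> cdom c" "cmap c (bpt c y) = (0, y)" if "y \<in> B" for y
    using bimgD[of y "bdry A"] that by (auto simp: B_def)
  have \<Omega>_open: "openin (top_of_set ({0..<\<epsilon>} \<times> B)) \<Omega>"
  proof -
    have c1: "continuous_on ({0..<\<epsilon>} \<times> bdry A) (\<lambda>(s, p). \<Phi> s p)" using homeo by (simp add: homeomorphism_def)
    have c2: "continuous_on ({0..<\<epsilon>} \<times> B) (\<lambda>z. bpt c (snd z))"
      unfolding B_def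
      by (rule continuous_on_compose2[OF cont_bpt continuous_on_snd[OF continuous_on_id]]) auto
    have c3: "continuous_on ({0..<\<epsilon>} \<times> B) (\<lambda>z. (fst z, bpt c (snd z)))"
      by (rule continuous_on_Pair[OF continuous_on_fst[OF continuous_on_id] c2])
    have "(\<lambda>z. (fst z, bpt c (snd z))) ` ({0..<\<epsilon>} \<times> B) \<subseteq> {0..<\<epsilon>} \<times> bdry A"
      using bB(1) by auto
    from continuous_on_compose2[OF c1 c3 this]
    have "continuous_on ({0..<\<epsilon>} \<times> B) (\<lambda>z. (\<lambda>(s, p). \<Phi> s p) (fst z, bpt c (snd z)))" .
    from continuous_openin_preimage_gen[OF this cdom_open]
    have "openin (top_of_set ({0..<\<epsilon>} \<times> B)) (({0..<\<epsilon>} \<times> B) \<inter> (\<lambda>z. (\<lambda>(s, p). \<Phi> s p) (fst z, bpt c (snd z))) -` cdom c)" .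
    moreover have "({0..<\<epsilon>} \<times> B) \<inter> (\<lambda>z. (\<lambda>(s, p). \<Phi> s p) (fst z, bpt c (snd z))) -` cdom c = \<Omega>"
      by (auto simp: \<Omega>_def)
    ultimately show ?thesis by simp
  qed
  then obtain T where T: "open T" "\<Omega> = ({0..<\<epsilon>} \<times> B) \<inter> T" by (auto simp: openin_open)
  have y0B: "y0 \<in> B" using y0 W by (auto simp: B_def)
  have "(0, y0) \<in> \<Omega>" using \<epsilon> y0B bB[OF y0B] \<Phi>0 by (simp add: \<Omega>_def)
  then have y0T: "(0, y0) \<in> T" using T(2) by simp
  obtain T1 T2 where T12': "open T1" "open T2" "(0, y0) \<in> T1 \<times> T2" "T1 \<times> T2 \<subseteq> T"
    by (rule open_prod_elim[OF T(1) y0T])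
  then have T12: "open T1" "open T2" "0 \<in> T1" "y0 \<in> T2" "T1 \<times> T2 \<subseteq> T" by auto
  obtain d where d: "d > 0" "ball 0 d \<subseteq> T1" using openE[OF T12(1,3)] .
  define \<delta> where "\<delta> = min d \<epsilon>"
  define V where "V = T2 \<inter> W"
  define D where "D = {0..<\<delta>} \<times> V"
  have \<delta>: "\<delta> > 0" "\<delta> \<le> \<epsilon>" using d \<epsilon> by (auto simp: \<delta>_def)
  have V: "open V" "V \<subseteq> W" "y0 \<in> V" using T12 W y0 by (auto simp: V_def)
  have VB: "V \<subseteq> B" using V W by (auto simp: B_def)
  have sub: "{0..<\<delta>} \<subseteq> {0..<\<epsilon>}" using \<delta> by auto
  have D\<Omega>: "D \<subseteq> \<Omega>"
  proof
    fix z assume z: "z \<in> D"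
    then obtain s y where sy: "z = (s, y)" "0 \<le> s" "s < \<delta>" "y \<in> V" by (auto simp: D_def)
    have "s \<in> ball 0 d" using sy by (simp add: \<delta>_def)
    then have "s \<in> T1" using d by blast
    moreover have "y \<in> T2" using sy by (simp add: V_def)
    ultimately have "z \<in> T" using T12(5) sy(1) by blast
    then show "z \<in> \<Omega>" unfolding T(2) using sy \<delta> VB by auto
  qed
  have DO: "openin (top_of_set \<Omega>) D"
  proof -
    have "D = \<Omega> \<inter> ({..<\<delta>} \<times> V)" using D\<Omega> by (auto simp: D_def \<Omega>_def)
    then show ?thesis unfolding openin_open using V(1) by (intro exI[of _ "{..<\<delta>} \<times> V"]) (auto intro: open_Times)
  qed
  have dD: "corner_domain D" unfolding D_def by (rule corner_domain_halfspace[OF openin_collar[OF V(1)]])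
  have F_tw: "twice_diff D F" by (rule twice_diff_subset[OF DO smooth_on_twice[OF sm]])
  have F_tw2: "twice_diff D (\<lambda>z. pd D F z a)" for a
  proof -
    have "twice_diff D (\<lambda>z. pd \<Omega> F z a)" by (rule twice_diff_subset[OF DO smooth_on_twice[OF smooth_on_pd[OF sm]]])
    moreover have "pd D F z a = pd \<Omega> F z a" if "z \<in> D" for z by (simp only: pd_openin[OF DO that])
    ultimately show ?thesis using twice_diff_cong[of D "\<lambda>z. pd D F z a" "\<lambda>z. pd \<Omega> F z a"] by blast
  qed
  have F_dom: "\<Phi> (fst z) (bpt c (snd z)) \<in> cdom c" if "z \<in> D" for z using D\<Omega> that by (auto simp: \<Omega>_def)
  have F_cimg: "F z \<in> cimg c" if "z \<in> D" for z
    using F_dom[OF that] by (cases z) (auto simp: F_def cimg_def)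
  have Fd: "F differentiable (at z within D)" if "z \<in> D" for z
    by (rule differentiable_onD[OF twice_diffD(1)[OF F_tw] that])
  \<comment> \<open>The same curve has one one-sided derivative from F and one from the flow
    equation; uniqueness identifies them.\<close>
  have N: "pd D F z (1, 0) = grad gb x c (F z)" if z: "z \<in> D" for z
  proof -
    obtain s y where sy: "z = (s, y)" "s \<in> {0..<\<delta>}" "y \<in> V" using z by (auto simp: D_def)
    have yB: "y \<in> B" using sy VB by auto
    have "((\<lambda>r. (r, y)) has_derivative (\<lambda>r. (r, 0))) (at s within {0..<\<delta>})"
      by (intro has_derivative_Pair has_derivative_const has_derivative_ident)
    from has_derivative_pd_compose[OF this, of F D] Fd[OF z] sy
    have 1: "((\<lambda>r. F (r, y)) has_derivative (\<lambda>r. pd D F (s, y) (r, 0))) (at s within {0..<\<delta>})"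
      by (simp add: D_def)
    have "((\<lambda>r. cmap c (\<Phi> r (bpt c y))) has_vector_derivative grad gb x c (cmap c (\<Phi> s (bpt c y)))) (at s within {0..<\<epsilon>})"
      by (rule flow[OF bB(1)[OF yB]]) (use sy sub F_dom[OF z] in auto)
    then have "((\<lambda>r. F (r, y)) has_derivative (\<lambda>r. r *\<^sub>R grad gb x c (F (s, y)))) (at s within {0..<\<epsilon>})"
      by (simp add: has_vector_derivative_def F_def)
    then have 2: "((\<lambda>r. F (r, y)) has_derivative (\<lambda>r. r *\<^sub>R grad gb x c (F (s, y)))) (at s within {0..<\<delta>})"
      by (rule has_derivative_subset[OF _ sub])
    have "(\<lambda>r. pd D F (s, y) (r, 0)) = (\<lambda>r. r *\<^sub>R grad gb x c (F (s, y)))"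
      by (rule corner_domain_unique[OF corner_domain_interval sy(2) 1 2])
    from fun_cong[OF this, of 1] show ?thesis using sy(1) by simp
  qed
  have xs: "in_chart c x differentiable_on cimg c"
    using bd cA smooth_on_twice twice_diffD(1) unfolding bdf_def by blast
  have "collar (cimg c) (gb c) \<delta> V F (in_chart c x)"
  proof (intro collar.intro chart_map.intro chart_map_axioms.intro collar_axioms.intro)
    show "chart_metric (cimg c) (gb c)" by (rule M.chart_metric_axioms)
    show "corner_domain ({0..<\<delta>} \<times> V)" "twice_diff ({0..<\<delta>} \<times> V) F" using dD F_tw by (simp_all add: D_def)
    show "F z \<in> cimg c" if "z \<in> {0..<\<delta>} \<times> V" for z using F_cimg that by (simp add: D_def)
    show "0 < \<delta>" "open V" by fact+
    show "cimg c \<subseteq> halfspace" using cimg_openin openin_imp_subset by blast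
    show "twice_diff ({0..<\<delta>} \<times> V) (\<lambda>z. pd ({0..<\<delta>} \<times> V) F z a)" for a using F_tw2 by (simp add: D_def)
    show "F (0, y) = (0, y)" if "y \<in> V" for y
      using bB[of y] \<Phi>0 that VB by (auto simp: F_def)
    show "in_chart c x differentiable_on cimg c" by (rule xs)
    show "in_chart c x (0, y) = 0" if "y \<in> V" for y
    proof -
      have "bpt c y \<in> bdry A" using bB(1) that VB by blast
      then show ?thesis using bd unfolding bdf_def in_chart_def bpt_def by blast
    qed
  next
    fix z w assume z: "z \<in> {0..<\<delta>} \<times> V"
    then have zD: "z \<in> D" by (simp add: D_def)
    note Fz = F_cimg[OF zD]
    have gr: "gb c (F z) (grad gb x c (F z)) w = pd (cimg c) (in_chart c x) (F z) w" for w
      unfolding grad_def pd_openin[OF cimg_openin Fz, symmetric]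
      by (rule sharp_works[OF M.met[OF Fz] linear_pd[OF differentiable_onD[OF xs Fz]]])
    then show "gb c (F z) (pd ({0..<\<delta>} \<times> V) F z (1, 0)) w = pd (cimg c) (in_chart c x) (F z) w"
      using N[OF zD] by (simp add: D_def)
    \<comment> \<open>The point is in the image of the collar homeomorphism, and there the eikonal
      equation holds.\<close>
    have "(\<lambda>(s, p). \<Phi> s p) (fst z, bpt c (snd z)) \<in> U"
      using homeo z sub VB bB(1) unfolding homeomorphism_def by (intro subsetD[of "(\<lambda>(s, p). \<Phi> s p) ` ({0..<\<epsilon>} \<times> bdry A)" U] imageI) auto
    then have "eikonal_at A gb x (\<Phi> (fst z) (bpt c (snd z)))" using U by simp
    then have "gb c (F z) (grad gb x c (F z)) (grad gb x c (F z)) = 1"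
      using F_dom[OF zD] cA unfolding eikonal_at_def F_def by (cases z) auto
    then show "gb c (F z) (pd ({0..<\<delta>} \<times> V) F z (1, 0)) (pd ({0..<\<delta>} \<times> V) F z (1, 0)) = 1"
      using N[OF zD] by (simp add: D_def)
  qed
  moreover have "pd ({0..<\<delta>} \<times> V) F z (1, 0) = grad gb x c (F z)" if "z \<in> {0..<\<delta>} \<times> V" for z
    using N that by (simp add: D_def)
  ultimately show ?thesis using V(2,3) unfolding F_def by blast
qed

text \<open>The last two statements identify the gradient of x as the unit normal of the boundary,
  for the comparison of two representatives.\<close>

lemma obstruction_eq_weyl:
  assumes data: "obstruction_data A g h0 x gb \<epsilon> \<Phi> I V t cl \<alpha>" and i: "i \<in> I" and y: "y \<in> bimg c (V i)"
  shows "(0, obstruction_tensor (h0 c y) (collar_metric gb \<Phi> c y) (soldering cl i c) (\<alpha> i c) y v)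
           = 2 *\<^sub>R (weyl_magnetic gb x c (0, y) (0, v) - weyl_electric gb x c (0, y) (0, v))"
    "gb c (0, y) (grad gb x c (0, y)) (grad gb x c (0, y)) = 1"
    "gb c (0, y) (grad gb x c (0, y)) (0, v) = 0"
proof -
  note data' = data[unfolded obstruction_data_def]
  have geo: "geodesic_bdf A g h0 x gb" by (rule data'[THEN conjunct2, THEN conjunct1])
  have col: "geodesic_collar A gb x \<epsilon> \<Phi>" by (rule data'[THEN conjunct2, THEN conjunct2, THEN conjunct1])
  have spin: "spin_structure A h0 I V t cl"
    by (rule data'[THEN conjunct2, THEN conjunct2, THEN conjunct2, THEN conjunct1])
  have conn: "SU2_connection A I V t \<alpha>"
    by (rule data'[THEN conjunct2, THEN conjunct2, THEN conjunct2, THEN conjunct2, THEN conjunct1])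
  note eqn = data'[THEN conjunct2, THEN conjunct2, THEN conjunct2, THEN conjunct2, THEN conjunct2, rule_format, OF i cA]
  note spin' = spin[unfolded spin_structure_def]
  have Vi: "openin (top_of_set (bdry A)) (V i)"
    using spin'[THEN conjunct1, unfolded SU2_bundle_def, THEN conjunct1] i by (rule bspec)
  note lie = spin'[THEN conjunct2, THEN conjunct2, THEN conjunct2, rule_format, OF i cA]
  have WB: "bimg c (V i) \<subseteq> bimg c (bdry A)" using bimgD(5) by blast
  obtain B \<delta> where B: "y \<in> B" "B \<subseteq> bimg c (V i)" and
    collar: "collar (cimg c) (gb c) \<delta> B (\<lambda>(s, y). cmap c (\<Phi> s (bpt c y))) (in_chart c x)" and
    gr: "\<And>z. z \<in> {0..<\<delta>} \<times> B \<Longrightarrow> pd ({0..<\<delta>} \<times> B) (\<lambda>(s, y). cmap c (\<Phi> s (bpt c y))) z (1, 0) = grad gb x c (case z of (s, y) \<Rightarrow> cmap c (\<Phi> s (bpt c y)))"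
    using collar_exists[OF geo col bimg_open[OF Vi] WB y] by (elim exE conjE) blast
  interpret C: collar "cimg c" "gb c" \<delta> B "\<lambda>(s, y). cmap c (\<Phi> s (bpt c y))" "in_chart c x" by (rule collar)
  have rest: "restricts_to A gb h0" using geo by (simp add: geodesic_bdf_def)
  have h: "C.h y = h0 c y" if "y \<in> B" for y
  proof (intro ext)
    have "y \<in> bimg c (bdry A)" using that B WB by blast
    then show "C.h y u v = h0 c y u v" for u v using rest cA unfolding restricts_to_def C.h_def by simp
  qed
  have N0: "C.N0 y = grad gb x c (0, y)" if "y \<in> B" for y
    unfolding C.N0_def gr[OF C.zD[OF that]] using C.F0[OF that] by simp
  show "gb c (0, y) (grad gb x c (0, y)) (grad gb x c (0, y)) = 1"
    "gb c (0, y) (grad gb x c (0, y)) (0, v) = 0"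
    using C.N0N0[OF B(1)] C.N0u[OF B(1)] unfolding N0[OF B(1)] by simp_all
  have Bo: "openin (top_of_set (bimg c (V i))) B"
    by (rule open_subset[OF B(2) C.V])
  have forms: "smooth_on (bimg c (V i)) (\<lambda>y. \<gamma> i c y u)" "y \<in> bimg c (V i) \<Longrightarrow> linear (\<gamma> i c y)" "y \<in> bimg c (V i) \<Longrightarrow> \<gamma> i c y u \<in> su2"
    if "local_su_forms A I V \<gamma>" for \<gamma> y u
  proof -
    note f = that[unfolded local_su_forms_def]
    show "smooth_on (bimg c (V i)) (\<lambda>y. \<gamma> i c y u)" by (rule f[THEN conjunct1, rule_format, OF i cA])
    assume "y \<in> bimg c (V i)"
    note g = f[THEN conjunct2, THEN conjunct1, rule_format, OF i cA this]
    show "linear (\<gamma> i c y)" by (rule g[THEN conjunct1])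
    show "\<gamma> i c y u \<in> su2" using g[THEN conjunct2] by blast
  qed
  have clf: "local_su_forms A I V cl" by (rule spin'[THEN conjunct2, THEN conjunct1])
  have alf: "local_su_forms A I V \<alpha>" by (rule conn[unfolded SU2_connection_def, THEN conjunct1])
  \<comment> \<open>On the open set B the unrestricted derivative in \<open>collar_metric\<close> is
    that of a slice of F, so it agrees with H for all s below \<open>\<delta>\<close>.\<close>
  have hsH: "collar_metric gb \<Phi> c y s = C.H (s, y)" if y: "y \<in> B" and s: "s \<in> {0..<\<delta>}" for y s
  proof (intro ext)
    fix u v
    have z: "(s, y) \<in> {0..<\<delta>} \<times> B" using y s by simp
    have "pd UNIV (\<lambda>z. cmap c (\<Phi> s (bpt c z))) y u = C.E u (s, y)" for u
      unfolding pd_open[OF C.V y]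
      using pd_eqI[OF C.domV y C.slice_y[OF y s differentiableI[OF C.F_has[OF z]]]] by simp
    then show "collar_metric gb \<Phi> c y s u v = C.H (s, y) u v"
      unfolding collar_metric_def C.H_def by simp
  qed
  have sold: "soldering cl i c y = (\<lambda>u. (1/2) *\<^sub>R cl i c y u)" for y by (simp add: soldering_def fun_eq_iff)
  have "(0, obstruction_tensor (C.h y) (collar_metric gb \<Phi> c y) (soldering cl i c) (\<alpha> i c) y v) =
    2 *\<^sub>R (dual_alg (gb c (0, y)) (weyl_alg (gb c (0, y)) (C.R (0, y))) (0, v) (C.N0 y) (C.N0 y) - weyl_alg (gb c (0, y)) (C.R (0, y)) (0, v) (C.N0 y) (C.N0 y))"
  proof (rule C.obstruction_formula[OF _ _ _ _ _ _ _ _ _ B(1)])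
    fix y assume "y \<in> B"
    then have yW: "y \<in> bimg c (V i)" using B by blast
    show "linear (soldering cl i c y)" unfolding sold by (intro linear_compose_scale_right forms(2)[OF clf yW])
    show "bij_betw (soldering cl i c y) UNIV su2" by (rule lie[OF yW, THEN conjunct1])
    show "lie_bracket (soldering cl i c y u) (soldering cl i c y v) = soldering cl i c y (metric_cross (C.h y) u v)" for u v
      unfolding h[OF \<open>y \<in> B\<close>] using lie[OF yW, THEN conjunct2] by blast
    show "linear (\<alpha> i c y)" by (rule forms(2)[OF alf yW])
    show "\<alpha> i c y u \<in> su2" for u by (rule forms(3)[OF alf yW])
    show "\<exists>\<epsilon>>0. \<forall>s\<in>{0..<\<epsilon>}. collar_metric gb \<Phi> c y s = C.H (s, y)"
      using hsH[OF \<open>y \<in> B\<close>] C.\<delta> by blast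
    show "cov_ext_deriv (\<alpha> i c) (soldering cl i c) y u v = hodge1_coeff 1 (collar_metric gb \<Phi> c y) (soldering cl i c y) u v" for u v
      by (rule eqn[OF yW])
  next
    show "(\<lambda>y. \<alpha> i c y u) differentiable_on B" for u
      by (rule differentiable_on_subset[OF twice_diffD(1)[OF smooth_on_twice[OF forms(1)[OF alf]]] B(2)])
    show "twice_diff B (\<lambda>y. soldering cl i c y u)" for u
    proof -
      have tw: "twice_diff B (\<lambda>y. cl i c y u)" by (rule twice_diff_subset[OF Bo smooth_on_twice[OF forms(1)[OF clf]]])
      have d: "((\<lambda>y. soldering cl i c y u) has_derivative (\<lambda>a. (1/2) *\<^sub>R pd B (\<lambda>y. cl i c y u) y a)) (at y within B)" if "y \<in> B" for y
        unfolding soldering_def by (intro has_derivative_scaleR_right pd_has_derivative differentiable_onD[OF twice_diffD(1)[OF tw] that])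
      have d2: "(\<lambda>y. (1/2) *\<^sub>R pd B (\<lambda>y. cl i c y u) y a) differentiable (at y within B)" if "y \<in> B" for y a
        by (rule differentiableI[OF has_derivative_scaleR_right[OF pd_has_derivative[OF differentiable_onD[OF twice_diffD(2)[OF tw] that]]]])
      have d3: "(\<lambda>y. pd B (\<lambda>y. soldering cl i c y u) y a) differentiable (at y within B)" if "y \<in> B" for y a
        by (rule differentiableI[OF has_derivative_transform[OF that _ pd_has_derivative[OF d2[OF that, of a]]]])
          (simp add: pd_eqI[OF C.domV _ d])
      show ?thesis unfolding twice_diff_def differentiable_on_def using differentiableI[OF d] d3 by blast
    qed
  qed
  then show "(0, obstruction_tensor (h0 c y) (collar_metric gb \<Phi> c y) (soldering cl i c) (\<alpha> i c) y v)
           = 2 *\<^sub>R (weyl_magnetic gb x c (0, y) (0, v) - weyl_electric gb x c (0, y) (0, v))"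
    unfolding h[OF B(1)] N0[OF B(1)] weyl_magnetic_def weyl_electric_def dual_weyl_eq weyl_eq_weyl_alg
      riemann_openin[OF cimg_openin C.y_S[OF B(1)]] .
qed

end

lemma weyl_alg_scale:
  assumes g: "is_metric g" and R: "\<And>u w. linear (\<lambda>v. R u v w)" "\<And>u v. linear (\<lambda>w. R u v w)"
  shows "weyl_alg g R u (a *\<^sub>R v) (b *\<^sub>R w) = (a * b) *\<^sub>R weyl_alg g R u v w"
proof -
  note sl = schouten_alg_linear(1)[OF g R] and sl' = schouten_alg_linear(2)[OF g R]
  have sh: "sharp g (schouten_alg g R (a *\<^sub>R v)) = a *\<^sub>R sharp g (schouten_alg g R v)"
    by (rule sharp_eqI[OF g]) (simp add: metric_add[OF g] sharp_works[OF g sl] linear_cmul[OF sl'])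
  show ?thesis
    unfolding weyl_alg_def sh
    by (simp add: linear_cmul[OF R(1)] linear_cmul[OF R(2)] linear_cmul[OF sl] linear_cmul[OF sl'] metric_add[OF g] algebra_simps)
qed

lemma dual_alg_scale:
  assumes W: "\<And>u v. W u v (b *\<^sub>R w) = b *\<^sub>R W u v w"
  shows "dual_alg g W u (a *\<^sub>R v) (b *\<^sub>R w) = (a * b) *\<^sub>R dual_alg g W u v w"
proof -
  have "vol4 g u (a *\<^sub>R v) x y = a * vol4 g u v x y" for x y
    unfolding vol4_def by (simp add: det_4 vector_4 algebra_simps)
  then show ?thesis unfolding dual_alg_def W by (simp add: scaleR_sum_right mult_ac)
qed

section \<open>Comparison of two compactifications\<close>

context boundary_chart begin

text \<open>Membership in \<open>bdry A\<close> only asks for some chart with first coordinate 0. A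
  boundary point with positive first coordinate in c would be an interior minimum of the nonnegative
  function x, against the condition that dx does not vanish there.\<close>

lemma bdf_nonzero_interior:
  assumes x: "bdf A x" and z: "z \<in> cimg c" "0 < fst z"
  shows "cinv c z \<notin> bdry A"
proof
  assume p: "cinv c z \<in> bdry A"
  note x' = x[unfolded bdf_def]
  have nonneg: "\<And>p. 0 \<le> x p" and zero: "\<And>p. x p = 0 \<longleftrightarrow> p \<in> bdry A"
    using x'[THEN conjunct2] by simp_all
  have sm: "smooth_on (cimg c) (in_chart c x)" by (rule x'[THEN conjunct1, rule_format, OF cA])
  have "cinv c z \<in> cdom c \<inter> bdry A" using p cinv_in[OF z(1)] by simp
  then obtain v where v: "pd halfspace (in_chart c x) (cmap c (cinv c z)) v \<noteq> 0"
    using x'[THEN conjunct2, THEN conjunct2, THEN conjunct2, rule_format, OF cA] by blast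
  define U where "U = cimg c \<inter> {z. 0 < fst z}"
  have "open U"
  proof -
    obtain T where T: "open T" "cimg c = halfspace \<inter> T" using cimg_openin by (auto simp: openin_open)
    have "U = T \<inter> {z. 0 < fst z}" unfolding U_def T(2) by (auto simp: halfspace_def)
    moreover have "open {z::real \<times> (real^3). 0 < fst z}" by (intro open_Collect_less continuous_intros)
    ultimately show ?thesis using T(1) by auto
  qed
  have zU: "z \<in> U" using z by (simp add: U_def)
  have "(in_chart c x has_derivative pd (cimg c) (in_chart c x) z) (at z within cimg c)"
    by (rule pd_has_derivative[OF differentiable_onD[OF twice_diffD(1)[OF smooth_on_twice[OF sm]] z(1)]])
  then have "(in_chart c x has_derivative pd (cimg c) (in_chart c x) z) (at z within U)"
    by (rule has_derivative_subset) (simp add: U_def)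
  then have "(in_chart c x has_derivative pd (cimg c) (in_chart c x) z) (at z)"
    using at_within_open[OF zU \<open>open U\<close>] by simp
  moreover have "\<forall>y\<in>U. in_chart c x z \<le> in_chart c x y"
    using zero[of "cinv c z"] p nonneg by (simp add: in_chart_def)
  ultimately have "pd (cimg c) (in_chart c x) z = (\<lambda>v. 0)"
    by (intro differential_zero_maxmin[OF zU \<open>open U\<close>]) blast+
  then show False using v unfolding cmap_cinv[OF z(1)] pd_openin[OF cimg_openin z(1), symmetric] by simp
qed

text \<open>At interior points both metrics are multiples of g. The cross-multiplied form of
  proportionality contains no quotient of x and x', so continuity carries it to the
  boundary.\<close>

lemma compactifications_proportional:
  assumes bd: "bdf A x" "bdf A x'" and co: "compactification A g x gb" "compactification A g x' gb'"
    and z: "z \<in> cimg c"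
  shows "gb' c z u v * gb c z w w = gb c z u v * gb' c z w w"
proof -
  interpret M: chart_metric "cimg c" "gb c"
    by (rule chart_metric_metric_field) (rule co(1)[unfolded compactification_def, THEN conjunct1])
  interpret M': chart_metric "cimg c" "gb' c"
    by (rule chart_metric_metric_field) (rule co(2)[unfolded compactification_def, THEN conjunct1])
  define f where "f = (\<lambda>z. gb' c z u v * gb c z w w - gb c z u v * gb' c z w w)"
  have int: "f z = 0" if z: "z \<in> cimg c" "0 < fst z" for z
  proof -
    define p where "p = cinv c z"
    have p: "p \<in> cdom c - bdry A" "cmap c p = z"
      using bdf_nonzero_interior[OF bd(1) z] cinv_in[OF z(1)] cmap_cinv[OF z(1)] by (auto simp: p_def)
    have "gb c (cmap c p) a b = (x p)\<^sup>2 * g c (cmap c p) a b" for a b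
      using co(1)[unfolded compactification_def, THEN conjunct2] cA p(1) by blast
    moreover have "gb' c (cmap c p) a b = (x' p)\<^sup>2 * g c (cmap c p) a b" for a b
      using co(2)[unfolded compactification_def, THEN conjunct2] cA p(1) by blast
    ultimately show ?thesis unfolding f_def p(2) by simp
  qed
  have "f z = 0"
  proof (cases "0 < fst z")
    case True then show ?thesis using int z by blast
  next
    case False
    have sub: "cimg c \<subseteq> halfspace" using cimg_openin openin_imp_subset by blast
    obtain y where y: "z = (0, y)" using False sub z by (cases z) (auto simp: halfspace_def)
    have "f differentiable (at z within cimg c)"
      unfolding f_def by (intro derivative_intros M.g_diff M'.g_diff z)
    then have cont: "(f \<longlongrightarrow> f z) (at z within cimg c)"
      using differentiable_imp_continuous_within by (auto simp: continuous_within)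
    show ?thesis
    proof (rule ccontr)
      assume ne: "f z \<noteq> 0"
      have "eventually (\<lambda>w. dist (f w) (f z) < \<bar>f z\<bar>) (at z within cimg c)"
        using cont ne by (intro tendstoD) auto
      then obtain d where d: "d > 0" "\<And>w. w \<in> cimg c \<Longrightarrow> w \<noteq> z \<Longrightarrow> dist w z < d \<Longrightarrow> dist (f w) (f z) < \<bar>f z\<bar>"
        unfolding eventually_at by blast
      obtain T where T: "open T" "cimg c = halfspace \<inter> T" using cimg_openin by (auto simp: openin_open)
      obtain e where e: "e > 0" "ball z e \<subseteq> T" using T z openE[of T z] by blast
      \<comment> \<open>A point straight above the boundary point, near enough both for the chart
        and for the continuity bound.\<close>
      define t where "t = min d e / 2"
      have t: "t > 0" "t < d" "t < e" using d(1) e(1) by (auto simp: t_def)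
      have dist: "dist (t, y) z = t" using t(1) by (simp add: y dist_Pair_Pair)
      then have "(t, y) \<in> T" using e(2) t by (auto simp: dist_commute)
      then have S: "(t, y) \<in> cimg c" using t(1) by (simp add: T(2) halfspace_def)
      have "dist (f (t, y)) (f z) < \<bar>f z\<bar>" using d(2)[OF S] t dist by (auto simp: y)
      then show False using int[OF S] t(1) by (simp add: dist_norm)
    qed
  qed
  then show ?thesis by (simp add: f_def)
qed

lemma conformal_pair_exists:
  assumes bd: "bdf A x" "bdf A x'" and co: "compactification A g x gb" "compactification A g x' gb'"
  shows "\<exists>lam. conformal_pair (cimg c) (gb c) (gb' c) lam"
proof -
  have M: "chart_metric (cimg c) (gb c)"
    by (rule chart_metric_metric_field) (rule co(1)[unfolded compactification_def, THEN conjunct1])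
  have M': "chart_metric (cimg c) (gb' c)"
    by (rule chart_metric_metric_field) (rule co(2)[unfolded compactification_def, THEN conjunct1])
  interpret M: chart_metric "cimg c" "gb c" by (rule M)
  interpret M': chart_metric "cimg c" "gb' c" by (rule M')
  \<comment> \<open>Reading \<open>\<lambda>\<close> off the two metrics shows its regularity at the boundary, where \<open>x'/x\<close> is 0/0.\<close>
  define w :: "real \<times> (real^3)" where "w = (1, 0)"
  have w: "w \<noteq> 0" by (simp add: w_def zero_prod_def)
  have pos: "0 < gb c z w w" "0 < gb' c z w w" if "z \<in> cimg c" for z
    using is_metricD(3)[OF M.met[OF that] w] is_metricD(3)[OF M'.met[OF that] w] by auto
  have "conformal_pair (cimg c) (gb c) (gb' c) (\<lambda>z. gb' c z w w / gb c z w w)"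
  proof (intro conformal_pair.intro conformal_pair_axioms.intro M M')
    show "twice_diff (cimg c) (\<lambda>z. gb' c z w w / gb c z w w)"
      by (rule twice_diff_divide[OF M.dom M.tw M'.tw]) (use pos in force)
  next
    fix z u v assume z: "z \<in> cimg c"
    show "0 < gb' c z w w / gb c z w w" using pos[OF z] by simp
    show "gb' c z u v = gb' c z w w / gb c z w w * gb c z u v"
      using compactifications_proportional[OF bd co z, of u v w] pos[OF z] by (simp add: field_simps)
  qed
  then show ?thesis by blast
qed

text \<open>The comparison passes through the Weyl tensor alone; the two spin structures and
  connections never meet. Both normals span the orthogonal complement of the boundary directions,
  which conformal metrics share, and only the square of their ratio k matters because both parts of
  the Weyl tensor are quadratic in the normal.\<close>

lemma obstruction_conformally_invariant:
  assumes data: "obstruction_data A g h0 x gb \<epsilon> \<Phi> I V t cl \<alpha>" and data': "obstruction_data A g h0' x' gb' \<epsilon>' \<Phi>' I' V' t' cl' \<alpha>'"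
    and i: "i \<in> I" and j: "j \<in> I'" and y: "y \<in> bimg c (V i \<inter> V' j)"
  shows "h0' c y (obstruction_tensor (h0' c y) (collar_metric gb' \<Phi>' c y) (soldering cl' j c) (\<alpha>' j c) y u) v
       = h0 c y (obstruction_tensor (h0 c y) (collar_metric gb \<Phi> c y) (soldering cl i c) (\<alpha> i c) y u) v"
proof -
  have yi: "y \<in> bimg c (V i)" and yj: "y \<in> bimg c (V' j)" using y by (auto simp: bimg_def)
  note geo = data[unfolded obstruction_data_def, THEN conjunct2, THEN conjunct1, unfolded geodesic_bdf_def]
  note geo' = data'[unfolded obstruction_data_def, THEN conjunct2, THEN conjunct1, unfolded geodesic_bdf_def]
  have bd: "bdf A x" "bdf A x'" and co: "compactification A g x gb" "compactification A g x' gb'"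
    and re: "restricts_to A gb h0" "restricts_to A gb' h0'"
    using geo geo' by simp_all
  note P = obstruction_eq_weyl[OF data i yi] and P' = obstruction_eq_weyl[OF data' j yj]
  obtain lam where "conformal_pair (cimg c) (gb c) (gb' c) lam"
    using conformal_pair_exists[OF bd co] by blast
  then interpret C: conformal_pair "cimg c" "gb c" "gb' c" lam .
  define z where "z = (0 :: real, y)"
  have z: "z \<in> cimg c" using bimgD(1)[OF yi] by (simp add: z_def)
  define N where "N = grad gb x c z"
  define N' where "N' = grad gb' x' c z"
  define k where "k = gb c z N' N"
  note m = metric_add[OF C.A.met[OF z]]
  have NN: "gb c z N N = 1" "gb c z N (0, u) = 0" for u using P(2,3) by (simp_all add: N_def z_def)
  have NN': "lam z * gb c z N' N' = 1" "gb c z N' (0, u) = 0" for u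
    using P'(2,3) C.lam_pos[OF z] unfolding C.conf[OF z, symmetric] N'_def
    by (simp_all add: z_def) (metis C.conf[OF z] less_irrefl mult_eq_0_iff z_def)
  have N': "N' = k *\<^sub>R N"
  proof -
    \<comment> \<open>w is orthogonal to N and to all boundary directions, which together span the
      tangent space.\<close>
    define w where "w = N' - k *\<^sub>R N"
    have wN: "gb c z w N = 0" by (simp add: w_def m NN k_def)
    have wu: "gb c z w (0, u) = 0" for u by (simp add: w_def m NN NN')
    have n0: "fst N \<noteq> 0"
    proof
      assume "fst N = 0"
      then have "N = (0, snd N)" by (simp add: prod_eq_iff)
      then show False using NN by (metis zero_neq_one)
    qed
    have "w = (fst w / fst N) *\<^sub>R N + (0, snd w - (fst w / fst N) *\<^sub>R snd N)"
      using n0 by (simp add: prod_eq_iff)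
    then have "gb c z w w = gb c z w ((fst w / fst N) *\<^sub>R N + (0, snd w - (fst w / fst N) *\<^sub>R snd N))" by simp
    also have "\<dots> = 0" by (simp only: m wN wu mult_zero_right add_0_right)
    finally have "w = 0" using is_metricD(3)[OF C.A.met[OF z], of w] by (cases "w = 0") auto
    then show ?thesis by (simp add: w_def)
  qed
  have k2: "lam z * (k * k) = 1" using NN'(1) unfolding N' by (simp add: m NN mult_ac)
  define W where "W = weyl_alg (gb c z) (riemann (cimg c) (gb c) z)"
  have W: "weyl halfspace (gb c) z = W" "weyl halfspace (gb' c) z = W"
    unfolding W_def weyl_eq_weyl_alg riemann_openin[OF cimg_openin z] by (simp_all add: C.weyl_conf[OF z])
  have g': "gb' c z = (\<lambda>u v. lam z * gb c z u v)" by (intro ext C.conf[OF z])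
  have Ws: "W u (a *\<^sub>R v) (b *\<^sub>R w) = (a * b) *\<^sub>R W u v w" for u a v b w
    unfolding W_def by (rule weyl_alg_scale[OF C.A.met[OF z] C.A.riemann_linear(2,3)[OF z]])
  have Ws3: "W u v (b *\<^sub>R w) = b *\<^sub>R W u v w" for u v b w using Ws[of u 1 v b w] by simp
  have "weyl_electric gb' x' c z (0, u) = (k * k) *\<^sub>R weyl_electric gb x c z (0, u)"
    unfolding weyl_electric_def W N_def[symmetric] N'_def[symmetric] unfolding N' Ws ..
  moreover have "weyl_magnetic gb' x' c z (0, u) = (k * k) *\<^sub>R weyl_magnetic gb x c z (0, u)"
    unfolding weyl_magnetic_def dual_weyl_eq W N_def[symmetric] N'_def[symmetric] g' dual_alg_conformal[OF C.A.met[OF z] C.lam_pos[OF z]]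
    unfolding N' by (rule dual_alg_scale) (rule Ws3)
  ultimately have "(0, obstruction_tensor (h0' c y) (collar_metric gb' \<Phi>' c y) (soldering cl' j c) (\<alpha>' j c) y u)
    = (k * k) *\<^sub>R (0::real, obstruction_tensor (h0 c y) (collar_metric gb \<Phi> c y) (soldering cl i c) (\<alpha> i c) y u)"
    unfolding P(1) P'(1) z_def[symmetric] by (simp add: scaleR_diff_right mult.commute[of _ 2])
  then have O: "obstruction_tensor (h0' c y) (collar_metric gb' \<Phi>' c y) (soldering cl' j c) (\<alpha>' j c) y u
    = (k * k) *\<^sub>R obstruction_tensor (h0 c y) (collar_metric gb \<Phi> c y) (soldering cl i c) (\<alpha> i c) y u" by simp
  have yb: "y \<in> bimg c (bdry A)" by (rule bimgD(5)[OF yi])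
  have h: "h0 c y a b = gb c z (0, a) (0, b)" "h0' c y a b = lam z * gb c z (0, a) (0, b)" for a b
    unfolding C.conf[OF z, of "(0, a)", symmetric] unfolding z_def
    by (rule re(1)[unfolded restricts_to_def, rule_format, OF cA yb] re(2)[unfolded restricts_to_def, rule_format, OF cA yb])+
  have "gb c z (0, (k * k) *\<^sub>R a) b = (k * k) * gb c z (0, a) b" for a b
    using m(5)[of "k * k" "(0, a)" b] by simp
  then show ?thesis unfolding O h using k2 by (simp add: mult.assoc[symmetric])
qed

end

theorem theorem5p12:
  fixes A :: "'a::t2_space chart set"
    and g :: "'a bulk_form2"
  assumes "oriented_atlas A"
    and "compact (UNIV :: 'a set)"
    and "asymptotically_hyperbolic A g"
  shows
    "(\<forall>h0 x gb \<epsilon> \<Phi> (I :: 'i set) V t cl \<alpha>.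
        obstruction_data A g h0 x gb \<epsilon> \<Phi> I V t cl \<alpha> \<longrightarrow>
        (\<forall>c\<in>A. \<forall>i\<in>I. \<forall>y\<in>bimg c (V i). \<forall>v.
           (0, obstruction_tensor (h0 c y) (collar_metric gb \<Phi> c y) (soldering cl i c) (\<alpha> i c) y v)
           = 2 *\<^sub>R (weyl_magnetic gb x c (0, y) (0, v) - weyl_electric gb x c (0, y) (0, v))))
     \<and>
     (\<forall>h0 x gb \<epsilon> \<Phi> (I :: 'i set) V t cl \<alpha> h0' x' gb' \<epsilon>' \<Phi>' (I' :: 'j set) V' t' cl' \<alpha>'.
        obstruction_data A g h0 x gb \<epsilon> \<Phi> I V t cl \<alpha> \<longrightarrow>
        obstruction_data A g h0' x' gb' \<epsilon>' \<Phi>' I' V' t' cl' \<alpha>' \<longrightarrow>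
        (\<forall>c\<in>A. \<forall>i\<in>I. \<forall>j\<in>I'. \<forall>y\<in>bimg c (V i \<inter> V' j). \<forall>u v.
           h0' c y (obstruction_tensor (h0' c y) (collar_metric gb' \<Phi>' c y)
                      (soldering cl' j c) (\<alpha>' j c) y u) v
           = h0 c y (obstruction_tensor (h0 c y) (collar_metric gb \<Phi> c y)
                      (soldering cl i c) (\<alpha> i c) y u) v))"
proof -
  have chart: "boundary_chart A c" if "c \<in> A" for c
    using assms(1) that by (rule boundary_chart.intro)
  show ?thesis
    by (intro conjI allI impI ballI boundary_chart.obstruction_eq_weyl(1)[OF chart]
        boundary_chart.obstruction_conformally_invariant[OF chart])
qed

end
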